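(* Let $(\Gamma,\mu)$ be a connected infinite weighted graph with measure $m$ and random walk operator $P$, and assume that it satisfies (LB), (D$_\beta$) and (UE$_\beta$). Then there exist two complete normed spaces $H^1(\Gamma)\subset L^1(\Gamma)$ and $H^1(T_\Gamma)\subset L^1(T_\Gamma)$ (continuous inclusions) such that: 1. The Riesz transform $d\Delta^{-1/2}$ is a homomorphism (bounded linear operator) from $H^1(\Gamma)$ to $H^1(T_\Gamma)$. 2. Every linear operator which is bounded from $H^1(\Gamma)$ to $L^1(\Gamma)$ and bounded on $L^2(\Gamma)$ is bounded on $L^p(\Gamma)$ for every $p\in(1,2)$. As a consequence, the Riesz transform $\nabla\Delta^{-1/2}$ is bounded on $L^p(\Gamma)$ for every $p\in(1,2)$, i.e. for each $p\in(1,2)$ there is $C_p$ with $\|\nabla\Delta^{-1/2}f\|_{L^p}\le C_p\|f\|_{L^p}$ for all $f\in L^p(\Gamma)\cap L^2(\Gamma)$.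
   Context: Setting. $\Gamma$ is an infinite set with a symmetric weight $\mu_{xy}=\mu_{yx}\ge 0$ on $\Gamma\times\Gamma$; $x\sim y$ iff $\mu_{xy}>0$ (so $x\sim x$ is allowed). The graph is connected and $\sup_x\#\{y: y\sim x\}<\infty$. Put $m(x)=\sum_{y\sim x}\mu_{xy}$, $m(E)=\sum_{x\in E}m(x)$, $L^p(\Gamma)=L^p(\Gamma,m)$. Put $p(x,y)=\frac{\mu_{xy}}{m(x)m(y)}$, $p_0(x,y)=\frac{1_{x=y}}{m(y)}$, $p_{k+1}(x,y)=\sum_z p(x,z)p_k(z,y)m(z)$, $Pf(x)=\sum_y p(x,y)f(y)m(y)$ (so $P^k$ has kernel $p_k$), $\Delta=I-P$; powers of $\Delta$ are defined on $L^2(\Gamma)$ by the spectral theorem. Let $\delta$ be the graph distance (length of a shortest path), $B<\infty$, $\beta:\Gamma\times\Gamma\to[1,B]$ a function and $\rho(x,y)=\delta(x,y)^{\beta(x,y)}$. It is understood that $\rho$ is a quasidistance: it is symmetric and $\rho(x,z)\le 2^{B-1}[\rho(x,y)+\rho(y,z)]$. Let $V_\rho(x,r)=m(\{y:\rho(x,y)<r\})$. (LB): there is $\epsilon>0$ with $p(x,x)m(x)>\epsilon$ for all $x\in\Gamma$. (D$_\beta$): there is $C$ with $V_\rho(x,2r)\le C V_\rho(x,r)$ for all $x\in\Gamma$, $r>0$. (UE$_\beta$): for every $N\in\mathbb N$ there is $C_N$ with $p_{k-1}(x,y)\le \frac{C_N}{V_\rho(x,k)}\left(1+\frac{\rho(x,y)}{k}\right)^{-N}$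 for all $x,y\in\Gamma$, $k\ge1$. 1-forms. $T_\Gamma=\{(x,y)\in\Gamma^2: x\sim y\}$. For $F:T_\Gamma\to\mathbb R$ put $|F(x,\cdot)|_{T_x}=\left(\frac12\sum_{y\sim x}p(x,y)m(y)|F(x,y)|^2\right)^{1/2}$; $L^p(T_\Gamma)$ is the space of antisymmetric $F$ with $\|F\|_{L^p(T_\Gamma)}=\|x\mapsto|F(x,\cdot)|_{T_x}\|_{L^p(\Gamma)}<\infty$. $df(x,y)=f(x)-f(y)$ and $\nabla f(x)=|df(x,\cdot)|_{T_x}$. One has $\|df\|_{L^2(T_\Gamma)}=\|\Delta^{1/2}f\|_{L^2(\Gamma)}$, and $d\Delta^{-1/2}$ denotes the resulting isometry $L^2(\Gamma)\to L^2(T_\Gamma)$; $\nabla\Delta^{-1/2}f(x)=|(d\Delta^{-1/2}f)(x,\cdot)|_{T_x}$. Conventions. $d\Delta^{-1/2}$ is initially defined on $L^2(\Gamma)$; statement 1 means that it is bounded from $H^1(\Gamma)\cap L^2(\Gamma)$ (with the $H^1(\Gamma)$ norm) to $H^1(T_\Gamma)$ and so extends to a bounded linear operator $H^1(\Gamma)\to H^1(T_\Gamma)$. In statement 2, the operator $T$ is linear and bounded on $L^2(\Gamma)$, boundedness from $H^1(\Gamma)$ to $L^1(\Gamma)$ means $\|Tf\|_{L^1}\le C\|f\|_{H^1(\Gamma)}$ for $f\in H^1(\Gamma)\cap L^2(\Gamma)$, and boundedness on $L^p$ means $\|Tf\|_{L^p}\le C_p\|f\|_{L^p}$ for $f\in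 L^p(\Gamma)\cap L^2(\Gamma)$. *)

theory Defs
  imports "HOL-Analysis.Analysis" "HOL-Computational_Algebra.Polynomial"
begin

section \<open>Weighted graphs\<close>

text \<open>The vertex set is the whole type; loops are allowed.\<close>

definition edges :: "('a \<Rightarrow> 'a \<Rightarrow> real) \<Rightarrow> ('a \<times> 'a) set" where
  "edges mu = {(x, y). mu x y > 0}"

definition nbrs :: "('a \<Rightarrow> 'a \<Rightarrow> real) \<Rightarrow> 'a \<Rightarrow> 'a set" where
  "nbrs mu x = {y. (x, y) \<in> edges mu}"

definition weighted_graph :: "('a \<Rightarrow> 'a \<Rightarrow> real) \<Rightarrow> bool" where
  "weighted_graph mu \<longleftrightarrow>
     infinite (UNIV :: 'a set) \<and>
     (\<forall>x y. mu x y = mu y x) \<and>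
     (\<forall>x y. 0 \<le> mu x y) \<and>
     (\<forall>x y. (x, y) \<in> (edges mu)\<^sup>*) \<and>
     (\<exists>K. \<forall>x. finite (nbrs mu x) \<and> card (nbrs mu x) \<le> K)"

definition wt :: "('a \<Rightarrow> 'a \<Rightarrow> real) \<Rightarrow> 'a \<Rightarrow> real" where
  "wt mu x = (\<Sum>y\<in>nbrs mu x. mu x y)"

definition vol :: "('a \<Rightarrow> 'a \<Rightarrow> real) \<Rightarrow> 'a measure" where
  "vol mu = point_measure UNIV (\<lambda>x. ennreal (wt mu x))"

text \<open>The kernel \<open>p\<close> vanishes outside the edges, so sums over all vertices
  are written as finite sums over neighbours.\<close>

definition kern :: "('a \<Rightarrow> 'a \<Rightarrow> real) \<Rightarrow> 'a \<Rightarrow> 'a \<Rightarrow> real" where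
  "kern mu x y = mu x y / (wt mu x * wt mu y)"

primrec kern_iter :: "('a \<Rightarrow> 'a \<Rightarrow> real) \<Rightarrow> nat \<Rightarrow> 'a \<Rightarrow> 'a \<Rightarrow> real" where
  "kern_iter mu 0 x y = (if x = y then 1 / wt mu y else 0)"
| "kern_iter mu (Suc k) x y = (\<Sum>z\<in>nbrs mu x. kern mu x z * kern_iter mu k z y * wt mu z)"

definition walk :: "('a \<Rightarrow> 'a \<Rightarrow> real) \<Rightarrow> ('a \<Rightarrow> real) \<Rightarrow> 'a \<Rightarrow> real" where
  "walk mu f x = (\<Sum>y\<in>nbrs mu x. kern mu x y * f y * wt mu y)"

definition laplacian :: "('a \<Rightarrow> 'a \<Rightarrow> real) \<Rightarrow> ('a \<Rightarrow> real) \<Rightarrow> 'a \<Rightarrow> real" where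
  "laplacian mu f x = f x - walk mu f x"


section \<open>Quasidistance and the assumptions on the graph\<close>

definition gdist :: "('a \<Rightarrow> 'a \<Rightarrow> real) \<Rightarrow> 'a \<Rightarrow> 'a \<Rightarrow> nat" where
  "gdist mu x y = (LEAST n. (x, y) \<in> edges mu ^^ n)"

definition qdist :: "('a \<Rightarrow> 'a \<Rightarrow> real) \<Rightarrow> ('a \<Rightarrow> 'a \<Rightarrow> real) \<Rightarrow> 'a \<Rightarrow> 'a \<Rightarrow> real" where
  "qdist mu \<beta> x y = real (gdist mu x y) powr \<beta> x y"

definition quasidistance_exponent ::
    "('a \<Rightarrow> 'a \<Rightarrow> real) \<Rightarrow> real \<Rightarrow> ('a \<Rightarrow> 'a \<Rightarrow> real) \<Rightarrow> bool" where
  "quasidistance_exponent mu B \<beta> \<longleftrightarrow>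
     (\<forall>x y. 1 \<le> \<beta> x y \<and> \<beta> x y \<le> B) \<and>
     (\<forall>x y. qdist mu \<beta> x y = qdist mu \<beta> y x) \<and>
     (\<forall>x y z. qdist mu \<beta> x z \<le> 2 powr (B - 1) * (qdist mu \<beta> x y + qdist mu \<beta> y z))"

text \<open>As \<open>\<beta> \<ge> 1\<close> and vertex degrees are bounded, the balls below are finite sets, so the
  real-valued \<open>measure\<close> loses nothing.\<close>

definition ball_vol :: "('a \<Rightarrow> 'a \<Rightarrow> real) \<Rightarrow> ('a \<Rightarrow> 'a \<Rightarrow> real) \<Rightarrow> 'a \<Rightarrow> real \<Rightarrow> real" where
  "ball_vol mu \<beta> x r = measure (vol mu) {y. qdist mu \<beta> x y < r}"

definition LB :: "('a \<Rightarrow> 'a \<Rightarrow> real) \<Rightarrow> bool" where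
  "LB mu \<longleftrightarrow> (\<exists>\<epsilon>>0. \<forall>x. kern mu x x * wt mu x > \<epsilon>)"

definition doubling :: "('a \<Rightarrow> 'a \<Rightarrow> real) \<Rightarrow> ('a \<Rightarrow> 'a \<Rightarrow> real) \<Rightarrow> bool" where
  "doubling mu \<beta> \<longleftrightarrow>
     (\<exists>C. \<forall>x. \<forall>r>0. ball_vol mu \<beta> x (2 * r) \<le> C * ball_vol mu \<beta> x r)"

definition UE :: "('a \<Rightarrow> 'a \<Rightarrow> real) \<Rightarrow> ('a \<Rightarrow> 'a \<Rightarrow> real) \<Rightarrow> bool" where
  "UE mu \<beta> \<longleftrightarrow>
     (\<forall>N::nat. \<exists>C. \<forall>x y. \<forall>k\<ge>1.
        kern_iter mu (k - 1) x y
          \<le> C / ball_vol mu \<beta> x (real k) * (1 + qdist mu \<beta> x y / real k) powr (- real N))"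


section \<open>Lebesgue spaces of functions and of 1-forms\<close>

definition Lp :: "'b measure \<Rightarrow> real \<Rightarrow> ('b \<Rightarrow> real) set" where
  "Lp M p = {f \<in> borel_measurable M. integrable M (\<lambda>x. \<bar>f x\<bar> powr p)}"

definition Lp_norm :: "'b measure \<Rightarrow> real \<Rightarrow> ('b \<Rightarrow> real) \<Rightarrow> real" where
  "Lp_norm M p f = (\<integral>x. \<bar>f x\<bar> powr p \<partial>M) powr (1 / p)"

text \<open>A function on the set of edges is represented by its extension by zero to all pairs.
  Every vertex has positive weight, so no identification of functions modulo null sets is
  needed.\<close>

definition tangent_norm :: "('a \<Rightarrow> 'a \<Rightarrow> real) \<Rightarrow> ('a \<times> 'a \<Rightarrow> real) \<Rightarrow> 'a \<Rightarrow> real" where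
  "tangent_norm mu F x = sqrt (1 / 2 * (\<Sum>y\<in>nbrs mu x. kern mu x y * wt mu y * \<bar>F (x, y)\<bar>\<^sup>2))"

definition Lp_form :: "('a \<Rightarrow> 'a \<Rightarrow> real) \<Rightarrow> real \<Rightarrow> ('a \<times> 'a \<Rightarrow> real) set" where
  "Lp_form mu p = {F. (\<forall>e. e \<notin> edges mu \<longrightarrow> F e = 0) \<and> (\<forall>x y. F (y, x) = - F (x, y)) \<and>
                      tangent_norm mu F \<in> Lp (vol mu) p}"

definition Lp_form_norm :: "('a \<Rightarrow> 'a \<Rightarrow> real) \<Rightarrow> real \<Rightarrow> ('a \<times> 'a \<Rightarrow> real) \<Rightarrow> real" where
  "Lp_form_norm mu p F = Lp_norm (vol mu) p (tangent_norm mu F)"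

definition diff_form :: "('a \<Rightarrow> 'a \<Rightarrow> real) \<Rightarrow> ('a \<Rightarrow> real) \<Rightarrow> 'a \<times> 'a \<Rightarrow> real" where
  "diff_form mu f = (\<lambda>(x, y). if (x, y) \<in> edges mu then f x - f y else 0)"


section \<open>Functional calculus and the Riesz transform\<close>

definition poly_laplacian ::
    "('a \<Rightarrow> 'a \<Rightarrow> real) \<Rightarrow> real poly \<Rightarrow> ('a \<Rightarrow> real) \<Rightarrow> 'a \<Rightarrow> real" where
  "poly_laplacian mu q f x = (\<Sum>i\<le>degree q. coeff q i * (laplacian mu ^^ i) f x)"

text \<open>Spectral theorem in continuous functional calculus form: the Laplacian is a bounded
  self-adjoint operator on \<open>L\<^sup>2\<close> with spectrum in \<open>[0, 2]\<close>, and for \<open>\<phi>\<close> continuous on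
  \<open>[0, 2]\<close> the operator \<open>\<phi>(\<Delta>)\<close> is the limit of \<open>q\<^sub>n(\<Delta>)\<close> for all polynomials \<open>q\<^sub>n\<close>
  converging uniformly to \<open>\<phi>\<close> on \<open>[0, 2]\<close>. Meaningful for \<open>f\<close> in \<open>L\<^sup>2\<close> only.\<close>

definition functional_calculus ::
    "('a \<Rightarrow> 'a \<Rightarrow> real) \<Rightarrow> (real \<Rightarrow> real) \<Rightarrow> ('a \<Rightarrow> real) \<Rightarrow> 'a \<Rightarrow> real" where
  "functional_calculus mu \<phi> f =
     (THE h. h \<in> Lp (vol mu) 2 \<and>
        (\<forall>q. uniform_limit {0..2} (\<lambda>n t. poly (q n) t) \<phi> sequentially \<longrightarrow>
             (\<lambda>n. Lp_norm (vol mu) 2 (\<lambda>x. poly_laplacian mu (q n) f x - h x)) \<longlonglongrightarrow> 0))"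

definition sqrt_laplacian :: "('a \<Rightarrow> 'a \<Rightarrow> real) \<Rightarrow> ('a \<Rightarrow> real) \<Rightarrow> 'a \<Rightarrow> real" where
  "sqrt_laplacian mu = functional_calculus mu sqrt"

text \<open>The operator \<open>d \<Delta>\<^sup>-\<^sup>1\<^sup>/\<^sup>2\<close> on \<open>L\<^sup>2\<close>: the map sending \<open>\<Delta>\<^sup>1\<^sup>/\<^sup>2 g\<close> to \<open>d g\<close> is isometric
  into the \<open>L\<^sup>2\<close> forms, and is extended by continuity from the range of \<open>\<Delta>\<^sup>1\<^sup>/\<^sup>2\<close>.\<close>

definition riesz :: "('a \<Rightarrow> 'a \<Rightarrow> real) \<Rightarrow> ('a \<Rightarrow> real) \<Rightarrow> 'a \<times> 'a \<Rightarrow> real" where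
  "riesz mu f =
     (THE F. F \<in> Lp_form mu 2 \<and>
        (\<exists>g. (\<forall>n. g n \<in> Lp (vol mu) 2) \<and>
             (\<lambda>n. Lp_norm (vol mu) 2 (\<lambda>x. sqrt_laplacian mu (g n) x - f x)) \<longlonglongrightarrow> 0 \<and>
             (\<lambda>n. Lp_form_norm mu 2 (\<lambda>e. diff_form mu (g n) e - F e)) \<longlonglongrightarrow> 0))"


section \<open>Complete normed spaces of functions and bounded operators\<close>

definition complete_normed_space :: "('b \<Rightarrow> real) set \<Rightarrow> (('b \<Rightarrow> real) \<Rightarrow> real) \<Rightarrow> bool" where
  "complete_normed_space V N \<longleftrightarrow>
     (\<lambda>_. 0) \<in> V \<and>
     (\<forall>f\<in>V. \<forall>g\<in>V. (\<lambda>x. f x + g x) \<in> V) \<and>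
     (\<forall>c. \<forall>f\<in>V. (\<lambda>x. c * f x) \<in> V) \<and>
     (\<forall>f\<in>V. 0 \<le> N f \<and> (N f = 0 \<longleftrightarrow> f = (\<lambda>_. 0))) \<and>
     (\<forall>f\<in>V. \<forall>g\<in>V. N (\<lambda>x. f x + g x) \<le> N f + N g) \<and>
     (\<forall>c. \<forall>f\<in>V. N (\<lambda>x. c * f x) = \<bar>c\<bar> * N f) \<and>
     (\<forall>u. (\<forall>n::nat. u n \<in> V) \<and>
          (\<forall>e>0. \<exists>n0. \<forall>i\<ge>n0. \<forall>j\<ge>n0. N (\<lambda>x. u i x - u j x) < e) \<longrightarrow>
          (\<exists>f\<in>V. (\<lambda>n. N (\<lambda>x. u n x - f x)) \<longlonglongrightarrow> 0))"

definition continuously_included ::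
    "('b \<Rightarrow> real) set \<Rightarrow> (('b \<Rightarrow> real) \<Rightarrow> real) \<Rightarrow> ('b \<Rightarrow> real) set \<Rightarrow> (('b \<Rightarrow> real) \<Rightarrow> real) \<Rightarrow> bool"
  where
  "continuously_included V N W M \<longleftrightarrow> V \<subseteq> W \<and> (\<exists>C. \<forall>f\<in>V. M f \<le> C * N f)"

definition linear_op ::
    "('b \<Rightarrow> real) set \<Rightarrow> (('b \<Rightarrow> real) \<Rightarrow> ('c \<Rightarrow> real)) \<Rightarrow> bool" where
  "linear_op V T \<longleftrightarrow>
     (\<forall>f\<in>V. \<forall>g\<in>V. T (\<lambda>x. f x + g x) = (\<lambda>y. T f y + T g y)) \<and>
     (\<forall>c. \<forall>f\<in>V. T (\<lambda>x. c * f x) = (\<lambda>y. c * T f y))"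

definition bounded_op ::
    "('b \<Rightarrow> real) set \<Rightarrow> (('b \<Rightarrow> real) \<Rightarrow> real) \<Rightarrow> ('c \<Rightarrow> real) set \<Rightarrow> (('c \<Rightarrow> real) \<Rightarrow> real) \<Rightarrow>
     (('b \<Rightarrow> real) \<Rightarrow> ('c \<Rightarrow> real)) \<Rightarrow> bool" where
  "bounded_op V N W M T \<longleftrightarrow> (\<exists>C. \<forall>f\<in>V. T f \<in> W \<and> M (T f) \<le> C * N f)"

end

theory Submission
imports Defs
begin

text \<open>The Hardy space of forms is all of \<open>L\<^sup>1\<close>, with its norm written as a supremum over finite sums. The
  Hardy space of functions consists of those \<open>f\<close> in \<open>L\<^sup>1\<close> for which the regularised Riesz transforms
  \<open>d K\<^sub>n f\<close> are bounded in \<open>L\<^sup>1\<close> uniformly in \<open>n\<close> and converge at every edge. Here \<open>K\<^sub>n\<close> is the Cesaro mean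
  of the series \<open>\<Delta>\<^sup>-\<^sup>1\<^sup>/\<^sup>2 = \<Sum> c\<^sub>l P\<^sup>l\<close>; it has finite range, hence acts on every function. With
  these spaces the Riesz transform is bounded almost by definition (\<open>riesz_ext_bounded\<close>), and agrees with
  \<open>d \<Delta>\<^sup>-\<^sup>1\<^sup>/\<^sup>2\<close> on \<open>L\<^sup>2\<close> (\<open>riesz_limit\<close>). The substance of the theorem is that the Hardy space
  is large enough for interpolation, and this rests on two estimates.

  The first (\<open>atom_estimate\<close>) says that \<open>b - A\<^sub>k b\<close> lies in the Hardy space, with the natural
  bound, when \<open>b\<close> is supported in a ball of radius \<open>k\<close> and \<open>A\<^sub>k\<close> is the average of \<open>P\<^sup>j\<close> over
  \<open>k \<le> j < 2k\<close>. Near the ball this follows from the \<open>L\<^sup>2\<close> theory. Far from it the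
  coefficients of \<open>K\<^sub>n (I - A\<^sub>k)\<close> decay like \<open>k l\<^sup>-\<^sup>3\<^sup>/\<^sup>2\<close> for large \<open>l\<close>, and the gradient of
  the kernel of \<open>P\<^sup>l\<close> has to be summed in \<open>L\<^sup>1\<close> over dyadic blocks of times. The kernel bound
  gives no pointwise bound of the gradient. Instead, the squared gradient is bounded by a
  product of the square root of the kernel and of the defect in Jensen's inequality for \<open>t\<^sup>3\<^sup>/\<^sup>2\<close>
  (\<open>gradient_pointwise\<close>; this is where the loops enter), and these defects telescope in time
  (\<open>jdef_telescope\<close>). Cauchy-Schwarz over a dyadic block then gives \<open>gradient_block\<close>. Averaging over \<open>j\<close>
  smooths the coefficients, and takes the place of regularity of the kernel in time.

  The second is that an operator bounded on \<open>L\<^sup>2\<close> and on these atoms is bounded on \<open>L\<^sup>p\<close>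
  (\<open>interpolation\<close>). By duality the adjoint maps bounded functions to functions whose sharp maximal
  function, formed with \<open>A\<^sub>k\<close> in place of mean values, is bounded (\<open>Tadj_sharp\<close>). A good-\<open>\<lambda>\<close>
  inequality (\<open>good_lambda\<close>) compares the sharp with the usual maximal function. Splitting at the height
  of each level then bounds the adjoint on \<open>L\<^sup>r\<close> for \<open>r > 2\<close> (\<open>adjoint_bound\<close>), and Hoelder's
  inequality returns to \<open>p < 2\<close>.

  The spectral theorem is replaced by one fact: a polynomial that is nonnegative on \<open>[0, 2]\<close> yields a
  positive operator \<open>q(\<Delta>)\<close> (\<open>pos_nonneg\<close>), because its Bernstein coefficients are nonnegative after
  an arbitrarily small shift. The \<open>L\<^sup>p\<close> bound of the Riesz transform itself follows by applying the
  interpolation theorem to its components along an enumeration of the neighbours of each vertex (\<open>riesz_Lp\<close>).\<close>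

section \<open>Limits under suprema of seminorms\<close>

text \<open>Seminorms that control the values at points force pointwise convergence; since each of them is
  continuous for pointwise limits, the uniform Cauchy bound survives the limit. This one argument gives the
  completeness of \<open>L\<^sup>2\<close> and of both Hardy spaces, and the existence of the Riesz transform.\<close>

lemma cauchy_sup_limit:
  fixes \<phi> :: "'i \<Rightarrow> ('b \<Rightarrow> real) \<Rightarrow> real"
  assumes eval: "\<And>x. \<exists>i\<in>I. \<exists>c. \<forall>f. \<bar>f x\<bar> \<le> c * \<phi> i f"
    and cont: "\<And>i g (h :: nat \<Rightarrow> 'b \<Rightarrow> real). i \<in> I \<Longrightarrow> (\<forall>x. (\<lambda>n. h n x) \<longlonglongrightarrow> g x) \<Longrightarrow> (\<lambda>n. \<phi> i (h n)) \<longlonglongrightarrow> \<phi> i g"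
    and nonneg: "\<And>i f. 0 \<le> \<phi> i f"
    and cauchy: "\<And>e. e > 0 \<Longrightarrow> \<exists>n0. \<forall>k\<ge>n0. \<forall>l\<ge>n0. \<forall>i\<in>I. \<phi> i (\<lambda>x. u k x - u l x) \<le> e"
  obtains f where "\<And>x. (\<lambda>n. u n x) \<longlonglongrightarrow> f x"
    and "\<And>e. e > 0 \<Longrightarrow> \<exists>n0. \<forall>k\<ge>n0. \<forall>i\<in>I. \<phi> i (\<lambda>x. u k x - f x) \<le> e"
proof -
  have "convergent (\<lambda>n. u n x)" for x
  proof -
    obtain i c where i: "i \<in> I" and c: "\<And>f. \<bar>f x\<bar> \<le> c * \<phi> i f" using eval by meson
    have "Cauchy (\<lambda>n. u n x)"
      unfolding Cauchy_def
    proof safe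
      fix e :: real assume e: "e > 0"
      define e' where "e' = e / (2 * (\<bar>c\<bar> + 1))"
      have "e' > 0" using e by (simp add: e'_def)
      then obtain n0 where n0: "\<forall>k\<ge>n0. \<forall>l\<ge>n0. \<forall>i\<in>I. \<phi> i (\<lambda>x. u k x - u l x) \<le> e'"
        using cauchy by meson
      have "dist (u k x) (u l x) < e" if "k \<ge> n0" "l \<ge> n0" for k l
      proof -
        have "\<bar>u k x - u l x\<bar> \<le> c * \<phi> i (\<lambda>x. u k x - u l x)" using c[of "\<lambda>x. u k x - u l x"] by simp
        also have "\<dots> \<le> (\<bar>c\<bar> + 1) * \<phi> i (\<lambda>x. u k x - u l x)"
          by (intro mult_right_mono nonneg) simp
        also have "\<dots> \<le> (\<bar>c\<bar> + 1) * e'" using n0 that i by (intro mult_left_mono) auto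
        also have "\<dots> < e" using e unfolding e'_def by (simp add: field_simps add_pos_nonneg)
        finally show ?thesis by (simp add: dist_real_def)
      qed
      then show "\<exists>M. \<forall>m\<ge>M. \<forall>n\<ge>M. dist (u m x) (u n x) < e" by blast
    qed
    then show ?thesis by (rule Cauchy_convergent)
  qed
  then obtain f where f: "\<And>x. (\<lambda>n. u n x) \<longlonglongrightarrow> f x" unfolding convergent_def by metis
  have "\<exists>n0. \<forall>k\<ge>n0. \<forall>i\<in>I. \<phi> i (\<lambda>x. u k x - f x) \<le> e" if e: "e > 0" for e
  proof -
    obtain n0 where n0: "\<forall>k\<ge>n0. \<forall>l\<ge>n0. \<forall>i\<in>I. \<phi> i (\<lambda>x. u k x - u l x) \<le> e" using cauchy[OF e] by blast
    have "\<phi> i (\<lambda>x. u k x - f x) \<le> e" if "k \<ge> n0" "i \<in> I" for k i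
    proof (rule LIMSEQ_le_const2)
      show "(\<lambda>l. \<phi> i (\<lambda>x. u k x - u l x)) \<longlonglongrightarrow> \<phi> i (\<lambda>x. u k x - f x)"
        using that by (intro cont) (auto intro!: tendsto_intros f)
      show "\<exists>N. \<forall>n\<ge>N. \<phi> i (\<lambda>x. u k x - u n x) \<le> e" using n0 that by blast
    qed
    then show ?thesis by blast
  qed
  with f show ?thesis by (rule that)
qed

section \<open>The random walk\<close>

locale walk_graph =
  fixes mu :: "'a \<Rightarrow> 'a \<Rightarrow> real"
  assumes graph: "weighted_graph mu"
begin

abbreviation "w \<equiv> wt mu"
abbreviation "P \<equiv> walk mu"
abbreviation "nb \<equiv> nbrs mu"
abbreviation "Lap \<equiv> laplacian mu"

definition fin :: "('a \<Rightarrow> real) \<Rightarrow> bool" where "fin f \<longleftrightarrow> finite {x. f x \<noteq> 0}"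

text \<open>The sum runs over the support of the first argument, so that the second one may be an arbitrary
  function.\<close>

definition ip :: "('a \<Rightarrow> real) \<Rightarrow> ('a \<Rightarrow> real) \<Rightarrow> real" where
  "ip f g = (\<Sum>x | f x \<noteq> 0. w x * f x * g x)"

lemma mu_sym: "mu x y = mu y x" and mu_nonneg: "0 \<le> mu x y"
  and infinite_UNIV: "infinite (UNIV :: 'a set)" and conn: "(x, y) \<in> (edges mu)\<^sup>*"
  using graph unfolding weighted_graph_def by blast+

lemma finite_nb [simp]: "finite (nb x)"
  using graph unfolding weighted_graph_def by blast

lemma card_nb: "\<exists>K. \<forall>x. card (nb x) \<le> K"
  using graph unfolding weighted_graph_def by blast

lemma nb_iff: "y \<in> nb x \<longleftrightarrow> mu x y > 0" by (simp add: nbrs_def edges_def)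

lemma nb_sym: "y \<in> nb x \<longleftrightarrow> x \<in> nb y" by (simp add: nb_iff mu_sym)

lemma mu_zero: "y \<notin> nb x \<Longrightarrow> mu x y = 0" using mu_nonneg[of x y] by (auto simp: nb_iff)

lemma w_pos: "w x > 0"
proof -
  obtain y where "y \<noteq> x" using infinite_UNIV
    by (metis finite.emptyI finite.insertI UNIV_eq_I insertI1)
  with conn[of x y] obtain z where "(x, z) \<in> edges mu" by (metis converse_rtranclE)
  then have "z \<in> nb x" by (simp add: nbrs_def)
  then show ?thesis unfolding wt_def by (intro sum_pos) (auto simp: nb_iff)
qed

lemma w_nonneg [simp]: "0 \<le> w x" and w_neq0 [simp]: "w x \<noteq> 0"
  using w_pos[of x] by auto

lemma kern_w: "kern mu x y * w y = mu x y / w x"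
  by (simp add: kern_def)

lemma sum_mu: "finite S \<Longrightarrow> nb x \<subseteq> S \<Longrightarrow> (\<Sum>y\<in>S. mu x y) = w x"
  unfolding wt_def by (rule sum.mono_neutral_right) (auto simp: mu_zero)

lemma walk_eq: "P f x = (\<Sum>y\<in>nb x. mu x y / w x * f y)"
  unfolding walk_def by (intro sum.cong) (auto simp flip: kern_w simp: mult_ac)

lemma w_walk:
  assumes "finite S" "\<And>y. mu x y \<noteq> 0 \<Longrightarrow> f y \<noteq> 0 \<Longrightarrow> y \<in> S"
  shows "w x * P f x = (\<Sum>y\<in>S. mu x y * f y)"
proof -
  have "w x * P f x = (\<Sum>y\<in>nb x. mu x y * f y)"
    by (simp add: walk_eq sum_distrib_left)
  also have "\<dots> = (\<Sum>y\<in>nb x \<union> S. mu x y * f y)"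
    using assms(1) by (intro sum.mono_neutral_left) (auto simp: mu_zero)
  also have "\<dots> = (\<Sum>y\<in>S. mu x y * f y)"
    using assms by (intro sum.mono_neutral_right) auto
  finally show ?thesis .
qed

lemma walk_add: "P (\<lambda>x. f x + g x) = (\<lambda>x. P f x + P g x)"
  and walk_diff: "P (\<lambda>x. f x - g x) = (\<lambda>x. P f x - P g x)"
  and walk_cmult: "P (\<lambda>x. c * f x) = (\<lambda>x. c * P f x)"
  by (auto simp: walk_eq fun_eq_iff algebra_simps sum.distrib sum_subtractf sum_distrib_left add_divide_distrib diff_divide_distrib)

lemma walk_const [simp]: "P (\<lambda>x. c) = (\<lambda>x. c)"
proof
  fix x have "w x * P (\<lambda>x. c) x = w x * c"
    by (subst w_walk[of "nb x"]) (auto simp: mu_zero sum_mu simp flip: sum_distrib_right intro: ccontr)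
  then show "P (\<lambda>x. c) x = c" by simp
qed

lemma walk_mono: "(\<And>y. y \<in> nb x \<Longrightarrow> f y \<le> g y) \<Longrightarrow> P f x \<le> P g x"
  unfolding walk_eq by (intro sum_mono mult_left_mono) (auto simp: mu_nonneg)

lemma walk_cong: "(\<And>y. y \<in> nb x \<Longrightarrow> f y = g y) \<Longrightarrow> P f x = P g x"
  unfolding walk_eq by (intro sum.cong) auto

lemma walk_nonneg: "(\<And>y. 0 \<le> f y) \<Longrightarrow> 0 \<le> P f x"
  using walk_mono[of x "\<lambda>_. 0" f] by simp

lemma walk_abs: "\<bar>P f x\<bar> \<le> P (\<lambda>y. \<bar>f y\<bar>) x"
  unfolding walk_eq by (rule order_trans[OF sum_abs]) (auto intro!: sum_mono simp: abs_mult mu_nonneg)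

text \<open>Jensen's inequality for the averaging operator, from the positivity of its variance.\<close>

lemma walk_square: "(P f x)\<^sup>2 \<le> P (\<lambda>y. (f y)\<^sup>2) x"
proof -
  define c where "c = P f x"
  have "0 \<le> P (\<lambda>y. (f y - c)\<^sup>2) x" by (intro walk_nonneg) auto
  also have "(\<lambda>y. (f y - c)\<^sup>2) = (\<lambda>y. ((f y)\<^sup>2 - (2 * c) * f y) + c\<^sup>2)"
    by (simp add: power2_eq_square algebra_simps)
  also have "P \<dots> x = P (\<lambda>y. (f y)\<^sup>2) x - 2 * c * P f x + c\<^sup>2"
    by (simp add: walk_add walk_diff walk_cmult)
  finally show ?thesis by (simp add: c_def power2_eq_square algebra_simps)
qed

lemma funpow_walk_add: "(P ^^ n) (\<lambda>x. f x + g x) = (\<lambda>x. (P ^^ n) f x + (P ^^ n) g x)"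
  and funpow_walk_cmult: "(P ^^ n) (\<lambda>x. c * f x) = (\<lambda>x. c * (P ^^ n) f x)"
  and funpow_walk_const [simp]: "(P ^^ n) (\<lambda>x. c) = (\<lambda>x. c)"
  by (induction n) (auto simp: walk_add walk_cmult walk_diff)

lemma funpow_walk_sum: "(P ^^ n) (\<lambda>x. \<Sum>i\<in>A. f i x) = (\<lambda>x. \<Sum>i\<in>A. (P ^^ n) (f i) x)"
  by (induction A rule: infinite_finite_induct) (auto simp: funpow_walk_add)

lemma funpow_walk_mono: "(\<And>y. f y \<le> g y) \<Longrightarrow> (P ^^ n) f x \<le> (P ^^ n) g x"
  by (induction n arbitrary: x) (auto intro!: walk_mono)

lemma funpow_walk_nonneg: "(\<And>y. 0 \<le> f y) \<Longrightarrow> 0 \<le> (P ^^ n) f x"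
  using funpow_walk_mono[of "\<lambda>_. 0" f] by simp

lemma funpow_walk_abs: "\<bar>(P ^^ n) f x\<bar> \<le> (P ^^ n) (\<lambda>y. \<bar>f y\<bar>) x"
proof (induction n arbitrary: x)
  case (Suc n)
  have "\<bar>P ((P ^^ n) f) x\<bar> \<le> P (\<lambda>y. \<bar>(P ^^ n) f y\<bar>) x" by (rule walk_abs)
  also have "\<dots> \<le> P ((P ^^ n) (\<lambda>y. \<bar>f y\<bar>)) x" by (intro walk_mono Suc)
  finally show ?case by simp
qed simp

lemma funpow_walk_square: "((P ^^ n) f x)\<^sup>2 \<le> (P ^^ n) (\<lambda>y. (f y)\<^sup>2) x"
proof (induction n arbitrary: x)
  case (Suc n)
  have "(P ((P ^^ n) f) x)\<^sup>2 \<le> P (\<lambda>y. ((P ^^ n) f y)\<^sup>2) x" by (rule walk_square)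
  also have "\<dots> \<le> P ((P ^^ n) (\<lambda>y. (f y)\<^sup>2)) x" by (intro walk_mono Suc)
  finally show ?case by simp
qed simp

subsection \<open>Operators of finite range\<close>

text \<open>Finite range operators: a value of \<open>A f\<close> depends on finitely many values of \<open>f\<close>. Such operators are
  determined by their action on finitely supported functions, where all sums are finite.\<close>

definition local_op :: "(('a \<Rightarrow> real) \<Rightarrow> 'a \<Rightarrow> real) \<Rightarrow> bool" where
  "local_op A \<longleftrightarrow> (\<forall>x. \<exists>R. finite R \<and> (\<forall>f g. (\<forall>y\<in>R. f y = g y) \<longrightarrow> A f x = A g x))"

lemma local_id: "local_op (\<lambda>f. f)" unfolding local_op_def by (metis finite.emptyI finite_insert insertI1)

lemma local_walk: "local_op P"
  unfolding local_op_def using walk_cong finite_nb by meson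

lemma local_opE:
  assumes "local_op A" "finite S"
  obtains R where "finite R" "\<And>f g x. x \<in> S \<Longrightarrow> (\<And>y. y \<in> R \<Longrightarrow> f y = g y) \<Longrightarrow> A f x = A g x"
proof -
  obtain R where R: "\<And>x. finite (R x)" "\<And>x f g. (\<forall>y\<in>R x. f y = g y) \<Longrightarrow> A f x = A g x"
    using assms(1) unfolding local_op_def by metis
  show ?thesis
  proof (rule that[of "\<Union>x\<in>S. R x"])
    show "finite (\<Union>x\<in>S. R x)" using assms R by auto
    show "A f x = A g x" if "x \<in> S" "\<And>y. y \<in> (\<Union>x\<in>S. R x) \<Longrightarrow> f y = g y" for f g x
      using that by (intro R(2)) blast
  qed
qed

lemma local_comp: assumes "local_op A" "local_op A'" shows "local_op (\<lambda>f. A (A' f))"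
  unfolding local_op_def
proof
  fix x
  obtain R where R: "finite R" "\<And>f g y. y \<in> {x} \<Longrightarrow> (\<And>y. y \<in> R \<Longrightarrow> f y = g y) \<Longrightarrow> A f y = A g y"
    using local_opE[OF assms(1), of "{x}"] by auto
  obtain R' where R': "finite R'" "\<And>f g y. y \<in> R \<Longrightarrow> (\<And>y. y \<in> R' \<Longrightarrow> f y = g y) \<Longrightarrow> A' f y = A' g y"
    using local_opE[OF assms(2) R(1)] by metis
  show "\<exists>R. finite R \<and> (\<forall>f g. (\<forall>y\<in>R. f y = g y) \<longrightarrow> A (A' f) x = A (A' g) x)"
  proof (intro exI conjI allI impI)
    fix f g :: "'a \<Rightarrow> real" assume a: "\<forall>y\<in>R'. f y = g y"
    show "A (A' f) x = A (A' g) x" by (rule R(2)) (use a in \<open>auto intro: R'(2)\<close>)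
  qed (rule R')
qed

lemma local_pair:
  assumes "local_op A" "local_op A'" shows "local_op (\<lambda>f x. h x (A f x) (A' f x))"
  unfolding local_op_def
proof
  fix x
  obtain R where R: "finite R" "\<And>f g y. y \<in> {x} \<Longrightarrow> (\<And>y. y \<in> R \<Longrightarrow> f y = g y) \<Longrightarrow> A f y = A g y"
    using local_opE[OF assms(1), of "{x}"] by auto
  obtain R' where R': "finite R'" "\<And>f g y. y \<in> {x} \<Longrightarrow> (\<And>y. y \<in> R' \<Longrightarrow> f y = g y) \<Longrightarrow> A' f y = A' g y"
    using local_opE[OF assms(2), of "{x}"] by auto
  show "\<exists>R. finite R \<and> (\<forall>f g. (\<forall>y\<in>R. f y = g y) \<longrightarrow> h x (A f x) (A' f x) = h x (A g x) (A' g x))"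
  proof (intro exI conjI allI impI)
    show "finite (R \<union> R')" using R R' by simp
    fix f g :: "'a \<Rightarrow> real" assume "\<forall>y\<in>R \<union> R'. f y = g y"
    then have "A f x = A g x" "A' f x = A' g x" using R(2)[of x f g] R'(2)[of x f g] by auto
    then show "h x (A f x) (A' f x) = h x (A g x) (A' g x)" by simp
  qed
qed

lemma local_funpow: "local_op (P ^^ n)"
proof (induction n)
  case 0 show ?case using local_id by (simp add: id_def)
next
  case (Suc n) show ?case using local_comp[OF local_walk Suc] by (simp add: o_def)
qed

text \<open>Restriction to a finite set; finite range operators do not see it far inside the set.\<close>

definition cut :: "'a set \<Rightarrow> ('a \<Rightarrow> real) \<Rightarrow> 'a \<Rightarrow> real" where
  "cut S f = (\<lambda>x. if x \<in> S then f x else 0)"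

lemma fin_cut [simp]: "finite S \<Longrightarrow> fin (cut S f)"
  unfolding fin_def cut_def by (rule finite_subset[of _ S]) auto

lemma local_cut:
  assumes "local_op A" "finite S"
  obtains R where "finite R" "S \<subseteq> R" "\<And>R' f x. R \<subseteq> R' \<Longrightarrow> x \<in> S \<Longrightarrow> A (cut R' f) x = A f x"
proof -
  obtain R where R: "finite R" "\<And>f g x. x \<in> S \<Longrightarrow> (\<And>y. y \<in> R \<Longrightarrow> f y = g y) \<Longrightarrow> A f x = A g x"
    using local_opE[OF assms] by metis
  show ?thesis
  proof (rule that[of "R \<union> S"])
    fix R' f x assume "R \<union> S \<subseteq> R'" "x \<in> S"
    then show "A (cut R' f) x = A f x" by (intro R(2)) (auto simp: cut_def)
  qed (use R assms in auto)
qed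

subsection \<open>Finitely supported functions and symmetry\<close>

lemma ip_eq: "finite S \<Longrightarrow> (\<And>x. f x \<noteq> 0 \<Longrightarrow> g x \<noteq> 0 \<Longrightarrow> x \<in> S) \<Longrightarrow> fin f \<Longrightarrow> ip f g = (\<Sum>x\<in>S. w x * f x * g x)"
proof -
  assume a: "finite S" "\<And>x. f x \<noteq> 0 \<Longrightarrow> g x \<noteq> 0 \<Longrightarrow> x \<in> S" "fin f"
  have "ip f g = (\<Sum>x\<in>{x. f x \<noteq> 0} \<union> S. w x * f x * g x)"
    unfolding ip_def using a by (intro sum.mono_neutral_left) (auto simp: fin_def)
  also have "\<dots> = (\<Sum>x\<in>S. w x * f x * g x)"
    using a by (intro sum.mono_neutral_right) (auto simp: fin_def)
  finally show ?thesis .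
qed

lemma fin_supp: "fin f \<Longrightarrow> finite {x. f x \<noteq> 0}" by (simp add: fin_def)

lemma fin_zero [simp]: "fin (\<lambda>x. 0)" by (simp add: fin_def)

lemma fin_add: "fin f \<Longrightarrow> fin g \<Longrightarrow> fin (\<lambda>x. f x + g x)"
  and fin_diff: "fin f \<Longrightarrow> fin g \<Longrightarrow> fin (\<lambda>x. f x - g x)"
  unfolding fin_def by (rule finite_subset[of _ "{x. f x \<noteq> 0} \<union> {x. g x \<noteq> 0}"]; auto)+

lemma fin_cmult: "fin f \<Longrightarrow> fin (\<lambda>x. c x * f x)"
  unfolding fin_def by (rule finite_subset[of _ "{x. f x \<noteq> 0}"]) auto

lemma fin_comp: "fin f \<Longrightarrow> h 0 = 0 \<Longrightarrow> fin (\<lambda>x. h (f x))"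
  unfolding fin_def by (rule finite_subset[of _ "{x. f x \<noteq> 0}"]) auto

lemma fin_sum: "(\<And>i. i \<in> I \<Longrightarrow> fin (f i)) \<Longrightarrow> fin (\<lambda>x. \<Sum>i\<in>I. f i x)"
  by (induction I rule: infinite_finite_induct) (auto intro: fin_add)

lemma fin_walk: assumes "fin f" shows "fin (P f)"
proof -
  have "{x. P f x \<noteq> 0} \<subseteq> (\<Union>y\<in>{y. f y \<noteq> 0}. nb y)"
  proof
    fix x assume "x \<in> {x. P f x \<noteq> 0}"
    then have "\<exists>y\<in>nb x. f y \<noteq> 0" unfolding walk_eq using sum.neutral by fastforce
    then show "x \<in> (\<Union>y\<in>{y. f y \<noteq> 0}. nb y)" using nb_sym by blast
  qed
  then show ?thesis using assms unfolding fin_def by (meson finite_UN finite_nb finite_subset)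
qed

lemma fin_funpow: "fin f \<Longrightarrow> fin ((P ^^ n) f)" by (induction n) (auto intro: fin_walk)

lemma ip_commute: "fin f \<Longrightarrow> fin g \<Longrightarrow> ip f g = ip g f"
  using ip_eq[of "{x. f x \<noteq> 0}" f g] ip_eq[of "{x. f x \<noteq> 0}" g f]
  by (simp add: fin_def mult_ac)

lemma ip_walk: assumes f: "fin f" shows "ip (P f) g = ip f (P g)"
proof -
  define S where "S = {y. f y \<noteq> 0}"
  define T where "T = {x. P f x \<noteq> 0} \<union> (\<Union>y\<in>S. nb y)"
  have S: "finite S" using f by (simp add: S_def fin_def)
  have T: "finite T" using S fin_walk[OF f] by (auto simp: T_def fin_def)
  have "ip (P f) g = (\<Sum>x\<in>T. w x * P f x * g x)" by (intro ip_eq T fin_walk f) (auto simp: T_def)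
  also have "\<dots> = (\<Sum>x\<in>T. \<Sum>y\<in>S. mu x y * f y * g x)"
    by (intro sum.cong refl, subst w_walk[OF S]) (auto simp: S_def sum_distrib_right)
  also have "\<dots> = (\<Sum>y\<in>S. \<Sum>x\<in>T. mu x y * f y * g x)" by (rule sum.swap)
  also have "\<dots> = (\<Sum>y\<in>S. f y * (\<Sum>x\<in>T. mu y x * g x))"
    by (simp add: sum_distrib_left mult_ac mu_sym)
  also have "\<dots> = (\<Sum>y\<in>S. f y * (w y * P g y))"
  proof (intro sum.cong refl arg_cong2[of _ _ _ _ "(*)"])
    fix y assume "y \<in> S"
    have "x \<in> T" if "mu y x \<noteq> 0" for x using mu_zero[of x y] that \<open>y \<in> S\<close> unfolding T_def by blast
    then show "(\<Sum>x\<in>T. mu y x * g x) = w y * P g y" by (intro w_walk[symmetric] T)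
  qed
  also have "\<dots> = ip f (P g)" by (subst ip_eq[OF S]) (auto simp: S_def f mult_ac)
  finally show ?thesis .
qed

lemma ip_funpow: "fin f \<Longrightarrow> ip ((P ^^ n) f) g = ip f ((P ^^ n) g)"
proof (induction n arbitrary: g)
  case (Suc n)
  have "ip ((P ^^ Suc n) f) g = ip ((P ^^ n) f) (P g)" using Suc by (simp add: ip_walk fin_funpow)
  also have "\<dots> = ip f ((P ^^ n) (P g))" using Suc by simp
  finally show ?case by (simp add: funpow_swap1)
qed simp

lemma ip_add_right: "ip f (\<lambda>x. g x + h x) = ip f g + ip f h"
  and ip_diff_right: "ip f (\<lambda>x. g x - h x) = ip f g - ip f h"
  and ip_cmult_right: "ip f (\<lambda>x. c * g x) = c * ip f g"
  by (simp_all add: ip_def sum.distrib sum_subtractf sum_distrib_left algebra_simps)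

lemma ip_add_left: "fin f \<Longrightarrow> fin g \<Longrightarrow> ip (\<lambda>x. f x + g x) h = ip f h + ip g h"
proof -
  assume a: "fin f" "fin g"
  let ?S = "{x. f x \<noteq> 0} \<union> {x. g x \<noteq> 0}"
  have "finite ?S" using a by (simp add: fin_def)
  then show ?thesis using a
    by (subst (1 2 3) ip_eq[of ?S]) (auto intro: fin_add simp: sum.distrib algebra_simps)
qed

lemma ip_cmult_left: "fin f \<Longrightarrow> ip (\<lambda>x. c * f x) g = c * ip f g"
  by (subst (1 2) ip_eq[of "{x. f x \<noteq> 0}"]) (auto simp: fin_def intro: fin_cmult simp: sum_distrib_left algebra_simps)

lemma ip_sum_right: "ip f (\<lambda>x. \<Sum>i\<in>I. g i x) = (\<Sum>i\<in>I. ip f (g i))"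
proof (induction I rule: infinite_finite_induct)
  case (insert i I) then show ?case by (simp add: ip_add_right)
qed (simp_all add: ip_def)

lemma ip_self_nonneg: "0 \<le> ip f f"
  unfolding ip_def by (intro sum_nonneg) (simp add: mult.assoc)

subsection \<open>Point masses and the kernels\<close>

definition delta :: "'a \<Rightarrow> 'a \<Rightarrow> real" where "delta y = (\<lambda>x. if x = y then 1 else 0)"

lemma fin_delta [simp]: "fin (delta y)"
  unfolding fin_def delta_def by (rule finite_subset[of _ "{y}"]) auto

lemma ip_delta: "ip (delta x) g = w x * g x"
  by (subst ip_eq[of "{x}"], auto simp: delta_def split: if_splits) (auto simp: fin_def)

lemma fin_decomp: "finite S \<Longrightarrow> (\<And>x. f x \<noteq> 0 \<Longrightarrow> x \<in> S) \<Longrightarrow> f = (\<lambda>x. \<Sum>y\<in>S. f y * delta y x)"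
  by (rule ext) (auto simp: delta_def if_distrib[where f="\<lambda>t. _ * t"] sum.delta cong: if_cong)

lemma kern_iter_eq: "kern_iter mu k x y * w y = (P ^^ k) (delta y) x"
proof (induction k arbitrary: x)
  case 0 show ?case by (simp add: delta_def)
next
  case (Suc k)
  have "kern_iter mu (Suc k) x y * w y = (\<Sum>z\<in>nb x. (kern mu x z * w z) * (kern_iter mu k z y * w y))"
    by (simp add: sum_distrib_right sum_distrib_left mult_ac)
  also have "\<dots> = P ((P ^^ k) (delta y)) x" by (simp add: walk_eq[of _ x] kern_w Suc)
  finally show ?case by simp
qed

lemma kern_iter_walk: "kern_iter mu k x y = (P ^^ k) (delta y) x / w y"
  by (simp add: kern_iter_eq[symmetric])

lemma kern_iter_sym: "kern_iter mu k x y = kern_iter mu k y x"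
proof -
  have "ip (delta x) ((P ^^ k) (delta y)) = ip (delta y) ((P ^^ k) (delta x))"
    by (metis fin_delta fin_funpow ip_commute ip_funpow)
  then have "w x * (kern_iter mu k x y * w y) = w y * (kern_iter mu k y x * w x)"
    by (simp add: ip_delta kern_iter_eq)
  then show ?thesis by simp
qed

lemma kern_iter_nonneg: "0 \<le> kern_iter mu k x y"
  unfolding kern_iter_walk by (intro divide_nonneg_nonneg funpow_walk_nonneg) (auto simp: delta_def)

lemma funpow_kernel: "\<exists>R. finite R \<and> (\<forall>f. (P ^^ k) f x = (\<Sum>y\<in>R. kern_iter mu k x y * w y * f y))"
proof -
  obtain R where R: "finite R" "{x} \<subseteq> R" "\<And>R' f z. R \<subseteq> R' \<Longrightarrow> z \<in> {x} \<Longrightarrow> (P ^^ k) (cut R' f) z = (P ^^ k) f z"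
    using local_cut[OF local_funpow, of "{x}" k] by auto
  have "(P ^^ k) f x = (\<Sum>y\<in>R. kern_iter mu k x y * w y * f y)" for f
  proof -
    have "(P ^^ k) f x = (P ^^ k) (cut R f) x" using R by simp
    also have "cut R f = (\<lambda>x. \<Sum>y\<in>R. f y * delta y x)"
      by (subst fin_decomp[of R "cut R f"]) (auto simp: R cut_def split: if_splits)
    also have "(P ^^ k) \<dots> x = (\<Sum>y\<in>R. f y * (P ^^ k) (delta y) x)"
      by (simp add: funpow_walk_sum funpow_walk_cmult)
    finally show ?thesis by (simp add: kern_iter_walk mult_ac)
  qed
  with R show ?thesis by blast
qed

text \<open>Reversibility: \<open>P\<close> is symmetric and fixes the constant \<open>1\<close>, so it preserves total mass.\<close>

lemma ip_one: "fin f \<Longrightarrow> ip ((P ^^ k) f) (\<lambda>_. 1) = ip f (\<lambda>_. 1)"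
  by (simp add: ip_funpow)

lemma sum_funpow_le:
  assumes f: "fin f" "\<And>x. 0 \<le> f x" and S: "finite S" "finite T" "\<And>x. f x \<noteq> 0 \<Longrightarrow> x \<in> T"
  shows "(\<Sum>x\<in>S. w x * (P ^^ k) f x) \<le> (\<Sum>x\<in>T. w x * f x)"
proof -
  have "(\<Sum>x\<in>S. w x * (P ^^ k) f x) \<le> (\<Sum>x\<in>S \<union> {x. (P ^^ k) f x \<noteq> 0}. w x * (P ^^ k) f x)"
    using S fin_supp[OF fin_funpow[OF f(1)]] by (intro sum_mono2) (auto intro!: mult_nonneg_nonneg funpow_walk_nonneg f)
  also have "\<dots> = ip ((P ^^ k) f) (\<lambda>_. 1)"
    using S fin_supp[OF fin_funpow[OF f(1)]]
    by (subst ip_eq[where S="S \<union> {x. (P ^^ k) f x \<noteq> 0}"]) (auto simp: fin_funpow f)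
  also have "\<dots> = (\<Sum>x\<in>T. w x * f x)"
    using f S by (subst ip_one, simp, subst ip_eq[where S=T]) auto
  finally show ?thesis .
qed

end

section \<open>Positivity of polynomials of the Laplacian\<close>

lemma binomial_ratio_approx:
  assumes "i \<le> n" "2 * k \<le> n" "0 < n"
  shows "\<bar>real (i choose k) / real (n choose k) - (real i / real n) ^ k\<bar> \<le> 2 * (real k)\<^sup>2 / real n"
proof -
  define z where "z j = (real i - real j) / (real n - real j)" for j
  have eq: "real (i choose k) / real (n choose k) = (\<Prod>j\<in>{0..<k}. z j)"
    unfolding binomial_gbinomial gbinomial_altdef_of_nat z_def
    by (simp flip: prod_dividef)
  have z1: "norm (z j) \<le> 1" if "j \<in> {0..<k}" for j
    using that assms by (auto simp: z_def abs_le_iff divide_simps)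
  have diff: "norm (z j - real i / real n) \<le> 2 * real k / real n" if "j \<in> {0..<k}" for j
  proof -
    have j: "real j \<le> real k" "2 * real k \<le> real n" "real j < real n" using that assms by auto
    have "z j - real i / real n = - (real j / real n) * ((real n - real i) / (real n - real j))"
      using j assms by (simp add: z_def field_simps)
    also have "norm \<dots> = (real j / real n) * ((real n - real i) / (real n - real j))"
      using j assms by (simp add: abs_mult)
    also have "\<dots> \<le> (real k / real n) * 2"
    proof (rule mult_mono)
      have "real n \<le> 2 * (real n - real j)" using j by simp
      then show "(real n - real i) / (real n - real j) \<le> 2" using j by (simp add: divide_simps)
    qed (use j assms in \<open>auto simp: divide_right_mono\<close>)
    finally show ?thesis by (simp add: mult.commute)
  qed
  have "norm ((\<Prod>j\<in>{0..<k}. z j) - (\<Prod>j\<in>{0..<k}. real i / real n)) \<le> (\<Sum>j\<in>{0..<k}. norm (z j - real i / real n))"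
    by (rule norm_prod_diff) (use z1 assms in auto)
  also have "\<dots> \<le> (\<Sum>j\<in>{0..<k}. 2 * real k / real n)" by (intro sum_mono diff)
  also have "\<dots> = 2 * (real k)\<^sup>2 / real n" by (simp add: power2_eq_square)
  finally show ?thesis by (simp add: eq)
qed

lemma monomial_bernstein:
  fixes x :: real
  assumes "k \<le> n"
  shows "2 ^ n * x ^ k = (\<Sum>i\<le>n. (2 ^ k * (real (n choose i) * (real (i choose k) / real (n choose k)))) * (x ^ i * (2 - x) ^ (n - i)))"
proof -
  have r: "real (n choose i) * (real (i choose k) / real (n choose k)) = (if k \<le> i then real ((n - k) choose (i - k)) else 0)"
    if "i \<le> n" for i
  proof (cases "k \<le> i")
    case True
    have "(n choose i) * (i choose k) = (n choose k) * ((n - k) choose (i - k))"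
      by (rule choose_mult) (use that True in auto)
    then have "real (n choose i) * real (i choose k) = real (n choose k) * real ((n - k) choose (i - k))"
      by (metis of_nat_mult)
    moreover have "real (n choose k) \<noteq> 0" using assms by simp
    ultimately show ?thesis using True by (simp add: field_simps)
  qed (simp add: binomial_eq_0)
  have "2 ^ n * x ^ k = 2 ^ k * x ^ k * (x + (2 - x)) ^ (n - k)"
    using assms by (simp flip: power_add)
  also have "(x + (2 - x)) ^ (n - k) = (\<Sum>j\<le>n - k. real ((n - k) choose j) * x ^ j * (2 - x) ^ (n - k - j))"
    by (rule binomial_ring)
  also have "2 ^ k * x ^ k * \<dots> = (\<Sum>j\<le>n - k. 2 ^ k * real ((n - k) choose j) * (x ^ (j + k) * (2 - x) ^ (n - (j + k))))"
    by (simp add: sum_distrib_left power_add mult_ac diff_diff_left add.commute)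
  also have "\<dots> = (\<Sum>i\<in>{k..n}. 2 ^ k * real ((n - k) choose (i - k)) * (x ^ i * (2 - x) ^ (n - i)))"
    by (rule sum.reindex_bij_witness[of _ "\<lambda>i. i - k" "\<lambda>j. j + k"]) (use assms in auto)
  also have "\<dots> = (\<Sum>i\<in>{k..n}. (2 ^ k * (real (n choose i) * (real (i choose k) / real (n choose k)))) * (x ^ i * (2 - x) ^ (n - i)))"
    by (intro sum.cong refl, subst r) auto
  also have "\<dots> = (\<Sum>i\<le>n. (2 ^ k * (real (n choose i) * (real (i choose k) / real (n choose k)))) * (x ^ i * (2 - x) ^ (n - i)))"
    by (rule sum.mono_neutral_left) (auto simp: r)
  finally show ?thesis .
qed

text \<open>A polynomial that is positive on \<open>[0, 2]\<close> has nonnegative Bernstein coefficients once the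
  degree of the Bernstein basis is large: the coefficients converge uniformly to its values.\<close>

lemma bernstein_positive:
  fixes q :: "real poly"
  assumes "\<delta> > 0" "\<And>x. 0 \<le> x \<Longrightarrow> x \<le> 2 \<Longrightarrow> \<delta> \<le> poly q x"
  shows "\<exists>n b. (\<forall>i\<le>n. 0 \<le> b i) \<and> q = (\<Sum>i\<le>n. smult (b i) ([:0, 1:] ^ i * [:2, -1:] ^ (n - i)))"
proof -
  define d where "d = degree q"
  define M where "M = (\<Sum>k\<le>d. \<bar>coeff q k\<bar> * 2 ^ k * (2 * (real k)\<^sup>2))"
  obtain n where n: "real n \<ge> M / \<delta> + 2 * real d + 1" using real_arch_simple by blast
  have "0 \<le> M" unfolding M_def by (intro sum_nonneg) auto
  then have "0 \<le> M / \<delta>" using assms by simp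
  with n have nd: "2 * d \<le> n" "0 < n" by linarith+
  have "M / \<delta> \<le> real n" using n by linarith
  then have M: "M / real n \<le> \<delta>" using assms(1) nd by (simp add: field_simps)
  define \<beta> where "\<beta> i = (\<Sum>k\<le>d. coeff q k * 2 ^ k * (real (i choose k) / real (n choose k)))" for i
  have \<beta>: "0 \<le> \<beta> i" if "i \<le> n" for i
  proof -
    have "poly q (2 * real i / real n) = (\<Sum>k\<le>d. coeff q k * 2 ^ k * (real i / real n) ^ k)"
      by (simp add: poly_altdef d_def power_mult_distrib power_divide mult_ac)
    then have "\<bar>\<beta> i - poly q (2 * real i / real n)\<bar>
        = \<bar>\<Sum>k\<le>d. coeff q k * 2 ^ k * (real (i choose k) / real (n choose k) - (real i / real n) ^ k)\<bar>"
      by (simp add: \<beta>_def sum_subtractf algebra_simps)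
    also have "\<dots> \<le> (\<Sum>k\<le>d. \<bar>coeff q k\<bar> * 2 ^ k * (2 * (real k)\<^sup>2 / real n))"
      by (rule order_trans[OF sum_abs], intro sum_mono)
        (use that nd in \<open>simp add: abs_mult mult_left_mono binomial_ratio_approx del: times_divide_eq_right\<close>)
    also have "\<dots> = M / real n" by (simp add: M_def sum_divide_distrib)
    finally have "\<bar>\<beta> i - poly q (2 * real i / real n)\<bar> \<le> \<delta>" using M by simp
    moreover have "\<delta> \<le> poly q (2 * real i / real n)" using that nd by (intro assms(2)) (auto simp: field_simps)
    ultimately show ?thesis by linarith
  qed
  define b where "b i = \<beta> i * real (n choose i) / 2 ^ n" for i
  have "q = (\<Sum>i\<le>n. smult (b i) ([:0, 1:] ^ i * [:2, -1:] ^ (n - i)))"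
  proof (rule poly_eq_poly_eq_iff[THEN iffD1], rule ext)
    fix x :: real
    have "2 ^ n * poly q x = (\<Sum>k\<le>d. coeff q k * (2 ^ n * x ^ k))"
      by (simp add: poly_altdef d_def sum_distrib_left mult_ac)
    also have "\<dots> = (\<Sum>k\<le>d. \<Sum>i\<le>n. coeff q k * ((2 ^ k * (real (n choose i) * (real (i choose k) / real (n choose k)))) * (x ^ i * (2 - x) ^ (n - i))))"
      by (intro sum.cong refl, subst monomial_bernstein[where n=n]) (use nd in \<open>auto simp: sum_distrib_left\<close>)
    also have "\<dots> = (\<Sum>i\<le>n. 2 ^ n * (b i * (x ^ i * (2 - x) ^ (n - i))))"
      by (subst sum.swap) (simp add: b_def \<beta>_def sum_distrib_right sum_distrib_left sum_divide_distrib mult_ac)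
    finally show "poly q x = poly (\<Sum>i\<le>n. smult (b i) ([:0, 1:] ^ i * [:2, -1:] ^ (n - i))) x"
      by (simp add: poly_sum sum_distrib_left[symmetric])
  qed
  moreover have "\<forall>i\<le>n. 0 \<le> b i" using \<beta> by (auto simp: b_def)
  ultimately show ?thesis by blast
qed

context walk_graph
begin

abbreviation "pol \<equiv> poly_laplacian mu"
abbreviation "tnorm \<equiv> tangent_norm mu"
abbreviation "df \<equiv> diff_form mu"

lemma lap_eq: "Lap f = (\<lambda>x. f x - P f x)" by (simp add: laplacian_def fun_eq_iff)

lemma lap_add: "Lap (\<lambda>x. f x + g x) = (\<lambda>x. Lap f x + Lap g x)"
  and lap_cmult: "Lap (\<lambda>x. c * f x) = (\<lambda>x. c * Lap f x)"
  by (auto simp: lap_eq walk_add walk_cmult algebra_simps)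

lemma lap_sum: "Lap (\<lambda>x. \<Sum>i\<in>A. f i x) = (\<lambda>x. \<Sum>i\<in>A. Lap (f i) x)"
  by (induction A rule: infinite_finite_induct) (auto simp: lap_add lap_eq)

lemma fin_lap: "fin f \<Longrightarrow> fin (Lap f)" unfolding lap_eq by (intro fin_diff fin_walk)

lemma pol_0 [simp]: "pol 0 f = (\<lambda>x. 0)"
  by (simp add: poly_laplacian_def fun_eq_iff)

lemma pol_pCons: "pol (pCons a p) f = (\<lambda>x. a * f x + Lap (pol p f) x)"
proof (cases "p = 0")
  case True
  then show ?thesis by (simp add: poly_laplacian_def fun_eq_iff lap_eq)
next
  case False
  have "pol (pCons a p) f x = a * f x + (\<Sum>i\<le>degree p. coeff p i * (Lap ^^ Suc i) f x)" for x
    unfolding poly_laplacian_def by (subst degree_pCons_eq[OF False], subst sum.atMost_Suc_shift) simp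
  moreover have "Lap (pol p f) = (\<lambda>x. \<Sum>i\<le>degree p. coeff p i * (Lap ^^ Suc i) f x)"
    unfolding poly_laplacian_def by (simp add: lap_sum lap_cmult)
  ultimately show ?thesis by (simp add: fun_eq_iff)
qed

lemma pol_add: "pol (p + q) f = (\<lambda>x. pol p f x + pol q f x)"
  by (induction p q rule: poly_induct2) (auto simp: pol_pCons lap_add algebra_simps)

lemma pol_smult: "pol (smult c p) f = (\<lambda>x. c * pol p f x)"
  by (induction p) (auto simp: pol_pCons lap_cmult algebra_simps)

lemma pol_diff: "pol (p - q) f = (\<lambda>x. pol p f x - pol q f x)"
  using pol_add[of p "smult (-1) q" f] unfolding pol_smult by simp

lemma pol_sum: "pol (\<Sum>i\<in>A. p i) f = (\<lambda>x. \<Sum>i\<in>A. pol (p i) f x)"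
  by (induction A rule: infinite_finite_induct) (auto simp: pol_add)

lemma pol_add_arg: "pol p (\<lambda>x. f x + g x) = (\<lambda>x. pol p f x + pol p g x)"
  and pol_cmult_arg: "pol p (\<lambda>x. c * f x) = (\<lambda>x. c * pol p f x)"
  by (induction p) (auto simp: pol_pCons lap_add lap_cmult algebra_simps)

lemma pol_diff_arg: "pol p (\<lambda>x. f x - g x) = (\<lambda>x. pol p f x - pol p g x)"
  using pol_add_arg[of p f "\<lambda>x. (-1) * g x"] unfolding pol_cmult_arg by simp

lemma pol_mult: "pol (p * q) f = pol p (pol q f)"
  by (induction p) (auto simp: pol_pCons pol_add pol_smult)

lemma pol_1 [simp]: "pol 1 f = f"
  by (simp add: one_pCons pol_pCons lap_eq)

lemma pol_X: "pol [:0, 1:] f = Lap f"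
  by (simp add: pol_pCons lap_eq)

lemma pol_walk: "pol ([:1, -1:] ^ k) f = (P ^^ k) f"
proof (induction k)
  case (Suc k)
  have "pol [:1, -1:] g = P g" for g by (simp add: pol_pCons lap_eq walk_cmult[of "-1", simplified])
  then show ?case using Suc by (simp only: power_Suc pol_mult) simp
qed simp

lemma local_pol: "local_op (pol p)"
proof (induction p)
  case 0
  show ?case by (auto simp: local_op_def)
next
  case (pCons a p)
  have "local_op (\<lambda>f. Lap (pol p f))"
    unfolding lap_eq by (intro local_pair[where h="\<lambda>x a b. a - b"] local_comp[OF local_walk] pCons)
  then show ?case unfolding pol_pCons[abs_def]
    by (intro local_pair[OF local_id, where h="\<lambda>x b c. a * b + c"])
qed

lemma fin_pol: "fin f \<Longrightarrow> fin (pol p f)"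
  by (induction p) (auto simp: pol_pCons intro: fin_add fin_cmult fin_lap)

lemma ip_lap: "fin f \<Longrightarrow> ip (Lap f) g = ip f (Lap g)"
  unfolding lap_eq using ip_add_left[of f "\<lambda>x. -1 * P f x" g] ip_cmult_left[of "P f" "-1" g]
  by (simp add: fin_walk fin_cmult ip_walk ip_diff_right fin_comp[where h=uminus])

lemma pol_lap: "pol p (Lap g) = Lap (pol p g)"
  using pol_mult[of p "[:0, 1:]" g] pol_mult[of "[:0, 1:]" p g] by (simp add: mult.commute pol_X)

lemma ip_pol: "fin f \<Longrightarrow> ip (pol p f) g = ip f (pol p g)"
proof (induction p arbitrary: g)
  case (pCons a p)
  then show ?case
    by (simp add: pol_pCons ip_add_left ip_add_right fin_cmult fin_lap fin_pol ip_cmult_left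
        ip_cmult_right ip_lap pol_lap)
qed (simp add: ip_def)

lemma tnorm_nonneg [simp]: "0 \<le> tnorm F x"
  unfolding tangent_norm_def by (intro real_sqrt_ge_zero mult_nonneg_nonneg sum_nonneg)
    (auto simp: kern_def mu_nonneg)

lemma tnorm_sq: "(tnorm F x)\<^sup>2 = (\<Sum>y\<in>nb x. mu x y / w x * (F (x, y))\<^sup>2) / 2"
proof -
  have "0 \<le> (\<Sum>y\<in>nb x. mu x y / w x * (F (x, y))\<^sup>2)" by (intro sum_nonneg) (auto simp: mu_nonneg)
  then show ?thesis unfolding tangent_norm_def by (simp add: kern_w)
qed

lemma tnorm_df_sq: "(tnorm (df f) x)\<^sup>2 = ((f x)\<^sup>2 - 2 * (f x * P f x) + P (\<lambda>y. (f y)\<^sup>2) x) / 2"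
proof -
  have "(\<Sum>y\<in>nb x. mu x y / w x * (df f (x, y))\<^sup>2) = P (\<lambda>y. (f x - f y)\<^sup>2) x"
    unfolding walk_eq by (intro sum.cong) (auto simp: diff_form_def nbrs_def)
  also have "(\<lambda>y. (f x - f y)\<^sup>2) = (\<lambda>y. ((f x)\<^sup>2 - (2 * f x) * f y) + (f y)\<^sup>2)"
    by (auto simp: power2_eq_square algebra_simps)
  also have "P \<dots> x = (f x)\<^sup>2 - 2 * f x * P f x + P (\<lambda>y. (f y)\<^sup>2) x"
    by (simp add: walk_add walk_diff walk_cmult)
  finally show ?thesis by (simp add: tnorm_sq)
qed

lemma ip_sq_one: "fin f \<Longrightarrow> ip (P (\<lambda>x. (f x)\<^sup>2)) (\<lambda>_. 1) = ip f f"
proof -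
  assume f: "fin f"
  have "ip (P (\<lambda>x. (f x)\<^sup>2)) (\<lambda>_. 1) = ip (\<lambda>x. (f x)\<^sup>2) (\<lambda>_. 1)"
    using f by (simp add: ip_walk fin_comp[where h="\<lambda>t. t\<^sup>2"])
  also have "\<dots> = ip f f" unfolding ip_def by (intro sum.cong) (auto simp: power2_eq_square)
  finally show ?thesis .
qed

text \<open>Summation by parts. Only the inequality is recorded, because the left-hand side is restricted to a
  finite set; the terms outside that set are nonnegative.\<close>

lemma dirichlet_form:
  assumes f: "fin f" and S: "finite S"
  shows "(\<Sum>x\<in>S. w x * (tnorm (df f) x)\<^sup>2) \<le> ip f (Lap f)"
proof -
  define T where "T = S \<union> {x. f x \<noteq> 0} \<union> {x. P (\<lambda>y. (f y)\<^sup>2) x \<noteq> 0}"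
  have f2: "fin (P (\<lambda>x. (f x)\<^sup>2))" using f by (intro fin_walk fin_comp[where h="\<lambda>t. t\<^sup>2"]) auto
  have T: "finite T" unfolding T_def using S fin_supp[OF f] fin_supp[OF f2] by auto
  have "(\<Sum>x\<in>S. w x * (tnorm (df f) x)\<^sup>2) \<le> (\<Sum>x\<in>T. w x * (tnorm (df f) x)\<^sup>2)"
    using T by (intro sum_mono2) (auto simp: T_def)
  also have "\<dots> = ((\<Sum>x\<in>T. w x * f x * f x) - 2 * (\<Sum>x\<in>T. w x * f x * P f x) + (\<Sum>x\<in>T. w x * P (\<lambda>y. (f y)\<^sup>2) x * 1)) / 2"
  proof -
    have "w x * (tnorm (df f) x)\<^sup>2 = (w x * f x * f x - 2 * (w x * f x * P f x) + w x * P (\<lambda>y. (f y)\<^sup>2) x * 1) / 2" for x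
      unfolding tnorm_df_sq by (simp add: power2_eq_square algebra_simps)
    then have "(\<Sum>x\<in>T. w x * (tnorm (df f) x)\<^sup>2)
        = (\<Sum>x\<in>T. (w x * f x * f x - 2 * (w x * f x * P f x) + w x * P (\<lambda>y. (f y)\<^sup>2) x * 1) / 2)"
      by (rule sum.cong[OF refl])
    then show ?thesis by (simp only: sum_divide_distrib[symmetric] sum.distrib sum_subtractf sum_distrib_left)
  qed
  also have "(\<Sum>x\<in>T. w x * f x * f x) = ip f f" by (rule ip_eq[symmetric]) (use T f in \<open>auto simp: T_def\<close>)
  also have "(\<Sum>x\<in>T. w x * f x * P f x) = ip f (P f)" by (rule ip_eq[symmetric]) (use T f in \<open>auto simp: T_def\<close>)
  also have "(\<Sum>x\<in>T. w x * P (\<lambda>y. (f y)\<^sup>2) x * 1) = ip (P (\<lambda>y. (f y)\<^sup>2)) (\<lambda>_. 1)"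
    by (rule ip_eq[symmetric]) (use T f2 in \<open>auto simp: T_def\<close>)
  finally show ?thesis using f by (simp add: ip_sq_one lap_eq ip_diff_right)
qed

lemma ip_walk_lower: assumes f: "fin f" shows "- ip f f \<le> ip f (P f)"
proof -
  define T where "T = {x. f x \<noteq> 0} \<union> {x. P (\<lambda>y. (f y)\<^sup>2) x \<noteq> 0}"
  have f2: "fin (P (\<lambda>x. (f x)\<^sup>2))" using f by (intro fin_walk fin_comp[where h="\<lambda>t. t\<^sup>2"]) auto
  have T: "finite T" unfolding T_def using fin_supp[OF f] fin_supp[OF f2] by auto
  have "0 \<le> w x * f x * f x + 2 * (w x * f x * P f x) + w x * P (\<lambda>y. (f y)\<^sup>2) x * 1" for x
  proof -
    have "0 \<le> (f x + P f x)\<^sup>2" by simp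
    also have "\<dots> \<le> (f x)\<^sup>2 + 2 * (f x * P f x) + P (\<lambda>y. (f y)\<^sup>2) x"
      using walk_square[of f x] by (simp add: power2_sum)
    finally have "0 \<le> w x * ((f x)\<^sup>2 + 2 * (f x * P f x) + P (\<lambda>y. (f y)\<^sup>2) x)" by simp
    then show ?thesis by (simp add: algebra_simps power2_eq_square)
  qed
  then have "0 \<le> (\<Sum>x\<in>T. w x * f x * f x + 2 * (w x * f x * P f x) + w x * P (\<lambda>y. (f y)\<^sup>2) x * 1)"
    by (intro sum_nonneg) auto
  also have "\<dots> = (\<Sum>x\<in>T. w x * f x * f x) + 2 * (\<Sum>x\<in>T. w x * f x * P f x) + (\<Sum>x\<in>T. w x * P (\<lambda>y. (f y)\<^sup>2) x * 1)"
    by (simp add: sum.distrib sum_distrib_left)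
  also have "(\<Sum>x\<in>T. w x * f x * f x) = ip f f" by (rule ip_eq[symmetric]) (use T f in \<open>auto simp: T_def\<close>)
  also have "(\<Sum>x\<in>T. w x * f x * P f x) = ip f (P f)" by (rule ip_eq[symmetric]) (use T f in \<open>auto simp: T_def\<close>)
  also have "(\<Sum>x\<in>T. w x * P (\<lambda>y. (f y)\<^sup>2) x * 1) = ip (P (\<lambda>y. (f y)\<^sup>2)) (\<lambda>_. 1)"
    by (rule ip_eq[symmetric]) (use T f2 in \<open>auto simp: T_def\<close>)
  finally show ?thesis using f by (simp add: ip_sq_one)
qed

text \<open>Positivity of the operator \<open>q(\<Delta>)\<close>, tested on finitely supported functions.\<close>

definition pos :: "real poly \<Rightarrow> bool" where
  "pos q \<longleftrightarrow> (\<forall>f. fin f \<longrightarrow> 0 \<le> ip f (pol q f))"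

lemma pos_smult: "pos q \<Longrightarrow> 0 \<le> c \<Longrightarrow> pos (smult c q)"
  by (auto simp: pos_def pol_smult ip_cmult_right)

lemma pos_sum: "(\<And>i. i \<in> A \<Longrightarrow> pos (q i)) \<Longrightarrow> pos (\<Sum>i\<in>A. q i)"
  by (auto simp: pos_def pol_sum ip_sum_right intro!: sum_nonneg)

lemma pos_add: "pos p \<Longrightarrow> pos q \<Longrightarrow> pos (p + q)"
  by (auto simp: pos_def pol_add ip_add_right)

lemma pos_sq_mult: assumes "pos r" shows "pos (p ^ 2 * r)"
  unfolding pos_def
proof safe
  fix f assume f: "fin f"
  have "ip f (pol (p ^ 2 * r) f) = ip f (pol (p * (r * p)) f)"
    by (simp add: power2_eq_square mult_ac)
  also have "\<dots> = ip (pol p f) (pol r (pol p f))" using f by (simp add: pol_mult ip_pol)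
  finally show "0 \<le> ip f (pol (p\<^sup>2 * r) f)" using assms fin_pol[OF f] by (simp add: pos_def)
qed

lemma pos_1: "pos 1" by (simp add: pos_def ip_self_nonneg)

lemma pos_X: "pos [:0, 1:]"
  unfolding pos_def pol_X using dirichlet_form[where S="{}"] by simp

lemma pos_2X: "pos [:2, -1:]"
  unfolding pos_def
proof safe
  fix f assume f: "fin f"
  have "pol [:2, -1:] f = (\<lambda>x. f x + P f x)"
    by (simp add: pol_pCons lap_eq walk_cmult[of "-1", simplified])
  then show "0 \<le> ip f (pol [:2, - 1:] f)" using ip_walk_lower[OF f] by (simp add: ip_add_right)
qed

lemma power_parity_split:
  fixes x y :: "'b :: comm_monoid_mult"
  shows "x ^ i * y ^ j = (x ^ (i div 2) * y ^ (j div 2)) ^ 2 * (x ^ (i mod 2) * y ^ (j mod 2))"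
proof -
  have "x ^ i = (x ^ (i div 2)) ^ 2 * x ^ (i mod 2)" "y ^ j = (y ^ (j div 2)) ^ 2 * y ^ (j mod 2)"
    by (simp_all only: power_mult[symmetric] power_add[symmetric] div_mult_mod_eq)
  then have "x ^ i * y ^ j = ((x ^ (i div 2)) ^ 2 * x ^ (i mod 2)) * ((y ^ (j div 2)) ^ 2 * y ^ (j mod 2))"
    by (simp only:)
  then show ?thesis by (simp only: power_mult_distrib mult_ac)
qed

text \<open>Even powers come out as squares of symmetric operators and preserve positivity. What remains is \<open>X\<close>
  (the Dirichlet form), \<open>2 - X = 1 + P\<close> (as \<open>P\<close> is a contraction) and their product, which equals
  \<open>((2 - X)\<^sup>2 X + X\<^sup>2 (2 - X)) / 2\<close>.\<close>

lemma pos_bernstein: "pos ([:0, 1:] ^ i * [:2, -1:] ^ j)"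
proof -
  let ?X = "[:0, 1:] :: real poly" and ?Y = "[:2, -1:] :: real poly"
  have XY: "pos (?X * ?Y)"
  proof -
    have "?X * ?Y = smult (1/2) (?Y ^ 2 * ?X + ?X ^ 2 * ?Y)"
      by (simp add: power2_eq_square)
    also have "pos \<dots>" by (intro pos_smult pos_add pos_sq_mult pos_X pos_2X) simp
    finally show ?thesis .
  qed
  have *: "pos (?X ^ (i mod 2) * ?Y ^ (j mod 2))"
  proof -
    have "i mod 2 = 0 \<or> i mod 2 = 1" "j mod 2 = 0 \<or> j mod 2 = 1" by linarith+
    then show ?thesis using XY pos_1 pos_X pos_2X
      by (elim disjE) (simp_all only: power_0 power_one_right mult_1_left mult_1_right)
  qed
  have "?X ^ i * ?Y ^ j = (?X ^ (i div 2) * ?Y ^ (j div 2)) ^ 2 * (?X ^ (i mod 2) * ?Y ^ (j mod 2))"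
    by (rule power_parity_split)
  then show ?thesis using pos_sq_mult[OF *] by (simp only:)
qed

text \<open>The spectral theorem in the form needed here. Adding a small constant makes the polynomial strictly
  positive, so that its Bernstein coefficients are nonnegative and \<open>pos_bernstein\<close> applies to each term.\<close>

theorem pos_nonneg:
  assumes "\<And>x. 0 \<le> x \<Longrightarrow> x \<le> 2 \<Longrightarrow> 0 \<le> poly q x"
  shows "pos q"
  unfolding pos_def
proof safe
  fix f assume f: "fin f"
  have ge: "0 \<le> ip f (pol q f) + e * (ip f f + 1)" if e: "e > 0" for e
  proof -
    have "pos (q + [:e:])"
    proof -
      have "\<And>x. 0 \<le> x \<Longrightarrow> x \<le> 2 \<Longrightarrow> e \<le> poly (q + [:e:]) x" using assms by simp
      then have "\<exists>n b. (\<forall>i\<le>n. 0 \<le> b i) \<and> q + [:e:] = (\<Sum>i\<le>n. smult (b i) ([:0, 1:] ^ i * [:2, -1:] ^ (n - i)))"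
        by (rule bernstein_positive[OF e])
      then obtain n b where b: "\<forall>i\<le>n. 0 \<le> b i"
        and q: "q + [:e:] = (\<Sum>i\<le>n. smult (b i) ([:0, 1:] ^ i * [:2, -1:] ^ (n - i)))"
        by (elim exE conjE)
      have "pos (\<Sum>i\<le>n. smult (b i) ([:0, 1:] ^ i * [:2, -1:] ^ (n - i)))"
        using b by (intro pos_sum pos_smult pos_bernstein) auto
      then show ?thesis unfolding q .
    qed
    then have "0 \<le> ip f (pol (q + [:e:]) f)" using f by (simp add: pos_def)
    also have "pol (q + [:e:]) f = (\<lambda>x. pol q f x + e * f x)" by (simp add: pol_add pol_pCons lap_eq)
    finally show ?thesis using e ip_self_nonneg[of f] by (simp add: ip_add_right ip_cmult_right algebra_simps)
  qed
  have *: "- ip f (pol q f) \<le> e * (ip f f + 1)" if "e > 0" for e using ge[OF that] by linarith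
  show "0 \<le> ip f (pol q f)"
  proof (rule ccontr)
    assume n: "\<not> 0 \<le> ip f (pol q f)"
    define e where "e = - ip f (pol q f) / (2 * (ip f f + 1))"
    have "e > 0" using n ip_self_nonneg[of f] unfolding e_def by (intro divide_pos_pos) auto
    moreover have "e * (ip f f + 1) = - ip f (pol q f) / 2"
      using ip_self_nonneg[of f] by (simp add: e_def field_simps)
    ultimately show False using *[of e] n by linarith
  qed
qed

lemma ip_pol_le:
  assumes "fin f" "\<And>x. 0 \<le> x \<Longrightarrow> x \<le> 2 \<Longrightarrow> \<bar>poly q x\<bar> \<le> C"
  shows "ip (pol q f) (pol q f) \<le> C\<^sup>2 * ip f f"
proof -
  have "pos ([:C\<^sup>2:] - q * q)"
  proof (rule pos_nonneg)
    fix x :: real assume "0 \<le> x" "x \<le> 2"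
    then have "(poly q x)\<^sup>2 \<le> C\<^sup>2" using assms(2) by (metis abs_ge_zero power2_abs power_mono)
    then show "0 \<le> poly ([:C\<^sup>2:] - q * q) x" by (simp add: power2_eq_square)
  qed
  then have "0 \<le> ip f (pol ([:C\<^sup>2:] - q * q) f)" using assms by (simp add: pos_def)
  also have "\<dots> = C\<^sup>2 * ip f f - ip (pol q f) (pol q f)"
    using assms(1) by (simp add: pol_diff pol_mult pol_pCons lap_eq ip_diff_right ip_cmult_right ip_pol)
  finally show ?thesis by simp
qed

lemma dirichlet_pol_le:
  assumes f: "fin f" and S: "finite S" and q: "\<And>x. 0 \<le> x \<Longrightarrow> x \<le> 2 \<Longrightarrow> x * (poly q x)\<^sup>2 \<le> C"
  shows "(\<Sum>x\<in>S. w x * (tnorm (df (pol q f)) x)\<^sup>2) \<le> C * ip f f"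
proof -
  have "pos ([:C:] - [:0, 1:] * (q * q))"
    by (rule pos_nonneg) (use q in \<open>auto simp: power2_eq_square\<close>)
  then have "0 \<le> ip f (pol ([:C:] - [:0, 1:] * (q * q)) f)" using f by (simp add: pos_def)
  also have "[:C:] - [:0, 1:] * (q * q) = [:C:] - q * ([:0, 1:] * q)" by (simp add: mult_ac)
  also have "ip f (pol \<dots> f) = C * ip f f - ip (pol q f) (Lap (pol q f))"
    using f by (simp only: pol_diff pol_mult pol_X) (simp add: pol_pCons lap_eq[of "\<lambda>_. 0"] ip_diff_right ip_cmult_right ip_pol)
  finally show ?thesis using dirichlet_form[OF fin_pol[OF f] S, of q] by linarith
qed

end

section \<open>The binomial series of \<open>(1 - t)\<^sup>-\<^sup>1\<^sup>/\<^sup>2\<close> and its Cesaro means\<close>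

text \<open>The coefficients \<open>(2n choose n) / 4\<^sup>n\<close> of \<open>(1 - t)\<^sup>-\<^sup>1\<^sup>/\<^sup>2\<close>.\<close>

primrec cf :: "nat \<Rightarrow> real" where
  "cf 0 = 1"
| "cf (Suc n) = cf n * (2 * real n + 1) / (2 * real n + 2)"

lemma cf_pos [simp]: "0 < cf n" by (induction n) auto

lemma cf_nonneg [simp]: "0 \<le> cf n" by (rule less_imp_le) simp

lemma cf_sq_le: "(cf n)\<^sup>2 * (2 * real n + 1) \<le> 1"
proof (induction n)
  case (Suc n)
  define r where "r = real n"
  have r: "0 \<le> r" by (simp add: r_def)
  have "(2 * r + 1) * (2 * r + 3) \<le> (2 * r + 2)\<^sup>2" by (simp add: power2_eq_square algebra_simps)
  then have 1: "((2 * r + 1) * (2 * r + 3)) / (2 * r + 2)\<^sup>2 \<le> 1" using r by (simp add: divide_le_eq_1)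
  have "(cf (Suc n))\<^sup>2 * (2 * real (Suc n) + 1)
      = ((cf n)\<^sup>2 * (2 * r + 1)) * (((2 * r + 1) * (2 * r + 3)) / (2 * r + 2)\<^sup>2)"
    by (simp add: r_def power2_eq_square field_simps)
  also have "\<dots> \<le> ((cf n)\<^sup>2 * (2 * r + 1)) * 1" using 1 r by (intro mult_left_mono) auto
  also have "\<dots> \<le> 1" using Suc by (simp add: r_def)
  finally show ?case .
qed simp

lemma cf_le: "cf n \<le> 1 / sqrt (real n + 1)"
proof -
  have "(cf n)\<^sup>2 * (real n + 1) \<le> (cf n)\<^sup>2 * (2 * real n + 1)" by (intro mult_left_mono) auto
  with cf_sq_le[of n] have "(cf n)\<^sup>2 * (real n + 1) \<le> 1" by linarith
  then have "sqrt ((cf n)\<^sup>2 * (real n + 1)) \<le> 1" by simp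
  then have "cf n * sqrt (real n + 1) \<le> 1" by (simp add: real_sqrt_mult)
  then show ?thesis by (simp add: field_simps)
qed

lemma cf_le_1: "cf n \<le> 1"
  by (rule order_trans[OF cf_le]) simp

definition binom_sum :: "nat \<Rightarrow> real \<Rightarrow> real" where
  "binom_sum n t = (\<Sum>l\<le>n. cf l * t ^ l)"

text \<open>Differentiating \<open>\<surd>(1 - t)\<close> times a partial sum leaves a single monomial, so this product can be
  compared with \<open>1\<close> by monotonicity alone.\<close>

lemma binom_sum_deriv:
  assumes "t < 1"
  shows "((\<lambda>t. sqrt (1 - t) * binom_sum n t) has_real_derivative
           - ((real n + 1 / 2) * cf n * t ^ n / sqrt (1 - t))) (at t)"
proof -
  have D: "\<exists>d. (binom_sum n has_real_derivative d) (at t) \<and> (1 - t) * d - binom_sum n t / 2 = - ((real n + 1 / 2) * cf n * t ^ n)" for n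
  proof (induction n)
    case 0
    have "(binom_sum 0 has_real_derivative 0) (at t)" unfolding binom_sum_def by simp
    then show ?case by (intro exI[of _ 0]) (auto simp: binom_sum_def)
  next
    case (Suc n)
    then obtain d where d: "(binom_sum n has_real_derivative d) (at t)"
      "(1 - t) * d - binom_sum n t / 2 = - ((real n + 1 / 2) * cf n * t ^ n)" by blast
    define c where "c = cf (Suc n)"
    have eq: "binom_sum (Suc n) = (\<lambda>t. binom_sum n t + c * t ^ Suc n)"
      by (simp add: binom_sum_def fun_eq_iff c_def)
    have c: "(real n + 1) * c = (real n + 1 / 2) * cf n" by (simp add: c_def field_simps)
    have D: "(binom_sum (Suc n) has_real_derivative d + c * (real (Suc n) * t ^ n)) (at t)"
      unfolding eq by (rule derivative_eq_intros d refl | simp)+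
    have "(1 - t) * (d + c * (real (Suc n) * t ^ n)) - binom_sum (Suc n) t / 2
        = ((1 - t) * d - binom_sum n t / 2) + (1 - t) * ((real n + 1) * c) * t ^ n - c * t ^ Suc n / 2"
      by (simp add: eq field_simps)
    also have "\<dots> = - t * ((real n + 1) * c) * t ^ n - c * t ^ Suc n / 2"
      unfolding d(2) c by (simp add: field_simps)
    also have "\<dots> = - ((real (Suc n) + 1 / 2) * cf (Suc n) * t ^ Suc n)"
      unfolding c_def[symmetric] by (simp add: field_simps)
    finally show ?case using D by blast
  qed
  obtain d where d: "(binom_sum n has_real_derivative d) (at t)"
    "(1 - t) * d - binom_sum n t / 2 = - ((real n + 1 / 2) * cf n * t ^ n)" using D by blast
  have *: "(- inverse r / 2) * b + d * r = (r * r * d - b / 2) / r" if "r > 0" for r b :: real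
    using that by (simp add: field_simps)
  have "((\<lambda>t. sqrt (1 - t) * binom_sum n t) has_real_derivative
      (- inverse (sqrt (1 - t)) / 2) * binom_sum n t + d * sqrt (1 - t)) (at t)"
    using assms by (auto intro!: derivative_eq_intros d)
  also have "(- inverse (sqrt (1 - t)) / 2) * binom_sum n t + d * sqrt (1 - t)
      = ((1 - t) * d - binom_sum n t / 2) / sqrt (1 - t)"
    using *[of "sqrt (1 - t)" "binom_sum n t"] assms by simp
  finally show ?thesis unfolding d(2) by simp
qed

text \<open>The product \<open>f\<close> of \<open>sqrt (1 - t)\<close> and the partial sum decreases from \<open>1\<close>. How far it can fall is seen
  from \<open>f + 2 c\<^sub>n / sqrt (1 - t)\<close>, which increases, since \<open>(n + 1) t\<^sup>n \<le> 1 + t + \<dots> + t\<^sup>n \<le> 1 / (1 - t)\<close>.\<close>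

lemma binom_sum_pos_side:
  assumes t: "0 \<le> t" "t < 1"
  shows "0 \<le> sqrt (1 - t) * binom_sum n t" "sqrt (1 - t) * binom_sum n t \<le> 1"
    "sqrt (1 - t) * (1 - sqrt (1 - t) * binom_sum n t) \<le> 2 * cf n"
proof -
  let ?f = "\<lambda>t. sqrt (1 - t) * binom_sum n t"
  show "0 \<le> ?f t" using t by (auto simp: binom_sum_def intro!: mult_nonneg_nonneg sum_nonneg)
  have f0: "?f 0 = 1" by (simp add: binom_sum_def sum.atMost_shift)
  have "?f t \<le> ?f 0"
  proof (rule DERIV_nonpos_imp_nonincreasing[OF t(1)])
    fix x assume "0 \<le> x" "x \<le> t"
    then show "\<exists>y. (?f has_real_derivative y) (at x) \<and> y \<le> 0"
      using t by (intro exI[of _ "- ((real n + 1 / 2) * cf n * x ^ n / sqrt (1 - x))"] conjI binom_sum_deriv)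
        (auto intro!: divide_nonneg_nonneg mult_nonneg_nonneg)
  qed
  then show "?f t \<le> 1" by (simp only: f0)
  let ?g = "\<lambda>t. ?f t + 2 * cf n / sqrt (1 - t)"
  have "?g 0 \<le> ?g t"
  proof (rule DERIV_nonneg_imp_nondecreasing[OF t(1)])
    fix x assume x: "0 \<le> x" "x \<le> t"
    then have x1: "x < 1" using t by simp
    have s: "sqrt (1 - x) > 0" using x1 by simp
    have D: "(?g has_real_derivative - ((real n + 1 / 2) * cf n * x ^ n / sqrt (1 - x))
        + cf n / ((1 - x) * sqrt (1 - x))) (at x)"
      by (rule derivative_eq_intros binom_sum_deriv x1 refl | use x1 in \<open>simp add: field_simps\<close>)+
    have "(real n + 1) * x ^ n = (\<Sum>l\<le>n. x ^ n)" by simp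
    also have "\<dots> \<le> (\<Sum>l\<le>n. x ^ l)" using x x1 by (intro sum_mono power_decreasing) auto
    finally have "(1 - x) * ((real n + 1) * x ^ n) \<le> (1 - x) * (\<Sum>l\<le>n. x ^ l)"
      using x1 by (intro mult_left_mono) auto
    also have "\<dots> = 1 - x ^ Suc n" by (rule sum_gp_basic)
    also have "\<dots> \<le> 1" using x by simp
    finally have "(1 - x) * ((real n + 1) * x ^ n) \<le> 1" .
    moreover have "(1 - x) * ((real n + 1 / 2) * x ^ n) \<le> (1 - x) * ((real n + 1) * x ^ n)"
      using x x1 by (intro mult_left_mono mult_right_mono) auto
    ultimately have "(1 - x) * ((real n + 1 / 2) * x ^ n) \<le> 1" by linarith
    then have "(real n + 1 / 2) * x ^ n \<le> 1 / (1 - x)" using x1 by (simp add: field_simps)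
    then have "cf n / sqrt (1 - x) * ((real n + 1 / 2) * x ^ n) \<le> cf n / sqrt (1 - x) * (1 / (1 - x))"
      using x1 by (intro mult_left_mono) auto
    then have "0 \<le> - ((real n + 1 / 2) * cf n * x ^ n / sqrt (1 - x)) + cf n / ((1 - x) * sqrt (1 - x))"
      by (simp add: mult_ac)
    with D show "\<exists>y. (?g has_real_derivative y) (at x) \<and> y \<ge> 0" by blast
  qed
  then have "1 \<le> ?f t + 2 * cf n / sqrt (1 - t)" using f0 cf_nonneg[of n] by (simp del: cf_nonneg)
  then have "sqrt (1 - t) * (1 - ?f t) \<le> sqrt (1 - t) * (2 * cf n / sqrt (1 - t))"
    using t by (intro mult_left_mono) auto
  also have "\<dots> = 2 * cf n" using t by simp
  finally show "sqrt (1 - t) * (1 - ?f t) \<le> 2 * cf n" .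
qed

text \<open>At \<open>t = - u\<close> there is no singularity, and the derivative of the product is dominated by that of
  \<open>c\<^sub>n u\<^sup>n\<^sup>+\<^sup>1\<close>.\<close>

lemma binom_sum_neg_side:
  assumes u: "0 \<le> u" "u \<le> 1"
  shows "\<bar>sqrt (1 + u) * binom_sum n (- u) - 1\<bar> \<le> cf n"
proof -
  let ?F = "\<lambda>u. sqrt (1 + u) * binom_sum n (- u)"
  define D where "D v = (real n + 1 / 2) * cf n * (- v) ^ n / sqrt (1 + v)" for v
  have D: "(?F has_real_derivative D v) (at v)" if "0 \<le> v" for v
  proof -
    have "((\<lambda>u. (\<lambda>t. sqrt (1 - t) * binom_sum n t) (- u)) has_real_derivative
        - ((real n + 1 / 2) * cf n * (- v) ^ n / sqrt (1 - - v)) * - 1) (at v)"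
      by (rule DERIV_chain2[OF binom_sum_deriv]) (use that in \<open>auto intro!: derivative_eq_intros\<close>)
    then show ?thesis by (simp add: D_def)
  qed
  have bd: "\<bar>D v\<bar> \<le> cf n * (real (Suc n) * v ^ n)" if "0 \<le> v" for v
  proof -
    have "\<bar>D v\<bar> = (real n + 1 / 2) * cf n * v ^ n / sqrt (1 + v)"
      using that by (simp add: D_def abs_mult power_abs)
    also have "\<dots> \<le> (real n + 1 / 2) * cf n * v ^ n / 1"
      using that by (intro divide_left_mono) auto
    also have "\<dots> \<le> cf n * (real (Suc n) * v ^ n)"
      using that mult_right_mono[of "real n + 1/2" "real (Suc n)" "cf n * v ^ n"] by (simp add: mult_ac)
    finally show ?thesis .
  qed
  have f0: "?F 0 = 1" by (simp add: binom_sum_def sum.atMost_shift)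
  have P: "((\<lambda>u. cf n * u ^ Suc n) has_real_derivative cf n * (real (Suc n) * v ^ n)) (at v)" for v
    by (rule derivative_eq_intros refl | simp)+
  have "?F u - cf n * u ^ Suc n \<le> ?F 0 - cf n * 0 ^ Suc n"
  proof (rule DERIV_nonpos_imp_nonincreasing[OF u(1)])
    fix v assume v: "0 \<le> v" "v \<le> u"
    show "\<exists>y. ((\<lambda>u. ?F u - cf n * u ^ Suc n) has_real_derivative y) (at v) \<and> y \<le> 0"
      using bd[OF v(1)] by (intro exI[of _ "D v - cf n * (real (Suc n) * v ^ n)"] conjI DERIV_diff D P v) auto
  qed
  moreover have "?F 0 + cf n * 0 ^ Suc n \<le> ?F u + cf n * u ^ Suc n"
  proof (rule DERIV_nonneg_imp_nondecreasing[OF u(1)])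
    fix v assume v: "0 \<le> v" "v \<le> u"
    show "\<exists>y. ((\<lambda>u. ?F u + cf n * u ^ Suc n) has_real_derivative y) (at v) \<and> 0 \<le> y"
      using bd[OF v(1)] by (intro exI[of _ "D v + cf n * (real (Suc n) * v ^ n)"] conjI DERIV_add D P v) auto
  qed
  moreover have "cf n * u ^ Suc n \<le> cf n * 1" using u by (intro mult_left_mono power_le_one) auto
  ultimately have "?F u - cf n * u ^ Suc n \<le> 1" "1 \<le> ?F u + cf n * u ^ Suc n" "cf n * u ^ Suc n \<le> cf n"
    unfolding f0 by (simp_all only: power_Suc mult_zero_left mult_zero_right mult_1_right diff_zero add_0_right)
  then show ?thesis unfolding abs_le_iff by linarith
qed

lemma binom_sum_bounds:
  assumes x: "0 \<le> x" "x \<le> 2"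
  shows "\<bar>sqrt x * binom_sum n (1 - x)\<bar> \<le> 2"
    and "\<bar>sqrt x * (1 - sqrt x * binom_sum n (1 - x))\<bar> \<le> 2 * cf n"
proof -
  consider "x = 0" | "0 < x" "x \<le> 1" | "1 \<le> x" using x by linarith
  then have "\<bar>sqrt x * binom_sum n (1 - x)\<bar> \<le> 2 \<and> \<bar>sqrt x * (1 - sqrt x * binom_sum n (1 - x))\<bar> \<le> 2 * cf n"
  proof cases
    case 2
    then show ?thesis using binom_sum_pos_side[of "1 - x" n] by (auto simp: abs_mult)
  next
    case 3
    have *: "\<bar>sqrt x * binom_sum n (1 - x) - 1\<bar> \<le> cf n"
      using binom_sum_neg_side[of "x - 1" n] 3 x by simp
    have "sqrt x \<le> sqrt 4" using x by (intro real_sqrt_le_mono) auto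
    then have "sqrt x \<le> 2" by simp
    then have "\<bar>sqrt x * (1 - sqrt x * binom_sum n (1 - x))\<bar> \<le> 2 * cf n"
      unfolding abs_mult using * x by (intro mult_mono) (auto simp: abs_minus_commute)
    then show ?thesis using * cf_le_1[of n] by linarith
  qed simp
  then show "\<bar>sqrt x * binom_sum n (1 - x)\<bar> \<le> 2"
    and "\<bar>sqrt x * (1 - sqrt x * binom_sum n (1 - x))\<bar> \<le> 2 * cf n" by auto
qed

text \<open>Cesaro means are preferred to partial sums because their coefficients taper off to zero: differences
  of coefficients stay of order \<open>l\<^sup>-\<^sup>3\<^sup>/\<^sup>2\<close> uniformly in \<open>n\<close> (\<open>cfc_step\<close>), whereas a sharp truncation has a jump.\<close>

definition cesaro :: "nat \<Rightarrow> real poly" where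
  "cesaro n = (\<Sum>l\<le>n. smult (cf l * (1 - real l / (real n + 1))) ([:1, -1:] ^ l))"

lemma poly_cesaro: "poly (cesaro n) x = (\<Sum>m\<le>n. binom_sum m (1 - x)) / (real n + 1)"
proof -
  have "(\<Sum>l\<le>n. a l * (real n + 1 - real l)) = (\<Sum>m\<le>n. \<Sum>l\<le>m. a l)" for a :: "nat \<Rightarrow> real"
  proof (induction n)
    case (Suc n)
    have "(\<Sum>l\<le>Suc n. a l * (real (Suc n) + 1 - real l)) = (\<Sum>l\<le>n. a l * (real n + 1 - real l)) + (\<Sum>l\<le>n. a l) + a (Suc n)"
      by (simp add: algebra_simps sum.distrib sum_subtractf sum_distrib_right[symmetric])
    then show ?case using Suc by simp
  qed simp
  note * = this[of "\<lambda>l. cf l * (1 - x) ^ l"]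
  have "poly (cesaro n) x = (\<Sum>l\<le>n. cf l * (1 - x) ^ l * (real n + 1 - real l)) / (real n + 1)"
    unfolding cesaro_def poly_sum sum_divide_distrib
    by (intro sum.cong) (auto simp: field_simps)
  then show ?thesis unfolding * by (simp add: binom_sum_def)
qed

lemma sum_inv_sqrt_le: "(\<Sum>m\<le>n. 1 / sqrt (real m + 1)) \<le> 2 * sqrt (real n + 1)"
proof (induction n)
  case (Suc n)
  define a b where "a = sqrt (real n + 1)" and "b = sqrt (real n + 2)"
  have ab: "a \<ge> 0" "b > 0" "b * b - a * a = 1" by (auto simp: a_def b_def)
  have "0 \<le> (b - a)\<^sup>2" by simp
  then have "2 * a * b + 1 \<le> 2 * b * b" using ab(3) by (simp add: power2_eq_square algebra_simps)
  then have "2 * a + 1 / b \<le> 2 * b" using ab by (simp add: field_simps)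
  moreover have "b = sqrt (real (Suc n) + 1)" by (simp add: b_def add.commute)
  ultimately show ?case using Suc by (simp add: a_def)
qed simp

text \<open>The first bound makes \<open>d K\<^sub>n\<close> uniformly bounded on \<open>L\<^sup>2\<close>. The second one gives convergence after
  multiplication by \<open>sqrt x\<close>, which removes the singularity of \<open>x\<^sup>-\<^sup>1\<^sup>/\<^sup>2\<close> at the bottom of the spectrum.\<close>

lemma cesaro_bounds:
  assumes x: "0 \<le> x" "x \<le> 2"
  shows "\<bar>sqrt x * poly (cesaro n) x\<bar> \<le> 2"
    and "\<bar>sqrt x * (1 - sqrt x * poly (cesaro n) x)\<bar> \<le> 4 / sqrt (real n + 1)"
proof -
  have "\<bar>sqrt x * poly (cesaro n) x\<bar> = \<bar>\<Sum>m\<le>n. sqrt x * binom_sum m (1 - x)\<bar> / (real n + 1)"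
    by (simp add: poly_cesaro abs_divide abs_mult sum_distrib_left[symmetric])
  also have "\<dots> \<le> (\<Sum>m\<le>n. 2) / (real n + 1)"
    by (intro divide_right_mono order_trans[OF sum_abs] sum_mono binom_sum_bounds x) auto
  also have "\<dots> = 2" by (simp add: field_simps)
  finally show "\<bar>sqrt x * poly (cesaro n) x\<bar> \<le> 2" .
  have "sqrt x * (1 - sqrt x * poly (cesaro n) x) = (\<Sum>m\<le>n. sqrt x * (1 - sqrt x * binom_sum m (1 - x))) / (real n + 1)"
    by (simp add: poly_cesaro sum_subtractf sum_distrib_left[symmetric] right_diff_distrib diff_divide_distrib) (simp add: field_simps)
  then have "\<bar>sqrt x * (1 - sqrt x * poly (cesaro n) x)\<bar> = \<bar>\<Sum>m\<le>n. sqrt x * (1 - sqrt x * binom_sum m (1 - x))\<bar> / (real n + 1)"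
    by (simp add: abs_divide)
  also have "\<dots> \<le> (\<Sum>m\<le>n. 2 * (1 / sqrt (real m + 1))) / (real n + 1)"
    by (intro divide_right_mono order_trans[OF sum_abs] sum_mono order_trans[OF binom_sum_bounds(2)] x mult_left_mono cf_le) auto
  also have "\<dots> \<le> 2 * (2 * sqrt (real n + 1)) / (real n + 1)"
    unfolding sum_distrib_left[symmetric] by (intro divide_right_mono mult_left_mono sum_inv_sqrt_le) auto
  also have "\<dots> = 4 / sqrt (real n + 1)"
    using real_div_sqrt[of "real n + 1"] by (simp add: field_simps)
  finally show "\<bar>sqrt x * (1 - sqrt x * poly (cesaro n) x)\<bar> \<le> 4 / sqrt (real n + 1)" .
qed

section \<open>Lebesgue spaces through finite partial sums\<close>

context walk_graph
begin

abbreviation "l2 f \<equiv> f \<in> Lp (vol mu) 2"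
abbreviation "n2 \<equiv> Lp_norm (vol mu) 2"

lemma integrable_vol:
  fixes g :: "'a \<Rightarrow> real"
  shows "integrable (vol mu) g \<longleftrightarrow> Infinite_Set_Sum.abs_summable_on (\<lambda>x. w x * g x) UNIV"
    and "(\<integral>x. g x \<partial>vol mu) = infsetsum (\<lambda>x. w x * g x) UNIV"
  unfolding vol_def point_measure_def Infinite_Set_Sum.abs_summable_on_def infsetsum_def
  by (simp_all add: integrable_density integral_density)

lemma measurable_vol [simp]: "f \<in> borel_measurable (vol mu)"
  by (simp add: vol_def measurable_def space_point_measure sets_point_measure)

lemma Lp_norm_nonneg [simp]: "0 \<le> Lp_norm M p f" by (simp add: Lp_norm_def)

lemma Lp_partial:
  assumes "f \<in> Lp (vol mu) p" "finite S" "0 < p"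
  shows "(\<Sum>x\<in>S. w x * \<bar>f x\<bar> powr p) \<le> Lp_norm (vol mu) p f powr p"
proof -
  let ?g = "\<lambda>x. w x * \<bar>f x\<bar> powr p"
  have s: "Infinite_Set_Sum.abs_summable_on ?g UNIV" using assms(1) by (simp add: Lp_def integrable_vol)
  have "sum ?g S = infsetsum ?g S" using assms by simp
  also have "\<dots> \<le> infsetsum ?g UNIV"
    using assms s by (intro infsetsum_mono_neutral) auto
  also have "\<dots> = Lp_norm (vol mu) p f powr p"
    using assms infsetsum_nonneg[of UNIV ?g] by (simp add: Lp_norm_def integrable_vol powr_powr)
  finally show ?thesis .
qed

lemma LpI:
  assumes "0 < p" "0 \<le> C" "\<And>S. finite S \<Longrightarrow> (\<Sum>x\<in>S. w x * \<bar>f x\<bar> powr p) \<le> C powr p"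
  shows "f \<in> Lp (vol mu) p" "Lp_norm (vol mu) p f \<le> C"
proof -
  let ?g = "\<lambda>x. w x * \<bar>f x\<bar> powr p"
  have s: "Infinite_Set_Sum.abs_summable_on ?g UNIV" by (rule abs_summable_finite_sumsI) (use assms in auto)
  then show "f \<in> Lp (vol mu) p" by (simp add: Lp_def integrable_vol)
  have "ereal (infsetsum ?g UNIV) \<le> ereal (C powr p)"
    by (subst infsetsum_nonneg_is_SUPREMUM_ereal[OF s]) (use assms in \<open>auto intro!: SUP_least\<close>)
  then have "infsetsum ?g UNIV \<le> C powr p" by simp
  then have "infsetsum ?g UNIV powr (1 / p) \<le> (C powr p) powr (1 / p)"
    using assms infsetsum_nonneg[of UNIV ?g] by (intro powr_mono2) auto
  then show "Lp_norm (vol mu) p f \<le> C" using assms by (simp add: Lp_norm_def integrable_vol powr_powr)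
qed

lemma Lp_tail:
  assumes f: "f \<in> Lp (vol mu) p" and p: "0 < p" and e: "0 < e"
  obtains S where "finite S" "\<And>T. finite T \<Longrightarrow> S \<inter> T = {} \<Longrightarrow> (\<Sum>x\<in>T. w x * \<bar>f x\<bar> powr p) \<le> e"
proof -
  let ?g = "\<lambda>x. w x * \<bar>f x\<bar> powr p"
  let ?N = "Lp_norm (vol mu) p f powr p"
  have "\<exists>S. finite S \<and> ?N - e < sum ?g S"
  proof (rule ccontr)
    assume n: "\<not> ?thesis"
    then have le: "sum ?g S \<le> ?N - e" if "finite S" for S using that by (meson not_less)
    from le[of "{}"] have ge: "0 \<le> ?N - e" by simp
    define C where "C = (?N - e) powr (1 / p)"
    have C: "C powr p = ?N - e" using ge p by (simp add: C_def powr_powr)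
    have "Lp_norm (vol mu) p f \<le> C" using le C p by (intro LpI) (auto simp: C_def)
    then have "?N \<le> C powr p" using p by (intro powr_mono2) auto
    with C e show False by simp
  qed
  then obtain S where S: "finite S" "?N - e < sum ?g S" by blast
  show ?thesis
  proof (rule that[OF S(1)])
    fix T :: "'a set" assume T: "finite T" "S \<inter> T = {}"
    have "sum ?g S + sum ?g T = sum ?g (S \<union> T)" using S T by (simp add: sum.union_disjoint)
    also have "\<dots> \<le> ?N" using S T p by (intro Lp_partial f) auto
    finally show "sum ?g T \<le> e" using S by simp
  qed
qed

definition s2 :: "'a set \<Rightarrow> ('a \<Rightarrow> real) \<Rightarrow> real" where
  "s2 S f = sqrt (\<Sum>x\<in>S. w x * (f x)\<^sup>2)"

lemma s2_L2_set: "s2 S f = L2_set (\<lambda>x. sqrt (w x) * f x) S"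
  by (simp add: s2_def L2_set_def power_mult_distrib)

lemma s2_nonneg [simp]: "0 \<le> s2 S f" by (simp add: s2_L2_set)

lemma s2_sq: "(s2 S f)\<^sup>2 = (\<Sum>x\<in>S. w x * (f x)\<^sup>2)"
  unfolding s2_def by (intro real_sqrt_pow2 sum_nonneg) auto

lemma s2_triangle: "s2 S (\<lambda>x. f x + g x) \<le> s2 S f + s2 S g"
  unfolding s2_L2_set by (simp only: distrib_left L2_set_triangle_ineq)

lemma s2_mono: "(\<And>x. x \<in> S \<Longrightarrow> \<bar>f x\<bar> \<le> \<bar>g x\<bar>) \<Longrightarrow> s2 S f \<le> s2 S g"
  unfolding s2_def by (intro real_sqrt_le_mono sum_mono mult_left_mono) (auto simp: abs_le_square_iff)

lemma s2_cmult: "s2 S (\<lambda>x. c * f x) = \<bar>c\<bar> * s2 S f"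
  unfolding s2_def by (simp add: power_mult_distrib mult.left_commute[of _ "c\<^sup>2"] sum_distrib_left[symmetric] real_sqrt_mult)

lemma s2_cong: "(\<And>x. x \<in> S \<Longrightarrow> f x = g x) \<Longrightarrow> s2 S f = s2 S g"
  unfolding s2_def by (auto intro: sum.cong)

lemma s2_tendsto: "(\<And>x. (\<lambda>n. h n x) \<longlonglongrightarrow> g x) \<Longrightarrow> (\<lambda>n. s2 S (h n)) \<longlonglongrightarrow> s2 S g"
  unfolding s2_def by (intro tendsto_intros)

lemma s2_le: assumes "l2 f" "finite S" shows "s2 S f \<le> n2 f"
proof -
  have "(\<Sum>x\<in>S. w x * \<bar>f x\<bar> powr 2) \<le> n2 f powr 2" by (rule Lp_partial) (use assms in auto)
  then have "(\<Sum>x\<in>S. w x * (f x)\<^sup>2) \<le> (n2 f)\<^sup>2" by simp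
  then show ?thesis unfolding s2_def by (intro real_le_lsqrt) auto
qed

lemma n2I: assumes "\<And>S. finite S \<Longrightarrow> s2 S f \<le> C" shows "l2 f" "n2 f \<le> C"
proof -
  have C: "0 \<le> C" using assms[of "{}"] by (simp add: s2_def)
  have "(\<Sum>x\<in>S. w x * \<bar>f x\<bar> powr 2) \<le> C powr 2" if "finite S" for S
  proof -
    have "(s2 S f)\<^sup>2 \<le> C\<^sup>2" using assms[OF that] by (intro power_mono) auto
    then show ?thesis using C by (simp add: s2_sq)
  qed
  then show "l2 f" "n2 f \<le> C" using LpI[of 2 C f] C by auto
qed

lemma l2_add: "l2 f \<Longrightarrow> l2 g \<Longrightarrow> l2 (\<lambda>x. f x + g x)"
  and n2_triangle: "l2 f \<Longrightarrow> l2 g \<Longrightarrow> n2 (\<lambda>x. f x + g x) \<le> n2 f + n2 g"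
proof -
  assume "l2 f" "l2 g"
  then have "s2 S (\<lambda>x. f x + g x) \<le> n2 f + n2 g" if "finite S" for S
    using s2_triangle[of S f g] s2_le[of f S] s2_le[of g S] that by linarith
  then show "l2 (\<lambda>x. f x + g x)" "n2 (\<lambda>x. f x + g x) \<le> n2 f + n2 g" using n2I by blast+
qed

lemma l2_cmult: "l2 f \<Longrightarrow> l2 (\<lambda>x. c * f x)"
  and n2_cmult: "l2 f \<Longrightarrow> n2 (\<lambda>x. c * f x) \<le> \<bar>c\<bar> * n2 f"
proof -
  assume "l2 f"
  then have "s2 S (\<lambda>x. c * f x) \<le> \<bar>c\<bar> * n2 f" if "finite S" for S
    using s2_le[of f S] that by (simp add: s2_cmult mult_left_mono)
  then show "l2 (\<lambda>x. c * f x)" "n2 (\<lambda>x. c * f x) \<le> \<bar>c\<bar> * n2 f" using n2I by blast+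
qed

lemma l2_diff: "l2 f \<Longrightarrow> l2 g \<Longrightarrow> l2 (\<lambda>x. f x - g x)"
  and n2_diff: "l2 f \<Longrightarrow> l2 g \<Longrightarrow> n2 (\<lambda>x. f x - g x) \<le> n2 f + n2 g"
proof -
  assume a: "l2 f" "l2 g"
  have e: "(\<lambda>x. f x - g x) = (\<lambda>x. f x + (-1) * g x)" by simp
  show "l2 (\<lambda>x. f x - g x)" unfolding e using a by (intro l2_add l2_cmult)
  show "n2 (\<lambda>x. f x - g x) \<le> n2 f + n2 g"
    unfolding e using a n2_triangle[OF a(1) l2_cmult[OF a(2), of "-1"]] n2_cmult[OF a(2), of "-1"] by simp
qed

lemma s2_zero_imp: assumes "\<And>S. finite S \<Longrightarrow> s2 S f \<le> 0" shows "f x = 0"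
proof -
  have "sqrt (w x * (f x)\<^sup>2) \<le> 0" using assms[of "{x}"] by (simp add: s2_def)
  then have "w x * (f x)\<^sup>2 = 0" using w_pos[of x] by (metis antisym real_sqrt_ge_zero real_sqrt_eq_zero_cancel_iff w_nonneg zero_le_power2 mult_nonneg_nonneg)
  then show ?thesis by simp
qed

lemma s2_eval: "\<bar>f x\<bar> \<le> (1 / sqrt (w x)) * s2 {x} f"
  using w_pos[of x] by (simp add: s2_def real_sqrt_mult)

lemma fin_l2: assumes "fin f" shows "l2 f" "n2 f \<le> sqrt (ip f f)"
proof -
  have "s2 S f \<le> sqrt (ip f f)" if "finite S" for S
  proof -
    have "(\<Sum>x\<in>S. w x * (f x)\<^sup>2) \<le> (\<Sum>x\<in>S \<union> {x. f x \<noteq> 0}. w x * (f x)\<^sup>2)"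
      using that fin_supp[OF assms] by (intro sum_mono2) auto
    also have "\<dots> = ip f f"
      using that fin_supp[OF assms] assms by (subst ip_eq[of "S \<union> {x. f x \<noteq> 0}"]) (auto simp: power2_eq_square mult.assoc)
    finally show ?thesis by (simp add: s2_def)
  qed
  then show "l2 f" "n2 f \<le> sqrt (ip f f)" using n2I by blast+
qed

lemma ip_cut: "finite R \<Longrightarrow> ip (cut R f) (cut R f) = (s2 R f)\<^sup>2"
proof -
  assume R: "finite R"
  have "ip (cut R f) (cut R f) = (\<Sum>x\<in>R. w x * cut R f x * cut R f x)"
    using R by (intro ip_eq fin_cut) (auto simp: cut_def split: if_splits)
  also have "\<dots> = (s2 R f)\<^sup>2" unfolding s2_sq by (intro sum.cong) (auto simp: cut_def power2_eq_square)
  finally show ?thesis .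
qed

lemma l2_cut:
  assumes "l2 f" "0 < e"
  obtains R where "finite R" "\<And>R'. finite R' \<Longrightarrow> R \<subseteq> R' \<Longrightarrow> n2 (\<lambda>x. f x - cut R' f x) \<le> e"
proof -
  obtain R where R: "finite R" "\<And>T. finite T \<Longrightarrow> R \<inter> T = {} \<Longrightarrow> (\<Sum>x\<in>T. w x * \<bar>f x\<bar> powr 2) \<le> e\<^sup>2"
    using Lp_tail[OF assms(1), of "e\<^sup>2"] assms(2) by auto
  show ?thesis
  proof (rule that[OF R(1)])
    fix R' assume R': "finite R'" "R \<subseteq> R'"
    show "n2 (\<lambda>x. f x - cut R' f x) \<le> e"
    proof (rule n2I)
      fix S :: "'a set" assume S: "finite S"
      have "(\<Sum>x\<in>S. w x * (f x - cut R' f x)\<^sup>2) = (\<Sum>x\<in>S - R'. w x * \<bar>f x\<bar> powr 2)"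
        using S by (intro sum.mono_neutral_cong_right) (auto simp: cut_def)
      also have "\<dots> \<le> e\<^sup>2" using S R' by (intro R) auto
      finally show "s2 S (\<lambda>x. f x - cut R' f x) \<le> e" unfolding s2_def using assms by (intro real_le_lsqrt) auto
    qed
  qed
qed

section \<open>Functional calculus on square summable functions\<close>

lemma pol_l2:
  assumes f: "l2 f" and q: "\<And>x. 0 \<le> x \<Longrightarrow> x \<le> 2 \<Longrightarrow> \<bar>poly q x\<bar> \<le> C"
  shows "l2 (pol q f)" "n2 (pol q f) \<le> C * n2 f"
proof -
  have C: "0 \<le> C" using q[of 0] by linarith
  have "s2 S (pol q f) \<le> C * n2 f" if S: "finite S" for S
  proof -
    obtain R where R: "finite R" "S \<subseteq> R" "\<And>R' f x. R \<subseteq> R' \<Longrightarrow> x \<in> S \<Longrightarrow> pol q (cut R' f) x = pol q f x"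
      using local_cut[OF local_pol S, of q] by metis
    let ?g = "cut R f"
    have g: "fin ?g" using R by simp
    have "s2 S (pol q f) = s2 S (pol q ?g)" using R by (intro s2_cong) auto
    also have "\<dots> \<le> n2 (pol q ?g)" by (intro s2_le fin_l2 fin_pol g S)
    also have "\<dots> \<le> sqrt (ip (pol q ?g) (pol q ?g))" by (intro fin_l2 fin_pol g)
    also have "\<dots> \<le> sqrt (C\<^sup>2 * ip ?g ?g)" by (intro real_sqrt_le_mono ip_pol_le g q)
    also have "\<dots> = C * s2 R f" using C R by (simp add: real_sqrt_mult ip_cut)
    also have "\<dots> \<le> C * n2 f" using C R f by (intro mult_left_mono s2_le)
    finally show ?thesis .
  qed
  then show "l2 (pol q f)" "n2 (pol q f) \<le> C * n2 f" using n2I by blast+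
qed

lemma poly_bounded: "\<exists>C. \<forall>x. 0 \<le> x \<and> x \<le> 2 \<longrightarrow> \<bar>poly q x\<bar> \<le> (C::real)"
proof -
  have "compact (poly q ` {0..2})" by (intro compact_continuous_image continuous_intros) auto
  then obtain C where "\<forall>y\<in>poly q ` {0..2}. norm y \<le> C" using compact_imp_bounded bounded_iff by blast
  then show ?thesis by (intro exI[of _ C]) auto
qed

lemma l2_pol: "l2 f \<Longrightarrow> l2 (pol q f)"
  using poly_bounded[of q] pol_l2(1) by blast

lemma tnorm_L2_set: "tnorm F x = L2_set (\<lambda>y. sqrt (mu x y / w x / 2) * F (x, y)) (nb x)"
proof -
  have "1 / 2 * (\<Sum>y\<in>nb x. kern mu x y * w y * \<bar>F (x, y)\<bar>\<^sup>2) = (\<Sum>y\<in>nb x. (sqrt (mu x y / w x / 2) * F (x, y))\<^sup>2)"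
    by (simp add: sum_distrib_left power_mult_distrib mu_nonneg kern_w) (simp add: sum_divide_distrib mult.commute)
  then show ?thesis by (simp add: tangent_norm_def L2_set_def)
qed

lemma tnorm_triangle: "tnorm (\<lambda>e. F e + G e) x \<le> tnorm F x + tnorm G x"
  unfolding tnorm_L2_set by (simp only: distrib_left L2_set_triangle_ineq)

lemma tnorm_cmult: "tnorm (\<lambda>e. c * F e) x = \<bar>c\<bar> * tnorm F x"
proof -
  have "(tnorm (\<lambda>e. c * F e) x)\<^sup>2 = (\<bar>c\<bar> * tnorm F x)\<^sup>2"
    by (simp add: tnorm_sq power_mult_distrib sum_distrib_left mult_ac)
  then show ?thesis by (rule power2_eq_imp_eq) auto
qed

lemma tnorm_uminus: "tnorm (\<lambda>e. - F e) x = tnorm F x"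
  using tnorm_cmult[of "-1" F x] by simp

lemma tnorm_diff: "tnorm (\<lambda>e. F e - G e) x \<le> tnorm F x + tnorm G x"
  using tnorm_triangle[of F "\<lambda>e. - G e" x] by (simp add: tnorm_uminus)

lemma tnorm_sum: "tnorm (\<lambda>e. \<Sum>i\<in>I. F i e) x \<le> (\<Sum>i\<in>I. tnorm (F i) x)"
proof (induction I rule: infinite_finite_induct)
  case (insert i I)
  then show ?case using tnorm_triangle[of "F i" "\<lambda>e. \<Sum>i\<in>I. F i e" x] by simp
qed (auto simp: tangent_norm_def)

lemma tnorm_tendsto:
  "(\<And>e. (\<lambda>n. F n e) \<longlonglongrightarrow> G e) \<Longrightarrow> (\<lambda>n. tnorm (F n) x) \<longlonglongrightarrow> tnorm G x"
  unfolding tangent_norm_def by (intro tendsto_intros)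

lemma tnorm_eval:
  assumes "y \<in> nb x" shows "\<bar>F (x, y)\<bar> \<le> (1 / sqrt (mu x y / w x / 2)) * tnorm F x"
proof -
  have p: "sqrt (mu x y / w x / 2) > 0" using assms w_pos[of x] by (simp add: nb_iff)
  have "\<bar>sqrt (mu x y / w x / 2) * F (x, y)\<bar> \<le> tnorm F x"
    unfolding tnorm_L2_set using member_le_L2_set[OF finite_nb assms, of "\<lambda>y. \<bar>sqrt (mu x y / w x / 2) * F (x, y)\<bar>"]
    by (simp add: L2_set_def)
  then show ?thesis using p by (simp add: abs_mult field_simps)
qed

lemma df_add: "df (\<lambda>x. f x + g x) = (\<lambda>e. df f e + df g e)"
  and df_diff: "df (\<lambda>x. f x - g x) = (\<lambda>e. df f e - df g e)"
  and df_cmult: "df (\<lambda>x. c * f x) = (\<lambda>e. c * df f e)"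
  by (auto simp: diff_form_def fun_eq_iff algebra_simps)

lemma df_sum: "df (\<lambda>x. \<Sum>i\<in>I. f i x) = (\<lambda>e. \<Sum>i\<in>I. df (f i) e)"
  by (induction I rule: infinite_finite_induct) (auto simp: df_add, auto simp: diff_form_def fun_eq_iff)

lemma edges_sym: "(x, y) \<in> edges mu \<longleftrightarrow> (y, x) \<in> edges mu"
  by (simp add: edges_def mu_sym)

lemma df_form: "df f e = 0 \<or> e \<in> edges mu" "df f (y, x) = - df f (x, y)"
  by (auto simp: diff_form_def edges_sym split: prod.splits)

lemma tnorm_df_cong: "(\<And>y. y \<in> insert x (nb x) \<Longrightarrow> f y = g y) \<Longrightarrow> tnorm (df f) x = tnorm (df g) x"
  unfolding tangent_norm_def diff_form_def by (auto intro!: sum.cong arg_cong[where f=sqrt])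

lemma df_pol_cut:
  assumes "finite S"
  obtains R where "finite R" "S \<subseteq> R"
    "\<And>R' f x. R \<subseteq> R' \<Longrightarrow> x \<in> S \<Longrightarrow> tnorm (df (pol q (cut R' f))) x = tnorm (df (pol q f)) x"
proof -
  let ?S = "S \<union> (\<Union>x\<in>S. nb x)"
  have "finite ?S" using assms by simp
  then obtain R where R: "finite R" "?S \<subseteq> R" "\<And>R' f x. R \<subseteq> R' \<Longrightarrow> x \<in> ?S \<Longrightarrow> pol q (cut R' f) x = pol q f x"
    using local_cut[OF local_pol] by metis
  show ?thesis
  proof (rule that[of R])
    fix R' x and f :: "'a \<Rightarrow> real" assume R': "R \<subseteq> R'" "x \<in> S"
    show "tnorm (df (pol q (cut R' f))) x = tnorm (df (pol q f)) x"
      by (rule tnorm_df_cong, rule R(3)) (use R' in auto)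
  qed (use R in auto)
qed

lemma df_pol_l2:
  assumes f: "l2 f" and S: "finite S" and q: "\<And>x. 0 \<le> x \<Longrightarrow> x \<le> 2 \<Longrightarrow> \<bar>sqrt x * poly q x\<bar> \<le> C"
  shows "s2 S (tnorm (df (pol q f))) \<le> C * n2 f"
proof -
  have C: "0 \<le> C" using q[of 0] by simp
  obtain R where R: "finite R" "S \<subseteq> R"
    "\<And>R' f x. R \<subseteq> R' \<Longrightarrow> x \<in> S \<Longrightarrow> tnorm (df (pol q (cut R' f))) x = tnorm (df (pol q f)) x"
    using df_pol_cut[OF S] by metis
  let ?g = "cut R f"
  have q2: "x * (poly q x)\<^sup>2 \<le> C\<^sup>2" if "0 \<le> x" "x \<le> 2" for x
  proof -
    have "\<bar>sqrt x * poly q x\<bar>\<^sup>2 \<le> C\<^sup>2" using q[OF that] by (intro power_mono) auto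
    then show ?thesis using that by (simp add: power_mult_distrib)
  qed
  have "s2 S (tnorm (df (pol q f))) = s2 S (tnorm (df (pol q ?g)))"
    using R by (intro s2_cong) auto
  also have "\<dots> \<le> sqrt (C\<^sup>2 * ip ?g ?g)"
    unfolding s2_def by (intro real_sqrt_le_mono dirichlet_pol_le S q2 fin_cut R)
  also have "\<dots> = C * s2 R f" using C R by (simp add: real_sqrt_mult ip_cut)
  also have "\<dots> \<le> C * n2 f" using C R f by (intro mult_left_mono s2_le)
  finally show ?thesis .
qed

lemma l2_complete:
  assumes u: "\<And>n. l2 (u n)"
    and cauchy: "\<And>e. e > 0 \<Longrightarrow> \<exists>n0. \<forall>k\<ge>n0. \<forall>l\<ge>n0. n2 (\<lambda>x. u k x - u l x) \<le> e"
  obtains h where "l2 h" "(\<lambda>n. n2 (\<lambda>x. u n x - h x)) \<longlonglongrightarrow> 0"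
proof -
  have c: "\<exists>n0. \<forall>k\<ge>n0. \<forall>l\<ge>n0. \<forall>S\<in>{S. finite S}. s2 S (\<lambda>x. u k x - u l x) \<le> e" if e: "e > 0" for e
  proof -
    obtain n0 where "\<forall>k\<ge>n0. \<forall>l\<ge>n0. n2 (\<lambda>x. u k x - u l x) \<le> e" using cauchy[OF e] by blast
    then show ?thesis using order_trans[OF s2_le[OF l2_diff[OF u u]]] by blast
  qed
  have ev: "\<exists>S\<in>{S. finite S}. \<exists>c. \<forall>f. \<bar>f x\<bar> \<le> c * s2 S f" for x
    using s2_eval by (intro bexI[of _ "{x}"]) blast+
  have ct: "(\<lambda>n. s2 S (h n)) \<longlonglongrightarrow> s2 S g" if "\<forall>x. (\<lambda>n. h n x) \<longlonglongrightarrow> g x" for S g and h :: "nat \<Rightarrow> 'a \<Rightarrow> real"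
    using that by (intro s2_tendsto) blast
  obtain h where h: "\<And>x. (\<lambda>n. u n x) \<longlonglongrightarrow> h x"
    "\<And>e. e > 0 \<Longrightarrow> \<exists>n0. \<forall>k\<ge>n0. \<forall>S\<in>{S. finite S}. s2 S (\<lambda>x. u k x - h x) \<le> e"
    by (rule cauchy_sup_limit[OF ev ct s2_nonneg c]) blast+
  obtain n0 where "\<forall>S\<in>{S. finite S}. s2 S (\<lambda>x. u n0 x - h x) \<le> 1" using h(2)[of 1] by auto
  then have "l2 (\<lambda>x. u n0 x - h x)" by (intro n2I[where C=1]) auto
  from l2_diff[OF u[of n0] this] have "l2 h" by simp
  moreover have "(\<lambda>n. n2 (\<lambda>x. u n x - h x)) \<longlonglongrightarrow> 0"
  proof (rule LIMSEQ_I)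
    fix r :: real assume "r > 0"
    then obtain n0 where n0: "\<forall>k\<ge>n0. \<forall>S\<in>{S. finite S}. s2 S (\<lambda>x. u k x - h x) \<le> r / 2" using h(2)[of "r/2"] by auto
    have "n2 (\<lambda>x. u k x - h x) \<le> r / 2" if "k \<ge> n0" for k using n0 that by (intro n2I) auto
    then show "\<exists>n0. \<forall>n\<ge>n0. norm (n2 (\<lambda>x. u n x - h x) - 0) < r" using \<open>r > 0\<close> by (intro exI[of _ n0]) fastforce
  qed
  ultimately show ?thesis by (rule that)
qed

section \<open>The square root of the Laplacian and the Riesz transform\<close>

abbreviation "K n \<equiv> pol (cesaro n)"
abbreviation "slap \<equiv> sqrt_laplacian mu"

lemma sqrt_approx:
  assumes "0 \<le> x" "x \<le> (2::real)"
  shows "\<bar>poly ([:0, 1:] * cesaro n) x - sqrt x\<bar> \<le> 4 / sqrt (real n + 1)"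
proof -
  have "x = sqrt x * sqrt x" using assms by simp
  then have "poly ([:0, 1:] * cesaro n) x - sqrt x = - (sqrt x * (1 - sqrt x * poly (cesaro n) x))"
    by (simp add: algebra_simps)
  then show ?thesis using cesaro_bounds(2)[OF assms, of n] by simp
qed

lemma tendsto_inv_sqrt: "(\<lambda>n. c / sqrt (real n + 1)) \<longlonglongrightarrow> 0"
proof -
  have "filterlim (\<lambda>n. sqrt (real n + 1)) at_top sequentially"
    by (intro filterlim_compose[OF sqrt_at_top] filterlim_tendsto_add_at_top[OF tendsto_const, of _ _ 1, simplified add.commute[of 1]]
      filterlim_real_sequentially)
  then show ?thesis by (intro tendsto_divide_0[OF tendsto_const] filterlim_at_top_imp_at_infinity)
qed

lemma sqrt_approx_uniform:
  "uniform_limit {0..2} (\<lambda>n t. poly ([:0, 1:] * cesaro n) t) sqrt sequentially"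
proof (rule uniform_limitI)
  fix e :: real assume "e > 0"
  then have "\<forall>\<^sub>F n in sequentially. 4 / sqrt (real n + 1) < e"
    using tendsto_inv_sqrt[of 4] by (rule order_tendstoD(2)[rotated])
  then show "\<forall>\<^sub>F n in sequentially. \<forall>x\<in>{0..2}. dist (poly ([:0, 1:] * cesaro n) x) (sqrt x) < e"
    by eventually_elim (use sqrt_approx order.strict_trans1 in \<open>fastforce simp: dist_real_def\<close>)
qed

lemma n2_diff_le: "l2 f \<Longrightarrow> l2 g \<Longrightarrow> l2 h \<Longrightarrow> n2 (\<lambda>x. f x - h x) \<le> n2 (\<lambda>x. f x - g x) + n2 (\<lambda>x. g x - h x)"
  using n2_triangle[of "\<lambda>x. f x - g x" "\<lambda>x. g x - h x"] by (simp add: l2_diff)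

lemma n2_commute: "n2 (\<lambda>x. f x - g x) = n2 (\<lambda>x. g x - f x)"
  unfolding Lp_norm_def by (simp add: abs_minus_commute)

lemma n2_diff_zero: assumes "l2 f" "l2 g" "n2 (\<lambda>x. f x - g x) \<le> 0" shows "f = g"
proof
  fix x have "f x - g x = 0"
    by (rule s2_zero_imp) (use s2_le[OF l2_diff[OF assms(1,2)]] assms(3) in fastforce)
  then show "f x = g x" by simp
qed

text \<open>The polynomials \<open>x K\<^sub>n(x)\<close> converge to \<open>sqrt x\<close> uniformly on \<open>[0, 2]\<close>; by \<open>pol_l2\<close> any other uniformly
  convergent sequence of polynomials yields the same limit.\<close>

lemma functional_calculus_sqrt:
  assumes f: "l2 f"
  shows "l2 (slap f)" "(\<lambda>n. n2 (\<lambda>x. pol ([:0, 1:] * cesaro n) f x - slap f x)) \<longlonglongrightarrow> 0"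
proof -
  let ?q = "\<lambda>n. [:0, 1:] * cesaro n"
  have diff: "n2 (\<lambda>x. pol p f x - pol q f x) \<le> C * n2 f"
    if "\<And>x. 0 \<le> x \<Longrightarrow> x \<le> 2 \<Longrightarrow> \<bar>poly p x - poly q x\<bar> \<le> C" for p q C
    using pol_l2(2)[OF f, of "p - q" C] that by (simp add: pol_diff)
  have "\<exists>n0. \<forall>k\<ge>n0. \<forall>l\<ge>n0. n2 (\<lambda>x. pol (?q k) f x - pol (?q l) f x) \<le> e" if e: "e > 0" for e
  proof -
    have "(\<lambda>n. 4 / sqrt (real n + 1) * n2 f) \<longlonglongrightarrow> 0 * n2 f" by (intro tendsto_intros tendsto_inv_sqrt)
    then have "\<forall>\<^sub>F n in sequentially. 4 / sqrt (real n + 1) * n2 f < e / 2"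
      using e by (intro order_tendstoD(2)) auto
    then obtain n0 where n0: "\<And>n. n \<ge> n0 \<Longrightarrow> 4 / sqrt (real n + 1) * n2 f < e / 2"
      unfolding eventually_sequentially by blast
    have "n2 (\<lambda>x. pol (?q k) f x - pol (?q l) f x) \<le> e" if "k \<ge> n0" "l \<ge> n0" for k l
    proof -
      have "n2 (\<lambda>x. pol (?q k) f x - pol (?q l) f x) \<le> (4 / sqrt (real k + 1) + 4 / sqrt (real l + 1)) * n2 f"
      proof (rule diff)
        fix x :: real assume "0 \<le> x" "x \<le> 2"
        then show "\<bar>poly (?q k) x - poly (?q l) x\<bar> \<le> 4 / sqrt (real k + 1) + 4 / sqrt (real l + 1)"
          using sqrt_approx[of x k] sqrt_approx[of x l] by linarith
      qed
      then show ?thesis using n0[OF that(1)] n0[OF that(2)] by (simp add: distrib_right)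
    qed
    then show ?thesis by blast
  qed
  then obtain h where h: "l2 h" "(\<lambda>n. n2 (\<lambda>x. pol (?q n) f x - h x)) \<longlonglongrightarrow> 0"
    by (rule l2_complete[OF l2_pol[OF f]])
  have all: "(\<lambda>n. n2 (\<lambda>x. pol (q n) f x - h x)) \<longlonglongrightarrow> 0"
    if q: "uniform_limit {0..2} (\<lambda>n t. poly (q n) t) sqrt sequentially" for q
  proof (rule LIMSEQ_I)
    fix r :: real assume r: "r > 0"
    define \<eta> where "\<eta> = r / (4 * (n2 f + 1))"
    have \<eta>: "\<eta> > 0" using r by (simp add: \<eta>_def add_nonneg_pos)
    have "\<forall>\<^sub>F n in sequentially. \<forall>x\<in>{0..2}. dist (poly (q n) x) (sqrt x) < \<eta>" using uniform_limitD[OF q \<eta>] .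
    moreover have "\<forall>\<^sub>F n in sequentially. \<forall>x\<in>{0..2}. dist (poly (?q n) x) (sqrt x) < \<eta>" using uniform_limitD[OF sqrt_approx_uniform \<eta>] .
    moreover have "\<forall>\<^sub>F n in sequentially. n2 (\<lambda>x. pol (?q n) f x - h x) < r / 4"
      using h(2) r by (intro order_tendstoD(2)) auto
    ultimately have "\<forall>\<^sub>F n in sequentially. norm (n2 (\<lambda>x. pol (q n) f x - h x) - 0) < r"
    proof eventually_elim
      case (elim n)
      have "n2 (\<lambda>x. pol (q n) f x - pol (?q n) f x) \<le> (2 * \<eta>) * n2 f"
      proof (rule diff)
        fix x :: real assume "0 \<le> x" "x \<le> 2"
        then have "x \<in> {0..2}" by simp
        then have "dist (poly (q n) x) (sqrt x) < \<eta>" "dist (poly (?q n) x) (sqrt x) < \<eta>" using elim by blast+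
        then show "\<bar>poly (q n) x - poly (?q n) x\<bar> \<le> 2 * \<eta>" unfolding dist_real_def by linarith
      qed
      also have "\<dots> = (r / 2) * (n2 f / (n2 f + 1))"
        using add_nonneg_pos[OF Lp_norm_nonneg zero_less_one, of "vol mu" 2 f] by (simp add: \<eta>_def field_simps)
      also have "\<dots> \<le> (r / 2) * 1" using r by (intro mult_left_mono) (auto simp: divide_le_eq_1 add_nonneg_pos)
      also have "\<dots> = r / 2" by simp
      finally have "n2 (\<lambda>x. pol (q n) f x - h x) \<le> r / 2 + r / 4"
        using n2_diff_le[OF l2_pol[OF f] l2_pol[OF f] h(1), of "q n" "?q n"] elim by linarith
      then show ?case using r by simp
    qed
    then show "\<exists>n0. \<forall>n\<ge>n0. norm (n2 (\<lambda>x. pol (q n) f x - h x) - 0) < r"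
      by (simp add: eventually_sequentially)
  qed
  have "slap f = h"
    unfolding sqrt_laplacian_def functional_calculus_def
  proof (rule the_equality)
    show "l2 h \<and> (\<forall>q. uniform_limit {0..2} (\<lambda>n t. poly (q n) t) sqrt sequentially \<longrightarrow>
        (\<lambda>n. n2 (\<lambda>x. pol (q n) f x - h x)) \<longlonglongrightarrow> 0)" using h(1) all by blast
    fix h' assume h0: "l2 h' \<and> (\<forall>q. uniform_limit {0..2} (\<lambda>n t. poly (q n) t) sqrt sequentially \<longrightarrow>
        (\<lambda>n. n2 (\<lambda>x. pol (q n) f x - h' x)) \<longlonglongrightarrow> 0)"
    have h': "l2 h'" "(\<lambda>n. n2 (\<lambda>x. pol (?q n) f x - h' x)) \<longlonglongrightarrow> 0"
      using h0 sqrt_approx_uniform by (blast, intro h0[THEN conjunct2, rule_format])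
    have "n2 (\<lambda>x. h' x - h x) \<le> n2 (\<lambda>x. pol (?q n) f x - h' x) + n2 (\<lambda>x. pol (?q n) f x - h x)" for n
      using n2_diff_le[OF h'(1) l2_pol[OF f, of "?q n"] h(1)] by (simp add: n2_commute[of h'])
    moreover have "(\<lambda>n. n2 (\<lambda>x. pol (?q n) f x - h' x) + n2 (\<lambda>x. pol (?q n) f x - h x)) \<longlonglongrightarrow> 0 + 0"
      by (intro tendsto_add h h')
    ultimately have "n2 (\<lambda>x. h' x - h x) \<le> 0" by (intro LIMSEQ_le_const[of _ "0::real"]) auto
    then show "h' = h" using h'(1) h(1) by (rule n2_diff_zero[rotated 2])
  qed
  with h show "l2 (slap f)" "(\<lambda>n. n2 (\<lambda>x. pol ([:0, 1:] * cesaro n) f x - slap f x)) \<longlonglongrightarrow> 0" by auto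
qed

lemma slap_add:
  assumes "l2 f" "l2 g" shows "slap (\<lambda>x. f x + g x) = (\<lambda>x. slap f x + slap g x)"
proof -
  let ?q = "\<lambda>n. [:0, 1:] * cesaro n"
  note F = functional_calculus_sqrt[OF assms(1)] and G = functional_calculus_sqrt[OF assms(2)]
    and FG = functional_calculus_sqrt[OF l2_add[OF assms]]
  have "n2 (\<lambda>x. slap (\<lambda>x. f x + g x) x - (slap f x + slap g x))
    \<le> n2 (\<lambda>x. pol (?q n) (\<lambda>x. f x + g x) x - slap (\<lambda>x. f x + g x) x)
      + (n2 (\<lambda>x. pol (?q n) f x - slap f x) + n2 (\<lambda>x. pol (?q n) g x - slap g x))" for n
  proof -
    have "n2 (\<lambda>x. pol (?q n) (\<lambda>x. f x + g x) x - (slap f x + slap g x))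
        = n2 (\<lambda>x. (pol (?q n) f x - slap f x) + (pol (?q n) g x - slap g x))"
      by (simp add: pol_add_arg algebra_simps)
    also have "\<dots> \<le> n2 (\<lambda>x. pol (?q n) f x - slap f x) + n2 (\<lambda>x. pol (?q n) g x - slap g x)"
      by (intro n2_triangle l2_diff l2_pol F G assms)
    finally show ?thesis
      using n2_diff_le[OF FG(1) l2_pol[OF l2_add[OF assms], of "?q n"] l2_add[OF F(1) G(1)]]
      by (simp add: n2_commute[of "slap (\<lambda>x. f x + g x)"])
  qed
  moreover have "(\<lambda>n. n2 (\<lambda>x. pol (?q n) (\<lambda>x. f x + g x) x - slap (\<lambda>x. f x + g x) x)
      + (n2 (\<lambda>x. pol (?q n) f x - slap f x) + n2 (\<lambda>x. pol (?q n) g x - slap g x))) \<longlonglongrightarrow> 0 + (0 + 0)"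
    by (intro tendsto_add F G FG)
  ultimately have "n2 (\<lambda>x. slap (\<lambda>x. f x + g x) x - (slap f x + slap g x)) \<le> 0"
    by (intro LIMSEQ_le_const[of _ "0::real"]) auto
  then show ?thesis using FG(1) l2_add[OF F(1) G(1)] by (rule n2_diff_zero[rotated 2])
qed

lemma slap_diff:
  assumes "l2 f" "l2 g" shows "slap (\<lambda>x. f x - g x) = (\<lambda>x. slap f x - slap g x)"
proof -
  have "slap f = slap (\<lambda>x. (f x - g x) + g x)" by simp
  also have "\<dots> = (\<lambda>x. slap (\<lambda>x. f x - g x) x + slap g x)" by (intro slap_add l2_diff assms)
  finally show ?thesis by (simp add: fun_eq_iff)
qed

lemma slap_pol_bound:
  assumes f: "l2 f" and C: "\<And>x. 0 \<le> x \<Longrightarrow> x \<le> 2 \<Longrightarrow> \<bar>sqrt x * poly q x - poly r x\<bar> \<le> C"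
  shows "n2 (\<lambda>x. slap (pol q f) x - pol r f x) \<le> C * n2 f"
proof -
  let ?q = "\<lambda>n. [:0, 1:] * cesaro n"
  obtain M where M: "\<And>x. 0 \<le> x \<and> x \<le> 2 \<longrightarrow> \<bar>poly q x\<bar> \<le> M" using poly_bounded by blast
  then have M0: "0 \<le> M" using abs_ge_zero[of "poly q 0"] by (metis order_trans order_refl zero_le_numeral)
  note S = functional_calculus_sqrt[OF l2_pol[OF f, of q]]
  have "n2 (\<lambda>x. slap (pol q f) x - pol r f x)
      \<le> n2 (\<lambda>x. pol (?q n) (pol q f) x - slap (pol q f) x) + (C + 4 / sqrt (real n + 1) * M) * n2 f" for n
  proof -
    have "n2 (pol (?q n * q - r) f) \<le> (C + 4 / sqrt (real n + 1) * M) * n2 f"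
    proof (rule pol_l2(2)[OF f])
      fix x :: real assume x: "0 \<le> x" "x \<le> 2"
      have "poly (?q n * q - r) x = (sqrt x * poly q x - poly r x) + (poly (?q n) x - sqrt x) * poly q x"
        by (simp add: algebra_simps)
      then have "\<bar>poly (?q n * q - r) x\<bar> \<le> \<bar>sqrt x * poly q x - poly r x\<bar> + \<bar>poly (?q n) x - sqrt x\<bar> * \<bar>poly q x\<bar>"
        by (metis abs_mult abs_triangle_ineq)
      also have "\<dots> \<le> C + 4 / sqrt (real n + 1) * M"
        using C[OF x] sqrt_approx[OF x, of n] M[of x] x by (intro add_mono mult_mono) auto
      finally show "\<bar>poly (?q n * q - r) x\<bar> \<le> C + 4 / sqrt (real n + 1) * M" .
    qed
    then have "n2 (\<lambda>x. pol (?q n) (pol q f) x - pol r f x) \<le> (C + 4 / sqrt (real n + 1) * M) * n2 f"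
      unfolding pol_diff pol_mult[of "?q n"] .
    then show ?thesis
      using n2_diff_le[OF S(1) l2_pol[OF l2_pol[OF f], of "?q n" q] l2_pol[OF f, of r]]
      unfolding n2_commute[of "slap (pol q f)" "pol (?q n) (pol q f)"] by linarith
  qed
  moreover have "(\<lambda>n. n2 (\<lambda>x. pol (?q n) (pol q f) x - slap (pol q f) x) + (C + 4 / sqrt (real n + 1) * M) * n2 f)
      \<longlonglongrightarrow> 0 + (C + 0 * M) * n2 f"
    by (intro tendsto_intros S tendsto_inv_sqrt)
  ultimately show ?thesis by (intro LIMSEQ_le_const) auto
qed

text \<open>Let \<open>q = x K\<^sub>n(x)\<close> and let \<open>\<eta>\<close> bound its distance to \<open>sqrt x\<close> on \<open>[0, 2]\<close>. Then \<open>q\<^sup>2 + 6 \<eta> - x\<close> is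
  nonnegative there, so \<open>pos_nonneg\<close> bounds the Dirichlet form by \<open>\<parallel>q(\<Delta>) g\<parallel>\<^sup>2\<close> up to an error of order
  \<open>\<eta>\<close>. The function \<open>g\<close> is first cut off so far away from \<open>S\<close> that \<open>d g\<close> does not change on \<open>S\<close>.\<close>

lemma df_le_slap:
  assumes g: "l2 g" and S: "finite S"
  shows "s2 S (tnorm (df g)) \<le> n2 (slap g)"
proof -
  let ?q = "\<lambda>n. [:0, 1:] * cesaro n"
  note G = functional_calculus_sqrt[OF g]
  have bd: "(s2 S (tnorm (df g)))\<^sup>2 \<le> (n2 (pol (?q n) g) + 4 * (1 / sqrt (real n + 1)))\<^sup>2 + (24 / sqrt (real n + 1)) * (n2 g)\<^sup>2" for n
  proof -
    define \<eta> where "\<eta> = 4 / sqrt (real n + 1)"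
    have \<eta>: "\<eta> > 0" by (simp add: \<eta>_def)
    obtain R where R: "finite R" "S \<subseteq> R"
      "\<And>R' f x. R \<subseteq> R' \<Longrightarrow> x \<in> S \<Longrightarrow> tnorm (df (pol 1 (cut R' f))) x = tnorm (df (pol 1 f)) x"
      using df_pol_cut[OF S, of 1] by metis
    obtain R2 where R2: "finite R2" "\<And>R'. finite R' \<Longrightarrow> R2 \<subseteq> R' \<Longrightarrow> n2 (\<lambda>x. g x - cut R' g x) \<le> 1 / sqrt (real n + 1)"
      using l2_cut[OF g, of "1 / sqrt (real n + 1)"] by (metis zero_less_divide_1_iff real_sqrt_gt_zero of_nat_0_le_iff add_nonneg_pos zero_less_one)
    define T where "T = R \<union> R2"
    let ?g = "cut T g"
    have T: "finite T" "R \<subseteq> T" "R2 \<subseteq> T" using R R2 by (auto simp: T_def)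
    have q4: "\<bar>poly (?q n) x\<bar> \<le> 4" and qe: "x \<le> (poly (?q n) x)\<^sup>2 + 6 * \<eta>" if x: "0 \<le> x" "x \<le> 2" for x
    proof -
      have s: "sqrt x \<le> 2" using x by (intro real_le_lsqrt) auto
      have xx: "x = sqrt x * sqrt x" using x by simp
      have "\<bar>poly (?q n) x\<bar> = sqrt x * \<bar>sqrt x * poly (cesaro n) x\<bar>"
        by (subst xx) (use x in \<open>simp add: abs_mult mult_ac\<close>)
      also have "\<dots> \<le> 2 * 2" using s x cesaro_bounds(1)[OF x] by (intro mult_mono) auto
      finally show q4: "\<bar>poly (?q n) x\<bar> \<le> 4" by simp
      have "x - (poly (?q n) x)\<^sup>2 = (sqrt x - poly (?q n) x) * (sqrt x + poly (?q n) x)"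
        using xx by (simp add: algebra_simps power2_eq_square)
      also have "\<dots> \<le> \<bar>sqrt x - poly (?q n) x\<bar> * \<bar>sqrt x + poly (?q n) x\<bar>" by (metis abs_ge_self abs_mult)
      also have "\<dots> \<le> \<eta> * 6"
      proof (rule mult_mono)
        show "\<bar>sqrt x - poly (?q n) x\<bar> \<le> \<eta>" using sqrt_approx[OF x, of n] by (simp add: \<eta>_def abs_minus_commute)
        have "0 \<le> sqrt x" using x by simp
        then show "\<bar>sqrt x + poly (?q n) x\<bar> \<le> 6" using q4 s by linarith
      qed (use \<eta> in auto)
      finally show "x \<le> (poly (?q n) x)\<^sup>2 + 6 * \<eta>" by simp
    qed
    have fg: "fin ?g" using T by simp
    have ipg: "ip ?g ?g = (s2 T g)\<^sup>2" using T by (simp add: ip_cut)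
    have "pos (?q n * ?q n + [:6 * \<eta>:] - [:0, 1:])"
      by (rule pos_nonneg) (use qe in \<open>auto simp: power2_eq_square algebra_simps\<close>)
    then have "0 \<le> ip ?g (pol (?q n * ?q n + [:6 * \<eta>:] - [:0, 1:]) ?g)" using fg by (simp add: pos_def)
    also have "\<dots> = ip (pol (?q n) ?g) (pol (?q n) ?g) + 6 * \<eta> * ip ?g ?g - ip ?g (Lap ?g)"
      using fg by (simp only: pol_diff pol_add pol_mult[of "?q n" "?q n"] pol_X ip_diff_right ip_add_right ip_pol)
        (simp add: pol_pCons lap_eq[of "\<lambda>_. 0"] ip_cmult_right)
    finally have e: "ip ?g (Lap ?g) \<le> ip (pol (?q n) ?g) (pol (?q n) ?g) + 6 * \<eta> * ip ?g ?g" by simp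
    have "s2 S (tnorm (df g)) = s2 S (tnorm (df ?g))" using R(3)[OF T(2)] by (intro s2_cong) (simp add: pol_1)
    then have e0: "(s2 S (tnorm (df g)))\<^sup>2 \<le> ip ?g (Lap ?g)" using dirichlet_form[OF fg S] by (simp add: s2_sq)
    have e1: "ip (pol (?q n) ?g) (pol (?q n) ?g) \<le> (n2 (pol (?q n) ?g))\<^sup>2"
    proof -
      let ?h = "pol (?q n) ?g"
      have fh: "fin ?h" by (intro fin_pol fg)
      have "ip ?h ?h = (s2 {x. ?h x \<noteq> 0} ?h)\<^sup>2"
        unfolding s2_sq using fin_supp[OF fh] fh by (subst ip_eq[of "{x. ?h x \<noteq> 0}"]) (auto simp: power2_eq_square mult.assoc)
      also have "\<dots> \<le> (n2 ?h)\<^sup>2" by (intro power_mono s2_le fin_l2 fh fin_supp) auto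
      finally show ?thesis .
    qed
    have e2: "n2 (pol (?q n) ?g) \<le> n2 (pol (?q n) g) + 4 * (1 / sqrt (real n + 1))"
    proof -
      have "n2 (pol (?q n) ?g) = n2 (\<lambda>x. pol (?q n) g x - pol (?q n) (\<lambda>x. g x - ?g x) x)"
        by (simp add: pol_diff_arg)
      also have "\<dots> \<le> n2 (pol (?q n) g) + n2 (pol (?q n) (\<lambda>x. g x - ?g x))"
        using T by (intro n2_diff l2_pol l2_diff g fin_l2 fin_cut)
      also have "n2 (pol (?q n) (\<lambda>x. g x - ?g x)) \<le> 4 * n2 (\<lambda>x. g x - ?g x)"
        using T by (intro pol_l2(2) q4 l2_diff g fin_l2 fin_cut)
      also have "n2 (\<lambda>x. g x - ?g x) \<le> 1 / sqrt (real n + 1)" using R2(2)[OF T(1) T(3)] .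
      finally show ?thesis by simp
    qed
    have e3: "ip ?g ?g \<le> (n2 g)\<^sup>2" unfolding ipg using T by (intro power_mono s2_le g) auto
    have "(n2 (pol (?q n) ?g))\<^sup>2 \<le> (n2 (pol (?q n) g) + 4 * (1 / sqrt (real n + 1)))\<^sup>2"
      by (intro power_mono e2) auto
    moreover have "6 * \<eta> * ip ?g ?g \<le> 6 * \<eta> * (n2 g)\<^sup>2" using \<eta> by (intro mult_left_mono e3) auto
    moreover have "6 * \<eta> * (n2 g)\<^sup>2 = (24 / sqrt (real n + 1)) * (n2 g)\<^sup>2" by (simp add: \<eta>_def)
    ultimately show ?thesis using e0 e e1 by linarith
  qed
  have "(\<lambda>n. n2 (pol (?q n) g)) \<longlonglongrightarrow> n2 (slap g)"
  proof (rule LIM_zero_cancel, rule Lim_null_comparison[OF _ G(2)], rule always_eventually, rule allI)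
    fix n
    have "n2 (pol (?q n) g) \<le> n2 (\<lambda>x. pol (?q n) g x - slap g x) + n2 (slap g)"
      using n2_triangle[OF l2_diff[OF l2_pol[OF g, of "?q n"] G(1)] G(1)] by simp
    moreover have "n2 (slap g) \<le> n2 (\<lambda>x. slap g x - pol (?q n) g x) + n2 (pol (?q n) g)"
      using n2_triangle[OF l2_diff[OF G(1) l2_pol[OF g, of "?q n"]] l2_pol[OF g, of "?q n"]] by simp
    ultimately show "norm (n2 (pol (?q n) g) - n2 (slap g)) \<le> n2 (\<lambda>x. pol (?q n) g x - slap g x)"
      by (simp add: n2_commute[of "slap g"] abs_le_iff)
  qed
  then have "(\<lambda>n. (n2 (pol (?q n) g) + 4 * (1 / sqrt (real n + 1)))\<^sup>2 + (24 / sqrt (real n + 1)) * (n2 g)\<^sup>2)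
      \<longlonglongrightarrow> (n2 (slap g) + 4 * 0)\<^sup>2 + 0 * (n2 g)\<^sup>2"
    by (intro tendsto_intros tendsto_inv_sqrt)
  then have "(s2 S (tnorm (df g)))\<^sup>2 \<le> (n2 (slap g) + 4 * 0)\<^sup>2 + 0 * (n2 g)\<^sup>2"
    by (rule LIMSEQ_le_const) (use bd in blast)
  then show ?thesis using power2_le_imp_le[of "s2 S (tnorm (df g))" "n2 (slap g)"] by simp
qed

lemma Lp_form2_iff:
  "F \<in> Lp_form mu 2 \<longleftrightarrow> (\<forall>e. e \<notin> edges mu \<longrightarrow> F e = 0) \<and> (\<forall>x y. F (y, x) = - F (x, y)) \<and> l2 (tnorm F)"
  by (simp add: Lp_form_def)

lemma df_vanish: "e \<notin> edges mu \<Longrightarrow> df f e = 0" using df_form(1) by blast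

text \<open>Completeness of spaces of forms: the seminorms only see the edges, so the vanishing of the
  forms off the edges is built into them.\<close>

lemma form_limit:
  fixes \<psi> :: "'i \<Rightarrow> ('a \<Rightarrow> real) \<Rightarrow> real"
  assumes ev: "\<And>x. \<exists>i\<in>I. \<exists>c\<ge>0. \<forall>f. \<bar>f x\<bar> \<le> c * \<psi> i f"
    and ct: "\<And>i g (h :: nat \<Rightarrow> 'a \<Rightarrow> real). i \<in> I \<Longrightarrow> (\<forall>x. (\<lambda>n. h n x) \<longlonglongrightarrow> g x) \<Longrightarrow> (\<lambda>n. \<psi> i (h n)) \<longlonglongrightarrow> \<psi> i g"
    and nn: "\<And>i f. 0 \<le> \<psi> i f"
    and van: "\<And>n e. e \<notin> edges mu \<Longrightarrow> u n e = 0"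
    and cauchy: "\<And>e. e > 0 \<Longrightarrow> \<exists>n0. \<forall>k\<ge>n0. \<forall>l\<ge>n0. \<forall>i\<in>I. \<psi> i (tnorm (\<lambda>x. u k x - u l x)) \<le> e"
  obtains F where "\<And>e. (\<lambda>n. u n e) \<longlonglongrightarrow> F e" "\<And>e. e \<notin> edges mu \<Longrightarrow> F e = 0"
    "\<And>e. e > 0 \<Longrightarrow> \<exists>n0. \<forall>k\<ge>n0. \<forall>i\<in>I. \<psi> i (tnorm (\<lambda>x. u k x - F x)) \<le> e"
proof -
  define \<phi> where "\<phi> = (\<lambda>(i, e) F. \<psi> i (tnorm F) + (if e \<in> edges mu then 0 else \<bar>F e\<bar>))"
  have 1: "\<exists>i\<in>I \<times> UNIV. \<exists>c. \<forall>f. \<bar>f e\<bar> \<le> c * \<phi> i f" for e :: "'a \<times> 'a"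
  proof -
    obtain x y where xy: "e = (x, y)" by force
    obtain i c where i: "i \<in> I" "c \<ge> 0" "\<And>f. \<bar>f x\<bar> \<le> c * \<psi> i f" using ev by meson
    show ?thesis
    proof (cases "e \<in> edges mu")
      case False
      then have "\<bar>f e\<bar> \<le> 1 * \<phi> (i, e) f" for f using nn[of i "tnorm f"] by (simp add: \<phi>_def)
      then show ?thesis using i(1) by blast
    next
      case True
      then have y: "y \<in> nb x" by (simp add: nbrs_def xy)
      define d where "d = 1 / sqrt (mu x y / w x / 2)"
      have d: "d \<ge> 0" by (simp add: d_def mu_nonneg)
      have "\<bar>f e\<bar> \<le> (d * c) * \<phi> (i, e) f" for f
      proof -
        have "\<bar>f e\<bar> \<le> d * tnorm f x" unfolding d_def xy by (rule tnorm_eval[OF y])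
        also have "\<dots> \<le> d * (c * \<psi> i (tnorm f))" using i(3)[of "tnorm f"] d by (intro mult_left_mono) auto
        finally show ?thesis using True by (simp add: \<phi>_def mult_ac)
      qed
      then show ?thesis using i(1) by blast
    qed
  qed
  have 2: "(\<lambda>n. \<phi> i (h n)) \<longlonglongrightarrow> \<phi> i g" if "i \<in> I \<times> UNIV" "\<forall>x. (\<lambda>n. h n x) \<longlonglongrightarrow> g x" for i g and h :: "nat \<Rightarrow> 'a \<times> 'a \<Rightarrow> real"
    using that by (auto simp: \<phi>_def intro!: tendsto_intros ct tnorm_tendsto)
  have 3: "0 \<le> \<phi> i f" for i f using nn by (simp add: \<phi>_def split: prod.splits)
  have 4: "\<exists>n0. \<forall>k\<ge>n0. \<forall>l\<ge>n0. \<forall>i\<in>I \<times> UNIV. \<phi> i (\<lambda>x. u k x - u l x) \<le> e" if "e > 0" for e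
    using cauchy[OF that] van by (fastforce simp: \<phi>_def)
  obtain F where F: "\<And>e. (\<lambda>n. u n e) \<longlonglongrightarrow> F e"
    "\<And>e. e > 0 \<Longrightarrow> \<exists>n0. \<forall>k\<ge>n0. \<forall>i\<in>I \<times> UNIV. \<phi> i (\<lambda>x. u k x - F x) \<le> e"
    by (rule cauchy_sup_limit[OF 1 2 3 4]) blast+
  have F0: "F e = 0" if "e \<notin> edges mu" for e
    using LIMSEQ_unique[OF F(1)[of e], of 0] van[OF that] by simp
  show ?thesis
  proof (rule that[OF F(1) F0])
    fix e :: real assume "e > 0"
    then obtain n0 where "\<forall>k\<ge>n0. \<forall>i\<in>I \<times> UNIV. \<phi> i (\<lambda>x. u k x - F x) \<le> e" using F(2) by blast
    then have "\<forall>k\<ge>n0. \<forall>i\<in>I. \<psi> i (tnorm (\<lambda>x. u k x - F x)) \<le> e"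
      using F0 van by (fastforce simp: \<phi>_def split: if_splits)
    then show "\<exists>n0. \<forall>k\<ge>n0. \<forall>i\<in>I. \<psi> i (tnorm (\<lambda>x. u k x - F x)) \<le> e" by blast
  qed
qed

lemma form_zero:
  assumes "\<And>x. tnorm F x = 0" "\<And>e. e \<notin> edges mu \<Longrightarrow> F e = 0" shows "F e = 0"
proof (cases e)
  case (Pair x y)
  show ?thesis
  proof (cases "e \<in> edges mu")
    case True
    then have "y \<in> nb x" by (simp add: nbrs_def Pair)
    from tnorm_eval[OF this, of F] show ?thesis by (simp add: assms Pair)
  qed (use assms in auto)
qed

end

text \<open>Decay of the iterated kernel to zero is what makes the range of the Laplacian dense, and
  hence the Riesz transform defined on all of \<open>L\<^sup>2\<close>.\<close>

locale decaying_walk = walk_graph +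
  assumes decay: "(\<lambda>k. (P ^^ k) (delta y) x) \<longlonglongrightarrow> 0"
begin

text \<open>Neumann's series: \<open>\<Delta> (\<Sum>j<N. P\<^sup>j g) = g - P\<^sup>N g\<close>, and \<open>\<parallel>P\<^sup>N g\<parallel>\<^sup>2 = \<langle>g, P\<^sup>2\<^sup>N g\<rangle>\<close> tends to \<open>0\<close> by the
  decay of the kernel.\<close>

lemma lap_range_dense:
  assumes f: "l2 f" and e: "e > 0"
  obtains u where "fin u" "n2 (\<lambda>x. f x - Lap u x) \<le> e"
proof -
  obtain S where S: "finite S" "n2 (\<lambda>x. f x - cut S f x) \<le> e / 2"
    using l2_cut[OF f, of "e / 2"] e by auto
  let ?g = "cut S f"
  have g: "fin ?g" using S by simp
  have "(\<lambda>N. ip ?g ((P ^^ (2 * N)) ?g)) \<longlonglongrightarrow> 0"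
  proof -
    have gd: "?g = (\<lambda>x. \<Sum>y\<in>S. f y * delta y x)"
      by (subst fin_decomp[OF S(1), of ?g]) (auto simp: cut_def split: if_splits)
    have d2: "(\<lambda>N. (P ^^ (2 * N)) (delta y) x) \<longlonglongrightarrow> 0" for x y
      using LIMSEQ_subseq_LIMSEQ[OF decay, of "\<lambda>N. 2 * N"] by (simp add: o_def strict_mono_def)
    have "(\<lambda>N. \<Sum>x\<in>S. w x * ?g x * (\<Sum>y\<in>S. f y * (P ^^ (2 * N)) (delta y) x)) \<longlonglongrightarrow> (\<Sum>x\<in>S. w x * ?g x * (\<Sum>y\<in>S. f y * 0))"
      by (intro tendsto_intros d2)
    moreover have "ip ?g ((P ^^ (2 * N)) ?g) = (\<Sum>x\<in>S. w x * ?g x * (\<Sum>y\<in>S. f y * (P ^^ (2 * N)) (delta y) x))" for N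
    proof -
      have "ip ?g ((P ^^ (2 * N)) ?g) = (\<Sum>x\<in>S. w x * ?g x * (P ^^ (2 * N)) ?g x)"
        by (rule ip_eq[OF S(1) _ g]) (auto simp: cut_def split: if_splits)
      moreover have "(P ^^ (2 * N)) ?g x = (\<Sum>y\<in>S. f y * (P ^^ (2 * N)) (delta y) x)" for x
        by (subst gd) (simp only: funpow_walk_sum funpow_walk_cmult)
      ultimately show ?thesis by simp
    qed
    ultimately show ?thesis by simp
  qed
  then have "\<forall>\<^sub>F N in sequentially. ip ?g ((P ^^ (2 * N)) ?g) < (e / 2)\<^sup>2"
    using e by (intro order_tendstoD(2)) auto
  then obtain N where N: "ip ?g ((P ^^ (2 * N)) ?g) < (e / 2)\<^sup>2"
    by (auto simp: eventually_sequentially)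
  define h where "h = (P ^^ N) ?g"
  have h: "fin h" unfolding h_def by (intro fin_funpow g)
  have "ip h h = ip ?g ((P ^^ (2 * N)) ?g)"
    unfolding h_def using g by (simp add: ip_funpow mult_2 funpow_add)
  then have "n2 h \<le> sqrt ((e / 2)\<^sup>2)" using fin_l2(2)[OF h] N by (smt (verit) real_sqrt_le_mono)
  then have hn: "n2 h \<le> e / 2" using e by simp
  define u where "u = (\<lambda>x. \<Sum>j<N. (P ^^ j) ?g x)"
  have "Lap u = (\<lambda>x. ?g x - h x)"
  proof -
    have "Lap u = (\<lambda>x. \<Sum>j<N. (P ^^ j) ?g x - (P ^^ Suc j) ?g x)"
      unfolding u_def by (simp add: lap_sum) (simp add: lap_eq)
    moreover have "(\<Sum>j<N. (P ^^ j) ?g x - (P ^^ Suc j) ?g x) = ?g x - h x" for x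
      using sum_lessThan_telescope'[of "\<lambda>j. (P ^^ j) ?g x" N] by (simp add: h_def)
    ultimately show ?thesis by simp
  qed
  then have "n2 (\<lambda>x. f x - Lap u x) = n2 (\<lambda>x. (f x - ?g x) + h x)" by (simp add: algebra_simps)
  also have "\<dots> \<le> n2 (\<lambda>x. f x - ?g x) + n2 h" by (intro n2_triangle l2_diff f fin_l2 g h)
  finally have "n2 (\<lambda>x. f x - Lap u x) \<le> e" using S hn by simp
  moreover have "fin u" unfolding u_def by (intro fin_sum fin_funpow g)
  ultimately show ?thesis using that by blast
qed

text \<open>On the range of \<open>\<Delta>\<close> the convergence follows from \<open>sqrt_approx\<close>, and on the small remainder \<open>v\<close> from the
  uniform bound of \<open>\<Delta>\<^sup>1\<^sup>/\<^sup>2 K\<^sub>n\<close>.\<close>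

lemma slap_K_tendsto:
  assumes f: "l2 f"
  shows "(\<lambda>n. n2 (\<lambda>x. slap (K n f) x - f x)) \<longlonglongrightarrow> 0"
proof (rule LIMSEQ_I)
  fix r :: real assume r: "r > 0"
  obtain u where u: "fin u" "n2 (\<lambda>x. f x - Lap u x) \<le> r / 8" using lap_range_dense[OF f, of "r / 8"] r by auto
  define v where "v = (\<lambda>x. f x - Lap u x)"
  have lu: "l2 u" "l2 (Lap u)" by (intro fin_l2 fin_lap u)+
  have v: "l2 v" "n2 v \<le> r / 8" unfolding v_def using u lu by (auto intro: l2_diff f)
  have le: "n2 (\<lambda>x. slap (K n f) x - f x) \<le> 8 / sqrt (real n + 1) * n2 u + 3 * n2 v" for n
  proof -
    have 1: "n2 (\<lambda>x. slap (pol (cesaro n * [:0, 1:]) u) x - pol [:0, 1:] u x) \<le> 8 / sqrt (real n + 1) * n2 u"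
    proof (rule slap_pol_bound[OF lu(1)])
      fix x :: real assume x: "0 \<le> x" "x \<le> 2"
      have s: "sqrt x \<le> 2" "0 \<le> sqrt x" using x by (auto intro: real_le_lsqrt)
      have "sqrt x * poly (cesaro n * [:0, 1:]) x - poly [:0, 1:] x = sqrt x * (x * poly (cesaro n) x - sqrt x)"
        using x by (simp add: algebra_simps)
      also have "\<bar>\<dots>\<bar> = sqrt x * \<bar>poly ([:0, 1:] * cesaro n) x - sqrt x\<bar>" using s by (simp add: abs_mult)
      also have "\<dots> \<le> 2 * (4 / sqrt (real n + 1))" using s sqrt_approx[OF x, of n] by (intro mult_mono) auto
      finally show "\<bar>sqrt x * poly (cesaro n * [:0, 1:]) x - poly [:0, 1:] x\<bar> \<le> 8 / sqrt (real n + 1)" by simp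
    qed
    have 2: "n2 (\<lambda>x. slap (pol (cesaro n) v) x - pol 1 v x) \<le> 3 * n2 v"
    proof (rule slap_pol_bound[OF v(1)])
      fix x :: real assume x: "0 \<le> x" "x \<le> 2"
      show "\<bar>sqrt x * poly (cesaro n) x - poly 1 x\<bar> \<le> 3"
        using cesaro_bounds(1)[OF x, of n] unfolding poly_1 by linarith
    qed
    have f_eq: "f = (\<lambda>x. Lap u x + v x)" by (simp add: v_def)
    have "slap (K n f) = (\<lambda>x. slap (K n (Lap u)) x + slap (K n v) x)"
      by (subst (1) f_eq) (simp add: pol_add_arg slap_add l2_pol lu v)
    then have "n2 (\<lambda>x. slap (K n f) x - f x) = n2 (\<lambda>x. (slap (K n (Lap u)) x - Lap u x) + (slap (K n v) x - v x))"
      by (simp add: v_def algebra_simps)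
    also have "\<dots> \<le> n2 (\<lambda>x. slap (K n (Lap u)) x - Lap u x) + n2 (\<lambda>x. slap (K n v) x - v x)"
      by (intro n2_triangle l2_diff functional_calculus_sqrt l2_pol lu v)
    finally show ?thesis using 1 2 by (simp only: pol_mult pol_X pol_1)
  qed
  have "(\<lambda>n. 8 / sqrt (real n + 1) * n2 u) \<longlonglongrightarrow> 0 * n2 u" by (intro tendsto_intros tendsto_inv_sqrt)
  then have "\<forall>\<^sub>F n in sequentially. 8 / sqrt (real n + 1) * n2 u < r / 8" using r by (intro order_tendstoD(2)) auto
  then have "\<forall>\<^sub>F n in sequentially. norm (n2 (\<lambda>x. slap (K n f) x - f x) - 0) < r"
  proof eventually_elim
    case (elim n)
    show ?case unfolding diff_0_right real_norm_def abs_of_nonneg[OF Lp_norm_nonneg]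
      using le[of n] v(2) r elim by linarith
  qed
  then show "\<exists>n0. \<forall>n\<ge>n0. norm (n2 (\<lambda>x. slap (K n f) x - f x) - 0) < r" by (simp add: eventually_sequentially)
qed

lemma df_K_cauchy:
  assumes f: "l2 f" and e: "e > 0"
  shows "\<exists>n0. \<forall>k\<ge>n0. \<forall>l\<ge>n0. \<forall>S\<in>{S. finite S}. s2 S (tnorm (\<lambda>x. df (K k f) x - df (K l f) x)) \<le> e"
proof -
  obtain u where u: "fin u" "n2 (\<lambda>x. f x - Lap u x) \<le> e / 8" using lap_range_dense[OF f, of "e / 8"] e by auto
  define v where "v = (\<lambda>x. f x - Lap u x)"
  have lu: "l2 u" "l2 (Lap u)" by (intro fin_l2 fin_lap u)+
  have v: "l2 v" "n2 v \<le> e / 8" unfolding v_def using u lu by (auto intro: l2_diff f)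
  have "(\<lambda>n. 8 / sqrt (real n + 1) * n2 u) \<longlonglongrightarrow> 0 * n2 u" by (intro tendsto_intros tendsto_inv_sqrt)
  then have "\<forall>\<^sub>F n in sequentially. 8 / sqrt (real n + 1) * n2 u < e / 8" using e by (intro order_tendstoD(2)) auto
  then obtain n0 where n0: "\<And>n. n \<ge> n0 \<Longrightarrow> 8 / sqrt (real n + 1) * n2 u < e / 8" by (auto simp: eventually_sequentially)
  have "s2 S (tnorm (\<lambda>x. df (K k f) x - df (K l f) x)) \<le> e" if k: "k \<ge> n0" and l: "l \<ge> n0" and S: "finite S" for k l S
  proof -
    let ?q = "cesaro k - cesaro l"
    have 1: "s2 S (tnorm (df (pol (?q * [:0, 1:]) u))) \<le> (8 / sqrt (real k + 1) + 8 / sqrt (real l + 1)) * n2 u"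
    proof (rule df_pol_l2[OF lu(1) S])
      fix x :: real assume x: "0 \<le> x" "x \<le> 2"
      have s: "sqrt x \<le> 2" "0 \<le> sqrt x" using x by (auto intro: real_le_lsqrt)
      have "sqrt x * poly (?q * [:0, 1:]) x
          = sqrt x * ((poly ([:0, 1:] * cesaro k) x - sqrt x) - (poly ([:0, 1:] * cesaro l) x - sqrt x))"
        by (simp add: algebra_simps)
      also have "\<bar>\<dots>\<bar> \<le> sqrt x * (\<bar>poly ([:0, 1:] * cesaro k) x - sqrt x\<bar> + \<bar>poly ([:0, 1:] * cesaro l) x - sqrt x\<bar>)"
        unfolding abs_mult using s by (intro mult_mono abs_triangle_ineq4) auto
      also have "\<dots> \<le> 2 * (4 / sqrt (real k + 1) + 4 / sqrt (real l + 1))"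
        using s sqrt_approx[OF x] by (intro mult_mono add_mono) auto
      finally show "\<bar>sqrt x * poly (?q * [:0, 1:]) x\<bar> \<le> 8 / sqrt (real k + 1) + 8 / sqrt (real l + 1)" by simp
    qed
    have 2: "s2 S (tnorm (df (pol ?q v))) \<le> 4 * n2 v"
    proof (rule df_pol_l2[OF v(1) S])
      fix x :: real assume x: "0 \<le> x" "x \<le> 2"
      show "\<bar>sqrt x * poly ?q x\<bar> \<le> 4"
        using cesaro_bounds(1)[OF x, of k] cesaro_bounds(1)[OF x, of l] by (simp add: right_diff_distrib)
    qed
    have f_eq: "f = (\<lambda>x. Lap u x + v x)" by (simp add: v_def)
    have "(\<lambda>x. df (K k f) x - df (K l f) x) = df (pol ?q f)"
      by (simp add: pol_diff df_diff)
    also have "\<dots> = (\<lambda>x. df (pol ?q (Lap u)) x + df (pol ?q v) x)"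
      by (subst f_eq) (simp add: pol_add_arg df_add)
    finally have "s2 S (tnorm (\<lambda>x. df (K k f) x - df (K l f) x)) = s2 S (tnorm (\<lambda>x. df (pol ?q (Lap u)) x + df (pol ?q v) x))"
      by simp
    also have "\<dots> \<le> s2 S (\<lambda>x. tnorm (df (pol ?q (Lap u))) x + tnorm (df (pol ?q v)) x)"
      by (rule s2_mono) (simp add: tnorm_triangle)
    also have "\<dots> \<le> s2 S (tnorm (df (pol ?q (Lap u)))) + s2 S (tnorm (df (pol ?q v)))" by (rule s2_triangle)
    finally show ?thesis using 1 2 v n0[OF k] n0[OF l] e by (simp only: pol_mult pol_X distrib_right)
  qed
  then show ?thesis by blast
qed

text \<open>The functions \<open>K\<^sub>n f\<close> can serve as the approximating sequence in the definition of the Riesz transform,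
  and \<open>df_le_slap\<close> makes the limit independent of the sequence.\<close>

theorem riesz_limit:
  assumes f: "l2 f"
  shows "riesz mu f \<in> Lp_form mu 2"
    and "\<And>e. (\<lambda>n. df (K n f) e) \<longlonglongrightarrow> riesz mu f e"
    and "\<And>S. finite S \<Longrightarrow> s2 S (tnorm (riesz mu f)) \<le> 2 * n2 f"
proof -
  have ev: "\<exists>S\<in>{S. finite S}. \<exists>c\<ge>0. \<forall>f. \<bar>f x\<bar> \<le> c * s2 S f" for x
    using s2_eval by (intro bexI[of _ "{x}"] exI[of _ "1 / sqrt (w x)"]) auto
  have ct: "(\<lambda>n. s2 S (h n)) \<longlonglongrightarrow> s2 S g" if "\<forall>x. (\<lambda>n. h n x) \<longlonglongrightarrow> g x" for S g and h :: "nat \<Rightarrow> 'a \<Rightarrow> real"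
    using that by (intro s2_tendsto) blast
  obtain F where F: "\<And>e. (\<lambda>n. df (K n f) e) \<longlonglongrightarrow> F e" "\<And>e. e \<notin> edges mu \<Longrightarrow> F e = 0"
    "\<And>e. e > 0 \<Longrightarrow> \<exists>n0. \<forall>k\<ge>n0. \<forall>S\<in>{S. finite S}. s2 S (tnorm (\<lambda>x. df (K k f) x - F x)) \<le> e"
    by (rule form_limit[OF ev ct s2_nonneg df_vanish df_K_cauchy[OF f]]) blast+
  have bd: "s2 S (tnorm F) \<le> 2 * n2 f" if S: "finite S" for S
  proof (rule LIMSEQ_le_const2)
    show "(\<lambda>n. s2 S (tnorm (df (K n f)))) \<longlonglongrightarrow> s2 S (tnorm F)" by (intro s2_tendsto tnorm_tendsto F)
    show "\<exists>N. \<forall>n\<ge>N. s2 S (tnorm (df (K n f))) \<le> 2 * n2 f"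
      by (intro exI allI impI df_pol_l2 f S cesaro_bounds)
  qed
  have anti: "F (y, x) = - F (x, y)" for x y
    using LIMSEQ_unique[OF F(1)[of "(y, x)"] tendsto_minus[OF F(1)[of "(x, y)"], folded df_form(2)]] .
  have F2: "F \<in> Lp_form mu 2" unfolding Lp_form2_iff using F(2) anti n2I(1)[OF bd] by blast
  have conv: "(\<lambda>n. Lp_form_norm mu 2 (\<lambda>e. df (K n f) e - F e)) \<longlonglongrightarrow> 0"
  proof (rule LIMSEQ_I)
    fix r :: real assume r: "r > 0"
    then obtain n0 where n0: "\<forall>k\<ge>n0. \<forall>S\<in>{S. finite S}. s2 S (tnorm (\<lambda>x. df (K k f) x - F x)) \<le> r / 2"
      using F(3)[of "r / 2"] by auto
    have "Lp_form_norm mu 2 (\<lambda>e. df (K k f) e - F e) \<le> r / 2" if "k \<ge> n0" for k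
      unfolding Lp_form_norm_def using n0 that by (intro n2I(2)) auto
    then show "\<exists>n0. \<forall>n\<ge>n0. norm (Lp_form_norm mu 2 (\<lambda>e. df (K n f) e - F e) - 0) < r"
      using r by (intro exI[of _ n0]) (fastforce simp: Lp_form_norm_def)
  qed
  have "riesz mu f = F"
    unfolding riesz_def
  proof (rule the_equality)
    show "F \<in> Lp_form mu 2 \<and> (\<exists>g. (\<forall>n. l2 (g n)) \<and> (\<lambda>n. n2 (\<lambda>x. slap (g n) x - f x)) \<longlonglongrightarrow> 0 \<and>
        (\<lambda>n. Lp_form_norm mu 2 (\<lambda>e. df (g n) e - F e)) \<longlonglongrightarrow> 0)"
      using F2 conv slap_K_tendsto[OF f] l2_pol[OF f] by (intro conjI exI[of _ "\<lambda>n. K n f"]) auto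
    fix G assume "G \<in> Lp_form mu 2 \<and> (\<exists>g. (\<forall>n. l2 (g n)) \<and> (\<lambda>n. n2 (\<lambda>x. slap (g n) x - f x)) \<longlonglongrightarrow> 0 \<and>
        (\<lambda>n. Lp_form_norm mu 2 (\<lambda>e. df (g n) e - G e)) \<longlonglongrightarrow> 0)"
    then obtain g where G: "G \<in> Lp_form mu 2" "\<And>n. l2 (g n)" "(\<lambda>n. n2 (\<lambda>x. slap (g n) x - f x)) \<longlonglongrightarrow> 0"
      "(\<lambda>n. Lp_form_norm mu 2 (\<lambda>e. df (g n) e - G e)) \<longlonglongrightarrow> 0" by blast
    have l2t: "l2 (tnorm (\<lambda>e. df (h n) e - H e))" if "l2 (h n)" "H \<in> Lp_form mu 2" for h :: "nat \<Rightarrow> 'a \<Rightarrow> real" and n H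
    proof (rule n2I(1))
      fix S :: "'a set" assume S: "finite S"
      have "s2 S (tnorm (\<lambda>e. df (h n) e - H e)) \<le> s2 S (\<lambda>x. tnorm (df (h n)) x + tnorm H x)"
        by (rule s2_mono) (simp add: tnorm_diff)
      also have "\<dots> \<le> s2 S (tnorm (df (h n))) + s2 S (tnorm H)" by (rule s2_triangle)
      also have "\<dots> \<le> n2 (slap (h n)) + n2 (tnorm H)"
        using that unfolding Lp_form2_iff by (intro add_mono df_le_slap s2_le S) blast+
      finally show "s2 S (tnorm (\<lambda>e. df (h n) e - H e)) \<le> n2 (slap (h n)) + n2 (tnorm H)" .
    qed
    have zero: "s2 S (tnorm (\<lambda>e. G e - F e)) \<le> 0" if S: "finite S" for S
    proof (rule LIMSEQ_le_const)
      show "(\<lambda>n. Lp_form_norm mu 2 (\<lambda>e. df (g n) e - G e) + (n2 (\<lambda>x. slap (g n) x - f x) + n2 (\<lambda>x. slap (K n f) x - f x))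
          + Lp_form_norm mu 2 (\<lambda>e. df (K n f) e - F e)) \<longlonglongrightarrow> 0"
        using tendsto_add[OF tendsto_add[OF G(4) tendsto_add[OF G(3) slap_K_tendsto[OF f]]] conv] by simp
      have "s2 S (tnorm (\<lambda>e. G e - F e)) \<le> Lp_form_norm mu 2 (\<lambda>e. df (g n) e - G e)
          + (n2 (\<lambda>x. slap (g n) x - f x) + n2 (\<lambda>x. slap (K n f) x - f x)) + Lp_form_norm mu 2 (\<lambda>e. df (K n f) e - F e)" for n
      proof -
        let ?A = "\<lambda>e. df (g n) e - G e" and ?B = "\<lambda>e. df (K n f) e - F e" and ?D = "\<lambda>x. g n x - K n f x"
        have "tnorm (\<lambda>e. G e - F e) x \<le> tnorm ?A x + tnorm (df ?D) x + tnorm ?B x" for x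
        proof -
          have "(\<lambda>e. G e - F e) = (\<lambda>e. (df ?D e - ?A e) + ?B e)" by (simp add: df_diff fun_eq_iff)
          then have "tnorm (\<lambda>e. G e - F e) x \<le> tnorm (\<lambda>e. df ?D e - ?A e) x + tnorm ?B x"
            using tnorm_triangle[of "\<lambda>e. df ?D e - ?A e" ?B x] by simp
          then show ?thesis using tnorm_diff[of "df ?D" ?A x] by simp
        qed
        then have "s2 S (tnorm (\<lambda>e. G e - F e)) \<le> s2 S (\<lambda>x. tnorm ?A x + tnorm (df ?D) x + tnorm ?B x)"
          by (intro s2_mono) (auto intro!: add_nonneg_nonneg simp: abs_of_nonneg)
        also have "\<dots> \<le> s2 S (tnorm ?A) + s2 S (tnorm (df ?D)) + s2 S (tnorm ?B)"
          using s2_triangle[of S "\<lambda>x. tnorm ?A x + tnorm (df ?D) x" "tnorm ?B"] s2_triangle[of S "tnorm ?A" "tnorm (df ?D)"] by linarith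
        also have "\<dots> \<le> n2 (tnorm ?A) + n2 (slap ?D) + n2 (tnorm ?B)"
          by (intro add_mono s2_le df_le_slap S l2_diff l2_pol f G l2t F2)
        also have "n2 (slap ?D) \<le> n2 (\<lambda>x. slap (g n) x - f x) + n2 (\<lambda>x. slap (K n f) x - f x)"
          using n2_diff_le[OF functional_calculus_sqrt(1)[OF G(2)] f functional_calculus_sqrt(1)[OF l2_pol[OF f]], of n "cesaro n"]
          by (simp add: slap_diff G l2_pol f n2_commute[of f])
        finally show ?thesis by (simp add: Lp_form_norm_def)
      qed
      then show "\<exists>N. \<forall>n\<ge>N. s2 S (tnorm (\<lambda>e. G e - F e)) \<le> Lp_form_norm mu 2 (\<lambda>e. df (g n) e - G e)
          + (n2 (\<lambda>x. slap (g n) x - f x) + n2 (\<lambda>x. slap (K n f) x - f x)) + Lp_form_norm mu 2 (\<lambda>e. df (K n f) e - F e)" by blast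
    qed
    have tz: "tnorm (\<lambda>e. G e - F e) x = 0" for x by (rule s2_zero_imp) (rule zero)
    have G0: "G e = 0" if "e \<notin> edges mu" for e using G(1) that unfolding Lp_form2_iff by blast
    have "G e - F e = 0" for e
      by (rule form_zero[of "\<lambda>e. G e - F e"]) (use tz F(2) G0 in auto)
    then show "G = F" by (simp add: fun_eq_iff)
  qed
  with F F2 bd show "riesz mu f \<in> Lp_form mu 2" "\<And>e. (\<lambda>n. df (K n f) e) \<longlonglongrightarrow> riesz mu f e"
    "\<And>S. finite S \<Longrightarrow> s2 S (tnorm (riesz mu f)) \<le> 2 * n2 f" by auto
qed

end

section \<open>Balls, doubling and the decay of the kernel\<close>

locale riesz_graph = walk_graph +
  fixes \<beta> :: "'a \<Rightarrow> 'a \<Rightarrow> real" and B :: real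
  assumes quasi: "quasidistance_exponent mu B \<beta>"
    and lower: "LB mu"
    and dbl: "doubling mu \<beta>"
    and upper: "UE mu \<beta>"
begin

abbreviation "\<rho> \<equiv> qdist mu \<beta>"

text \<open>Balls of integer radius suffice: the averages of powers of \<open>P\<close> have integer times, and distinct
  points have distance at least \<open>1\<close>, so that the ball of radius \<open>1\<close> is a point.\<close>

definition Bl :: "'a \<Rightarrow> nat \<Rightarrow> 'a set" where "Bl x k = {y. \<rho> x y < real k}"

definition V :: "'a \<Rightarrow> nat \<Rightarrow> real" where "V x k = (\<Sum>y\<in>Bl x k. w y)"

definition \<kappa> :: nat where "\<kappa> = nat \<lceil>2 powr (B - 1)\<rceil>"

lemma beta_bounds: "1 \<le> \<beta> x y" "\<beta> x y \<le> B"
  and rho_sym: "\<rho> x y = \<rho> y x"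
  and rho_quasi': "\<rho> x z \<le> 2 powr (B - 1) * (\<rho> x y + \<rho> y z)"
  using quasi unfolding quasidistance_exponent_def by blast+

lemma rho_nonneg [simp]: "0 \<le> \<rho> x y" by (simp add: qdist_def)

lemma kappa: "2 powr (B - 1) \<le> real \<kappa>" "1 \<le> \<kappa>"
proof -
  show 1: "2 powr (B - 1) \<le> real \<kappa>" unfolding \<kappa>_def by (simp add: real_nat_ceiling_ge)
  have "0 \<le> B - 1" using order_trans[OF beta_bounds] by simp
  then have "1 \<le> 2 powr (B - 1)" by (intro ge_one_powr_ge_zero) auto
  with 1 show "1 \<le> \<kappa>" by linarith
qed

lemma rho_quasi: "\<rho> x z \<le> real \<kappa> * (\<rho> x y + \<rho> y z)"
  by (rule order_trans[OF rho_quasi'[of x z y]]) (intro mult_right_mono kappa add_nonneg_nonneg, auto)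

lemma gdist_path: "(x, y) \<in> edges mu ^^ gdist mu x y"
  unfolding gdist_def using conn[of x y] by (metis (mono_tags, lifting) LeastI rtrancl_imp_relpow)

lemma gdist_le: "(x, y) \<in> edges mu ^^ n \<Longrightarrow> gdist mu x y \<le> n"
  unfolding gdist_def by (rule Least_le)

lemma rho_self [simp]: "\<rho> x x = 0"
proof -
  have "gdist mu x x = 0" using gdist_le[of x x 0] by simp
  then show ?thesis by (simp add: qdist_def)
qed

lemma gdist_le_rho: "real (gdist mu x y) \<le> \<rho> x y"
proof (cases "gdist mu x y = 0")
  case False
  then have "real (gdist mu x y) powr 1 \<le> real (gdist mu x y) powr \<beta> x y"
    using beta_bounds by (intro powr_mono) auto
  then show ?thesis by (simp add: qdist_def)
qed simp

lemma rho_ge_1: "x \<noteq> y \<Longrightarrow> 1 \<le> \<rho> x y"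
proof -
  assume "x \<noteq> y"
  then have "gdist mu x y \<noteq> 0" using gdist_path[of x y] by (metis IdE relpow.simps(1) pair_in_Id_conv)
  then show ?thesis using gdist_le_rho[of x y] by linarith
qed

lemma rho_nb: "y \<in> nb x \<Longrightarrow> \<rho> x y \<le> 1"
proof -
  assume "y \<in> nb x"
  then have "(x, y) \<in> edges mu ^^ 1" by (simp add: nbrs_def)
  then have "gdist mu x y \<le> 1" by (rule gdist_le)
  then have "gdist mu x y = 0 \<or> gdist mu x y = 1" by linarith
  then show ?thesis by (auto simp: qdist_def)
qed

lemma finite_relpow: "finite {y. (x, y) \<in> edges mu ^^ n}"
proof (induction n)
  case (Suc n)
  have "{y. (x, y) \<in> edges mu ^^ Suc n} \<subseteq> (\<Union>z\<in>{y. (x, y) \<in> edges mu ^^ n}. nb z)"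
    by (auto simp: nbrs_def)
  then show ?case using Suc by (meson finite_UN finite_nb finite_subset)
qed simp

lemma finite_Bl [simp]: "finite (Bl x k)"
proof -
  have "Bl x k \<subseteq> (\<Union>n<k. {y. (x, y) \<in> edges mu ^^ n})"
  proof
    fix y assume "y \<in> Bl x k"
    then have "gdist mu x y < k" using gdist_le_rho[of x y] by (simp add: Bl_def)
    then show "y \<in> (\<Union>n<k. {y. (x, y) \<in> edges mu ^^ n})" using gdist_path[of x y] by blast
  qed
  then show ?thesis by (rule finite_subset) (simp add: finite_relpow)
qed

lemma Bl_self: "1 \<le> k \<Longrightarrow> x \<in> Bl x k" by (simp add: Bl_def)

lemma Bl_1: "Bl x 1 = {x}"
  using rho_ge_1 by (auto simp: Bl_def) (metis linorder_not_less)

lemma Bl_mono: "k \<le> l \<Longrightarrow> Bl x k \<subseteq> Bl x l" by (auto simp: Bl_def)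

lemma Bl_sym: "y \<in> Bl x k \<longleftrightarrow> x \<in> Bl y k" by (simp add: Bl_def rho_sym)

lemma Bl_trans: "y \<in> Bl x k \<Longrightarrow> z \<in> Bl y l \<Longrightarrow> z \<in> Bl x (\<kappa> * (k + l))"
proof -
  assume "y \<in> Bl x k" "z \<in> Bl y l"
  then have "\<rho> x y + \<rho> y z < real k + real l" by (simp add: Bl_def)
  then have "real \<kappa> * (\<rho> x y + \<rho> y z) < real \<kappa> * (real k + real l)" using kappa(2) by simp
  with rho_quasi[of x z y] show ?thesis by (simp add: Bl_def)
qed

lemma in_some_Bl: "finite S \<Longrightarrow> \<exists>k\<ge>n. S \<subseteq> Bl x k"
proof -
  assume S: "finite S"
  obtain k where k: "\<forall>y\<in>S. \<rho> x y < real k"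
  proof -
    obtain M where M: "\<forall>r\<in>\<rho> x ` S. r \<le> M" using finite_imageI[OF S, of "\<rho> x"] by (metis bdd_above_finite bdd_above.E)
    obtain k where "M < real k" using reals_Archimedean2 by blast
    then have "\<forall>y\<in>S. \<rho> x y < real k" using M by force
    then show ?thesis by (rule that)
  qed
  then show ?thesis by (intro exI[of _ "max n k"]) (auto simp: Bl_def less_max_iff_disj of_nat_max)
qed

lemma V_ball_vol: "ball_vol mu \<beta> x (real k) = V x k"
proof -
  have "emeasure (vol mu) (Bl x k) = (\<Sum>y\<in>Bl x k. ennreal (w y))"
    unfolding vol_def by (rule emeasure_point_measure_finite2) auto
  also have "\<dots> = ennreal (V x k)" by (simp add: V_def sum_nonneg flip: sum_ennreal)
  finally show ?thesis by (simp add: ball_vol_def measure_def V_def sum_nonneg flip: Bl_def)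
qed

lemma V_nonneg [simp]: "0 \<le> V x k" by (simp add: V_def sum_nonneg)

lemma V_mono: "k \<le> l \<Longrightarrow> V x k \<le> V x l"
  unfolding V_def by (intro sum_mono2) (auto dest: Bl_mono)

lemma V_1: "V x 1 = w x" by (simp add: V_def Bl_1[simplified])

lemma V_pos: "1 \<le> k \<Longrightarrow> 0 < V x k"
  using V_mono[of 1 k x] w_pos[of x] V_1[of x] by simp

definition Dc :: real where
  "Dc = (SOME D. 1 \<le> D \<and> (\<forall>x. \<forall>k\<ge>1. V x (2 * k) \<le> D * V x k))"

lemma Dc: "1 \<le> Dc" "1 \<le> k \<Longrightarrow> V x (2 * k) \<le> Dc * V x k"
proof -
  obtain C where C: "\<And>x r. r > 0 \<Longrightarrow> ball_vol mu \<beta> x (2 * r) \<le> C * ball_vol mu \<beta> x r"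
    using dbl unfolding doubling_def by blast
  have "V x (2 * k) \<le> max 1 C * V x k" if "1 \<le> k" for x k
  proof -
    have "V x (2 * k) \<le> C * V x k" using C[of "real k" x] that by (simp flip: V_ball_vol)
    also have "\<dots> \<le> max 1 C * V x k" by (intro mult_right_mono) auto
    finally show ?thesis .
  qed
  then have "\<exists>D. 1 \<le> D \<and> (\<forall>x. \<forall>k\<ge>1. V x (2 * k) \<le> D * V x k)" by (intro exI[of _ "max 1 C"]) auto
  from someI_ex[OF this, folded Dc_def] show "1 \<le> Dc" "1 \<le> k \<Longrightarrow> V x (2 * k) \<le> Dc * V x k" by auto
qed

lemma V_pow2: "1 \<le> k \<Longrightarrow> V x (2 ^ i * k) \<le> Dc ^ i * V x k"
proof (induction i)
  case (Suc i)
  have "V x (2 ^ Suc i * k) \<le> Dc * V x (2 ^ i * k)" using Dc(2)[of "2 ^ i * k" x] Suc.prems by (simp add: mult.assoc)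
  also have "\<dots> \<le> Dc * (Dc ^ i * V x k)" using Suc Dc(1) by (intro mult_left_mono) auto
  finally show ?case by (simp add: mult_ac)
qed simp

lemma V_mult: assumes "1 \<le> k" shows "V x (c * k) \<le> Dc ^ c * V x k"
proof -
  have "c * k \<le> 2 ^ c * k" by (intro mult_le_mono1 less_imp_le less_exp)
  then have "V x (c * k) \<le> V x (2 ^ c * k)" by (rule V_mono)
  also have "\<dots> \<le> Dc ^ c * V x k" using assms by (rule V_pow2)
  finally show ?thesis .
qed

text \<open>A vertex \<open>y\<close> outside a large ball around \<open>x\<close> is the
  centre of a ball that is disjoint from \<open>Bl x k\<close> and, by doubling, has comparable volume; so the volume of some
  larger ball around \<open>x\<close> exceeds that of \<open>Bl x k\<close> by a fixed factor.\<close>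

lemma V_step:
  assumes k: "1 \<le> k"
  shows "\<exists>l\<ge>1. (1 + 1 / Dc ^ (5 * \<kappa>\<^sup>2)) * V x k \<le> V x l"
proof -
  obtain y where y: "y \<notin> Bl x (2 * \<kappa> * k)" using infinite_UNIV finite_Bl ex_new_if_finite by blast
  define s where "s = nat \<lfloor>\<rho> x y / (2 * real \<kappa>)\<rfloor>"
  have kp: "0 < 2 * real \<kappa>" using kappa(2) by simp
  have s1: "2 * real \<kappa> * real s \<le> \<rho> x y"
  proof -
    have "real s \<le> \<rho> x y / (2 * real \<kappa>)" using kp by (simp add: s_def)
    then show ?thesis using kp by (simp add: field_simps)
  qed
  have s2: "\<rho> x y < 2 * real \<kappa> * (real s + 1)"
  proof -
    have "\<rho> x y / (2 * real \<kappa>) < real s + 1" using kp by (simp add: s_def)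
    then show ?thesis using kp by (simp add: field_simps)
  qed
  have "2 * real \<kappa> * real k \<le> \<rho> x y" using y by (simp add: Bl_def)
  then have "2 * real \<kappa> * real k < 2 * real \<kappa> * (real s + 1)" using s2 by linarith
  then have sk: "k \<le> s" using kp by simp
  have disj: "Bl x k \<inter> Bl y s = {}"
  proof (rule ccontr)
    assume "Bl x k \<inter> Bl y s \<noteq> {}"
    then obtain z where z: "z \<in> Bl x k" "z \<in> Bl y s" by blast
    then have "y \<in> Bl x (\<kappa> * (k + s))" using Bl_trans Bl_sym by blast
    moreover have "\<kappa> * (k + s) \<le> 2 * \<kappa> * s" using sk by (simp add: algebra_simps)
    ultimately have "y \<in> Bl x (2 * \<kappa> * s)" using Bl_mono by blast
    then show False using s1 by (simp add: Bl_def)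
  qed
  have "V x k \<le> Dc ^ (5 * \<kappa>\<^sup>2) * V y s"
  proof -
    have "Bl x k \<subseteq> Bl y (5 * \<kappa>\<^sup>2 * s)"
    proof
      fix z assume "z \<in> Bl x k"
      moreover have "x \<in> Bl y (2 * \<kappa> * (s + 1))" using s2 by (simp add: Bl_def rho_sym algebra_simps)
      ultimately have "z \<in> Bl y (\<kappa> * (2 * \<kappa> * (s + 1) + k))" using Bl_trans by blast
      moreover have "\<kappa> * (2 * \<kappa> * (s + 1) + k) \<le> \<kappa> * (2 * \<kappa> * (s + s) + \<kappa> * s)"
      proof -
        have "k \<le> \<kappa> * s" using sk kappa(2) by (metis le_trans mult_le_mono1 nat_mult_1)
        moreover have "2 * \<kappa> * (s + 1) \<le> 2 * \<kappa> * (s + s)" using sk k by (intro mult_le_mono2) simp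
        ultimately show ?thesis by (metis add_le_mono mult_le_mono2)
      qed
      moreover have "\<kappa> * (2 * \<kappa> * (s + s) + \<kappa> * s) = 5 * \<kappa>\<^sup>2 * s" by (simp add: power2_eq_square algebra_simps)
      ultimately show "z \<in> Bl y (5 * \<kappa>\<^sup>2 * s)" using Bl_mono[of "\<kappa> * (2 * \<kappa> * (s + 1) + k)" "5 * \<kappa>\<^sup>2 * s" y] by auto
    qed
    then have "V x k \<le> V y (5 * \<kappa>\<^sup>2 * s)" unfolding V_def by (intro sum_mono2) auto
    also have "\<dots> \<le> Dc ^ (5 * \<kappa>\<^sup>2) * V y s" using sk k by (intro V_mult) simp
    finally show ?thesis .
  qed
  then have "V x k / Dc ^ (5 * \<kappa>\<^sup>2) \<le> V y s" using Dc(1) by (simp add: divide_le_eq mult.commute)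
  then have "(1 + 1 / Dc ^ (5 * \<kappa>\<^sup>2)) * V x k \<le> V x k + V y s" by (simp add: algebra_simps)
  also have "\<dots> = sum w (Bl x k \<union> Bl y s)" unfolding V_def using disj by (simp add: sum.union_disjoint)
  also obtain l where l: "l \<ge> 1" "Bl x k \<union> Bl y s \<subseteq> Bl x l" using in_some_Bl[of "Bl x k \<union> Bl y s" 1 x] by auto
  have "sum w (Bl x k \<union> Bl y s) \<le> V x l" unfolding V_def using l by (intro sum_mono2) auto
  finally show ?thesis using l by blast
qed

lemma V_unbounded: "\<exists>k\<ge>1. M < V x k"
proof -
  define c where "c = 1 + 1 / Dc ^ (5 * \<kappa>\<^sup>2)"
  have c: "1 < c" using Dc(1) by (simp add: c_def)
  have step: "\<exists>k\<ge>1. c ^ n * w x \<le> V x k" for n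
  proof (induction n)
    case 0 show ?case using V_1[of x] by (intro exI[of _ 1]) simp
  next
    case (Suc n)
    then obtain k where k: "k \<ge> 1" "c ^ n * w x \<le> V x k" by blast
    then have "c ^ Suc n * w x \<le> c * V x k" using c by (simp add: mult.assoc)
    with V_step[OF k(1), of x, folded c_def] show ?case by (meson order_trans)
  qed
  obtain n where "M / w x < c ^ n" using real_arch_pow[OF c] by blast
  then have "M < c ^ n * w x" using w_pos[of x] by (simp add: field_simps)
  with step[of n] show ?thesis by (meson less_le_trans)
qed

lemma V_tendsto: "filterlim (V x) at_top sequentially"
  unfolding filterlim_at_top_dense eventually_sequentially
  using V_unbounded V_mono by (meson less_le_trans)

text \<open>The radius \<open>k\<close> belongs to the time \<open>k - 1\<close>, whence the successors. Natural exponents are enough, since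
  \<open>N\<close> is chosen according to need.\<close>

lemma UE_bound: "\<exists>C\<ge>0. \<forall>x y j. kern_iter mu j x y \<le> C / V x (Suc j) / (1 + \<rho> x y / real (Suc j)) ^ N"
proof -
  obtain C where C: "\<And>x y k. k \<ge> 1 \<Longrightarrow> kern_iter mu (k - 1) x y
      \<le> C / ball_vol mu \<beta> x (real k) * (1 + \<rho> x y / real k) powr (- real N)"
    using upper unfolding UE_def by blast
  have "kern_iter mu j x y \<le> max 0 C / V x (Suc j) / (1 + \<rho> x y / real (Suc j)) ^ N" for x y j
  proof -
    have p: "0 < 1 + \<rho> x y / real (Suc j)" by (intro add_pos_nonneg) auto
    have "kern_iter mu j x y \<le> C / V x (Suc j) * (1 + \<rho> x y / real (Suc j)) powr (- real N)"
      using C[of "Suc j" x y] by (simp add: V_ball_vol[of x "Suc j", simplified])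
    also have "\<dots> = C / V x (Suc j) / (1 + \<rho> x y / real (Suc j)) ^ N"
      using p by (simp add: powr_minus powr_realpow field_simps)
    also have "\<dots> \<le> max 0 C / V x (Suc j) / (1 + \<rho> x y / real (Suc j)) ^ N"
      using p by (intro divide_right_mono) auto
    finally show ?thesis .
  qed
  then show ?thesis by (intro exI[of _ "max 0 C"]) auto
qed

lemma kernel_decay: "(\<lambda>k. (P ^^ k) (delta y) x) \<longlonglongrightarrow> 0"
proof -
  obtain C where C: "\<And>x y j. kern_iter mu j x y \<le> C / V x (Suc j) / (1 + \<rho> x y / real (Suc j)) ^ 0"
    using UE_bound[of 0] by blast
  have lim: "(\<lambda>j. C / V x (Suc j) * w y) \<longlonglongrightarrow> 0"
    by (rule tendsto_eq_rhs[where x="0 * w y"], intro tendsto_intros tendsto_divide_0[OF tendsto_const] filterlim_at_top_imp_at_infinity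
        filterlim_compose[OF V_tendsto filterlim_Suc]) simp
  show ?thesis
  proof (rule tendsto_sandwich[OF _ _ tendsto_const lim])
    show "\<forall>\<^sub>F j in sequentially. 0 \<le> (P ^^ j) (delta y) x"
      by (auto simp: delta_def intro!: always_eventually funpow_walk_nonneg)
    show "\<forall>\<^sub>F j in sequentially. (P ^^ j) (delta y) x \<le> C / V x (Suc j) * w y"
    proof (rule always_eventually, rule allI)
      fix j
      have "kern_iter mu j x y * w y \<le> C / V x (Suc j) * w y"
        using C[of j x y] by (intro mult_right_mono) auto
      then show "(P ^^ j) (delta y) x \<le> C / V x (Suc j) * w y" by (simp only: kern_iter_eq)
    qed
  qed
qed

end

sublocale riesz_graph \<subseteq> decaying_walk mu
  by unfold_locales (rule kernel_decay)

context riesz_graph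
begin

text \<open>A rate of decay that beats the doubling of the volume.\<close>

definition N0 :: nat where "N0 = (SOME N. 2 * Dc \<le> 2 ^ N)"

lemma N0: "2 * Dc \<le> 2 ^ N0"
  unfolding N0_def by (rule someI_ex) (metis less_imp_le real_arch_pow one_less_numeral_iff semiring_norm(76))

text \<open>On the annulus of radius \<open>2\<^sup>i L\<close> the denominator is at least of order \<open>2 ^ (i * N0)\<close>, while the volume
  grows at most like \<open>Dc ^ i\<close>; by the choice of \<open>N0\<close> the sum over \<open>i\<close> is geometric with ratio at most \<open>1/2\<close>.\<close>

lemma dyadic_sum:
  assumes g: "\<And>z. 0 \<le> g z" and L: "1 \<le> L" and S: "finite S"
    and avg: "\<And>i. (\<Sum>z\<in>Bl y (2 ^ i * L). w z * g z) \<le> lam * V y (2 ^ i * L)" and lam: "0 \<le> lam"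
  shows "(\<Sum>z\<in>S. w z * g z / (1 + \<rho> y z / real L) ^ N0) \<le> 2 ^ (N0 + 1) * lam * V y L"
proof -
  obtain l where l: "S \<subseteq> Bl y l" using in_some_Bl[OF S] by blast
  define I where "I = l"
  have lI: "l \<le> 2 ^ I * L" using L less_exp[of l] unfolding I_def by (metis le_trans less_imp_le mult_le_mono2 mult.right_neutral)
  have pt: "w z * g z / (1 + \<rho> y z / real L) ^ N0 \<le> (\<Sum>i\<le>I. 2 ^ N0 * (1 / 2 ^ N0) ^ i * (if z \<in> Bl y (2 ^ i * L) then w z * g z else 0))"
    if z: "z \<in> S" for z
  proof -
    define i where "i = (LEAST i. z \<in> Bl y (2 ^ i * L))"
    have zI: "z \<in> Bl y (2 ^ I * L)" using z l lI Bl_mono by blast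
    have zi: "z \<in> Bl y (2 ^ i * L)" and iI: "i \<le> I"
      unfolding i_def using zI by (auto intro: LeastI Least_le)
    have p: "0 \<le> \<rho> y z / real L" by simp
    have "2 ^ i \<le> 2 * (1 + \<rho> y z / real L)"
    proof (cases i)
      case 0 then show ?thesis using p by simp
    next
      case (Suc i')
      have "z \<notin> Bl y (2 ^ i' * L)" using not_less_Least[of i' "\<lambda>i. z \<in> Bl y (2 ^ i * L)"] Suc i_def by simp
      then have "2 ^ i' * real L \<le> \<rho> y z" by (simp add: Bl_def)
      then have "2 ^ i' \<le> \<rho> y z / real L" using L by (simp add: field_simps)
      then show ?thesis using Suc by simp
    qed
    then have "(2 ^ i) ^ N0 \<le> (2 * (1 + \<rho> y z / real L)) ^ N0" by (intro power_mono) auto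
    moreover have "(2 ^ i) ^ N0 = ((2 :: real) ^ N0) ^ i" by (metis power_mult mult.commute)
    ultimately have "((2 :: real) ^ N0) ^ i \<le> 2 ^ N0 * (1 + \<rho> y z / real L) ^ N0"
      by (simp only: power_mult_distrib)
    moreover have "1 / a \<le> c * (1 / b)" if "b \<le> c * a" "0 < a" "0 < b" for a b c :: real
      using that by (simp add: field_simps)
    ultimately have "1 / (1 + \<rho> y z / real L) ^ N0 \<le> 2 ^ N0 * (1 / ((2 :: real) ^ N0) ^ i)"
      using p by (meson add_pos_nonneg zero_less_one zero_less_power zero_less_numeral)
    then have "1 / (1 + \<rho> y z / real L) ^ N0 \<le> 2 ^ N0 * (1 / 2 ^ N0) ^ i"
      by (simp only: power_one_over)
    then have "(w z * g z) * (1 / (1 + \<rho> y z / real L) ^ N0) \<le> (w z * g z) * (2 ^ N0 * (1 / 2 ^ N0) ^ i)"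
      using g by (intro mult_left_mono) auto
    also have "\<dots> = 2 ^ N0 * (1 / 2 ^ N0) ^ i * (if z \<in> Bl y (2 ^ i * L) then w z * g z else 0)"
      using zi by simp
    also have "\<dots> \<le> (\<Sum>i\<le>I. 2 ^ N0 * (1 / 2 ^ N0) ^ i * (if z \<in> Bl y (2 ^ i * L) then w z * g z else 0))"
      using g iI by (intro member_le_sum) auto
    finally show ?thesis by simp
  qed
  have "(\<Sum>z\<in>S. w z * g z / (1 + \<rho> y z / real L) ^ N0)
      \<le> (\<Sum>z\<in>S. \<Sum>i\<le>I. 2 ^ N0 * (1 / 2 ^ N0) ^ i * (if z \<in> Bl y (2 ^ i * L) then w z * g z else 0))"
    by (intro sum_mono pt)
  also have "\<dots> = (\<Sum>i\<le>I. 2 ^ N0 * (1 / 2 ^ N0) ^ i * (\<Sum>z\<in>S. if z \<in> Bl y (2 ^ i * L) then w z * g z else 0))"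
    by (subst sum.swap) (simp add: sum_distrib_left)
  also have "\<dots> \<le> (\<Sum>i\<le>I. 2 ^ N0 * (1 / 2 ^ N0) ^ i * (lam * (Dc ^ i * V y L)))"
  proof (intro sum_mono mult_left_mono)
    fix i
    have "(\<Sum>z\<in>S. if z \<in> Bl y (2 ^ i * L) then w z * g z else 0) = (\<Sum>z\<in>S \<inter> Bl y (2 ^ i * L). w z * g z)"
      using S by (simp add: sum.inter_restrict)
    also have "\<dots> \<le> (\<Sum>z\<in>Bl y (2 ^ i * L). w z * g z)" using g by (intro sum_mono2) auto
    also have "\<dots> \<le> lam * V y (2 ^ i * L)" by (rule avg)
    also have "\<dots> \<le> lam * (Dc ^ i * V y L)" using lam L by (intro mult_left_mono V_pow2)
    finally show "(\<Sum>z\<in>S. if z \<in> Bl y (2 ^ i * L) then w z * g z else 0) \<le> lam * (Dc ^ i * V y L)" .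
  qed auto
  also have "\<dots> = 2 ^ N0 * lam * V y L * (\<Sum>i\<le>I. (Dc / 2 ^ N0) ^ i)"
    by (simp add: sum_distrib_left power_divide mult_ac)
  also have "\<dots> \<le> 2 ^ N0 * lam * V y L * 2"
  proof (intro mult_left_mono)
    have "(\<Sum>i\<le>I. (Dc / 2 ^ N0) ^ i) \<le> (\<Sum>i\<le>I. (1 / 2) ^ i)"
    proof (intro sum_mono power_mono)
      show "Dc / 2 ^ N0 \<le> 1 / 2" using N0 by (simp add: field_simps)
    qed (use Dc(1) in auto)
    also have "\<dots> \<le> (\<Sum>i. (1 / 2 :: real) ^ i)" by (intro sum_le_suminf summable_geometric) auto
    also have "\<dots> = 2" by (simp add: suminf_geometric)
    finally show "(\<Sum>i\<le>I. (Dc / 2 ^ N0) ^ i) \<le> 2" .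
  qed (use lam in auto)
  finally show ?thesis by (simp add: mult_ac)
qed

lemma tail_sum:
  assumes "1 \<le> L" "finite S"
  shows "(\<Sum>z\<in>S. w z / (1 + \<rho> y z / real L) ^ N0) \<le> 2 ^ (N0 + 1) * V y L"
  using dyadic_sum[of "\<lambda>_. 1" L S y 1] assms by (simp add: V_def)

section \<open>Maximal functions and coverings\<close>

text \<open>The inequality \<open>M g z \<le> lam\<close> for the uncentred maximal function, stated without the supremum,
  which may be infinite.\<close>

definition avg_le :: "('a \<Rightarrow> real) \<Rightarrow> real \<Rightarrow> 'a \<Rightarrow> bool" where
  "avg_le g lam z \<longleftrightarrow> (\<forall>c. \<forall>s\<ge>1. z \<in> Bl c s \<longrightarrow> (\<Sum>u\<in>Bl c s. w u * g u) \<le> lam * V c s)"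

text \<open>Greedy choice: take a ball of largest radius, discard the balls that meet it, and recurse. Two uses of
  the quasi-triangle inequality turn intersecting balls into inclusion in the enlarged ball.\<close>

lemma vitali_cover:
  assumes "finite I" "\<And>i. i \<in> I \<Longrightarrow> 1 \<le> r i"
  shows "\<exists>J\<subseteq>I. (\<forall>i\<in>J. \<forall>j\<in>J. i \<noteq> j \<longrightarrow> Bl (c i) (r i) \<inter> Bl (c j) (r j) = {}) \<and>
    (\<forall>i\<in>I. \<exists>j\<in>J. Bl (c i) (r i) \<subseteq> Bl (c j) (3 * \<kappa>\<^sup>2 * r j))"
  using assms
proof (induction I rule: finite_psubset_induct)
  case (psubset I)
  show ?case
  proof (cases "I = {}")
    case False
    then obtain i where i: "i \<in> I" "\<And>j. j \<in> I \<Longrightarrow> r j \<le> r i"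
    proof -
      have "Max (r ` I) \<in> r ` I" using psubset(1) False by (intro Max_in) auto
      moreover have "r j \<le> Max (r ` I)" if "j \<in> I" for j using psubset(1) that by (intro Max_ge) auto
      ultimately show ?thesis using that by force
    qed
    define I' where "I' = {j \<in> I. Bl (c j) (r j) \<inter> Bl (c i) (r i) = {}}"
    have "i \<notin> I'" using psubset.prems[OF i(1)] Bl_self by (auto simp: I'_def)
    then have "I' \<subset> I" using i(1) by (auto simp: I'_def)
    then obtain J where J: "J \<subseteq> I'" "\<forall>i\<in>J. \<forall>j\<in>J. i \<noteq> j \<longrightarrow> Bl (c i) (r i) \<inter> Bl (c j) (r j) = {}"
      "\<forall>i\<in>I'. \<exists>j\<in>J. Bl (c i) (r i) \<subseteq> Bl (c j) (3 * \<kappa>\<^sup>2 * r j)"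
      using psubset.IH[of I'] psubset.prems by blast
    have near: "Bl (c j) (r j) \<subseteq> Bl (c i) (3 * \<kappa>\<^sup>2 * r i)" if j: "j \<in> I" "j \<notin> I'" for j
    proof
      fix u assume u: "u \<in> Bl (c j) (r j)"
      obtain v where v: "v \<in> Bl (c j) (r j)" "v \<in> Bl (c i) (r i)" using j by (auto simp: I'_def)
      have "u \<in> Bl v (\<kappa> * (r j + r j))" using Bl_trans Bl_sym u v(1) by blast
      with v(2) have "u \<in> Bl (c i) (\<kappa> * (r i + \<kappa> * (r j + r j)))" using Bl_trans by blast
      moreover have "\<kappa> * (r i + \<kappa> * (r j + r j)) \<le> \<kappa> * (\<kappa> * r i + \<kappa> * (r i + r i))"
        using i(2)[OF j(1)] kappa(2) by (intro mult_le_mono2 add_le_mono[of "r i"] add_le_mono) auto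
      moreover have "\<kappa> * (\<kappa> * r i + \<kappa> * (r i + r i)) = 3 * \<kappa>\<^sup>2 * r i"
        by (simp add: power2_eq_square algebra_simps)
      ultimately show "u \<in> Bl (c i) (3 * \<kappa>\<^sup>2 * r i)"
        using Bl_mono[of "\<kappa> * (r i + \<kappa> * (r j + r j))" "3 * \<kappa>\<^sup>2 * r i" "c i"] by auto
    qed
    show ?thesis
    proof (intro exI[of _ "insert i J"] conjI)
      show "insert i J \<subseteq> I" using J(1) i(1) by (auto simp: I'_def)
      show "\<forall>a\<in>insert i J. \<forall>b\<in>insert i J. a \<noteq> b \<longrightarrow> Bl (c a) (r a) \<inter> Bl (c b) (r b) = {}"
        using J(1,2) by (auto simp: I'_def)
      show "\<forall>a\<in>I. \<exists>j\<in>insert i J. Bl (c a) (r a) \<subseteq> Bl (c j) (3 * \<kappa>\<^sup>2 * r j)"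
        using J(3) near by blast
    qed
  qed auto
qed

lemma sum_UN_le:
  fixes f :: "'b \<Rightarrow> real"
  assumes "finite J" "\<And>j. j \<in> J \<Longrightarrow> finite (A j)" "\<And>x. 0 \<le> f x"
  shows "sum f (\<Union>j\<in>J. A j) \<le> (\<Sum>j\<in>J. sum f (A j))"
  using assms(1,2)
proof (induction J rule: finite_induct)
  case (insert j J)
  have "sum f (A j \<union> (\<Union>j\<in>J. A j)) \<le> sum f (A j) + sum f (\<Union>j\<in>J. A j)"
    using insert sum.union_inter[of "A j" "\<Union>j\<in>J. A j" f] sum_nonneg[of "A j \<inter> (\<Union>j\<in>J. A j)" f] assms(3) by force
  then show ?case using insert by simp
qed simp

lemma weak_type:
  assumes g: "\<And>z. 0 \<le> g z" and T: "\<And>S. finite S \<Longrightarrow> (\<Sum>z\<in>S. w z * g z) \<le> T" and lam: "0 < lam"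
    and G: "finite G" "\<And>x. x \<in> G \<Longrightarrow> \<not> avg_le g lam x"
  shows "(\<Sum>x\<in>G. w x) \<le> Dc ^ (3 * \<kappa>\<^sup>2) * T / lam"
proof -
  have "\<forall>x\<in>G. \<exists>c s. 1 \<le> s \<and> x \<in> Bl c s \<and> lam * V c s < (\<Sum>u\<in>Bl c s. w u * g u)"
    using G(2) unfolding avg_le_def by (meson not_less)
  then obtain c s where cs: "\<And>x. x \<in> G \<Longrightarrow> 1 \<le> s x" "\<And>x. x \<in> G \<Longrightarrow> x \<in> Bl (c x) (s x)"
    "\<And>x. x \<in> G \<Longrightarrow> lam * V (c x) (s x) < (\<Sum>u\<in>Bl (c x) (s x). w u * g u)" by metis
  obtain J where J: "J \<subseteq> G" "\<forall>i\<in>J. \<forall>j\<in>J. i \<noteq> j \<longrightarrow> Bl (c i) (s i) \<inter> Bl (c j) (s j) = {}"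
    "\<forall>i\<in>G. \<exists>j\<in>J. Bl (c i) (s i) \<subseteq> Bl (c j) (3 * \<kappa>\<^sup>2 * s j)"
    using vitali_cover[OF G(1), of s c] cs(1) by blast
  have fJ: "finite J" using J(1) G(1) finite_subset by blast
  have "G \<subseteq> (\<Union>j\<in>J. Bl (c j) (3 * \<kappa>\<^sup>2 * s j))" using J(3) cs(2) by blast
  then have "(\<Sum>x\<in>G. w x) \<le> (\<Sum>x\<in>(\<Union>j\<in>J. Bl (c j) (3 * \<kappa>\<^sup>2 * s j)). w x)" using fJ by (intro sum_mono2) auto
  also have "\<dots> \<le> (\<Sum>j\<in>J. V (c j) (3 * \<kappa>\<^sup>2 * s j))"
    unfolding V_def using fJ by (intro sum_UN_le) auto
  also have "\<dots> \<le> (\<Sum>j\<in>J. Dc ^ (3 * \<kappa>\<^sup>2) * ((\<Sum>u\<in>Bl (c j) (s j). w u * g u) / lam))"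
  proof (intro sum_mono)
    fix j assume j: "j \<in> J"
    then have jG: "j \<in> G" using J(1) by blast
    have "V (c j) (3 * \<kappa>\<^sup>2 * s j) \<le> Dc ^ (3 * \<kappa>\<^sup>2) * V (c j) (s j)" by (rule V_mult[OF cs(1)[OF jG]])
    also have "V (c j) (s j) \<le> (\<Sum>u\<in>Bl (c j) (s j). w u * g u) / lam"
      using cs(3)[OF jG] lam by (simp add: field_simps)
    finally show "V (c j) (3 * \<kappa>\<^sup>2 * s j) \<le> Dc ^ (3 * \<kappa>\<^sup>2) * ((\<Sum>u\<in>Bl (c j) (s j). w u * g u) / lam)"
      using Dc(1) by (simp add: mult_left_mono)
  qed
  also have "\<dots> = Dc ^ (3 * \<kappa>\<^sup>2) * ((\<Sum>j\<in>J. \<Sum>u\<in>Bl (c j) (s j). w u * g u) / lam)"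
    by (simp add: sum_distrib_left sum_divide_distrib)
  also have "(\<Sum>j\<in>J. \<Sum>u\<in>Bl (c j) (s j). w u * g u) = (\<Sum>u\<in>(\<Union>j\<in>J. Bl (c j) (s j)). w u * g u)"
    using fJ J(2) by (intro sum.UNION_disjoint[symmetric]) auto
  also have "Dc ^ (3 * \<kappa>\<^sup>2) * (\<dots> / lam) \<le> Dc ^ (3 * \<kappa>\<^sup>2) * (T / lam)"
    using fJ lam Dc(1) by (intro mult_left_mono divide_right_mono T) auto
  finally show ?thesis by simp
qed

end

section \<open>The coefficients of the regularised Riesz transform\<close>

text \<open>The coefficient of \<open>P\<^sup>l\<close> in \<open>K\<^sub>n\<close>.\<close>

definition cfc :: "nat \<Rightarrow> nat \<Rightarrow> real" where "cfc n l = cf l * max 0 (1 - real l / (real n + 1))"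

lemma cfc_nonneg [simp]: "0 \<le> cfc n l" by (simp add: cfc_def)

lemma cfc_le: "cfc n l \<le> 1 / sqrt (real l + 1)"
proof -
  have "cfc n l \<le> cf l * 1" unfolding cfc_def by (intro mult_left_mono) auto
  then show ?thesis using cf_le[of l] by simp
qed

lemma cfc_zero: "n < l \<Longrightarrow> cfc n l = 0"
  by (simp add: cfc_def max_def field_simps)

lemma cfc_step: "0 \<le> cfc n i - cfc n (Suc i)" "cfc n i - cfc n (Suc i) \<le> 2 / ((real i + 1) * sqrt (real i + 1))"
proof -
  define r where "r = real i + 1"
  have r: "r \<ge> 1" by (simp add: r_def)
  have "0 \<le> cfc n i - cfc n (Suc i) \<and> cfc n i - cfc n (Suc i) \<le> 2 / (r * sqrt r)"
  proof (cases "i \<le> n")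
    case True
    define t where "t = 1 - r / (real n + 1)"
    have t: "0 \<le> t" "t \<le> 1" "1 / (real n + 1) \<le> 1 / r" using True r by (auto simp: t_def r_def field_simps)
    have e1: "cfc n i = cf i * (t + 1 / (real n + 1))" "cfc n (Suc i) = cf (Suc i) * t"
      using True by (auto simp: cfc_def t_def r_def max_def field_simps)
    have c: "cf i - cf (Suc i) = cf i / (2 * r)"
      by (simp add: r_def field_simps)
    have eq: "cfc n i - cfc n (Suc i) = cf i / (2 * r) * t + cf i * (1 / (real n + 1))"
      unfolding e1 c[symmetric] by (simp add: algebra_simps)
    have "cf i / (2 * r) * t + cf i * (1 / (real n + 1)) \<le> cf i / (2 * r) * 1 + cf i * (1 / r)"
      using t r by (intro add_mono mult_left_mono) auto
    also have "\<dots> \<le> 2 * (cf i / r)" using r by (simp add: field_simps)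
    also have "\<dots> \<le> 2 * ((1 / sqrt r) / r)" using cf_le[of i] r by (intro mult_left_mono divide_right_mono) (auto simp: r_def)
    also have "\<dots> = 2 / (r * sqrt r)" by (simp add: mult.commute)
    finally show ?thesis using eq t r by (auto intro!: add_nonneg_nonneg mult_nonneg_nonneg)
  next
    case False
    then show ?thesis using r by (simp add: cfc_zero)
  qed
  then show "0 \<le> cfc n i - cfc n (Suc i)" "cfc n i - cfc n (Suc i) \<le> 2 / ((real i + 1) * sqrt (real i + 1))"
    by (auto simp: r_def)
qed

lemma cfc_diff:
  assumes "2 * j \<le> l"
  shows "0 \<le> cfc n (l - j) - cfc n l" "cfc n (l - j) - cfc n l \<le> 6 * real j / ((real l + 1) * sqrt (real l + 1))"
proof -
  define r where "r = (real l + 1) / 2"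
  have r: "r > 0" by (simp add: r_def)
  have "cfc n (l - j) - cfc n l = (\<Sum>i\<in>{l - j..<l}. cfc n i - cfc n (Suc i))"
    using sum_Suc_diff'[of "l - j" l "\<lambda>i. - cfc n i"] by simp
  moreover have "(\<Sum>i\<in>{l - j..<l}. cfc n i - cfc n (Suc i)) \<le> (\<Sum>i\<in>{l - j..<l}. 2 / (r * sqrt r))"
  proof (rule sum_mono)
    fix i assume "i \<in> {l - j..<l}"
    then have ri: "r \<le> real i + 1" using assms by (auto simp: r_def)
    have "cfc n i - cfc n (Suc i) \<le> 2 / ((real i + 1) * sqrt (real i + 1))" by (rule cfc_step)
    also have "\<dots> \<le> 2 / (r * sqrt r)" using ri r by (intro divide_left_mono mult_mono mult_pos_pos) auto
    finally show "cfc n i - cfc n (Suc i) \<le> 2 / (r * sqrt r)" .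
  qed
  moreover have "(\<Sum>i\<in>{l - j..<l}. 2 / (r * sqrt r)) = real j * (2 / (r * sqrt r))" using assms by simp
  moreover have "real j * (2 / (r * sqrt r)) \<le> 6 * real j / ((real l + 1) * sqrt (real l + 1))"
  proof -
    have s2: "sqrt 2 \<le> (3 / 2 :: real)" by (intro real_le_lsqrt) (auto simp: power2_eq_square)
    have "2 / (r * sqrt r) = 4 * sqrt 2 / ((real l + 1) * sqrt (real l + 1))"
      by (simp add: r_def real_sqrt_divide field_simps)
    also have "\<dots> \<le> 6 / ((real l + 1) * sqrt (real l + 1))" using s2 by (intro divide_right_mono) auto
    finally show ?thesis by (metis mult.commute mult_left_mono of_nat_0_le_iff times_divide_eq_left)
  qed
  moreover have "0 \<le> (\<Sum>i\<in>{l - j..<l}. cfc n i - cfc n (Suc i))" by (intro sum_nonneg cfc_step)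
  ultimately show "0 \<le> cfc n (l - j) - cfc n l" "cfc n (l - j) - cfc n l \<le> 6 * real j / ((real l + 1) * sqrt (real l + 1))"
    by linarith+
qed

text \<open>Coefficient of \<open>P\<^sup>l\<close> in the regularised Riesz transform composed with \<open>I - A\<^sub>k\<close>, where \<open>A\<^sub>k\<close>
  averages \<open>P\<^sup>j\<close> over \<open>k \<le> j < 2k\<close>. Averaging over \<open>j\<close> removes the singularity at \<open>l = k\<close> that
  \<open>I - P\<^sup>k\<close> would have.\<close>

definition ecf :: "nat \<Rightarrow> nat \<Rightarrow> nat \<Rightarrow> real" where
  "ecf n k l = cfc n l - (\<Sum>j\<in>{k..<2 * k}. if j \<le> l then cfc n (l - j) else 0) / real k"

text \<open>For \<open>l\<close> comparable to \<open>k\<close> there is no cancellation, but the average over \<open>j\<close> of the singular terms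
  \<open>(l - j)\<^sup>-\<^sup>1\<^sup>/\<^sup>2\<close> is at most of order \<open>l\<^sup>-\<^sup>1\<^sup>/\<^sup>2\<close>.\<close>

lemma ecf_small: assumes "1 \<le> k" "l < 4 * k" shows "\<bar>ecf n k l\<bar> \<le> 9 / sqrt (real l + 1)"
proof -
  let ?A = "\<Sum>j\<in>{k..<2 * k}. if j \<le> l then cfc n (l - j) else 0"
  have "?A = (\<Sum>j\<in>{j\<in>{k..<2 * k}. j \<le> l}. cfc n (l - j))" by (rule sum.inter_filter[symmetric]) simp
  also have "\<dots> = (\<Sum>i\<in>(\<lambda>j. l - j) ` {j\<in>{k..<2 * k}. j \<le> l}. cfc n i)"
    by (subst sum.reindex) (auto simp: inj_on_def)
  also have "\<dots> \<le> (\<Sum>i\<le>l. cfc n i)" by (intro sum_mono2) auto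
  also have "\<dots> \<le> (\<Sum>i\<le>l. 1 / sqrt (real i + 1))" by (intro sum_mono cfc_le)
  also have "\<dots> \<le> 2 * sqrt (real l + 1)" by (rule sum_inv_sqrt_le)
  finally have A: "?A \<le> 2 * sqrt (real l + 1)" .
  have A0: "0 \<le> ?A" by (intro sum_nonneg) auto
  have "?A / real k \<le> (2 * sqrt (real l + 1)) / real k" using A by (intro divide_right_mono) auto
  also have "\<dots> \<le> (2 * sqrt (real l + 1)) / ((real l + 1) / 4)"
    using assms by (intro divide_left_mono) auto
  also have "\<dots> = 8 / sqrt (real l + 1)"
  proof -
    have "(2 * s) / (s * s / 4) = 8 / s" if "s > 0" for s :: real using that by (simp add: field_simps)
    from this[of "sqrt (real l + 1)"] show ?thesis by simp
  qed
  finally have "?A / real k \<le> 8 / sqrt (real l + 1)" .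
  moreover have "0 \<le> ?A / real k" using A0 by simp
  moreover have "9 / sqrt (real l + 1) = 8 / sqrt (real l + 1) + 1 / sqrt (real l + 1)" by (simp add: add_divide_distrib[symmetric])
  ultimately show ?thesis unfolding ecf_def abs_le_iff using cfc_le[of n l] cfc_nonneg[of n l] by linarith
qed

text \<open>For large \<open>l\<close> each term is a difference of coefficients at distance at most \<open>2k\<close>, which gains the
  factor \<open>k / l\<close>.\<close>

lemma ecf_large: assumes "1 \<le> k" "4 * k \<le> l" shows "\<bar>ecf n k l\<bar> \<le> 12 * real k / ((real l + 1) * sqrt (real l + 1))"
proof -
  let ?b = "12 * real k / ((real l + 1) * sqrt (real l + 1))"
  have "ecf n k l = (\<Sum>j\<in>{k..<2 * k}. cfc n l - cfc n (l - j)) / real k"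
    using assms by (simp add: ecf_def sum_subtractf diff_divide_distrib)
  then have "\<bar>ecf n k l\<bar> = \<bar>\<Sum>j\<in>{k..<2 * k}. cfc n l - cfc n (l - j)\<bar> / real k" by (simp add: abs_divide)
  also have "\<dots> \<le> (\<Sum>j\<in>{k..<2 * k}. ?b) / real k"
  proof (intro divide_right_mono order_trans[OF sum_abs] sum_mono)
    fix j assume j: "j \<in> {k..<2 * k}"
    have "\<bar>cfc n l - cfc n (l - j)\<bar> \<le> 6 * real j / ((real l + 1) * sqrt (real l + 1))"
      using cfc_diff[of j l n] j assms by simp
    also have "\<dots> \<le> ?b" using j by (intro divide_right_mono) auto
    finally show "\<bar>cfc n l - cfc n (l - j)\<bar> \<le> ?b" .
  qed auto
  also have "\<dots> = ?b" using assms by simp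
  finally show ?thesis .
qed

lemma ecf_block:
  assumes k: "1 \<le> k" and l: "2 ^ i \<le> l + 1" "l + 1 < 2 ^ Suc i"
  shows "\<bar>ecf n k l\<bar> \<le> 36 / sqrt (2 ^ i) * min 1 (real k / 2 ^ i)"
proof -
  have "real (2 ^ i) \<le> real (l + 1)" using l(1) by (simp only: of_nat_le_iff)
  then have r: "2 ^ i \<le> real l + 1" by simp
  have s: "sqrt (2 ^ i) \<le> sqrt (real l + 1)" using r by simp
  have sp: "0 < sqrt ((2::real) ^ i)" by simp
  show ?thesis
  proof (cases "l < 4 * k")
    case True
    then have "real l + 1 \<le> 4 * real k" by linarith
    then have "2 ^ i \<le> 4 * real k" using r by linarith
    then have m: "1 / 4 \<le> min 1 (real k / 2 ^ i)" by (simp add: field_simps)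
    have "\<bar>ecf n k l\<bar> \<le> 9 / sqrt (real l + 1)" by (rule ecf_small[OF k True])
    also have "\<dots> \<le> 9 / sqrt (2 ^ i)" using s sp by (intro divide_left_mono) auto
    also have "\<dots> = 36 / sqrt (2 ^ i) * (1 / 4)" by simp
    also have "\<dots> \<le> 36 / sqrt (2 ^ i) * min 1 (real k / 2 ^ i)" using m by (intro mult_left_mono) auto
    finally show ?thesis .
  next
    case False
    then have l4: "4 * k \<le> l" by simp
    have "real (l + 1) < real (2 ^ Suc i)" using l(2) by (simp only: of_nat_less_iff)
    then have "real l + 1 < 2 * 2 ^ i" by simp
    then have "real k \<le> 2 ^ i" using l4 by linarith
    then have m: "min 1 (real k / 2 ^ i) = real k / 2 ^ i" by simp
    have "\<bar>ecf n k l\<bar> \<le> 12 * real k / ((real l + 1) * sqrt (real l + 1))" by (rule ecf_large[OF k l4])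
    also have "\<dots> \<le> 12 * real k / (2 ^ i * sqrt (2 ^ i))"
      using r s sp by (intro divide_left_mono mult_mono mult_pos_pos) auto
    also have "\<dots> = 12 / sqrt (2 ^ i) * (real k / 2 ^ i)" by simp
    also have "\<dots> \<le> 36 / sqrt (2 ^ i) * (real k / 2 ^ i)" by (intro mult_right_mono divide_right_mono) auto
    finally show ?thesis unfolding m .
  qed
qed

text \<open>The dyadic sum of the coefficient bounds against the decay \<open>1 / (1 + k / 2\<^sup>i)\<close> telescopes.\<close>

lemma sum_blocks: "(\<Sum>i<m. min 1 (real k / 2 ^ i) / (1 + real k / 2 ^ i)) \<le> 3"
proof -
  let ?f = "\<lambda>i. 1 / (1 + real k / 2 ^ i)"
  have "min 1 (real k / 2 ^ i) / (1 + real k / 2 ^ i) \<le> 3 * (?f (Suc i) - ?f i)" for i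
  proof -
    define t where "t = real k / 2 ^ i"
    have t: "0 \<le> t" by (simp add: t_def)
    have t2: "real k / 2 ^ Suc i = t / 2" by (simp add: t_def)
    have "3 * (1 / (1 + t / 2) - 1 / (1 + t)) = (3 * (t / 2) / (1 + t / 2)) / (1 + t)"
      using t by (simp add: divide_simps)
    moreover have "min 1 t \<le> 3 * (t / 2) / (1 + t / 2)"
    proof (cases "t \<le> 1")
      case True
      have "t * (1 + t / 2) \<le> t * (3 / 2)" using t True by (intro mult_left_mono) auto
      then show ?thesis using t True by (simp add: le_divide_eq algebra_simps)
    next
      case False
      then show ?thesis using t by (simp add: le_divide_eq algebra_simps)
    qed
    ultimately have "min 1 t / (1 + t) \<le> 3 * (1 / (1 + t / 2) - 1 / (1 + t))"
      using divide_right_mono[of "min 1 t" "3 * (t / 2) / (1 + t / 2)" "1 + t"] t by linarith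
    then show ?thesis unfolding t2 t_def[symmetric] .
  qed
  then have "(\<Sum>i<m. min 1 (real k / 2 ^ i) / (1 + real k / 2 ^ i)) \<le> (\<Sum>i<m. 3 * (?f (Suc i) - ?f i))"
    by (intro sum_mono) auto
  also have "\<dots> = 3 * (?f m - ?f 0)"
    unfolding sum_distrib_left[symmetric] using sum_lessThan_telescope[of ?f m] by simp
  also have "\<dots> \<le> 3 * (1 - 0)" by (intro mult_left_mono diff_mono) (auto simp: divide_le_eq_1 add_pos_nonneg)
  finally show ?thesis by simp
qed

section \<open>Gradient of the kernel\<close>

text \<open>With \<open>\<alpha>\<close> and \<open>\<beta>\<close> the square roots of \<open>a\<close> and \<open>b\<close>, the remainder of the tangent line approximation is
  exactly \<open>(\<alpha> - \<beta>)\<^sup>2 (\<alpha> + \<beta> / 2)\<close>, to be compared with \<open>(a - b)\<^sup>2 = (\<alpha> - \<beta>)\<^sup>2 (\<alpha> + \<beta>)\<^sup>2\<close>.\<close>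

lemma convexity_three_halves:
  fixes a b M :: real
  assumes "0 \<le> a" "0 \<le> b" "a \<le> M" "b \<le> M"
  shows "(a - b)\<^sup>2 \<le> 4 * sqrt M * (sqrt a ^ 3 - sqrt b ^ 3 - 3 / 2 * sqrt b * (a - b))"
    and "0 \<le> sqrt a ^ 3 - sqrt b ^ 3 - 3 / 2 * sqrt b * (a - b)"
proof -
  define \<alpha> \<beta> s where "\<alpha> = sqrt a" and "\<beta> = sqrt b" and "s = sqrt M"
  have ab: "a = \<alpha>\<^sup>2" "b = \<beta>\<^sup>2" "0 \<le> \<alpha>" "0 \<le> \<beta>" "\<alpha> \<le> s" "\<beta> \<le> s"
    using assms by (auto simp: \<alpha>_def \<beta>_def s_def)
  have eq: "\<alpha> ^ 3 - \<beta> ^ 3 - 3 / 2 * \<beta> * (a - b) = (\<alpha> - \<beta>)\<^sup>2 * (\<alpha> + \<beta> / 2)"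
    unfolding ab(1,2) by (simp add: power2_eq_square power3_eq_cube field_simps)
  have "(\<alpha> + \<beta>) * (\<alpha> + \<beta>) \<le> (2 * s) * (2 * (\<alpha> + \<beta> / 2))" using ab by (intro mult_mono) auto
  then have "(\<alpha> - \<beta>)\<^sup>2 * ((\<alpha> + \<beta>) * (\<alpha> + \<beta>)) \<le> (\<alpha> - \<beta>)\<^sup>2 * ((2 * s) * (2 * (\<alpha> + \<beta> / 2)))"
    by (intro mult_left_mono) auto
  then have "(a - b)\<^sup>2 \<le> 4 * s * ((\<alpha> - \<beta>)\<^sup>2 * (\<alpha> + \<beta> / 2))"
    unfolding ab(1,2) by (simp add: power2_eq_square algebra_simps)
  then show "(a - b)\<^sup>2 \<le> 4 * sqrt M * (sqrt a ^ 3 - sqrt b ^ 3 - 3 / 2 * sqrt b * (a - b))"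
    unfolding \<alpha>_def[symmetric] \<beta>_def[symmetric] s_def[symmetric] eq .
  show "0 \<le> sqrt a ^ 3 - sqrt b ^ 3 - 3 / 2 * sqrt b * (a - b)"
    unfolding \<alpha>_def[symmetric] \<beta>_def[symmetric] eq using ab by (intro mult_nonneg_nonneg) auto
qed

context riesz_graph
begin

lemma loops: "\<exists>\<epsilon>>0. \<forall>x. \<epsilon> < mu x x / w x"
  using lower unfolding LB_def by (simp only: kern_w)

lemma self_nb: "x \<in> nb x"
proof -
  obtain \<epsilon> where "\<epsilon> > 0" "\<forall>x. \<epsilon> < mu x x / w x" using loops by blast
  then have "0 < mu x x / w x" by (meson less_trans)
  then show ?thesis using w_pos[of x] by (simp add: nb_iff zero_less_divide_iff)
qed

definition nbmax :: "('a \<Rightarrow> real) \<Rightarrow> 'a \<Rightarrow> real" where "nbmax u x = Max (u ` nb x)"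

lemma nbmax_ge: "y \<in> nb x \<Longrightarrow> u y \<le> nbmax u x"
  unfolding nbmax_def by (intro Max_ge) auto

lemma nbmax_le: "(\<And>y. y \<in> nb x \<Longrightarrow> u y \<le> c) \<Longrightarrow> nbmax u x \<le> c"
  unfolding nbmax_def using self_nb by (subst Max_le_iff) auto

text \<open>The pseudo-gradient: the defect in Jensen's inequality for \<open>t\<^sup>3\<^sup>/\<^sup>2\<close>.\<close>

definition jdef :: "('a \<Rightarrow> real) \<Rightarrow> 'a \<Rightarrow> real" where
  "jdef u x = P (\<lambda>y. sqrt (u y) ^ 3) x - sqrt (P u x) ^ 3"

text \<open>The average of \<open>(u y - P u x)\<^sup>2\<close> over the neighbours is bounded by the Jensen defect through
  \<open>convexity_three_halves\<close>. The gradient also contains \<open>(u x - P u x)\<^sup>2\<close>; it is one term of this average, with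
  weight at least \<open>\<epsilon>\<close>, because of the loop at \<open>x\<close>.\<close>

lemma gradient_pointwise:
  "\<exists>C\<ge>0. \<forall>u x. (\<forall>y. 0 \<le> u y) \<longrightarrow> 0 \<le> jdef u x \<and> (tnorm (df u) x)\<^sup>2 \<le> C * (sqrt (nbmax u x) * jdef u x)"
proof -
  obtain \<epsilon> where \<epsilon>: "\<epsilon> > 0" "\<And>x. \<epsilon> < mu x x / w x" using loops by blast
  have "0 \<le> jdef u x \<and> (tnorm (df u) x)\<^sup>2 \<le> (2 * (1 + 1 / \<epsilon>)) * (sqrt (nbmax u x) * jdef u x)"
    if u: "\<forall>y. 0 \<le> u y" for u x
  proof -
    define b where "b = P u x"
    let ?M = "nbmax u x"
    have b0: "0 \<le> b" unfolding b_def using u by (intro walk_nonneg) auto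
    have bM: "b \<le> ?M"
    proof -
      have "P u x \<le> P (\<lambda>_. ?M) x" by (intro walk_mono nbmax_ge)
      then show ?thesis by (simp add: b_def)
    qed
    let ?d = "\<lambda>y. sqrt (u y) ^ 3 - sqrt b ^ 3 - 3 / 2 * sqrt b * (u y - b)"
    have Pd: "P ?d x = jdef u x"
    proof -
      have "?d = (\<lambda>y. (sqrt (u y) ^ 3 - (3 / 2 * sqrt b) * u y) + (- (sqrt b ^ 3) + 3 / 2 * sqrt b * b))"
        by (simp add: right_diff_distrib add_divide_distrib diff_divide_distrib algebra_simps)
      then have "P ?d x = P (\<lambda>y. sqrt (u y) ^ 3) x - 3 / 2 * sqrt b * P u x + (- (sqrt b ^ 3) + 3 / 2 * sqrt b * b)"
        by (simp only: walk_add walk_diff walk_cmult walk_const)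
      then show ?thesis by (simp add: jdef_def b_def)
    qed
    have "0 \<le> P ?d x"
    proof -
      have "P (\<lambda>_. 0) x \<le> P ?d x"
        using u b0 bM nbmax_ge[of _ x u] by (intro walk_mono convexity_three_halves(2)[where M="?M"]) auto
      then show ?thesis by simp
    qed
    then have j0: "0 \<le> jdef u x" by (simp only: Pd)
    have "P (\<lambda>y. (u y - b)\<^sup>2) x \<le> P (\<lambda>y. 4 * sqrt ?M * ?d y) x"
      using u b0 bM nbmax_ge[of _ x u] by (intro walk_mono convexity_three_halves(1)) auto
    then have var: "P (\<lambda>y. (u y - b)\<^sup>2) x \<le> 4 * sqrt ?M * jdef u x" by (simp only: walk_cmult Pd)
    have Pexp: "P (\<lambda>y. (u y - b)\<^sup>2) x = P (\<lambda>y. (u y)\<^sup>2) x - b\<^sup>2"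
    proof -
      have "(\<lambda>y. (u y - b)\<^sup>2) = (\<lambda>y. ((u y)\<^sup>2 - (2 * b) * u y) + b\<^sup>2)"
        by (simp add: power2_eq_square algebra_simps)
      then show ?thesis by (simp add: walk_add walk_diff walk_cmult b_def power2_eq_square)
    qed
    have t: "(tnorm (df u) x)\<^sup>2 = ((u x - b)\<^sup>2 + P (\<lambda>y. (u y - b)\<^sup>2) x) / 2"
      unfolding tnorm_df_sq Pexp by (simp add: b_def power2_eq_square algebra_simps)
    have "\<epsilon> * (u x - b)\<^sup>2 \<le> mu x x / w x * (u x - b)\<^sup>2" using \<epsilon>(2)[of x] by (intro mult_right_mono) auto
    also have "\<dots> \<le> P (\<lambda>y. (u y - b)\<^sup>2) x"
      unfolding walk_eq using self_nb by (intro member_le_sum[of x "nb x" "\<lambda>y. mu x y / w x * (u y - b)\<^sup>2"]) (auto simp: mu_nonneg)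
    finally have "(u x - b)\<^sup>2 \<le> 1 / \<epsilon> * P (\<lambda>y. (u y - b)\<^sup>2) x" using \<epsilon>(1) by (simp add: field_simps)
    then have "(tnorm (df u) x)\<^sup>2 \<le> (1 + 1 / \<epsilon>) / 2 * P (\<lambda>y. (u y - b)\<^sup>2) x"
      unfolding t by (simp add: algebra_simps add_divide_distrib)
    also have "\<dots> \<le> (1 + 1 / \<epsilon>) / 2 * (4 * sqrt ?M * jdef u x)" using \<epsilon>(1) by (intro mult_left_mono var) auto
    also have "\<dots> = (2 * (1 + 1 / \<epsilon>)) * (sqrt ?M * jdef u x)" by simp
    finally show ?thesis using j0 by blast
  qed
  then show ?thesis using \<epsilon>(1) by (intro exI[of _ "2 * (1 + 1 / \<epsilon>)"]) auto
qed

lemma kern_iter_fin: "fin (\<lambda>x. kern_iter mu l x y)"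
  unfolding kern_iter_walk divide_inverse mult.commute[of _ "inverse (w y)"] by (intro fin_cmult fin_funpow fin_delta)

lemma walk_kern_iter: "P (\<lambda>x. kern_iter mu l x y) = (\<lambda>x. kern_iter mu (Suc l) x y)"
  unfolding kern_iter_walk divide_inverse mult.commute[of _ "inverse (w y)"] by (simp add: walk_cmult)

lemma kern_iter_mass: "finite S \<Longrightarrow> (\<Sum>x\<in>S. w x * kern_iter mu l x y) \<le> 1"
proof -
  assume S: "finite S"
  have "(\<Sum>x\<in>S. w x * (P ^^ l) (delta y) x) \<le> (\<Sum>x\<in>{y}. w x * delta y x)"
    using S by (intro sum_funpow_le fin_delta) (auto simp: delta_def split: if_splits)
  then have "(\<Sum>x\<in>S. w x * (P ^^ l) (delta y) x) / w y \<le> w y / w y"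
    using w_pos[of y] by (intro divide_right_mono) (auto simp: delta_def)
  then show ?thesis by (simp add: kern_iter_walk sum_divide_distrib)
qed

text \<open>By symmetry of \<open>P\<close> the total mass of \<open>P (u\<^sup>3\<^sup>/\<^sup>2)\<close> is that of \<open>u\<^sup>3\<^sup>/\<^sup>2\<close>. So the defect at time \<open>l\<close> sums to the
  difference of the masses of \<open>u\<^sup>3\<^sup>/\<^sup>2\<close> at the times \<open>l\<close> and \<open>l + 1\<close>.\<close>

lemma jdef_telescope:
  assumes S: "finite S" and uv: "a \<le> b"
  shows "(\<Sum>l\<in>{a..<b}. \<Sum>x\<in>S. w x * jdef (\<lambda>x. kern_iter mu l x y) x) \<le> ip (\<lambda>x. sqrt (kern_iter mu a x y) ^ 3) (\<lambda>_. 1)"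
proof -
  let ?u = "\<lambda>l x. kern_iter mu l x y"
  let ?F = "\<lambda>l. ip (\<lambda>x. sqrt (?u l x) ^ 3) (\<lambda>_. 1)"
  have f3: "fin (\<lambda>x. sqrt (?u l x) ^ 3)" for l
    by (rule fin_comp[OF kern_iter_fin, where h="\<lambda>t. sqrt t ^ 3"]) simp
  obtain C where jn: "\<And>u x. (\<forall>y. 0 \<le> u y) \<Longrightarrow> 0 \<le> jdef u x" using gradient_pointwise by blast
  have step: "(\<Sum>x\<in>S. w x * jdef (?u l) x) \<le> ?F l - ?F (Suc l)" for l
  proof -
    let ?g = "\<lambda>x. sqrt (?u l x) ^ 3" and ?h = "\<lambda>x. sqrt (?u (Suc l) x) ^ 3"
    define T where "T = S \<union> {x. P ?g x \<noteq> 0} \<union> {x. ?h x \<noteq> 0}"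
    have T: "finite T" unfolding T_def using S fin_supp[OF fin_walk[OF f3[of l]]] fin_supp[OF f3[of "Suc l"]] by simp
    have "(\<Sum>x\<in>S. w x * jdef (?u l) x) \<le> (\<Sum>x\<in>T. w x * jdef (?u l) x)"
      using T by (intro sum_mono2) (auto simp: T_def kern_iter_nonneg jn)
    also have "\<dots> = (\<Sum>x\<in>T. w x * P ?g x * 1) - (\<Sum>x\<in>T. w x * ?h x * 1)"
      by (simp add: jdef_def walk_kern_iter[of l y] right_diff_distrib sum_subtractf del: kern_iter.simps)
    also have "(\<Sum>x\<in>T. w x * P ?g x * 1) = ip (P ?g) (\<lambda>_. 1)"
      by (rule ip_eq[symmetric, OF T _ fin_walk[OF f3]]) (auto simp: T_def)
    also have "(\<Sum>x\<in>T. w x * ?h x * 1) = ?F (Suc l)"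
      by (rule ip_eq[symmetric, OF T _ f3]) (auto simp: T_def)
    also have "ip (P ?g) (\<lambda>_. 1) = ?F l" using f3[of l] by (simp add: ip_walk)
    finally show ?thesis .
  qed
  have "(\<Sum>l\<in>{a..<b}. \<Sum>x\<in>S. w x * jdef (?u l) x) \<le> (\<Sum>l\<in>{a..<b}. ?F l - ?F (Suc l))" by (intro sum_mono step)
  also have "\<dots> = ?F a - ?F b" using sum_Suc_diff'[OF uv, of "\<lambda>l. - ?F l"] by simp
  also have "\<dots> \<le> ?F a"
  proof -
    have "0 \<le> ?F b" unfolding ip_def by (intro sum_nonneg) (simp add: kern_iter_nonneg)
    then show ?thesis by simp
  qed
  finally show ?thesis .
qed

text \<open>Cauchy-Schwarz over times and points splits the sum of the gradients by \<open>gradient_pointwise\<close>. The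
  factor with \<open>sqrt (nbmax u)\<close> is summed with the kernel estimate and carries the decay at distance \<open>k\<close>; the
  factor with the Jensen defects telescopes. The two powers of the volume cancel.\<close>

lemma gradient_block:
  "\<exists>C\<ge>0. \<forall>y k i S. finite S \<longrightarrow> (\<forall>x\<in>S. real k \<le> \<rho> y x) \<longrightarrow>
    (\<Sum>l\<in>{2 ^ i - 1..<2 ^ Suc i - 1}. \<Sum>x\<in>S. w x * tnorm (df (\<lambda>x. kern_iter mu l x y)) x) \<le> C * sqrt (2 ^ i) / (1 + real k / 2 ^ i)"
proof -
  \<comment> \<open>The square root halves the exponent; of the remaining \<open>N0 + 2\<close> powers, \<open>N0\<close> make the sum over the
    points converge and \<open>2\<close> give the decay in \<open>th\<close>.\<close>
  define N where "N = 2 * (N0 + 2)"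
  obtain C1 where C1: "C1 \<ge> 0" "\<And>u x. (\<forall>y. 0 \<le> u y) \<Longrightarrow> 0 \<le> jdef u x"
    "\<And>u x. (\<forall>y. 0 \<le> u y) \<Longrightarrow> (tnorm (df u) x)\<^sup>2 \<le> C1 * (sqrt (nbmax u x) * jdef u x)"
    using gradient_pointwise by blast
  obtain C2 where C2: "C2 \<ge> 0" "\<And>x y j. kern_iter mu j x y \<le> C2 / V x (Suc j) / (1 + \<rho> x y / real (Suc j)) ^ N"
    using UE_bound[of N] by blast
  define C3 where "C3 = sqrt (C2 * (2 * real \<kappa>) ^ N)"
  define E where "E = 4 * C3 * 2 ^ (N0 + 1) * sqrt Dc"
  have C3: "0 \<le> C3" unfolding C3_def using C2(1) by simp
  have E: "0 \<le> E" unfolding E_def using C3 Dc(1) by simp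
  define C where "C = sqrt (C1 * (E * sqrt C2))"
  have "(\<Sum>l\<in>{2 ^ i - 1..<2 ^ Suc i - 1}. \<Sum>x\<in>S. w x * tnorm (df (\<lambda>x. kern_iter mu l x y)) x) \<le> C * sqrt (2 ^ i) / (1 + real k / 2 ^ i)"
    if S: "finite S" and far: "\<forall>x\<in>S. real k \<le> \<rho> y x" for y k i S
  proof -
    let ?u = "\<lambda>l x. kern_iter mu l x y"
    let ?I = "{2 ^ i - 1..<2 ^ Suc i - (1::nat)}"
    define th where "th = real k / 2 ^ i"
    have th: "0 \<le> th" by (simp add: th_def)
    let ?V = "V y (2 ^ i)"
    have V: "0 < ?V" by (rule V_pos) simp
    have un: "\<forall>x. 0 \<le> ?u l x" for l by (simp add: kern_iter_nonneg)
    have en: "(\<Sum>x\<in>S. w x * sqrt (nbmax (?u l) x)) \<le> E * sqrt ?V / (1 + th)\<^sup>2" if l: "l \<in> ?I" for l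
    proof -
      define L where "L = Suc l"
      have L: "2 ^ i \<le> L" "L \<le> 2 ^ Suc i" "1 \<le> L" using l unfolding L_def by auto
      have VL: "0 < V y L" using L by (intro V_pos)
      have "real L \<le> real (2 ^ Suc i)" using L(2) by (simp only: of_nat_le_iff)
      then have Lr: "real L \<le> 2 * 2 ^ i" by simp
      \<comment> \<open>The kernel bound at \<open>x\<close> also holds at its neighbours, which are within distance \<open>1\<close> of \<open>x\<close>.\<close>
      have nm: "w x * sqrt (nbmax (?u l) x) \<le> C3 / sqrt (V y L) * (4 / (1 + th)\<^sup>2) * (w x / (1 + \<rho> y x / real L) ^ N0)"
        if x: "x \<in> S" for x
      proof -
        define t where "t = 1 + \<rho> y x / real L"
        have t1: "1 \<le> t" by (simp add: t_def)
        have "nbmax (?u l) x \<le> C2 * (2 * real \<kappa>) ^ N / V y L / t ^ N"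
        proof (rule nbmax_le)
          fix x' assume x': "x' \<in> nb x"
          define t' where "t' = 1 + \<rho> y x' / real L"
          have t': "1 \<le> t'" by (simp add: t'_def)
          have "\<rho> y x \<le> real \<kappa> * (\<rho> y x' + 1)"
          proof (rule order_trans[OF rho_quasi])
            show "real \<kappa> * (\<rho> y x' + \<rho> x' x) \<le> real \<kappa> * (\<rho> y x' + 1)"
              using rho_nb[OF x'] rho_sym[of x' x] by (intro mult_left_mono) auto
          qed
          then have "\<rho> y x / real L \<le> real \<kappa> * (\<rho> y x' + 1) / real L" by (intro divide_right_mono) auto
          also have "\<dots> = real \<kappa> * (\<rho> y x' / real L) + real \<kappa> / real L" by (simp add: add_divide_distrib distrib_left)
          also have "\<dots> \<le> real \<kappa> * (\<rho> y x' / real L) + real \<kappa>"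
          proof -
            have "real \<kappa> * 1 \<le> real \<kappa> * real L" using L(3) by (intro mult_left_mono) auto
            then show ?thesis using L(3) by (simp add: divide_le_eq)
          qed
          finally have "\<rho> y x / real L \<le> real \<kappa> * (\<rho> y x' / real L) + real \<kappa>" .
          moreover have "1 \<le> real \<kappa>" using kappa(2) by simp
          moreover have "0 \<le> real \<kappa> * (\<rho> y x' / real L)" by simp
          moreover have "2 * real \<kappa> * t' = 2 * real \<kappa> + 2 * (real \<kappa> * (\<rho> y x' / real L))"
            by (simp add: t'_def distrib_left)
          ultimately have "t \<le> 2 * real \<kappa> * t'" unfolding t_def by linarith
          then have "t ^ N \<le> (2 * real \<kappa> * t') ^ N" using t1 by (intro power_mono) auto
          then have "t ^ N \<le> (2 * real \<kappa>) ^ N * t' ^ N" by (simp only: power_mult_distrib)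
          moreover have "1 / b \<le> c / a" if "a \<le> c * b" "0 < a" "0 < b" for a b c :: real
            using that by (simp add: field_simps)
          ultimately have inv: "1 / t' ^ N \<le> (2 * real \<kappa>) ^ N / t ^ N" using t1 t' by simp
          have "?u l x' = kern_iter mu l y x'" by (rule kern_iter_sym)
          also have "\<dots> \<le> C2 / V y L * (1 / t' ^ N)" using C2(2)[of l y x'] by (simp add: L_def t'_def)
          also have "\<dots> \<le> C2 / V y L * ((2 * real \<kappa>) ^ N / t ^ N)" using C2(1) VL by (intro mult_left_mono inv) auto
          finally show "?u l x' \<le> C2 * (2 * real \<kappa>) ^ N / V y L / t ^ N" by (simp add: mult_ac)
        qed
        then have "sqrt (nbmax (?u l) x) \<le> sqrt (C2 * (2 * real \<kappa>) ^ N / V y L / t ^ N)" by (rule real_sqrt_le_mono)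
        also have "\<dots> = C3 / sqrt (V y L) / sqrt (t ^ N)" by (simp only: real_sqrt_divide C3_def)
        also have "sqrt (t ^ N) = t ^ (N0 + 2)"
        proof -
          have "t ^ N = (t ^ (N0 + 2))\<^sup>2" unfolding N_def power_mult[symmetric] by (simp only: mult.commute)
          moreover have "0 \<le> t ^ (N0 + 2)" using t1 by (intro zero_le_power) simp
          ultimately show ?thesis by (metis real_sqrt_unique)
        qed
        also have "\<dots> = t ^ N0 * t\<^sup>2" by (simp only: power_add)
        finally have nb: "sqrt (nbmax (?u l) x) \<le> C3 / sqrt (V y L) / (t ^ N0 * t\<^sup>2)" .
        have "(1 + th) / 2 \<le> t"
        proof -
          have "th / 2 = real k / (2 * 2 ^ i)" by (simp add: th_def)
          also have "\<dots> \<le> real k / real L" using Lr L by (intro divide_left_mono) auto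
          also have "\<dots> \<le> \<rho> y x / real L" using far x by (intro divide_right_mono) auto
          finally show ?thesis by (simp add: t_def)
        qed
        then have "((1 + th) / 2)\<^sup>2 \<le> t\<^sup>2" using th by (intro power_mono) auto
        then have "1 / t\<^sup>2 \<le> 1 / ((1 + th) / 2)\<^sup>2" using th t1 by (intro divide_left_mono) auto
        then have t2: "1 / t\<^sup>2 \<le> 4 / (1 + th)\<^sup>2" by (simp add: power_divide)
        have "sqrt (nbmax (?u l) x) \<le> C3 / sqrt (V y L) / t ^ N0 * (1 / t\<^sup>2)" using nb by (simp add: field_simps)
        also have "\<dots> \<le> C3 / sqrt (V y L) / t ^ N0 * (4 / (1 + th)\<^sup>2)"
          using C3 VL t1 by (intro mult_left_mono t2) auto
        finally have "w x * sqrt (nbmax (?u l) x) \<le> w x * (C3 / sqrt (V y L) / t ^ N0 * (4 / (1 + th)\<^sup>2))"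
          by (intro mult_left_mono) auto
        then show ?thesis by (simp add: t_def mult_ac)
      qed
      have "(\<Sum>x\<in>S. w x * sqrt (nbmax (?u l) x)) \<le> (\<Sum>x\<in>S. C3 / sqrt (V y L) * (4 / (1 + th)\<^sup>2) * (w x / (1 + \<rho> y x / real L) ^ N0))"
        by (intro sum_mono nm)
      also have "\<dots> = C3 / sqrt (V y L) * (4 / (1 + th)\<^sup>2) * (\<Sum>x\<in>S. w x / (1 + \<rho> y x / real L) ^ N0)"
        by (simp only: sum_distrib_left)
      also have "\<dots> \<le> C3 / sqrt (V y L) * (4 / (1 + th)\<^sup>2) * (2 ^ (N0 + 1) * V y L)"
        using C3 VL by (intro mult_left_mono tail_sum L S) auto
      also have "\<dots> = 4 * C3 * 2 ^ (N0 + 1) / (1 + th)\<^sup>2 * sqrt (V y L)"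
      proof -
        have "c / s * d * (e * (s * s)) = c * d * e * s" if "s > 0" for c d e s :: real
          using that by simp
        from this[of "sqrt (V y L)" C3 "4 / (1 + th)\<^sup>2" "2 ^ (N0 + 1)"] show ?thesis using VL by (simp add: mult_ac)
      qed
      also have "\<dots> \<le> 4 * C3 * 2 ^ (N0 + 1) / (1 + th)\<^sup>2 * (sqrt Dc * sqrt ?V)"
      proof -
        have "V y L \<le> V y (2 * 2 ^ i)" using L by (intro V_mono) simp
        also have "\<dots> \<le> Dc * ?V" by (rule Dc(2)) simp
        finally have "sqrt (V y L) \<le> sqrt Dc * sqrt ?V" by (metis real_sqrt_le_mono real_sqrt_mult)
        then show ?thesis using C3 by (intro mult_left_mono) auto
      qed
      finally show ?thesis by (simp add: E_def mult_ac)
    qed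
    have card: "card ?I = 2 ^ i" by simp
    have sumE: "(\<Sum>l\<in>?I. \<Sum>x\<in>S. w x * sqrt (nbmax (?u l) x)) \<le> 2 ^ i * (E * sqrt ?V / (1 + th)\<^sup>2)"
    proof -
      have "(\<Sum>l\<in>?I. \<Sum>x\<in>S. w x * sqrt (nbmax (?u l) x)) \<le> of_nat (card ?I) * (E * sqrt ?V / (1 + th)\<^sup>2)"
        by (intro sum_bounded_above en)
      then show ?thesis unfolding card by simp
    qed
    have sumD: "(\<Sum>l\<in>?I. \<Sum>x\<in>S. w x * jdef (?u l) x) \<le> sqrt C2 / sqrt ?V"
    proof -
      let ?a = "2 ^ i - 1 :: nat"
      have "(\<Sum>l\<in>?I. \<Sum>x\<in>S. w x * jdef (?u l) x) \<le> ip (\<lambda>x. sqrt (?u ?a x) ^ 3) (\<lambda>_. 1)"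
        by (rule jdef_telescope[OF S]) simp
      also have "\<dots> \<le> (\<Sum>x | sqrt (?u ?a x) ^ 3 \<noteq> 0. sqrt (C2 / ?V) * (w x * ?u ?a x))"
        unfolding ip_def
      proof (rule sum_mono)
        fix x
        have "?u ?a x = kern_iter mu ?a y x" by (rule kern_iter_sym)
        also have "\<dots> \<le> C2 / V y (Suc ?a) / (1 + \<rho> y x / real (Suc ?a)) ^ N" by (rule C2(2))
        also have "\<dots> \<le> C2 / V y (Suc ?a) / 1"
        proof (rule divide_left_mono)
          show "1 \<le> (1 + \<rho> y x / real (Suc ?a)) ^ N" by (rule one_le_power) simp
          then show "0 < (1 + \<rho> y x / real (Suc ?a)) ^ N * 1" by linarith
        qed (use C2(1) in simp)
        also have "Suc ?a = 2 ^ i" by simp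
        finally have "sqrt (?u ?a x) \<le> sqrt (C2 / ?V)" by simp
        moreover have "sqrt (?u ?a x) ^ 3 = sqrt (?u ?a x) * ?u ?a x"
          using un by (simp add: power3_eq_cube)
        ultimately show "w x * sqrt (?u ?a x) ^ 3 * 1 \<le> sqrt (C2 / ?V) * (w x * ?u ?a x)"
          using un[of ?a] by (simp add: mult_ac mult_left_mono mult_right_mono)
      qed
      also have "\<dots> = sqrt (C2 / ?V) * (\<Sum>x | sqrt (?u ?a x) ^ 3 \<noteq> 0. w x * ?u ?a x)" by (simp only: sum_distrib_left)
      also have "\<dots> \<le> sqrt (C2 / ?V) * 1"
      proof (intro mult_left_mono kern_iter_mass)
        show "finite {x. sqrt (?u ?a x) ^ 3 \<noteq> 0}" using fin_supp[OF kern_iter_fin[of ?a y]] by simp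
      qed (use C2(1) V in auto)
      finally show ?thesis by (simp add: real_sqrt_divide)
    qed
    have nbn: "0 \<le> nbmax (?u l) x" for l x using nbmax_ge[OF self_nb, of "?u l" x] un[of l] by (meson order_trans)
    have "(\<Sum>l\<in>?I. \<Sum>x\<in>S. w x * tnorm (df (?u l)) x)
        \<le> (\<Sum>l\<in>?I. \<Sum>x\<in>S. sqrt C1 * (sqrt (w x * sqrt (nbmax (?u l) x)) * sqrt (w x * jdef (?u l) x)))"
    proof (intro sum_mono)
      fix l x
      have "tnorm (df (?u l)) x \<le> sqrt (C1 * (sqrt (nbmax (?u l) x) * jdef (?u l) x))"
        using C1(3)[OF un] by (intro real_le_rsqrt)
      then have "w x * tnorm (df (?u l)) x \<le> w x * sqrt (C1 * (sqrt (nbmax (?u l) x) * jdef (?u l) x))"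
        by (intro mult_left_mono) auto
      also have "\<dots> = sqrt C1 * (sqrt (w x * sqrt (nbmax (?u l) x)) * sqrt (w x * jdef (?u l) x))"
        by (simp add: real_sqrt_mult)
      finally show "w x * tnorm (df (?u l)) x \<le> sqrt C1 * (sqrt (w x * sqrt (nbmax (?u l) x)) * sqrt (w x * jdef (?u l) x))" .
    qed
    also have "\<dots> = sqrt C1 * (\<Sum>(l, x)\<in>?I \<times> S. sqrt (w x * sqrt (nbmax (?u l) x)) * sqrt (w x * jdef (?u l) x))"
      by (simp only: sum_distrib_left[symmetric] sum.cartesian_product)
    also have "\<dots> \<le> sqrt C1 * (sqrt (\<Sum>(l, x)\<in>?I \<times> S. w x * sqrt (nbmax (?u l) x)) * sqrt (\<Sum>(l, x)\<in>?I \<times> S. w x * jdef (?u l) x))"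
    proof (rule mult_left_mono)
      have "(\<Sum>p\<in>?I \<times> S. (case p of (l, x) \<Rightarrow> sqrt (w x * sqrt (nbmax (?u l) x))) * (case p of (l, x) \<Rightarrow> sqrt (w x * jdef (?u l) x)))
          \<le> L2_set (\<lambda>p. case p of (l, x) \<Rightarrow> sqrt (w x * sqrt (nbmax (?u l) x))) (?I \<times> S)
            * L2_set (\<lambda>p. case p of (l, x) \<Rightarrow> sqrt (w x * jdef (?u l) x)) (?I \<times> S)"
        by (rule order_trans[OF _ L2_set_mult_ineq]) (auto intro!: sum_mono simp: abs_mult nbn C1(2) un mult_left_mono)
      also have "L2_set (\<lambda>p. case p of (l, x) \<Rightarrow> sqrt (w x * sqrt (nbmax (?u l) x))) (?I \<times> S) = sqrt (\<Sum>(l, x)\<in>?I \<times> S. w x * sqrt (nbmax (?u l) x))"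
        unfolding L2_set_def by (intro arg_cong[where f=sqrt] sum.cong) (auto simp: nbn)
      also have "L2_set (\<lambda>p. case p of (l, x) \<Rightarrow> sqrt (w x * jdef (?u l) x)) (?I \<times> S) = sqrt (\<Sum>(l, x)\<in>?I \<times> S. w x * jdef (?u l) x)"
        unfolding L2_set_def by (intro arg_cong[where f=sqrt] sum.cong) (auto simp: C1(2) un)
      finally show "(\<Sum>(l, x)\<in>?I \<times> S. sqrt (w x * sqrt (nbmax (?u l) x)) * sqrt (w x * jdef (?u l) x))
          \<le> sqrt (\<Sum>(l, x)\<in>?I \<times> S. w x * sqrt (nbmax (?u l) x)) * sqrt (\<Sum>(l, x)\<in>?I \<times> S. w x * jdef (?u l) x)"
        by (simp add: case_prod_unfold)
    qed (use C1(1) in auto)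
    also have "\<dots> \<le> sqrt C1 * (sqrt (2 ^ i * (E * sqrt ?V / (1 + th)\<^sup>2)) * sqrt (sqrt C2 / sqrt ?V))"
      using sumE sumD C1(1) E C2(1) V unfolding sum.cartesian_product[symmetric]
      by (intro mult_left_mono mult_mono real_sqrt_le_mono) (auto intro!: real_sqrt_ge_zero sum_nonneg mult_nonneg_nonneg simp: C1(2) un)
    also have "\<dots> = C * sqrt (2 ^ i) / (1 + th)"
    proof -
      have "sqrt (2 ^ i * (E * sqrt ?V / (1 + th)\<^sup>2)) * sqrt (sqrt C2 / sqrt ?V)
          = sqrt (2 ^ i) * sqrt (E * sqrt C2) * (sqrt (sqrt ?V) / sqrt (sqrt ?V)) / sqrt ((1 + th)\<^sup>2)"
        by (simp add: real_sqrt_mult real_sqrt_divide)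
      also have "sqrt (sqrt ?V) / sqrt (sqrt ?V) = 1" using V by simp
      also have "sqrt ((1 + th)\<^sup>2) = 1 + th" using th by simp
      finally show ?thesis by (simp add: C_def real_sqrt_mult mult_ac)
    qed
    finally show ?thesis by (simp add: th_def)
  qed
  moreover have "0 \<le> C" unfolding C_def using C1(1) E C2(1) by simp
  ultimately show ?thesis by blast
qed

section \<open>Atoms\<close>

text \<open>The approximation of the identity at scale \<open>k\<close>. It takes the place of the mean value over a ball.\<close>

definition Av :: "nat \<Rightarrow> ('a \<Rightarrow> real) \<Rightarrow> 'a \<Rightarrow> real" where
  "Av k g x = (\<Sum>j\<in>{k..<2 * k}. (P ^^ j) g x) / real k"

text \<open>\<open>A\<^sub>k\<close> as a polynomial in \<open>\<Delta> = 1 - P\<close>.\<close>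

definition Aq :: "nat \<Rightarrow> real poly" where
  "Aq k = smult (1 / real k) (\<Sum>j\<in>{k..<2 * k}. [:1, -1:] ^ j)"

lemma Av_pol: "Av k g = pol (Aq k) g"
  by (rule ext) (simp add: Av_def Aq_def pol_smult pol_sum pol_walk)

lemma I_Av_pol: "(\<lambda>x. g x - Av k g x) = pol (1 - Aq k) g"
  by (simp add: pol_diff Av_pol)

lemma poly_Aq: assumes "1 \<le> k" "0 \<le> x" "x \<le> 2" shows "\<bar>poly (1 - Aq k) x\<bar> \<le> 2"
proof -
  have "\<bar>poly (Aq k) x\<bar> \<le> (\<Sum>j\<in>{k..<2 * k}. \<bar>(1 - x) ^ j\<bar>) / real k"
    by (simp add: Aq_def poly_sum abs_divide divide_right_mono)
  also have "\<dots> \<le> (\<Sum>j\<in>{k..<2 * k}. 1) / real k"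
    using assms by (intro divide_right_mono sum_mono) (auto simp: power_abs intro!: power_le_one)
  also have "\<dots> = 1" using assms by simp
  finally show ?thesis by simp
qed

lemma Av_bounds:
  assumes "1 \<le> k" "\<And>j. j \<in> {k..<2 * k} \<Longrightarrow> (P ^^ j) g x \<le> c"
  shows "Av k g x \<le> c"
proof -
  have "(\<Sum>j\<in>{k..<2 * k}. (P ^^ j) g x) \<le> (\<Sum>j\<in>{k..<2 * k}. c)" by (intro sum_mono assms)
  then show ?thesis using assms(1) by (simp add: Av_def divide_le_eq mult.commute)
qed

lemma Av_square: "1 \<le> k \<Longrightarrow> (Av k F x)\<^sup>2 \<le> Av k (\<lambda>y. (F y)\<^sup>2) x"
proof -
  assume k: "1 \<le> k"
  have "(Av k F x)\<^sup>2 = (\<Sum>j\<in>{k..<2 * k}. (P ^^ j) F x)\<^sup>2 / (real k)\<^sup>2" by (simp add: Av_def power_divide)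
  also have "\<dots> \<le> ((\<Sum>j\<in>{k..<2 * k}. ((P ^^ j) F x)\<^sup>2) * real k) / (real k)\<^sup>2"
    using sum_squared_le_sum_of_squares[of "\<lambda>j. (P ^^ j) F x" "{k..<2 * k}"] by (intro divide_right_mono) auto
  also have "\<dots> = (\<Sum>j\<in>{k..<2 * k}. ((P ^^ j) F x)\<^sup>2) / real k" using k by (simp add: power2_eq_square)
  also have "\<dots> \<le> Av k (\<lambda>y. (F y)\<^sup>2) x"
    unfolding Av_def by (intro divide_right_mono sum_mono funpow_walk_square) auto
  finally show ?thesis .
qed

text \<open>A point of \<open>Bl x k\<close> lies, up to a dilation, in every ball of radius at least \<open>k\<close> around another one. So
  \<open>avg_le\<close> at \<open>z\<close> controls the averages around \<open>y\<close>, and \<open>dyadic_sum\<close> applies to the kernel of \<open>P\<^sup>j\<close>.\<close>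

lemma Av_maximal:
  "\<exists>C\<ge>1. \<forall>g lam x k y z. (\<forall>u. 0 \<le> g u) \<longrightarrow> 1 \<le> k \<longrightarrow> y \<in> Bl x k \<longrightarrow> z \<in> Bl x k \<longrightarrow> avg_le g lam z \<longrightarrow> Av k g y \<le> C * lam"
proof -
  obtain C0 where C0: "C0 \<ge> 0" "\<And>x y j. kern_iter mu j x y \<le> C0 / V x (Suc j) / (1 + \<rho> x y / real (Suc j)) ^ N0"
    using UE_bound[of N0] by blast
  define C where "C = C0 * (2 ^ (N0 + 1) * Dc ^ (2 * \<kappa>))"
  have "Av k g y \<le> max 1 C * lam"
    if g: "\<forall>u. 0 \<le> g u" and k: "1 \<le> k" and y: "y \<in> Bl x k" and z: "z \<in> Bl x k" and lam: "avg_le g lam z" for g lam x k y z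
  proof -
    have lam0: "0 \<le> lam"
    proof -
      have "(\<Sum>u\<in>Bl z 1. w u * g u) \<le> lam * V z 1" using lam Bl_self[of 1 z] unfolding avg_le_def by blast
      then have "w z * g z \<le> lam * w z" unfolding Bl_1 V_1 by simp
      then have "g z \<le> lam" using w_pos[of z] by (simp add: mult.commute)
      then show ?thesis using g by (meson order_trans)
    qed
    have "(P ^^ j) g y \<le> C * lam" if j: "j \<in> {k..<2 * k}" for j
    proof -
      define L where "L = Suc j"
      have L: "1 \<le> L" "k \<le> L" using j by (auto simp: L_def)
      have VL: "0 < V y L" using L by (intro V_pos)
      obtain R where R: "finite R" "\<And>f. (P ^^ j) f y = (\<Sum>u\<in>R. kern_iter mu j y u * w u * f u)"
        using funpow_kernel[of j y] by blast
      have "(P ^^ j) g y = (\<Sum>u\<in>R. kern_iter mu j y u * w u * g u)" by (rule R)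
      also have "\<dots> \<le> (\<Sum>u\<in>R. C0 / V y L * (w u * g u / (1 + \<rho> y u / real L) ^ N0))"
      proof (rule sum_mono)
        fix u
        have "kern_iter mu j y u * (w u * g u) \<le> C0 / V y L / (1 + \<rho> y u / real L) ^ N0 * (w u * g u)"
          using C0(2)[of j y u] g by (intro mult_right_mono) (auto simp: L_def)
        then show "kern_iter mu j y u * w u * g u \<le> C0 / V y L * (w u * g u / (1 + \<rho> y u / real L) ^ N0)"
          by (simp add: mult_ac)
      qed
      also have "\<dots> = C0 / V y L * (\<Sum>u\<in>R. w u * g u / (1 + \<rho> y u / real L) ^ N0)" by (simp only: sum_distrib_left)
      also have "\<dots> \<le> C0 / V y L * (2 ^ (N0 + 1) * (lam * Dc ^ (2 * \<kappa>)) * V y L)"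
      proof (intro mult_left_mono dyadic_sum R(1) L(1))
        fix i
        have m: "1 \<le> 2 ^ i * L" using L by simp
        have "z \<in> Bl y (\<kappa> * (k + k))" using y z Bl_sym Bl_trans by blast
        moreover have "\<kappa> * (k + k) \<le> 2 * \<kappa> * (2 ^ i * L)"
        proof -
          have "k * 1 \<le> L * 2 ^ i" using L by (intro mult_le_mono) auto
          then have "k \<le> 2 ^ i * L" by (simp add: mult.commute)
          then have "\<kappa> * (2 * k) \<le> \<kappa> * (2 * (2 ^ i * L))" by (intro mult_le_mono2)
          then show ?thesis by (simp add: mult_2 mult_ac distrib_left)
        qed
        ultimately have zb: "z \<in> Bl y (2 * \<kappa> * (2 ^ i * L))" using Bl_mono by blast
        have ks: "2 ^ i * L \<le> 2 * \<kappa> * (2 ^ i * L)" "1 \<le> 2 * \<kappa> * (2 ^ i * L)" using kappa(2) m by auto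
        have "(\<Sum>u\<in>Bl y (2 ^ i * L). w u * g u) \<le> (\<Sum>u\<in>Bl y (2 * \<kappa> * (2 ^ i * L)). w u * g u)"
          using g ks by (intro sum_mono2 Bl_mono) auto
        also have "\<dots> \<le> lam * V y (2 * \<kappa> * (2 ^ i * L))" using lam zb ks unfolding avg_le_def by blast
        also have "\<dots> \<le> lam * (Dc ^ (2 * \<kappa>) * V y (2 ^ i * L))" using lam0 m by (intro mult_left_mono V_mult)
        finally show "(\<Sum>u\<in>Bl y (2 ^ i * L). w u * g u) \<le> lam * Dc ^ (2 * \<kappa>) * V y (2 ^ i * L)" by (simp add: mult_ac)
      qed (use g lam0 Dc(1) C0(1) VL in auto)
      also have "\<dots> = C * lam" using VL by (simp add: C_def)
      finally show ?thesis .
    qed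
    then have "Av k g y \<le> C * lam" using k by (intro Av_bounds)
    also have "\<dots> \<le> max 1 C * lam" using lam0 by (intro mult_right_mono) auto
    finally show ?thesis .
  qed
  then show ?thesis by (intro exI[of _ "max 1 C"]) auto
qed

lemma pol_sum_arg: "pol q (\<lambda>x. \<Sum>i\<in>A. f i x) = (\<lambda>x. \<Sum>i\<in>A. pol q (f i) x)"
proof (induction A rule: infinite_finite_induct)
  case (insert i A) then show ?case by (simp add: pol_add_arg)
qed (use pol_cmult_arg[of q 0] in auto)

lemma K_expand: "n < m \<Longrightarrow> K n g x = (\<Sum>l<m. cfc n l * (P ^^ l) g x)"
proof -
  assume m: "n < m"
  have "K n g x = (\<Sum>l\<le>n. cfc n l * (P ^^ l) g x)"
    unfolding cesaro_def pol_sum pol_smult pol_walk by (intro sum.cong) (auto simp: cfc_def max_def field_simps)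
  also have "\<dots> = (\<Sum>l<m. cfc n l * (P ^^ l) g x)"
    using m by (intro sum.mono_neutral_left) (auto simp: cfc_zero)
  finally show ?thesis .
qed

lemma K_I_Av:
  assumes k: "1 \<le> k" and m: "n + 2 * k \<le> m"
  shows "K n (\<lambda>x. g x - Av k g x) = (\<lambda>x. \<Sum>l<m. ecf n k l * (P ^^ l) g x)"
proof
  fix x
  have shift: "K n ((P ^^ j) g) x = (\<Sum>l<m. (if j \<le> l then cfc n (l - j) else 0) * (P ^^ l) g x)" if j: "j \<in> {k..<2 * k}" for j
  proof -
    have "K n ((P ^^ j) g) x = (\<Sum>i<Suc n. cfc n i * (P ^^ (i + j)) g x)"
      by (subst K_expand[of n "Suc n"]) (auto simp: funpow_add)
    also have "\<dots> = (\<Sum>l\<in>{j..<Suc n + j}. cfc n (l - j) * (P ^^ l) g x)"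
      by (rule sum.reindex_bij_witness[of _ "\<lambda>l. l - j" "\<lambda>i. i + j"]) auto
    also have "\<dots> = (\<Sum>l\<in>{j..<Suc n + j}. (if j \<le> l then cfc n (l - j) else 0) * (P ^^ l) g x)"
      by (intro sum.cong) auto
    also have "\<dots> = (\<Sum>l<m. (if j \<le> l then cfc n (l - j) else 0) * (P ^^ l) g x)"
      using m j by (intro sum.mono_neutral_left) (auto simp: cfc_zero)
    finally show ?thesis .
  qed
  have av: "Av k g = (\<lambda>x. \<Sum>j\<in>{k..<2 * k}. (1 / real k) * (P ^^ j) g x)"
    by (simp add: Av_def fun_eq_iff sum_divide_distrib)
  have "K n (\<lambda>x. g x - Av k g x) x = K n g x - (\<Sum>j\<in>{k..<2 * k}. (1 / real k) * K n ((P ^^ j) g) x)"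
    unfolding pol_diff_arg av pol_sum_arg pol_cmult_arg ..
  also have "\<dots> = (\<Sum>l<m. cfc n l * (P ^^ l) g x)
      - (\<Sum>j\<in>{k..<2 * k}. (1 / real k) * (\<Sum>l<m. (if j \<le> l then cfc n (l - j) else 0) * (P ^^ l) g x))"
    using K_expand[of n m g x] k m by (simp add: shift)
  also have "(\<Sum>j\<in>{k..<2 * k}. (1 / real k) * (\<Sum>l<m. (if j \<le> l then cfc n (l - j) else 0) * (P ^^ l) g x))
      = (\<Sum>l<m. (\<Sum>j\<in>{k..<2 * k}. if j \<le> l then cfc n (l - j) else 0) / real k * (P ^^ l) g x)"
    unfolding sum_distrib_left by (subst sum.swap) (simp add: sum_distrib_right sum_divide_distrib)
  also have "(\<Sum>l<m. cfc n l * (P ^^ l) g x) - \<dots> = (\<Sum>l<m. ecf n k l * (P ^^ l) g x)"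
    by (simp add: ecf_def left_diff_distrib sum_subtractf)
  finally show "K n (\<lambda>x. g x - Av k g x) x = (\<Sum>l<m. ecf n k l * (P ^^ l) g x)" .
qed

lemma sum_dyadic_blocks:
  fixes f :: "nat \<Rightarrow> real" shows "(\<Sum>l<2 ^ m - 1. f l) = (\<Sum>i<m. \<Sum>l\<in>{2 ^ i - 1..<2 ^ Suc i - 1}. f l)"
proof (induction m)
  case (Suc m)
  have "(\<Sum>l\<in>{0..<2 ^ m - 1}. f l) + (\<Sum>l\<in>{2 ^ m - 1..<2 ^ Suc m - 1}. f l) = (\<Sum>l\<in>{0..<2 ^ Suc m - 1}. f l)"
    by (rule sum.atLeastLessThan_concat) auto
  then show ?case using Suc by (simp only: atLeast0LessThan sum.lessThan_Suc)
qed simp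

text \<open>On the dyadic block of times around \<open>2\<^sup>i\<close> the coefficients contribute
  \<open>2\<^sup>-\<^sup>i\<^sup>/\<^sup>2 min 1 (k / 2\<^sup>i)\<close> and the gradients contribute \<open>2\<^sup>i\<^sup>/\<^sup>2 / (1 + k / 2\<^sup>i)\<close>. The product is summable
  over \<open>i\<close>, uniformly in \<open>k\<close>: the first factor decays for \<open>2\<^sup>i\<close> above \<open>k\<close>, the second one below.\<close>

lemma far_estimate:
  "\<exists>C\<ge>0. \<forall>y k n S. 1 \<le> k \<longrightarrow> finite S \<longrightarrow> (\<forall>x\<in>S. real k \<le> \<rho> y x) \<longrightarrow>
     (\<Sum>x\<in>S. w x * tnorm (df (K n (\<lambda>z. delta y z - Av k (delta y) z))) x) \<le> C * w y"
proof -
  obtain C where C: "C \<ge> 0" "\<And>y k i S. finite S \<Longrightarrow> (\<forall>x\<in>S. real k \<le> \<rho> y x) \<Longrightarrow>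
    (\<Sum>l\<in>{2 ^ i - 1..<2 ^ Suc i - 1}. \<Sum>x\<in>S. w x * tnorm (df (\<lambda>x. kern_iter mu l x y)) x) \<le> C * sqrt (2 ^ i) / (1 + real k / 2 ^ i)"
    using gradient_block by blast
  have "(\<Sum>x\<in>S. w x * tnorm (df (K n (\<lambda>z. delta y z - Av k (delta y) z))) x) \<le> (108 * C) * w y"
    if k: "1 \<le> k" and S: "finite S" and far: "\<forall>x\<in>S. real k \<le> \<rho> y x" for y k n S
  proof -
    \<comment> \<open>Enough dyadic blocks to cover all powers of \<open>P\<close> that occur in \<open>K\<^sub>n (I - A\<^sub>k)\<close>.\<close>
    define m where "m = n + 2 * k"
    have mm: "n + 2 * k \<le> 2 ^ m - 1" using less_exp[of m] unfolding m_def by linarith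
    let ?t = "\<lambda>l x. tnorm (df (\<lambda>x. kern_iter mu l x y)) x"
    have pw: "tnorm (df (K n (\<lambda>z. delta y z - Av k (delta y) z))) x \<le> (\<Sum>l<2 ^ m - 1. \<bar>ecf n k l\<bar> * (w y * ?t l x))" for x
    proof -
      have "K n (\<lambda>z. delta y z - Av k (delta y) z) = (\<lambda>x. \<Sum>l<2 ^ m - 1. (ecf n k l * w y) * kern_iter mu l x y)"
        unfolding K_I_Av[OF k mm] by (simp flip: kern_iter_eq add: mult_ac)
      then have "df (K n (\<lambda>z. delta y z - Av k (delta y) z)) = (\<lambda>e. \<Sum>l<2 ^ m - 1. (ecf n k l * w y) * df (\<lambda>x. kern_iter mu l x y) e)"
        by (simp only: df_sum df_cmult)
      then have "tnorm (df (K n (\<lambda>z. delta y z - Av k (delta y) z))) x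
          \<le> (\<Sum>l<2 ^ m - 1. tnorm (\<lambda>e. (ecf n k l * w y) * df (\<lambda>x. kern_iter mu l x y) e) x)"
        by (simp only: tnorm_sum)
      then show ?thesis by (simp only: tnorm_cmult abs_mult abs_of_nonneg[OF w_nonneg] mult.assoc)
    qed
    have "(\<Sum>x\<in>S. w x * tnorm (df (K n (\<lambda>z. delta y z - Av k (delta y) z))) x)
        \<le> (\<Sum>x\<in>S. w x * (\<Sum>l<2 ^ m - 1. \<bar>ecf n k l\<bar> * (w y * ?t l x)))"
      by (intro sum_mono mult_left_mono pw) auto
    also have "\<dots> = (\<Sum>l<2 ^ m - 1. w y * (\<bar>ecf n k l\<bar> * (\<Sum>x\<in>S. w x * ?t l x)))"
      unfolding sum_distrib_left by (subst sum.swap) (simp add: mult_ac)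
    also have "\<dots> = (\<Sum>i<m. \<Sum>l\<in>{2 ^ i - 1..<2 ^ Suc i - 1}. w y * (\<bar>ecf n k l\<bar> * (\<Sum>x\<in>S. w x * ?t l x)))"
      by (rule sum_dyadic_blocks)
    also have "\<dots> \<le> (\<Sum>i<m. w y * (36 * C * (min 1 (real k / 2 ^ i) / (1 + real k / 2 ^ i))))"
    proof (rule sum_mono)
      fix i
      let ?e = "36 / sqrt (2 ^ i) * min 1 (real k / 2 ^ i)"
      have e0: "0 \<le> ?e" by simp
      have "(\<Sum>l\<in>{2 ^ i - 1..<2 ^ Suc i - 1}. w y * (\<bar>ecf n k l\<bar> * (\<Sum>x\<in>S. w x * ?t l x)))
          \<le> (\<Sum>l\<in>{2 ^ i - 1..<2 ^ Suc i - 1}. w y * (?e * (\<Sum>x\<in>S. w x * ?t l x)))"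
      proof (intro sum_mono mult_left_mono mult_right_mono)
        fix l assume l: "l \<in> {2 ^ i - 1..<2 ^ Suc i - (1::nat)}"
        show "\<bar>ecf n k l\<bar> \<le> ?e" by (rule ecf_block[OF k]) (use l in auto)
      qed (auto intro!: sum_nonneg mult_nonneg_nonneg)
      also have "\<dots> = w y * (?e * (\<Sum>l\<in>{2 ^ i - 1..<2 ^ Suc i - 1}. \<Sum>x\<in>S. w x * ?t l x))"
        by (simp only: sum_distrib_left)
      also have "\<dots> \<le> w y * (?e * (C * sqrt (2 ^ i) / (1 + real k / 2 ^ i)))"
        using e0 by (intro mult_left_mono C(2) S far) auto
      also have "\<dots> = w y * (36 * C * (min 1 (real k / 2 ^ i) / (1 + real k / 2 ^ i)))"
      proof -
        have "36 / s * a * (C * s / b) = 36 * C * (a / b)" if "s > 0" for s a b :: real using that by simp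
        from this[of "sqrt (2 ^ i)"] show ?thesis by simp
      qed
      finally show "(\<Sum>l\<in>{2 ^ i - 1..<2 ^ Suc i - 1}. w y * (\<bar>ecf n k l\<bar> * (\<Sum>x\<in>S. w x * ?t l x)))
        \<le> w y * (36 * C * (min 1 (real k / 2 ^ i) / (1 + real k / 2 ^ i)))" .
    qed
    also have "\<dots> = w y * (36 * C * (\<Sum>i<m. min 1 (real k / 2 ^ i) / (1 + real k / 2 ^ i)))"
      by (simp only: sum_distrib_left)
    also have "\<dots> \<le> w y * (36 * C * 3)" using C(1) by (intro mult_left_mono sum_blocks) auto
    finally show ?thesis by (simp add: mult.commute)
  qed
  then show ?thesis using C(1) by (intro exI[of _ "108 * C"]) auto
qed

lemma l1_le_l2: "(\<Sum>x\<in>S. w x * \<bar>f x\<bar>) \<le> sqrt (\<Sum>x\<in>S. w x) * s2 S f"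
proof -
  have "(\<Sum>x\<in>S. w x * \<bar>f x\<bar>) = (\<Sum>x\<in>S. \<bar>sqrt (w x)\<bar> * \<bar>sqrt (w x) * f x\<bar>)"
    by (intro sum.cong) (auto simp: abs_mult simp flip: mult.assoc)
  also have "\<dots> \<le> L2_set (\<lambda>x. sqrt (w x)) S * L2_set (\<lambda>x. sqrt (w x) * f x) S" by (rule L2_set_mult_ineq)
  finally show ?thesis by (simp add: s2_L2_set) (simp add: L2_set_def)
qed

text \<open>On the enlarged ball \<open>?N\<close> the \<open>L\<^sup>1\<close> norm is bounded by the \<open>L\<^sup>2\<close> norm, which the spectral bound
  controls. Outside of it every point has distance at least \<open>k\<close> from the support of \<open>b\<close>, so that \<open>b\<close> can be split
  into point masses and \<open>far_estimate\<close> applies to each of them.\<close>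

theorem atom_estimate:
  "\<exists>C\<ge>0. \<forall>x k b n S. 1 \<le> k \<longrightarrow> finite S \<longrightarrow> (\<forall>z. b z \<noteq> 0 \<longrightarrow> z \<in> Bl x k) \<longrightarrow>
     (\<Sum>z\<in>S. w z * \<bar>b z - Av k b z\<bar>) + (\<Sum>z\<in>S. w z * tnorm (df (K n (\<lambda>z. b z - Av k b z))) z)
       \<le> C * (sqrt (V x k) * s2 (Bl x k) b)"
proof -
  obtain C where C: "C \<ge> 0" "\<And>y k n S. 1 \<le> k \<Longrightarrow> finite S \<Longrightarrow> (\<forall>x\<in>S. real k \<le> \<rho> y x) \<Longrightarrow>
     (\<Sum>x\<in>S. w x * tnorm (df (K n (\<lambda>z. delta y z - Av k (delta y) z))) x) \<le> C * w y"
    using far_estimate by blast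
  define D where "D = sqrt (Dc ^ (2 * \<kappa>)) * 4"
  have D: "0 \<le> D" using Dc(1) by (simp add: D_def)
  have "(\<Sum>z\<in>S. w z * \<bar>b z - Av k b z\<bar>) + (\<Sum>z\<in>S. w z * tnorm (df (K n (\<lambda>z. b z - Av k b z))) z)
       \<le> (2 + D + C) * (sqrt (V x k) * s2 (Bl x k) b)"
    if k: "1 \<le> k" and S: "finite S" and supp: "\<forall>z. b z \<noteq> 0 \<longrightarrow> z \<in> Bl x k" for x k b n S
  proof -
    let ?a = "\<lambda>z. b z - Av k b z"
    let ?X = "sqrt (V x k) * s2 (Bl x k) b"
    have bf: "fin b" unfolding fin_def by (rule finite_subset[OF _ finite_Bl[of x k]]) (use supp in auto)
    have l1b: "(\<Sum>z\<in>Bl x k. w z * \<bar>b z\<bar>) \<le> ?X" using l1_le_l2[where S="Bl x k" and f=b] by (simp add: V_def)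
    have n2b: "n2 b \<le> s2 (Bl x k) b"
    proof -
      have "ip b b = (s2 (Bl x k) b)\<^sup>2"
        unfolding s2_sq using supp bf by (subst ip_eq[of "Bl x k"]) (auto simp: power2_eq_square mult.assoc)
      then show ?thesis using fin_l2(2)[OF bf] by simp
    qed
    have "(\<Sum>z\<in>S. w z * \<bar>?a z\<bar>) \<le> (\<Sum>z\<in>S. w z * \<bar>b z\<bar>) + (\<Sum>z\<in>S. w z * Av k (\<lambda>z. \<bar>b z\<bar>) z)"
    proof -
      have "\<bar>?a z\<bar> \<le> \<bar>b z\<bar> + Av k (\<lambda>z. \<bar>b z\<bar>) z" for z
      proof -
        have "\<bar>Av k b z\<bar> \<le> Av k (\<lambda>z. \<bar>b z\<bar>) z"
          unfolding Av_def abs_divide abs_of_nat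
          by (intro divide_right_mono order_trans[OF sum_abs] sum_mono funpow_walk_abs) auto
        then show ?thesis by linarith
      qed
      then have "(\<Sum>z\<in>S. w z * \<bar>?a z\<bar>) \<le> (\<Sum>z\<in>S. w z * (\<bar>b z\<bar> + Av k (\<lambda>z. \<bar>b z\<bar>) z))" by (intro sum_mono mult_left_mono) auto
      then show ?thesis by (simp only: distrib_left sum.distrib)
    qed
    also have "(\<Sum>z\<in>S. w z * \<bar>b z\<bar>) \<le> ?X"
    proof -
      have "(\<Sum>z\<in>S. w z * \<bar>b z\<bar>) \<le> (\<Sum>z\<in>S \<union> Bl x k. w z * \<bar>b z\<bar>)" using S by (intro sum_mono2) auto
      also have "\<dots> = (\<Sum>z\<in>Bl x k. w z * \<bar>b z\<bar>)" using S supp by (intro sum.mono_neutral_right) auto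
      finally show ?thesis using l1b by linarith
    qed
    also have "(\<Sum>z\<in>S. w z * Av k (\<lambda>z. \<bar>b z\<bar>) z) \<le> ?X"
    proof -
      have "(\<Sum>z\<in>S. w z * Av k (\<lambda>z. \<bar>b z\<bar>) z) = (\<Sum>j\<in>{k..<2 * k}. \<Sum>z\<in>S. w z * (P ^^ j) (\<lambda>z. \<bar>b z\<bar>) z) / real k"
        unfolding Av_def by (subst sum.swap) (simp add: sum_distrib_left sum_divide_distrib)
      also have "\<dots> \<le> (\<Sum>j\<in>{k..<2 * k}. ?X) / real k"
      proof (intro divide_right_mono sum_mono)
        fix j
        have "(\<Sum>z\<in>S. w z * (P ^^ j) (\<lambda>z. \<bar>b z\<bar>) z) \<le> (\<Sum>z\<in>Bl x k. w z * \<bar>b z\<bar>)"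
          using S supp bf by (intro sum_funpow_le fin_comp[where h=abs]) auto
        then show "(\<Sum>z\<in>S. w z * (P ^^ j) (\<lambda>z. \<bar>b z\<bar>) z) \<le> ?X" using l1b by linarith
      qed auto
      also have "\<dots> = ?X" using k by simp
      finally show ?thesis .
    qed
    finally have part1: "(\<Sum>z\<in>S. w z * \<bar>?a z\<bar>) \<le> 2 * ?X" by simp
    let ?N = "Bl x (2 * \<kappa> * k)"
    let ?t = "tnorm (df (K n ?a))"
    have near: "(\<Sum>z\<in>S \<inter> ?N. w z * ?t z) \<le> D * ?X"
    proof -
      have "(\<Sum>z\<in>S \<inter> ?N. w z * ?t z) \<le> sqrt (\<Sum>z\<in>S \<inter> ?N. w z) * s2 (S \<inter> ?N) ?t"
        using l1_le_l2[of ?t "S \<inter> ?N"] by simp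
      also have "\<dots> \<le> sqrt (Dc ^ (2 * \<kappa>) * V x k) * (2 * (2 * s2 (Bl x k) b))"
      proof (intro mult_mono real_sqrt_le_mono)
        have "(\<Sum>z\<in>S \<inter> ?N. w z) \<le> V x (2 * \<kappa> * k)" unfolding V_def by (intro sum_mono2) auto
        also have "\<dots> \<le> Dc ^ (2 * \<kappa>) * V x k" by (rule V_mult[OF k])
        finally show "(\<Sum>z\<in>S \<inter> ?N. w z) \<le> Dc ^ (2 * \<kappa>) * V x k" .
        have la: "l2 ?a" and na: "n2 ?a \<le> 2 * n2 b"
          unfolding I_Av_pol using fin_l2(1)[OF bf] k by (auto intro!: pol_l2 poly_Aq)
        have "s2 (S \<inter> ?N) ?t \<le> 2 * n2 ?a" using S by (intro df_pol_l2 la cesaro_bounds) auto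
        then show "s2 (S \<inter> ?N) ?t \<le> 2 * (2 * s2 (Bl x k) b)" using na n2b by linarith
      qed (use Dc(1) in auto)
      also have "\<dots> = D * ?X" by (simp add: D_def real_sqrt_mult)
      finally show ?thesis .
    qed
    have far: "(\<Sum>z\<in>S - ?N. w z * ?t z) \<le> C * ?X"
    proof -
      have decomp: "K n ?a = (\<lambda>z. \<Sum>y\<in>Bl x k. b y * K n (\<lambda>z. delta y z - Av k (delta y) z) z)"
      proof -
        have "b = (\<lambda>z. \<Sum>y\<in>Bl x k. b y * delta y z)" using supp by (intro fin_decomp) auto
        then have "K n (pol (1 - Aq k) b) = K n (pol (1 - Aq k) (\<lambda>z. \<Sum>y\<in>Bl x k. b y * delta y z))" by simp
        then show ?thesis unfolding I_Av_pol by (simp only: pol_sum_arg pol_cmult_arg)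
      qed
      have tle: "?t z \<le> (\<Sum>y\<in>Bl x k. \<bar>b y\<bar> * tnorm (df (K n (\<lambda>z. delta y z - Av k (delta y) z))) z)" for z
      proof -
        have "?t z \<le> (\<Sum>y\<in>Bl x k. tnorm (\<lambda>e. b y * df (K n (\<lambda>z. delta y z - Av k (delta y) z)) e) z)"
          unfolding decomp df_sum df_cmult by (rule tnorm_sum)
        then show ?thesis by (simp only: tnorm_cmult)
      qed
      have "(\<Sum>z\<in>S - ?N. w z * ?t z) \<le> (\<Sum>z\<in>S - ?N. w z * (\<Sum>y\<in>Bl x k. \<bar>b y\<bar> * tnorm (df (K n (\<lambda>z. delta y z - Av k (delta y) z))) z))"
        by (intro sum_mono mult_left_mono tle) auto
      also have "\<dots> = (\<Sum>y\<in>Bl x k. \<bar>b y\<bar> * (\<Sum>z\<in>S - ?N. w z * tnorm (df (K n (\<lambda>z. delta y z - Av k (delta y) z))) z))"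
        unfolding sum_distrib_left by (subst sum.swap) (simp add: mult_ac)
      also have "\<dots> \<le> (\<Sum>y\<in>Bl x k. \<bar>b y\<bar> * (C * w y))"
      proof (intro sum_mono mult_left_mono C(2) k)
        fix y assume y: "y \<in> Bl x k"
        show "\<forall>z\<in>S - ?N. real k \<le> \<rho> y z"
        proof (rule ballI, rule ccontr)
          fix z assume z: "z \<in> S - ?N" "\<not> real k \<le> \<rho> y z"
          then have "z \<in> Bl y k" by (simp add: Bl_def)
          then have "z \<in> Bl x (\<kappa> * (k + k))" using Bl_trans[OF y] by blast
          moreover have "\<kappa> * (k + k) = 2 * \<kappa> * k" by simp
          ultimately show False using z(1) by simp
        qed
      qed (use S in auto)
      also have "\<dots> = C * (\<Sum>y\<in>Bl x k. w y * \<bar>b y\<bar>)" by (simp add: sum_distrib_left mult_ac)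
      also have "\<dots> \<le> C * ?X" using C(1) by (intro mult_left_mono l1b) auto
      finally show ?thesis .
    qed
    have "(\<Sum>z\<in>S. w z * ?t z) = (\<Sum>z\<in>S \<inter> ?N. w z * ?t z) + (\<Sum>z\<in>S - ?N. w z * ?t z)"
      by (rule sum.Int_Diff[OF S])
    then show ?thesis using part1 near far by (simp add: distrib_right)
  qed
  then show ?thesis using C(1) D by (intro exI[of _ "2 + D + C"]) auto
qed

section \<open>The sharp maximal function and the good-\<open>\<lambda>\<close> inequality\<close>

text \<open>The volume of the set where the maximal function of \<open>g\<close> exceeds \<open>lam\<close>, as a supremum over finite
  subsets.\<close>

definition lev :: "('a \<Rightarrow> real) \<Rightarrow> real \<Rightarrow> real" where
  "lev g lam = Sup {(\<Sum>x\<in>G. w x) | G. finite G \<and> (\<forall>x\<in>G. \<not> avg_le g lam x)}"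

text \<open>The square of the sharp maximal function of \<open>F\<close> is at most \<open>c\<close> at \<open>y\<close>. Oscillation is measured in \<open>L\<^sup>2\<close>,
  with respect to \<open>Av k F\<close>.\<close>

definition sharp_le :: "('a \<Rightarrow> real) \<Rightarrow> real \<Rightarrow> 'a \<Rightarrow> bool" where
  "sharp_le F c y \<longleftrightarrow> (\<forall>x. \<forall>k\<ge>1. y \<in> Bl x k \<longrightarrow> (s2 (Bl x k) (\<lambda>u. F u - Av k F u))\<^sup>2 \<le> c * V x k)"

lemma avg_le_mono: "avg_le g lam z \<Longrightarrow> lam \<le> lam' \<Longrightarrow> avg_le g lam' z"
  unfolding avg_le_def by (meson mult_right_mono order_trans V_nonneg)

lemma lev_least:
  assumes "\<And>G. finite G \<Longrightarrow> (\<forall>x\<in>G. \<not> avg_le g lam x) \<Longrightarrow> (\<Sum>x\<in>G. w x) \<le> c"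
  shows "lev g lam \<le> c"
  unfolding lev_def
proof (rule cSup_least)
  show "{(\<Sum>x\<in>G. w x) | G. finite G \<and> (\<forall>x\<in>G. \<not> avg_le g lam x)} \<noteq> {}"
    by (rule ex_in_conv[THEN iffD1], rule exI[of _ 0], rule CollectI, rule exI[of _ "{}"]) simp
qed (use assms in blast)

lemma lev_weak:
  assumes g: "\<And>z. 0 \<le> g z" and T: "\<And>S. finite S \<Longrightarrow> (\<Sum>z\<in>S. w z * g z) \<le> T" and lam: "0 < lam"
  shows "lev g lam \<le> Dc ^ (3 * \<kappa>\<^sup>2) * T / lam"
  by (rule lev_least, rule weak_type[OF g T lam]) auto

lemma lev_upper:
  assumes g: "\<And>z. 0 \<le> g z" and T: "\<And>S. finite S \<Longrightarrow> (\<Sum>z\<in>S. w z * g z) \<le> T" and lam: "0 < lam"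
    and G: "finite G" "\<And>x. x \<in> G \<Longrightarrow> \<not> avg_le g lam x"
  shows "(\<Sum>x\<in>G. w x) \<le> lev g lam"
  unfolding lev_def
proof (rule cSup_upper)
  show "(\<Sum>x\<in>G. w x) \<in> {(\<Sum>x\<in>G. w x) | G. finite G \<and> (\<forall>x\<in>G. \<not> avg_le g lam x)}" using G by blast
  show "bdd_above {(\<Sum>x\<in>G. w x) | G. finite G \<and> (\<forall>x\<in>G. \<not> avg_le g lam x)}"
    by (rule bdd_aboveI[of _ "Dc ^ (3 * \<kappa>\<^sup>2) * T / lam"]) (use weak_type[OF g T lam] in blast)
qed

lemma lev_nonneg:
  assumes g: "\<And>z. 0 \<le> g z" and T: "\<And>S. finite S \<Longrightarrow> (\<Sum>z\<in>S. w z * g z) \<le> T" and lam: "0 < lam"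
  shows "0 \<le> lev g lam"
  using lev_upper[OF g T lam, of "{}"] by simp

text \<open>The level set has finite volume by the weak type estimate, whereas the volume of the balls around \<open>x\<close> is
  unbounded. The largest radius whose ball stays inside the level set therefore exists.\<close>

lemma maximal_ball:
  assumes g: "\<And>z. 0 \<le> g z" and T: "\<And>S. finite S \<Longrightarrow> (\<Sum>z\<in>S. w z * g z) \<le> T" and lam: "0 < lam"
    and x: "\<not> avg_le g lam x"
  shows "\<exists>r z. 1 \<le> r \<and> (\<forall>u\<in>Bl x r. \<not> avg_le g lam u) \<and> z \<in> Bl x (2 * r) \<and> avg_le g lam z"
proof -
  obtain k where k: "k \<ge> 1" "Dc ^ (3 * \<kappa>\<^sup>2) * T / lam < V x k" using V_unbounded by blast
  have "\<exists>u\<in>Bl x k. avg_le g lam u"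
  proof (rule ccontr)
    assume "\<not> (\<exists>u\<in>Bl x k. avg_le g lam u)"
    then have "V x k \<le> Dc ^ (3 * \<kappa>\<^sup>2) * T / lam" unfolding V_def by (intro weak_type[OF g T lam]) auto
    with k show False by simp
  qed
  then have ex: "\<exists>k. \<exists>u\<in>Bl x (Suc k). avg_le g lam u" using k(1) by (metis Suc_le_D One_nat_def)
  define r where "r = (LEAST k. \<exists>u\<in>Bl x (Suc k). avg_le g lam u)"
  obtain z where z: "z \<in> Bl x (Suc r)" "avg_le g lam z" using LeastI_ex[OF ex] unfolding r_def by blast
  have r1: "1 \<le> r"
  proof (rule ccontr)
    assume "\<not> 1 \<le> r"
    then have "Suc r = 1" by simp
    then have "z \<in> Bl x 1" using z(1) by simp
    then have "z = x" unfolding Bl_1 by simp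
    with z x show False by simp
  qed
  then obtain r' where r': "r = Suc r'" by (metis Suc_le_D One_nat_def)
  then have "\<not> (\<exists>u\<in>Bl x (Suc r'). avg_le g lam u)" unfolding r_def by (metis lessI not_less_Least)
  then have "\<forall>u\<in>Bl x r. \<not> avg_le g lam u" using r' by blast
  moreover have "z \<in> Bl x (2 * r)" using z(1) Bl_mono[of "Suc r" "2 * r" x] r1 by auto
  ultimately show ?thesis using r1 z(2) by blast
qed

text \<open>The level set at \<open>lam\<close> is covered by dilates of disjoint balls \<open>Bl j (r j)\<close> inside it, each of which has
  a point \<open>z j\<close> close by where the maximal function is at most \<open>lam\<close>. Near such a ball, \<open>F\<^sup>2\<close> is at most twice the
  squared oscillation plus a multiple of \<open>lam\<close>, by \<open>Av_maximal\<close> at \<open>z j\<close>. If the maximal function exceeds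
  \<open>K * lam\<close> at a point, the oscillation must be responsible when \<open>K\<close> is large; and it is small in mean, with the
  factor \<open>\<gamma>\<close>, so that the weak type estimate gives the bound near each ball.\<close>

theorem good_lambda:
  "\<exists>C0\<ge>0. \<exists>K0\<ge>1. \<forall>F T lam \<gamma> K G. (\<forall>S. finite S \<longrightarrow> (\<Sum>z\<in>S. w z * (F z)\<^sup>2) \<le> T) \<longrightarrow> 0 < lam \<longrightarrow> 0 \<le> \<gamma> \<longrightarrow> K0 \<le> K \<longrightarrow>
    finite G \<longrightarrow> (\<forall>y\<in>G. \<not> avg_le (\<lambda>z. (F z)\<^sup>2) (K * lam) y \<and> sharp_le F (\<gamma> * lam) y) \<longrightarrow>
    (\<Sum>x\<in>G. w x) \<le> C0 * \<gamma> / K * lev (\<lambda>z. (F z)\<^sup>2) lam"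
proof -
  obtain CA where CA: "CA \<ge> 1" "\<And>g lam x k y z. (\<forall>u. 0 \<le> g u) \<Longrightarrow> 1 \<le> k \<Longrightarrow> y \<in> Bl x k \<Longrightarrow> z \<in> Bl x k \<Longrightarrow> avg_le g lam z \<Longrightarrow> Av k g y \<le> CA * lam"
    using Av_maximal by blast
  \<comment> \<open>\<open>th\<close> is the dilation in the covering lemma. A ball of radius \<open>s \<ge> r j\<close> that meets the dilated ball
    reaches \<open>z j\<close> after dilation by \<open>C1\<close>; all smaller ones stay in the ball of radius \<open>c2 * r j\<close>.\<close>
  define th where "th = 3 * \<kappa>\<^sup>2"
  define C1 where "C1 = \<kappa> * (1 + \<kappa> * (th + 2))"
  define c2 where "c2 = \<kappa> * (th + 2 * \<kappa>)"
  define K0 where "K0 = Dc ^ C1 + 4 * CA"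
  define C0 where "C0 = 4 * Dc ^ th * Dc ^ c2"
  have DC: "1 \<le> Dc ^ n" for n using Dc(1) by (rule one_le_power)
  have th3: "3 \<le> th" unfolding th_def using kappa(2) by (metis mult.right_neutral mult_le_mono2 one_le_power)
  have c2th: "th \<le> c2" "2 \<le> c2"
  proof -
    have "1 * (th + 2 * \<kappa>) \<le> \<kappa> * (th + 2 * \<kappa>)" using kappa(2) by (intro mult_le_mono1)
    then have a: "th + 2 * \<kappa> \<le> c2" by (simp only: c2_def mult_1)
    show "th \<le> c2" using a by linarith
    show "2 \<le> c2" using a th3 by linarith
  qed
  have "(\<Sum>x\<in>G. w x) \<le> C0 * \<gamma> / K * lev (\<lambda>z. (F z)\<^sup>2) lam"
    if T: "\<forall>S. finite S \<longrightarrow> (\<Sum>z\<in>S. w z * (F z)\<^sup>2) \<le> T" and lam: "0 < lam" and \<gamma>: "0 \<le> \<gamma>" and K: "K0 \<le> K"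
      and G: "finite G" and bad: "\<forall>y\<in>G. \<not> avg_le (\<lambda>z. (F z)\<^sup>2) (K * lam) y \<and> sharp_le F (\<gamma> * lam) y" for F T lam \<gamma> K G
  proof -
    let ?g = "\<lambda>z. (F z)\<^sup>2"
    have g0: "\<And>z. 0 \<le> ?g z" by simp
    have T': "\<And>S. finite S \<Longrightarrow> (\<Sum>z\<in>S. w z * ?g z) \<le> T" using T by blast
    have K1: "1 \<le> K" "Dc ^ C1 \<le> K" "4 * CA \<le> K" using K CA(1) DC[of C1] by (auto simp: K0_def)
    have lK: "lam \<le> K * lam" using K1(1) lam by simp
    have inE: "\<not> avg_le ?g lam x" if "x \<in> G" for x using bad that avg_le_mono[OF _ lK] by blast
    obtain r z where rz: "\<And>x. x \<in> G \<Longrightarrow> 1 \<le> r x" "\<And>x u. x \<in> G \<Longrightarrow> u \<in> Bl x (r x) \<Longrightarrow> \<not> avg_le ?g lam u"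
      "\<And>x. x \<in> G \<Longrightarrow> z x \<in> Bl x (2 * r x)" "\<And>x. x \<in> G \<Longrightarrow> avg_le ?g lam (z x)"
    proof -
      have "\<forall>x\<in>G. \<exists>r z. 1 \<le> r \<and> (\<forall>u\<in>Bl x r. \<not> avg_le ?g lam u) \<and> z \<in> Bl x (2 * r) \<and> avg_le ?g lam z"
        using maximal_ball[OF g0 T' lam inE] by blast
      then show ?thesis using that by metis
    qed
    obtain J where J: "J \<subseteq> G" "\<forall>i\<in>J. \<forall>j\<in>J. i \<noteq> j \<longrightarrow> Bl i (r i) \<inter> Bl j (r j) = {}"
      "\<forall>i\<in>G. \<exists>j\<in>J. Bl i (r i) \<subseteq> Bl j (th * r j)"
      using vitali_cover[OF G, of r "\<lambda>x. x"] rz(1) unfolding th_def by blast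
    have fJ: "finite J" using J(1) G finite_subset by blast
    have loc: "(\<Sum>x\<in>G \<inter> Bl j (th * r j). w x) \<le> C0 * \<gamma> / K * V j (r j)" if j: "j \<in> J" for j
    proof (cases "G \<inter> Bl j (th * r j) = {}")
      case True
      then show ?thesis using \<gamma> K1(1) DC[of th] DC[of c2] by (simp add: C0_def)
    next
      case False
      then obtain y0 where y0: "y0 \<in> G" "y0 \<in> Bl j (th * r j)" by blast
      have jG: "j \<in> G" using j J(1) by blast
      define rr where "rr = r j"
      have rr: "1 \<le> rr" using rz(1)[OF jG] by (simp add: rr_def)
      define k where "k = c2 * rr"
      have k1: "1 \<le> k" using rr c2th by (simp add: k_def)
      let ?R = "Bl j k"
      have sub: "Bl j (th * rr) \<subseteq> ?R" "Bl j (2 * rr) \<subseteq> ?R"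
        unfolding k_def by (rule Bl_mono, use c2th in simp)+
      have zR: "z j \<in> ?R" "z j \<in> Bl j (2 * rr)" using rz(3)[OF jG] sub by (auto simp: rr_def)
      have zlam: "avg_le ?g lam (z j)" by (rule rz(4)[OF jG])
      let ?d = "\<lambda>u. F u - Av k F u"
      define g1 where "g1 = (\<lambda>u. if u \<in> ?R then 2 * (?d u)\<^sup>2 else 0)"
      have g1n: "0 \<le> g1 u" for u by (simp add: g1_def)
      have gR: "?g u \<le> g1 u + 2 * CA * lam" if u: "u \<in> ?R" for u
      proof -
        have "(F u)\<^sup>2 = (?d u + Av k F u)\<^sup>2" by simp
        also have "\<dots> \<le> 2 * (?d u)\<^sup>2 + 2 * (Av k F u)\<^sup>2"
          using sum_squares_bound[of "?d u" "Av k F u"] by (simp only: power2_sum)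
        also have "(Av k F u)\<^sup>2 \<le> Av k ?g u" by (rule Av_square[OF k1])
        also have "Av k ?g u \<le> CA * lam" by (rule CA(2)[OF _ k1 u zR(1) zlam]) simp
        finally show ?thesis using u by (simp add: g1_def)
      qed
      have g1T: "(\<Sum>u\<in>S. w u * g1 u) \<le> 2 * (\<gamma> * lam * V j k)" if S: "finite S" for S
      proof -
        have "(\<Sum>u\<in>S. w u * g1 u) \<le> (\<Sum>u\<in>S \<union> ?R. w u * g1 u)" using S g1n by (intro sum_mono2) auto
        also have "\<dots> = (\<Sum>u\<in>?R. w u * (2 * (?d u)\<^sup>2))"
          using S by (intro sum.mono_neutral_cong_right) (auto simp: g1_def)
        also have "\<dots> = 2 * (s2 ?R ?d)\<^sup>2" unfolding s2_sq by (simp add: sum_distrib_left mult_ac)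
        also have "(s2 ?R ?d)\<^sup>2 \<le> \<gamma> * lam * V j k"
          using bad y0 sub(1) k1 unfolding sharp_le_def rr_def by blast
        finally show ?thesis by simp
      qed
      have lam2: "0 < K * lam / 2" using K1(1) lam by simp
      have "\<not> avg_le g1 (K * lam / 2) y" if y: "y \<in> G \<inter> Bl j (th * rr)" for y
      proof -
        have "\<not> avg_le ?g (K * lam) y" using bad y by blast
        then obtain c s where cs: "1 \<le> s" "y \<in> Bl c s" "K * lam * V c s < (\<Sum>u\<in>Bl c s. w u * ?g u)"
          unfolding avg_le_def by (meson not_less)
        have Vc: "0 < V c s" by (rule V_pos[OF cs(1)])
        have yj: "y \<in> Bl j (th * rr)" using y by blast
        \<comment> \<open>Balls that are not smaller than \<open>rr\<close> see the point \<open>z j\<close> and have averages at most \<open>K * lam\<close>.\<close>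
        have "s < rr"
        proof (rule ccontr)
          assume "\<not> s < rr"
          then have rs: "rr \<le> s" by simp
          have "z j \<in> Bl y (\<kappa> * (th * rr + 2 * rr))" using yj zR(2) Bl_sym Bl_trans by blast
          then have "z j \<in> Bl c (\<kappa> * (s + \<kappa> * (th * rr + 2 * rr)))" using cs(2) Bl_trans by blast
          moreover have "\<kappa> * (s + \<kappa> * (th * rr + 2 * rr)) \<le> C1 * s"
          proof -
            have "th * rr + 2 * rr = (th + 2) * rr" by (simp add: algebra_simps)
            also have "\<dots> \<le> (th + 2) * s" using rs by (intro mult_le_mono2)
            finally have "\<kappa> * (s + \<kappa> * (th * rr + 2 * rr)) \<le> \<kappa> * (s + \<kappa> * ((th + 2) * s))"
              by (intro mult_le_mono2 add_le_mono order_refl)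
            also have "\<dots> = C1 * s" by (simp add: C1_def algebra_simps)
            finally show ?thesis .
          qed
          ultimately have zc: "z j \<in> Bl c (C1 * s)" using Bl_mono by blast
          have C11: "1 \<le> C1" unfolding C1_def using kappa(2) by simp
          have s1: "s \<le> C1 * s" "1 \<le> C1 * s" using C11 cs(1) by auto
          have "(\<Sum>u\<in>Bl c s. w u * ?g u) \<le> (\<Sum>u\<in>Bl c (C1 * s). w u * ?g u)"
            using s1(1) by (intro sum_mono2 Bl_mono) auto
          also have "\<dots> \<le> lam * V c (C1 * s)" using zlam zc s1(2) unfolding avg_le_def by blast
          also have "\<dots> \<le> lam * (Dc ^ C1 * V c s)" using lam cs(1) by (intro mult_left_mono V_mult) auto
          also have "\<dots> \<le> lam * (K * V c s)" using lam K1(2) Vc by (intro mult_left_mono mult_right_mono) auto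
          finally show False using cs(3) by (simp add: mult_ac)
        qed
        have cR: "Bl c s \<subseteq> ?R"
        proof
          fix u assume "u \<in> Bl c s"
          then have "u \<in> Bl y (\<kappa> * (s + s))" using cs(2) Bl_sym Bl_trans by blast
          then have "u \<in> Bl j (\<kappa> * (th * rr + \<kappa> * (s + s)))" using yj Bl_trans by blast
          moreover have "\<kappa> * (th * rr + \<kappa> * (s + s)) \<le> \<kappa> * (th * rr + \<kappa> * (rr + rr))"
            using \<open>s < rr\<close> by (intro mult_le_mono2 add_le_mono order_refl) auto
          moreover have "\<kappa> * (th * rr + \<kappa> * (rr + rr)) = k" by (simp add: k_def c2_def algebra_simps)
          ultimately show "u \<in> ?R" using Bl_mono[of "\<kappa> * (th * rr + \<kappa> * (s + s))" k j] by auto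
        qed
        have "K * lam * V c s < (\<Sum>u\<in>Bl c s. w u * ?g u)" by (rule cs(3))
        also have "\<dots> \<le> (\<Sum>u\<in>Bl c s. w u * (g1 u + 2 * CA * lam))" using cR gR by (intro sum_mono mult_left_mono) auto
        also have "\<dots> = (\<Sum>u\<in>Bl c s. w u * g1 u) + 2 * CA * lam * V c s"
          by (simp add: distrib_left sum.distrib V_def sum_distrib_left mult_ac)
        also have "2 * CA * lam * V c s \<le> K * lam / 2 * V c s"
          using K1(3) lam Vc by (intro mult_right_mono) auto
        finally have "K * lam / 2 * V c s < (\<Sum>u\<in>Bl c s. w u * g1 u)" by simp
        then show ?thesis using cs(1,2) unfolding avg_le_def by (meson not_less)
      qed
      then have "(\<Sum>x\<in>G \<inter> Bl j (th * rr). w x) \<le> Dc ^ (3 * \<kappa>\<^sup>2) * (2 * (\<gamma> * lam * V j k)) / (K * lam / 2)"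
        using G by (intro weak_type[OF g1n g1T lam2]) auto
      also have "\<dots> = 4 * Dc ^ th * \<gamma> / K * V j k"
        using lam K1(1) by (simp add: th_def field_simps)
      also have "\<dots> \<le> 4 * Dc ^ th * \<gamma> / K * (Dc ^ c2 * V j rr)"
        unfolding k_def using \<gamma> K1(1) DC[of th] by (intro mult_left_mono V_mult rr) auto
      finally show ?thesis by (simp add: C0_def rr_def mult_ac)
    qed
    have "G \<subseteq> (\<Union>j\<in>J. G \<inter> Bl j (th * r j))"
    proof
      fix x assume x: "x \<in> G"
      then obtain j where "j \<in> J" "Bl x (r x) \<subseteq> Bl j (th * r j)" using J(3) by blast
      with Bl_self[OF rz(1)[OF x], of x] x show "x \<in> (\<Union>j\<in>J. G \<inter> Bl j (th * r j))" by blast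
    qed
    then have "(\<Sum>x\<in>G. w x) \<le> (\<Sum>x\<in>(\<Union>j\<in>J. G \<inter> Bl j (th * r j)). w x)" using fJ G by (intro sum_mono2) auto
    also have "\<dots> \<le> (\<Sum>j\<in>J. \<Sum>x\<in>G \<inter> Bl j (th * r j). w x)" using fJ G by (intro sum_UN_le) auto
    also have "\<dots> \<le> (\<Sum>j\<in>J. C0 * \<gamma> / K * V j (r j))" by (intro sum_mono loc)
    also have "\<dots> = C0 * \<gamma> / K * (\<Sum>j\<in>J. \<Sum>x\<in>Bl j (r j). w x)" by (simp add: sum_distrib_left V_def)
    also have "(\<Sum>j\<in>J. \<Sum>x\<in>Bl j (r j). w x) = (\<Sum>x\<in>(\<Union>j\<in>J. Bl j (r j)). w x)"
      using fJ J(2) by (intro sum.UNION_disjoint[symmetric]) auto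
    also have "C0 * \<gamma> / K * \<dots> \<le> C0 * \<gamma> / K * lev ?g lam"
    proof (intro mult_left_mono lev_upper[OF g0 T' lam])
      show "finite (\<Union>j\<in>J. Bl j (r j))" using fJ by simp
      show "0 \<le> C0 * \<gamma> / K" using \<gamma> K1(1) DC[of th] DC[of c2] by (simp add: C0_def)
      show "\<And>x. x \<in> (\<Union>j\<in>J. Bl j (r j)) \<Longrightarrow> \<not> avg_le ?g lam x" using rz(2) J(1) by blast
    qed
    finally show ?thesis .
  qed
  moreover have "1 \<le> K0" using CA(1) DC[of C1] by (simp add: K0_def)
  moreover have "0 \<le> C0" using DC[of th] DC[of c2] by (simp add: C0_def)
  ultimately show ?thesis by blast
qed

section \<open>Duality\<close>

text \<open>The hypotheses on an operator that enter the interpolation argument. The adjoint is described by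
  its values at points, and used on finitely supported functions only.\<close>

definition admissible :: "(('a \<Rightarrow> real) \<Rightarrow> 'a \<Rightarrow> real) \<Rightarrow> real \<Rightarrow> real \<Rightarrow> bool" where
  "admissible T A2 A1 \<longleftrightarrow> 0 \<le> A2 \<and> 0 \<le> A1 \<and> linear_op (Lp (vol mu) 2) T \<and>
     (\<forall>f. l2 f \<longrightarrow> l2 (T f) \<and> n2 (T f) \<le> A2 * n2 f) \<and>
     (\<forall>x k b S. 1 \<le> k \<longrightarrow> finite S \<longrightarrow> (\<forall>z. b z \<noteq> 0 \<longrightarrow> z \<in> Bl x k) \<longrightarrow>
        (\<Sum>z\<in>S. w z * \<bar>T (\<lambda>z. b z - Av k b z) z\<bar>) \<le> A1 * (sqrt (V x k) * s2 (Bl x k) b))"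

definition Tadj :: "(('a \<Rightarrow> real) \<Rightarrow> 'a \<Rightarrow> real) \<Rightarrow> ('a \<Rightarrow> real) \<Rightarrow> 'a \<Rightarrow> real" where
  "Tadj T h x = ip h (T (delta x)) / w x"

lemma admissible_sum:
  assumes T: "linear_op (Lp (vol mu) 2) T" and S: "finite S"
  shows "T (\<lambda>x. \<Sum>y\<in>S. c y * delta y x) = (\<lambda>x. \<Sum>y\<in>S. c y * T (delta y) x)"
  using S
proof (induction S rule: finite_induct)
  case empty
  show ?case
    using T[unfolded linear_op_def, THEN conjunct2, rule_format, OF fin_l2(1)[OF fin_zero], of 0] by simp
next
  case (insert y S)
  have "l2 (\<lambda>x. c y * delta y x)" "l2 (\<lambda>x. \<Sum>y\<in>S. c y * delta y x)"
    by (intro fin_l2 fin_sum fin_cmult fin_delta)+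
  then have "T (\<lambda>x. c y * delta y x + (\<Sum>y\<in>S. c y * delta y x)) = (\<lambda>x. T (\<lambda>x. c y * delta y x) x + T (\<lambda>x. \<Sum>y\<in>S. c y * delta y x) x)"
    by (rule T[unfolded linear_op_def, THEN conjunct1, rule_format])
  moreover have "T (\<lambda>x. c y * delta y x) = (\<lambda>x. c y * T (delta y) x)"
    by (rule T[unfolded linear_op_def, THEN conjunct2, rule_format]) (rule fin_l2(1)[OF fin_delta])
  ultimately show ?case using insert by simp
qed

lemma Tadj_dual:
  assumes T: "linear_op (Lp (vol mu) 2) T" and b: "fin b"
  shows "ip h (T b) = ip b (Tadj T h)"
proof -
  let ?S = "{y. b y \<noteq> 0}"
  have S: "finite ?S" using b by (rule fin_supp)
  have bd: "b = (\<lambda>x. \<Sum>y\<in>?S. b y * delta y x)" by (rule fin_decomp[OF S]) auto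
  have "T b = (\<lambda>x. \<Sum>y\<in>?S. b y * T (delta y) x)" by (subst bd) (rule admissible_sum[OF T S])
  then have "ip h (T b) = (\<Sum>y\<in>?S. b y * ip h (T (delta y)))" by (simp add: ip_sum_right ip_cmult_right)
  also have "\<dots> = (\<Sum>y\<in>?S. w y * b y * Tadj T h y)" by (intro sum.cong) (auto simp: Tadj_def)
  also have "\<dots> = ip b (Tadj T h)" by (simp add: ip_def)
  finally show ?thesis .
qed

lemma ip_cauchy_schwarz: assumes "fin h" "l2 g" shows "\<bar>ip h g\<bar> \<le> sqrt (ip h h) * n2 g"
proof -
  let ?S = "{x. h x \<noteq> 0}"
  have S: "finite ?S" using assms by (simp add: fin_def)
  have "\<bar>ip h g\<bar> \<le> (\<Sum>x\<in>?S. \<bar>sqrt (w x) * h x\<bar> * \<bar>sqrt (w x) * g x\<bar>)"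
    unfolding ip_def
  proof (rule order_trans[OF sum_abs], rule sum_mono)
    fix x
    have "\<bar>sqrt (w x) * h x\<bar> * \<bar>sqrt (w x) * g x\<bar> = (sqrt (w x))\<^sup>2 * \<bar>h x\<bar> * \<bar>g x\<bar>"
      by (simp only: abs_mult abs_of_nonneg[OF real_sqrt_ge_zero[OF w_nonneg]] power2_eq_square mult_ac)
    then have e: "\<bar>sqrt (w x) * h x\<bar> * \<bar>sqrt (w x) * g x\<bar> = w x * \<bar>h x\<bar> * \<bar>g x\<bar>"
      by (simp only: real_sqrt_pow2[OF w_nonneg])
    show "\<bar>w x * h x * g x\<bar> \<le> \<bar>sqrt (w x) * h x\<bar> * \<bar>sqrt (w x) * g x\<bar>" unfolding e by (simp add: abs_mult)
  qed
  also have "\<dots> \<le> s2 ?S h * s2 ?S g" unfolding s2_L2_set by (rule L2_set_mult_ineq)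
  also have "s2 ?S h = sqrt (ip h h)"
    unfolding s2_def ip_def by (simp add: power2_eq_square mult.assoc)
  also have "sqrt (ip h h) * s2 ?S g \<le> sqrt (ip h h) * n2 g"
    by (intro mult_left_mono s2_le assms S) (auto simp: ip_self_nonneg)
  finally show ?thesis .
qed

lemma Tadj_l2:
  assumes T: "admissible T A2 A1" and h: "fin h" and S: "finite S"
  shows "s2 S (Tadj T h) \<le> A2 * sqrt (ip h h)"
proof -
  have A2: "0 \<le> A2" and lin: "linear_op (Lp (vol mu) 2) T" and bd: "\<And>f. l2 f \<Longrightarrow> l2 (T f)" "\<And>f. l2 f \<Longrightarrow> n2 (T f) \<le> A2 * n2 f"
    using T unfolding admissible_def by blast+
  let ?s = "s2 S (Tadj T h)"
  let ?b = "cut S (Tadj T h)"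
  have b: "fin ?b" using S by simp
  have "?s\<^sup>2 = ip ?b (Tadj T h)"
    unfolding s2_sq using S by (subst ip_eq[OF S]) (auto simp: cut_def power2_eq_square mult.assoc b[unfolded cut_def] split: if_splits)
  also have "\<dots> = ip h (T ?b)" by (rule Tadj_dual[OF lin b, symmetric])
  also have "\<dots> \<le> sqrt (ip h h) * n2 (T ?b)" using ip_cauchy_schwarz[OF h bd(1)[OF fin_l2(1)[OF b]]] by simp
  also have "\<dots> \<le> sqrt (ip h h) * (A2 * ?s)"
  proof (intro mult_left_mono)
    have "n2 (T ?b) \<le> A2 * n2 ?b" by (intro bd fin_l2 b)
    also have "\<dots> \<le> A2 * ?s" using fin_l2(2)[OF b] A2 by (intro mult_left_mono) (auto simp: ip_cut S)
    finally show "n2 (T ?b) \<le> A2 * ?s" .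
  qed (simp add: ip_self_nonneg)
  finally have "?s * ?s \<le> (A2 * sqrt (ip h h)) * ?s" by (simp add: power2_eq_square mult_ac)
  then show ?thesis
    using A2 ip_self_nonneg[of h] by (cases "?s = 0") (auto simp: mult_le_cancel_right less_le intro!: mult_nonneg_nonneg)
qed

text \<open>Testing against the restriction of the oscillation to the ball moves \<open>I - A\<^sub>k\<close>, which is symmetric,
  onto the test function; this turns it into an atom.\<close>

lemma Tadj_sharp:
  assumes T: "admissible T A2 A1" and h: "fin h" "\<And>x. \<bar>h x\<bar> \<le> M" and k: "1 \<le> k"
  shows "(s2 (Bl x k) (\<lambda>u. Tadj T h u - Av k (Tadj T h) u))\<^sup>2 \<le> (A1 * M)\<^sup>2 * V x k"
proof -
  have A1: "0 \<le> A1" and lin: "linear_op (Lp (vol mu) 2) T"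
    and atom: "\<And>x k b S. 1 \<le> k \<Longrightarrow> finite S \<Longrightarrow> (\<forall>z. b z \<noteq> 0 \<longrightarrow> z \<in> Bl x k) \<Longrightarrow>
        (\<Sum>z\<in>S. w z * \<bar>T (\<lambda>z. b z - Av k b z) z\<bar>) \<le> A1 * (sqrt (V x k) * s2 (Bl x k) b)"
    using T unfolding admissible_def by blast+
  let ?Q = "Bl x k"
  let ?F = "\<lambda>u. Tadj T h u - Av k (Tadj T h) u"
  let ?s = "s2 ?Q ?F"
  let ?b = "cut ?Q ?F"
  have b: "fin ?b" by simp
  have M: "0 \<le> M" using h(2) by (meson abs_ge_zero order_trans)
  have sb: "s2 ?Q ?b = ?s" by (rule s2_cong) (simp add: cut_def)
  have "?s\<^sup>2 = ip ?b ?F"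
    unfolding s2_sq by (subst ip_eq[OF finite_Bl]) (auto simp: cut_def power2_eq_square mult.assoc b[unfolded cut_def] split: if_splits)
  also have "\<dots> = ip ?b (pol (1 - Aq k) (Tadj T h))" unfolding I_Av_pol ..
  also have "\<dots> = ip (pol (1 - Aq k) ?b) (Tadj T h)" by (rule ip_pol[OF b, symmetric])
  also have "\<dots> = ip h (T (pol (1 - Aq k) ?b))" by (rule Tadj_dual[OF lin fin_pol[OF b], symmetric])
  also have "\<dots> \<le> (\<Sum>z | h z \<noteq> 0. M * (w z * \<bar>T (pol (1 - Aq k) ?b) z\<bar>))"
    unfolding ip_def
  proof (rule sum_mono)
    fix z
    have "w z * h z * T (pol (1 - Aq k) ?b) z \<le> \<bar>w z * h z * T (pol (1 - Aq k) ?b) z\<bar>" by simp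
    also have "\<dots> = \<bar>h z\<bar> * (w z * \<bar>T (pol (1 - Aq k) ?b) z\<bar>)" by (simp add: abs_mult)
    also have "\<dots> \<le> M * (w z * \<bar>T (pol (1 - Aq k) ?b) z\<bar>)" by (intro mult_right_mono h) auto
    finally show "w z * h z * T (pol (1 - Aq k) ?b) z \<le> M * (w z * \<bar>T (pol (1 - Aq k) ?b) z\<bar>)" .
  qed
  also have "\<dots> = M * (\<Sum>z | h z \<noteq> 0. w z * \<bar>T (\<lambda>z. ?b z - Av k ?b z) z\<bar>)"
    unfolding I_Av_pol by (simp only: sum_distrib_left)
  also have "\<dots> \<le> M * (A1 * (sqrt (V x k) * ?s))"
    using atom[OF k fin_supp[OF h(1)], of ?b x] M unfolding sb by (intro mult_left_mono) (auto simp: cut_def)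
  finally have "?s * ?s \<le> (A1 * M * sqrt (V x k)) * ?s" by (simp add: power2_eq_square mult_ac)
  then have "?s \<le> A1 * M * sqrt (V x k)"
    using A1 M by (cases "?s = 0") (auto simp: mult_le_cancel_right less_le intro!: mult_nonneg_nonneg)
  then have "?s\<^sup>2 \<le> (A1 * M * sqrt (V x k))\<^sup>2" by (intro power_mono) auto
  then show ?thesis by (simp add: power_mult_distrib)
qed

lemma Tadj_add:
  assumes "fin h1" "fin h2" shows "Tadj T (\<lambda>x. h1 x + h2 x) = (\<lambda>x. Tadj T h1 x + Tadj T h2 x)"
  using assms by (simp add: Tadj_def fun_eq_iff ip_add_left add_divide_distrib)

end

section \<open>Interpolation\<close>

lemma holder_sum:
  fixes a b v :: "'b \<Rightarrow> real"
  assumes S: "finite S" and v: "\<And>x. 0 \<le> v x" and a: "\<And>x. 0 \<le> a x" and b: "\<And>x. 0 \<le> b x"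
    and p: "1 < p" "1 < r" "1 / p + 1 / r = 1"
  shows "(\<Sum>x\<in>S. v x * (a x * b x)) \<le> (\<Sum>x\<in>S. v x * a x powr p) powr (1 / p) * (\<Sum>x\<in>S. v x * b x powr r) powr (1 / r)"
proof -
  let ?A = "\<Sum>x\<in>S. v x * a x powr p" and ?B = "\<Sum>x\<in>S. v x * b x powr r"
  have nn: "0 \<le> ?A" "0 \<le> ?B" using v by (auto intro!: sum_nonneg)
  show ?thesis
  proof (cases "?A = 0 \<or> ?B = 0")
    case True
    have "v x * (a x * b x) = 0" if "x \<in> S" for x
    proof -
      have "v x * a x powr p = 0 \<or> v x * b x powr r = 0"
        using True that sum_nonneg_eq_0_iff[OF S, of "\<lambda>x. v x * a x powr p"] sum_nonneg_eq_0_iff[OF S, of "\<lambda>x. v x * b x powr r"] v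
        by auto
      then show ?thesis by auto
    qed
    then have "(\<Sum>x\<in>S. v x * (a x * b x)) = 0" by (intro sum.neutral) blast
    then show ?thesis by (metis mult_nonneg_nonneg powr_ge_zero)
  next
    case False
    then have pos: "0 < ?A" "0 < ?B" using nn by auto
    define \<alpha> where "\<alpha> = ?A powr (1 / p)"
    define \<beta> where "\<beta> = ?B powr (1 / r)"
    have ab: "0 < \<alpha>" "0 < \<beta>" "\<alpha> powr p = ?A" "\<beta> powr r = ?B" using pos p by (auto simp: \<alpha>_def \<beta>_def powr_powr)
    have "(\<Sum>x\<in>S. v x * (a x / \<alpha> * (b x / \<beta>))) \<le> (\<Sum>x\<in>S. v x * ((a x / \<alpha>) powr p / p + (b x / \<beta>) powr r / r))"
      using p v a b ab by (intro sum_mono mult_left_mono Youngs_inequality) auto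
    also have "\<dots> = (\<Sum>x\<in>S. (v x * a x powr p) / (?A * p) + (v x * b x powr r) / (?B * r))"
      using ab a b by (intro sum.cong) (auto simp: powr_divide algebra_simps)
    also have "\<dots> = ?A / (?A * p) + ?B / (?B * r)" by (simp add: sum.distrib sum_divide_distrib)
    also have "\<dots> = 1" using pos p by simp
    finally have "(\<Sum>x\<in>S. v x * (a x / \<alpha> * (b x / \<beta>))) \<le> 1" .
    moreover have "(\<Sum>x\<in>S. v x * (a x / \<alpha> * (b x / \<beta>))) = (\<Sum>x\<in>S. v x * (a x * b x)) / (\<alpha> * \<beta>)"
      by (simp add: sum_divide_distrib)
    ultimately have "(\<Sum>x\<in>S. v x * (a x * b x)) \<le> \<alpha> * \<beta>" using ab by (simp add: divide_le_eq)
    then show ?thesis by (simp add: \<alpha>_def \<beta>_def)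
  qed
qed

lemma powr_level: "0 < K \<Longrightarrow> 0 < \<tau> \<Longrightarrow> (\<tau> * K ^ i) powr s = \<tau> powr s * (K powr s) ^ i" for K \<tau> s :: real
  by (simp add: powr_mult powr_powr mult.commute flip: powr_realpow)

lemma geometric_levels:
  fixes K \<tau> s u :: real
  assumes K: "1 < K" and \<tau>: "0 < \<tau>" and s: "0 < s"
  shows "(\<Sum>i<n. if \<tau> * K ^ i < u then (\<tau> * K ^ i) powr s else 0) \<le> K powr s / (K powr s - 1) * u powr s"
proof (induction n)
  case 0
  have "1 < K powr s" using K s by (simp add: gr_one_powr)
  then show ?case by simp
next
  case (Suc n)
  let ?q = "K powr s"
  have q: "1 < ?q" using K s by (simp add: gr_one_powr)
  show ?case
  proof (cases "\<tau> * K ^ n < u")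
    case False
    then show ?thesis using Suc by simp
  next
    case True
    have "(\<Sum>i<Suc n. if \<tau> * K ^ i < u then (\<tau> * K ^ i) powr s else 0) \<le> (\<Sum>i<Suc n. \<tau> powr s * ?q ^ i)"
      using K \<tau> by (intro sum_mono) (auto simp: powr_level)
    also have "\<dots> = \<tau> powr s * ((?q ^ Suc n - 1) / (?q - 1))"
      using q geometric_sum[of ?q "Suc n"] by (simp only: sum_distrib_left[symmetric])
    also have "\<dots> \<le> \<tau> powr s * (?q ^ Suc n / (?q - 1))"
      using q by (intro mult_left_mono divide_right_mono) auto
    also have "\<dots> = ?q / (?q - 1) * (\<tau> * K ^ n) powr s" using K \<tau> by (simp add: powr_level)
    also have "\<dots> \<le> ?q / (?q - 1) * u powr s"
    proof (rule mult_left_mono)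
      show "(\<tau> * K ^ n) powr s \<le> u powr s" using True K \<tau> s by (intro powr_mono2) auto
      show "0 \<le> ?q / (?q - 1)" using q by (intro divide_nonneg_nonneg) linarith+
    qed
    finally show ?thesis .
  qed
qed

lemma le_of_small_powr:
  fixes X A B s :: real
  assumes "0 < s" "0 \<le> A" "\<And>\<tau>. 0 < \<tau> \<Longrightarrow> X \<le> \<tau> powr s * A + B"
  shows "X \<le> B"
proof (rule field_le_epsilon)
  fix e :: real assume e: "0 < e"
  define \<tau> where "\<tau> = (e / (A + 1)) powr (1 / s)"
  have A1: "0 < A + 1" using assms by simp
  then have t: "0 < \<tau>" "\<tau> powr s = e / (A + 1)" using e assms by (auto simp: \<tau>_def powr_powr)
  have "e / (A + 1) * A = e * (A / (A + 1))" by simp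
  also have "\<dots> \<le> e * 1" using e A1 assms(2) by (intro mult_left_mono) (auto simp: divide_le_eq_1)
  finally show "X \<le> B + e" using assms(3)[OF t(1)] t(2) by simp
qed

context riesz_graph
begin

text \<open>Where the sharp function of \<open>T\<^sup>*h\<close> is large, the part of \<open>h\<close> above the corresponding height is
  responsible: the bounded part has a small sharp function, the rest is square summable.\<close>

lemma sharp_level:
  "\<exists>C\<ge>0. \<forall>T A2 A1 h lam \<gamma> \<eta> G. admissible T A2 A1 \<longrightarrow> fin h \<longrightarrow> 0 < lam \<longrightarrow> 0 < \<gamma> \<longrightarrow> 0 \<le> \<eta> \<longrightarrow> 4 * (A1 * \<eta>)\<^sup>2 \<le> \<gamma> \<longrightarrow>
     finite G \<longrightarrow> (\<forall>y\<in>G. \<not> sharp_le (Tadj T h) (\<gamma> * lam) y) \<longrightarrow>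
     (\<Sum>x\<in>G. w x) \<le> C * A2\<^sup>2 / (\<gamma> * lam) * (\<Sum>x | h x \<noteq> 0. if \<eta> * sqrt lam < \<bar>h x\<bar> then w x * (h x)\<^sup>2 else 0)"
proof -
  obtain CA where CA: "CA \<ge> 1" "\<And>g lam x k y z. (\<forall>u. 0 \<le> g u) \<Longrightarrow> 1 \<le> k \<Longrightarrow> y \<in> Bl x k \<Longrightarrow> z \<in> Bl x k \<Longrightarrow> avg_le g lam z \<Longrightarrow> Av k g y \<le> CA * lam"
    using Av_maximal by blast
  define C where "C = 16 * CA * Dc ^ (3 * \<kappa>\<^sup>2)"
  have "(\<Sum>x\<in>G. w x) \<le> C * A2\<^sup>2 / (\<gamma> * lam) * (\<Sum>x | h x \<noteq> 0. if \<eta> * sqrt lam < \<bar>h x\<bar> then w x * (h x)\<^sup>2 else 0)"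
    if T: "admissible T A2 A1" and h: "fin h" and lam: "0 < lam" and \<gamma>: "0 < \<gamma>" and \<eta>: "0 \<le> \<eta>" and g4: "4 * (A1 * \<eta>)\<^sup>2 \<le> \<gamma>"
      and G: "finite G" and bad: "\<forall>y\<in>G. \<not> sharp_le (Tadj T h) (\<gamma> * lam) y" for T A2 A1 h lam \<gamma> \<eta> G
  proof -
    define h2 where "h2 = (\<lambda>x. if \<eta> * sqrt lam < \<bar>h x\<bar> then h x else 0)"
    define h1 where "h1 = (\<lambda>x. if \<eta> * sqrt lam < \<bar>h x\<bar> then 0 else h x)"
    have h12: "h = (\<lambda>x. h1 x + h2 x)" by (auto simp: h1_def h2_def)
    have f1: "fin h1" and f2: "fin h2" using fin_supp[OF h]
      by (auto simp: fin_def h1_def h2_def intro: finite_subset[rotated])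
    have h1b: "\<And>x. \<bar>h1 x\<bar> \<le> \<eta> * sqrt lam" using \<eta> lam by (auto simp: h1_def)
    have A2: "0 \<le> A2" using T by (simp add: admissible_def)
    let ?H = "\<Sum>x | h x \<noteq> 0. if \<eta> * sqrt lam < \<bar>h x\<bar> then w x * (h x)\<^sup>2 else 0"
    have H: "ip h2 h2 = ?H"
      using fin_supp[OF h] f2
      by (subst ip_eq[of "{x. h x \<noteq> 0}"]) (auto simp: h2_def power2_eq_square mult.assoc intro!: sum.cong split: if_splits)
    let ?F = "Tadj T h" and ?F1 = "Tadj T h1" and ?F2 = "Tadj T h2"
    have F: "?F = (\<lambda>x. ?F1 x + ?F2 x)" by (subst h12) (rule Tadj_add[OF f1 f2])
    define lam' where "lam' = \<gamma> * lam / (16 * CA)"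
    have lam': "0 < lam'" using \<gamma> lam CA(1) by (simp add: lam'_def)
    let ?g = "\<lambda>z. (?F2 z)\<^sup>2"
    have notavg: "\<not> avg_le ?g lam' y" if y: "y \<in> G" for y
    proof
      assume avg: "avg_le ?g lam' y"
      obtain x k where xk: "1 \<le> k" "y \<in> Bl x k" "\<gamma> * lam * V x k < (s2 (Bl x k) (\<lambda>u. ?F u - Av k ?F u))\<^sup>2"
        using bad y unfolding sharp_le_def by (meson not_less)
      let ?Q = "Bl x k"
      let ?d1 = "\<lambda>u. ?F1 u - Av k ?F1 u" and ?d2 = "\<lambda>u. ?F2 u - Av k ?F2 u"
      have "(\<lambda>u. ?F u - Av k ?F u) = (\<lambda>u. ?d1 u + ?d2 u)"
      proof -
        have I: "g u - Av k g u = pol (1 - Aq k) g u" for g u using I_Av_pol[of g k] by (rule fun_cong)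
        show ?thesis unfolding I by (subst F) (simp only: pol_add_arg)
      qed
      then have "s2 ?Q (\<lambda>u. ?F u - Av k ?F u) \<le> s2 ?Q ?d1 + s2 ?Q ?d2" using s2_triangle[of ?Q ?d1 ?d2] by simp
      then have "(s2 ?Q (\<lambda>u. ?F u - Av k ?F u))\<^sup>2 \<le> (s2 ?Q ?d1 + s2 ?Q ?d2)\<^sup>2" by (intro power_mono) auto
      also have "\<dots> \<le> 2 * (s2 ?Q ?d1)\<^sup>2 + 2 * (s2 ?Q ?d2)\<^sup>2"
        using sum_squares_bound[of "s2 ?Q ?d1" "s2 ?Q ?d2"] by (simp only: power2_sum)
      finally have a: "\<gamma> * lam * V x k < 2 * (s2 ?Q ?d1)\<^sup>2 + 2 * (s2 ?Q ?d2)\<^sup>2" using xk(3) by linarith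
      have "(s2 ?Q ?d1)\<^sup>2 \<le> (A1 * (\<eta> * sqrt lam))\<^sup>2 * V x k" by (rule Tadj_sharp[OF T f1 h1b xk(1)])
      also have "(A1 * (\<eta> * sqrt lam))\<^sup>2 = (A1 * \<eta>)\<^sup>2 * lam" using lam by (simp add: power_mult_distrib)
      also have "(A1 * \<eta>)\<^sup>2 * lam * V x k \<le> \<gamma> / 4 * lam * V x k" using g4 lam by (intro mult_right_mono) auto
      finally have d1: "(s2 ?Q ?d1)\<^sup>2 \<le> \<gamma> * lam * V x k / 4" by simp
      have "(s2 ?Q ?d2)\<^sup>2 \<le> (\<Sum>u\<in>?Q. w u * (2 * ?g u + 2 * (CA * lam')))"
        unfolding s2_sq
      proof (intro sum_mono mult_left_mono)
        fix u assume u: "u \<in> ?Q"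
        have "(?d2 u)\<^sup>2 = (?F2 u + - Av k ?F2 u)\<^sup>2" by simp
        also have "\<dots> \<le> 2 * ?g u + 2 * (Av k ?F2 u)\<^sup>2"
          using sum_squares_bound[of "?F2 u" "- Av k ?F2 u"] unfolding power2_sum by simp
        also have "(Av k ?F2 u)\<^sup>2 \<le> Av k ?g u" by (rule Av_square[OF xk(1)])
        also have "Av k ?g u \<le> CA * lam'" by (rule CA(2)[OF _ xk(1) u xk(2) avg]) simp
        finally show "(?d2 u)\<^sup>2 \<le> 2 * ?g u + 2 * (CA * lam')" by simp
      qed auto
      also have "\<dots> = 2 * (\<Sum>u\<in>?Q. w u * ?g u) + 2 * (CA * lam') * V x k"
        by (simp add: distrib_left sum.distrib V_def sum_distrib_left mult_ac)
      also have "(\<Sum>u\<in>?Q. w u * ?g u) \<le> lam' * V x k" using avg xk unfolding avg_le_def by blast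
      also have "lam' * V x k \<le> CA * lam' * V x k" using CA(1) lam' by (intro mult_right_mono) auto
      finally have "(s2 ?Q ?d2)\<^sup>2 \<le> 4 * (CA * lam' * V x k)" by simp
      also have "\<dots> = \<gamma> * lam * V x k / 4" using CA(1) by (simp add: lam'_def)
      finally show False using a d1 by linarith
    qed
    have T2: "(\<Sum>z\<in>S. w z * ?g z) \<le> A2\<^sup>2 * ?H" if S: "finite S" for S
    proof -
      have "(s2 S ?F2)\<^sup>2 \<le> (A2 * sqrt (ip h2 h2))\<^sup>2" by (intro power_mono Tadj_l2[OF T f2 S]) auto
      then show ?thesis using ip_self_nonneg[of h2] by (simp add: s2_sq power_mult_distrib H)
    qed
    have "(\<Sum>x\<in>G. w x) \<le> Dc ^ (3 * \<kappa>\<^sup>2) * (A2\<^sup>2 * ?H) / lam'"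
      using notavg by (intro weak_type[OF _ T2 lam' G]) auto
    also have "\<dots> = C * A2\<^sup>2 / (\<gamma> * lam) * ?H" by (simp add: C_def lam'_def)
    finally show ?thesis .
  qed
  moreover have "0 \<le> C" using CA(1) Dc(1) by (simp add: C_def)
  ultimately show ?thesis by blast
qed

text \<open>The good-\<open>\<lambda>\<close> inequality and \<open>sharp_level\<close>, on the geometric scale of levels \<open>\<tau> K\<^sup>i\<close>, bound the level
  sets of the maximal function of \<open>(T\<^sup>*h)\<^sup>2\<close> recursively. After multiplication by the power \<open>\<sigma>\<close> of the level,
  the recursion has the factor \<open>1/2\<close> and can be summed. The sum over the inhomogeneous terms is controlled by the
  norm of \<open>h\<close>.
  The recursion needs a smallest level, which is \<open>\<tau>\<close>; everything that refers to the
  first level carries a positive power of \<open>\<tau>\<close> and disappears as \<open>\<tau>\<close> tends to \<open>0\<close>.\<close>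

theorem adjoint_bound:
  assumes T: "admissible T A2 A1" and \<sigma>: "1 < \<sigma>"
  shows "\<exists>C\<ge>0. \<forall>h S. fin h \<longrightarrow> finite S \<longrightarrow>
    (\<Sum>x\<in>S. w x * ((Tadj T h x)\<^sup>2) powr \<sigma>) \<le> C * (\<Sum>x | h x \<noteq> 0. w x * ((h x)\<^sup>2) powr \<sigma>)"
proof -
  obtain C0 K0 where C0: "C0 \<ge> 0" "K0 \<ge> 1" and gl: "\<And>F T lam \<gamma> K G. (\<forall>S. finite S \<longrightarrow> (\<Sum>z\<in>S. w z * (F z)\<^sup>2) \<le> T) \<Longrightarrow> 0 < lam \<Longrightarrow> 0 \<le> \<gamma> \<Longrightarrow> K0 \<le> K \<Longrightarrow>
    finite G \<Longrightarrow> (\<forall>y\<in>G. \<not> avg_le (\<lambda>z. (F z)\<^sup>2) (K * lam) y \<and> sharp_le F (\<gamma> * lam) y) \<Longrightarrow>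
    (\<Sum>x\<in>G. w x) \<le> C0 * \<gamma> / K * lev (\<lambda>z. (F z)\<^sup>2) lam"
    using good_lambda by blast
  obtain CS where CS: "CS \<ge> 0" and sl: "\<And>T A2 A1 h lam \<gamma> \<eta> G. admissible T A2 A1 \<Longrightarrow> fin h \<Longrightarrow> 0 < lam \<Longrightarrow> 0 < \<gamma> \<Longrightarrow> 0 \<le> \<eta> \<Longrightarrow> 4 * (A1 * \<eta>)\<^sup>2 \<le> \<gamma> \<Longrightarrow>
     finite G \<Longrightarrow> (\<forall>y\<in>G. \<not> sharp_le (Tadj T h) (\<gamma> * lam) y) \<Longrightarrow>
     (\<Sum>x\<in>G. w x) \<le> CS * A2\<^sup>2 / (\<gamma> * lam) * (\<Sum>x | h x \<noteq> 0. if \<eta> * sqrt lam < \<bar>h x\<bar> then w x * (h x)\<^sup>2 else 0)"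
    using sharp_level by blast
  have A: "0 \<le> A2" "0 \<le> A1" using T by (auto simp: admissible_def)
  define K where "K = K0 + 1"
  define s where "s = \<sigma> - 1"
  have K: "1 < K" "K0 \<le> K" using C0 by (auto simp: K_def)
  have s: "0 < s" using \<sigma> by (simp add: s_def)
  \<comment> \<open>\<open>\<gamma>\<close> makes the factor of the recursion at most \<open>1/2\<close> (\<open>coef\<close>); \<open>\<eta>\<close> is the relative height at which \<open>h\<close>
    is cut, such that the bounded part stays below \<open>\<gamma>\<close> in \<open>sharp_level\<close>.\<close>
  define \<gamma> where "\<gamma> = 1 / (2 * (C0 + 1) * K powr s)"
  have \<gamma>: "0 < \<gamma>" using C0 K by (simp add: \<gamma>_def)
  define \<eta> where "\<eta> = sqrt \<gamma> / (2 * (A1 + 1))"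
  have \<eta>: "0 < \<eta>" using \<gamma> A by (simp add: \<eta>_def)
  have g4: "4 * (A1 * \<eta>)\<^sup>2 \<le> \<gamma>"
  proof -
    have e1: "2 * (A1 * \<eta>) = A1 / (A1 + 1) * sqrt \<gamma>" using A by (simp add: \<eta>_def field_simps)
    have e2: "4 * (A1 * \<eta>)\<^sup>2 = (2 * (A1 * \<eta>))\<^sup>2" by (simp add: power_mult_distrib)
    have "4 * (A1 * \<eta>)\<^sup>2 = (A1 / (A1 + 1))\<^sup>2 * \<gamma>"
      unfolding e2 e1 by (simp only: power_mult_distrib real_sqrt_pow2[OF less_imp_le[OF \<gamma>]])
    also have "\<dots> \<le> 1\<^sup>2 * \<gamma>" using \<gamma> A by (intro mult_right_mono power_mono) (auto simp: divide_le_eq_1)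
    finally show ?thesis by simp
  qed
  define M where "M = K powr \<sigma> * (CS * A2\<^sup>2 / \<gamma>)"
  have M: "0 \<le> M" using CS \<gamma> by (simp add: M_def)
  define c where "c = K powr s / (K powr s - 1) * (1 / \<eta>\<^sup>2) powr s"
  have q1: "1 < K powr s" using K s by (simp add: gr_one_powr)
  have c: "0 \<le> c" using q1 by (simp add: c_def)
  have coef: "K powr \<sigma> * (C0 * \<gamma> / K) \<le> 1 / 2"
  proof -
    have "K powr \<sigma> = K * K powr s" using K unfolding s_def by (simp add: powr_diff)
    then have "K powr \<sigma> * (C0 * \<gamma> / K) = C0 / (2 * (C0 + 1))"
    proof -
      have "k * q * (C * (1 / (2 * (C + 1) * q)) / k) = C / (2 * (C + 1))" if "0 < k" "0 < q" for k q C :: real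
        using that by simp
      from this[of K "K powr s" C0] \<open>K powr \<sigma> = K * K powr s\<close> show ?thesis using K by (simp only: \<gamma>_def powr_gt_zero)
    qed
    also have "\<dots> \<le> 1 / 2" using C0 by (simp add: field_simps)
    finally show ?thesis .
  qed
  have "(\<Sum>x\<in>S. w x * ((Tadj T h x)\<^sup>2) powr \<sigma>) \<le> (2 * K powr \<sigma> * M * c) * (\<Sum>x | h x \<noteq> 0. w x * ((h x)\<^sup>2) powr \<sigma>)"
    if h: "fin h" and S: "finite S" for h S
  proof -
    let ?F = "Tadj T h"
    let ?g = "\<lambda>z. (?F z)\<^sup>2"
    define W where "W = (\<Sum>x | h x \<noteq> 0. w x * ((h x)\<^sup>2) powr \<sigma>)"
    define T0 where "T0 = A2\<^sup>2 * ip h h"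
    have T0: "(\<Sum>z\<in>S. w z * ?g z) \<le> T0" if S: "finite S" for S
    proof -
      have "(s2 S ?F)\<^sup>2 \<le> (A2 * sqrt (ip h h))\<^sup>2" by (intro power_mono Tadj_l2[OF T h S]) auto
      then show ?thesis using ip_self_nonneg[of h] by (simp add: s2_sq power_mult_distrib T0_def)
    qed
    have T0n: "0 \<le> T0" using ip_self_nonneg[of h] by (simp add: T0_def)
    have g0: "\<And>z. 0 \<le> ?g z" by simp
    define D where "D = Dc ^ (3 * \<kappa>\<^sup>2)"
    have D: "0 \<le> D" using Dc(1) by (simp add: D_def)
    have main: "(\<Sum>x\<in>S. w x * ?g x powr \<sigma>) \<le> \<tau> powr s * (T0 + 2 * K powr \<sigma> * D * T0) + (2 * K powr \<sigma> * M * c) * W"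
      if \<tau>: "0 < \<tau>" for \<tau>
    proof -
      define lam where "lam i = \<tau> * K ^ i" for i
      have lam: "0 < lam i" "lam (Suc i) = K * lam i" for i using \<tau> K by (auto simp: lam_def)
      define a where "a i = lev ?g (lam i)" for i
      have a0: "0 \<le> a i" for i unfolding a_def by (rule lev_nonneg[OF g0 T0 lam(1)])
      define H where "H i = (\<Sum>x | h x \<noteq> 0. if \<eta> * sqrt (lam i) < \<bar>h x\<bar> then w x * (h x)\<^sup>2 else 0)" for i
      have H0: "0 \<le> H i" for i unfolding H_def by (intro sum_nonneg) auto
      have rec: "a (Suc i) \<le> C0 * \<gamma> / K * a i + CS * A2\<^sup>2 / (\<gamma> * lam i) * H i" for i
        unfolding a_def[of "Suc i"]
      proof (rule lev_least)
        fix G assume G: "finite G" "\<forall>x\<in>G. \<not> avg_le ?g (lam (Suc i)) x"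
        let ?G1 = "{y \<in> G. sharp_le ?F (\<gamma> * lam i) y}" and ?G2 = "{y \<in> G. \<not> sharp_le ?F (\<gamma> * lam i) y}"
        have "(\<Sum>x\<in>G. w x) = (\<Sum>x\<in>?G1 \<union> ?G2. w x)" by (rule sum.cong) auto
        also have "\<dots> = (\<Sum>x\<in>?G1. w x) + (\<Sum>x\<in>?G2. w x)" using G(1) by (intro sum.union_disjoint) auto
        also have "(\<Sum>x\<in>?G1. w x) \<le> C0 * \<gamma> / K * a i"
          unfolding a_def by (rule gl[where T=T0]) (use T0 lam \<gamma> K G in auto)
        also have "(\<Sum>x\<in>?G2. w x) \<le> CS * A2\<^sup>2 / (\<gamma> * lam i) * H i"
          unfolding H_def by (rule sl[OF T h]) (use lam \<gamma> \<eta> g4 G in auto)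
        finally show "(\<Sum>x\<in>G. w x) \<le> C0 * \<gamma> / K * a i + CS * A2\<^sup>2 / (\<gamma> * lam i) * H i" by simp
      qed
      have step: "lam (Suc i) powr \<sigma> * a (Suc i) \<le> 1 / 2 * (lam i powr \<sigma> * a i) + M * (lam i powr s * H i)" for i
      proof -
        have l: "lam i powr \<sigma> = lam i * lam i powr s" using lam(1)[of i] unfolding s_def by (simp add: powr_diff)
        have "lam (Suc i) powr \<sigma> * a (Suc i) \<le> (K powr \<sigma> * lam i powr \<sigma>) * (C0 * \<gamma> / K * a i + CS * A2\<^sup>2 / (\<gamma> * lam i) * H i)"
        proof -
          have e: "lam (Suc i) powr \<sigma> = K powr \<sigma> * lam i powr \<sigma>"
            unfolding lam(2) using lam(1)[of i] K by (simp add: powr_mult)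
          show ?thesis unfolding e by (intro mult_left_mono rec) simp
        qed
        also have "\<dots> = (K powr \<sigma> * (C0 * \<gamma> / K)) * (lam i powr \<sigma> * a i) + M * (lam i powr \<sigma> / lam i * H i)"
          by (simp add: M_def algebra_simps)
        also have "lam i powr \<sigma> / lam i = lam i powr s" unfolding l using lam(1)[of i] by simp
        also have "(K powr \<sigma> * (C0 * \<gamma> / K)) * (lam i powr \<sigma> * a i) \<le> 1 / 2 * (lam i powr \<sigma> * a i)"
          using a0[of i] by (intro mult_right_mono coef) auto
        finally show ?thesis by simp
      qed
      have Dn: "(\<Sum>i<n. lam i powr s * H i) \<le> c * W" for n
      proof -
        have "(\<Sum>i<n. lam i powr s * H i) = (\<Sum>x | h x \<noteq> 0. \<Sum>i<n. lam i powr s * (if \<eta> * sqrt (lam i) < \<bar>h x\<bar> then w x * (h x)\<^sup>2 else 0))"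
          unfolding H_def sum_distrib_left by (rule sum.swap)
        also have "\<dots> = (\<Sum>x | h x \<noteq> 0. w x * (h x)\<^sup>2 * (\<Sum>i<n. if lam i < (h x)\<^sup>2 / \<eta>\<^sup>2 then lam i powr s else 0))"
        proof (intro sum.cong refl)
          fix x
          have "\<eta> * sqrt (lam i) < \<bar>h x\<bar> \<longleftrightarrow> lam i < (h x)\<^sup>2 / \<eta>\<^sup>2" for i
          proof -
            have "\<eta> * sqrt (lam i) < \<bar>h x\<bar> \<longleftrightarrow> (\<eta> * sqrt (lam i))\<^sup>2 < \<bar>h x\<bar>\<^sup>2"
              using \<eta> lam(1)[of i] power_strict_mono[of "\<eta> * sqrt (lam i)" "\<bar>h x\<bar>" 2]
                power_less_imp_less_base[of "\<eta> * sqrt (lam i)" 2 "\<bar>h x\<bar>"] by auto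
            also have "\<dots> \<longleftrightarrow> lam i < (h x)\<^sup>2 / \<eta>\<^sup>2"
              using \<eta> lam(1)[of i] by (simp add: power_mult_distrib less_divide_eq mult.commute)
            finally show ?thesis .
          qed
          then show "(\<Sum>i<n. lam i powr s * (if \<eta> * sqrt (lam i) < \<bar>h x\<bar> then w x * (h x)\<^sup>2 else 0))
              = w x * (h x)\<^sup>2 * (\<Sum>i<n. if lam i < (h x)\<^sup>2 / \<eta>\<^sup>2 then lam i powr s else 0)"
            by (simp add: sum_distrib_left if_distrib mult_ac cong: if_cong)
        qed
        also have "\<dots> \<le> (\<Sum>x | h x \<noteq> 0. w x * (h x)\<^sup>2 * (K powr s / (K powr s - 1) * ((h x)\<^sup>2 / \<eta>\<^sup>2) powr s))"
          unfolding lam_def by (intro sum_mono mult_left_mono geometric_levels K \<tau> s) auto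
        also have "\<dots> = (\<Sum>x | h x \<noteq> 0. c * (w x * ((h x)\<^sup>2) powr \<sigma>))"
        proof (intro sum.cong refl)
          fix x assume "x \<in> {x. h x \<noteq> 0}"
          then have hp: "0 < (h x)\<^sup>2" by simp
          have "((h x)\<^sup>2 / \<eta>\<^sup>2) powr s = ((h x)\<^sup>2) powr s * (1 / \<eta>\<^sup>2) powr s"
            using hp \<eta> powr_mult[of "(h x)\<^sup>2" "1 / \<eta>\<^sup>2" s] by simp
          moreover have "((h x)\<^sup>2) powr \<sigma> = (h x)\<^sup>2 * ((h x)\<^sup>2) powr s" using hp unfolding s_def by (simp add: powr_diff)
          ultimately show "w x * (h x)\<^sup>2 * (K powr s / (K powr s - 1) * ((h x)\<^sup>2 / \<eta>\<^sup>2) powr s) = c * (w x * ((h x)\<^sup>2) powr \<sigma>)"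
            by (simp add: c_def)
        qed
        also have "\<dots> = c * W" by (simp add: W_def sum_distrib_left)
        finally show ?thesis .
      qed
      define Y where "Y n = (\<Sum>i\<le>n. lam i powr \<sigma> * a i)" for n
      have Y: "Y n \<le> 2 * (\<tau> powr s * D * T0) + 2 * M * (c * W)" for n
      proof -
        have y1: "Y n = lam 0 powr \<sigma> * a 0 + (\<Sum>i<n. lam (Suc i) powr \<sigma> * a (Suc i))"
          unfolding Y_def by (rule sum.atMost_shift)
        have "(\<Sum>i<n. lam (Suc i) powr \<sigma> * a (Suc i)) \<le> (\<Sum>i<n. 1 / 2 * (lam i powr \<sigma> * a i) + M * (lam i powr s * H i))"
          by (intro sum_mono step)
        also have "\<dots> = 1 / 2 * (\<Sum>i<n. lam i powr \<sigma> * a i) + M * (\<Sum>i<n. lam i powr s * H i)"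
          by (simp only: sum.distrib sum_distrib_left)
        finally have y2: "(\<Sum>i<n. lam (Suc i) powr \<sigma> * a (Suc i)) \<le> 1 / 2 * (\<Sum>i<n. lam i powr \<sigma> * a i) + M * (\<Sum>i<n. lam i powr s * H i)" .
        have y3: "(\<Sum>i<n. lam i powr \<sigma> * a i) \<le> Y n" unfolding Y_def using a0 by (intro sum_mono2) auto
        have y4: "M * (\<Sum>i<n. lam i powr s * H i) \<le> M * (c * W)" using M by (intro mult_left_mono Dn)
        have y5: "lam 0 powr \<sigma> * a 0 \<le> \<tau> powr s * D * T0"
        proof -
          have "a 0 \<le> D * T0 / \<tau>" unfolding a_def D_def using lev_weak[OF g0 T0 lam(1)[of 0]] by (simp add: lam_def)
          then have "\<tau> powr \<sigma> * a 0 \<le> \<tau> powr \<sigma> * (D * T0 / \<tau>)" by (intro mult_left_mono) auto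
          also have "\<dots> = \<tau> powr s * D * T0" using \<tau> unfolding s_def by (simp add: powr_diff)
          finally show ?thesis by (simp add: lam_def)
        qed
        show ?thesis using y1 y2 y3 y4 y5 by linarith
      qed
      obtain n where n: "\<forall>x\<in>S. ?g x \<le> lam n"
      proof -
        obtain B where B: "\<forall>r\<in>?g ` S. r \<le> B" using finite_imageI[OF S, of ?g] by (metis bdd_above_finite bdd_above.E)
        obtain n where "B / \<tau> < K ^ n" using real_arch_pow[OF K(1)] by blast
        then have "B < lam n" using \<tau> by (simp add: lam_def field_simps)
        then have "\<forall>x\<in>S. ?g x \<le> lam n" using B by force
        then show ?thesis by (rule that)
      qed
      have pt: "w x * ?g x powr \<sigma> \<le> \<tau> powr s * (w x * ?g x) + (\<Sum>i\<le>n. K powr \<sigma> * lam i powr \<sigma> * (if lam i < ?g x then w x else 0))"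
        if x: "x \<in> S" for x
      proof (cases "?g x \<le> \<tau>")
        case True
        have "?g x powr \<sigma> \<le> \<tau> powr s * ?g x"
        proof (cases "?g x = 0")
          case False
          then have gp: "0 < ?g x" by simp
          then have "?g x powr \<sigma> = ?g x powr s * ?g x" unfolding s_def by (simp add: powr_diff)
          also have "\<dots> \<le> \<tau> powr s * ?g x" using gp True s by (intro mult_right_mono powr_mono2) auto
          finally show ?thesis .
        qed simp
        then have "w x * ?g x powr \<sigma> \<le> w x * (\<tau> powr s * ?g x)" by (intro mult_left_mono) auto
        moreover have "0 \<le> (\<Sum>i\<le>n. K powr \<sigma> * lam i powr \<sigma> * (if lam i < ?g x then w x else 0))" by (intro sum_nonneg) auto
        ultimately show ?thesis by (simp add: mult_ac)
      next
        case False
        define i where "i = (LEAST i. ?g x \<le> lam i)"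
        have gi: "?g x \<le> lam i" and iN: "i \<le> n" unfolding i_def using n x by (auto intro: LeastI Least_le)
        have "i \<noteq> 0"
        proof
          assume "i = 0"
          with gi False show False by (simp add: lam_def)
        qed
        then obtain j where j: "i = Suc j" by (metis not0_implies_Suc)
        then have lj: "lam j < ?g x" using not_less_Least[of j "\<lambda>i. ?g x \<le> lam i"] unfolding i_def[symmetric] by auto
        have "?g x powr \<sigma> \<le> lam (Suc j) powr \<sigma>" using gi j \<sigma> by (intro powr_mono2) auto
        also have "\<dots> = K powr \<sigma> * lam j powr \<sigma>" unfolding lam(2) using K lam(1)[of j] by (simp add: powr_mult)
        finally have "w x * ?g x powr \<sigma> \<le> w x * (K powr \<sigma> * lam j powr \<sigma>)" by (intro mult_left_mono) auto
        also have "\<dots> = K powr \<sigma> * lam j powr \<sigma> * (if lam j < ?g x then w x else 0)" using lj by simp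
        also have "\<dots> \<le> (\<Sum>i\<le>n. K powr \<sigma> * lam i powr \<sigma> * (if lam i < ?g x then w x else 0))"
          using iN j by (intro member_le_sum) auto
        finally show ?thesis using \<tau> by (simp add: add_increasing)
      qed
      have "(\<Sum>x\<in>S. w x * ?g x powr \<sigma>) \<le> (\<Sum>x\<in>S. \<tau> powr s * (w x * ?g x) + (\<Sum>i\<le>n. K powr \<sigma> * lam i powr \<sigma> * (if lam i < ?g x then w x else 0)))"
        by (intro sum_mono pt)
      also have "\<dots> = \<tau> powr s * (\<Sum>x\<in>S. w x * ?g x) + (\<Sum>i\<le>n. K powr \<sigma> * lam i powr \<sigma> * (\<Sum>x\<in>S. if lam i < ?g x then w x else 0))"
        unfolding sum.distrib sum_distrib_left by (subst (2) sum.swap) simp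
      also have "\<dots> \<le> \<tau> powr s * T0 + (\<Sum>i\<le>n. K powr \<sigma> * lam i powr \<sigma> * a i)"
      proof (intro add_mono mult_left_mono sum_mono T0 S)
        fix i
        have "(\<Sum>x\<in>S. if lam i < ?g x then w x else 0) = (\<Sum>x\<in>{x\<in>S. lam i < ?g x}. w x)"
          by (rule sum.inter_filter[OF S, symmetric])
        also have "\<dots> \<le> a i" unfolding a_def
        proof (rule lev_upper[OF g0 T0 lam(1)])
          fix x assume x: "x \<in> {x\<in>S. lam i < ?g x}"
          show "\<not> avg_le ?g (lam i) x"
          proof
            assume "avg_le ?g (lam i) x"
            then have "(\<Sum>u\<in>Bl x 1. w u * ?g u) \<le> lam i * V x 1" using Bl_self[of 1 x] unfolding avg_le_def by blast
            then have "w x * ?g x \<le> lam i * w x" unfolding Bl_1 V_1 by simp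
            then have "?g x \<le> lam i" using w_pos[of x] by (simp add: mult.commute)
            then show False using x by simp
          qed
        qed (use S in auto)
        finally show "(\<Sum>x\<in>S. if lam i < ?g x then w x else 0) \<le> a i" .
      qed auto
      also have "(\<Sum>i\<le>n. K powr \<sigma> * lam i powr \<sigma> * a i) = K powr \<sigma> * Y n" by (simp add: Y_def sum_distrib_left mult.assoc)
      also have "K powr \<sigma> * Y n \<le> K powr \<sigma> * (2 * (\<tau> powr s * D * T0) + 2 * M * (c * W))" by (intro mult_left_mono Y) auto
      finally show ?thesis by (simp add: algebra_simps)
    qed
    show ?thesis unfolding W_def[symmetric]
      by (rule le_of_small_powr[OF s _ main]) (use T0n D in auto)
  qed
  then show ?thesis using M c K by (intro exI[of _ "2 * K powr \<sigma> * M * c"]) auto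
qed

lemma sq_powr: "1 < r \<Longrightarrow> (t\<^sup>2) powr (r / 2) = \<bar>t\<bar> powr r" for t r :: real
proof -
  have "(\<bar>t\<bar> powr 2) powr (r / 2) = \<bar>t\<bar> powr (2 * (r / 2))" by (rule powr_powr)
  moreover have "\<bar>t\<bar> powr 2 = t\<^sup>2" by simp
  ultimately show ?thesis by (simp only:) simp
qed

text \<open>The converse of Hoelder's inequality: \<open>T f\<close> is tested against \<open>sgn (T f) \<bar>T f\<bar>\<^sup>p\<^sup>-\<^sup>1\<close> on \<open>S\<close>, to
  which the bound of the adjoint in the conjugate exponent \<open>r\<close> applies.\<close>

lemma interpolation_fin:
  assumes T: "admissible T A2 A1" and p: "1 < p" "p < 2"
  shows "\<exists>C\<ge>0. \<forall>f S. fin f \<longrightarrow> finite S \<longrightarrow> (\<Sum>x\<in>S. w x * \<bar>T f x\<bar> powr p) \<le> C * (\<Sum>x | f x \<noteq> 0. w x * \<bar>f x\<bar> powr p)"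
proof -
  define r where "r = p / (p - 1)"
  have r: "2 < r" "1 / p + 1 / r = 1" using p by (auto simp: r_def field_simps)
  have lin: "linear_op (Lp (vol mu) 2) T" using T by (simp add: admissible_def)
  obtain C where C: "C \<ge> 0" "\<And>h S. fin h \<Longrightarrow> finite S \<Longrightarrow>
    (\<Sum>x\<in>S. w x * ((Tadj T h x)\<^sup>2) powr (r / 2)) \<le> C * (\<Sum>x | h x \<noteq> 0. w x * ((h x)\<^sup>2) powr (r / 2))"
    using adjoint_bound[OF T, of "r / 2"] r by auto
  have "(\<Sum>x\<in>S. w x * \<bar>T f x\<bar> powr p) \<le> C powr (p / r) * (\<Sum>x | f x \<noteq> 0. w x * \<bar>f x\<bar> powr p)"
    if f: "fin f" and S: "finite S" for f S
  proof -
    let ?X = "\<Sum>x\<in>S. w x * \<bar>T f x\<bar> powr p" and ?N = "\<Sum>x | f x \<noteq> 0. w x * \<bar>f x\<bar> powr p"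
    have X0: "0 \<le> ?X" and N0: "0 \<le> ?N" by (auto intro!: sum_nonneg)
    let ?h = "cut S (\<lambda>x. sgn (T f x) * \<bar>T f x\<bar> powr (p - 1))"
    have h: "fin ?h" using S by simp
    have "?X = ip ?h (T f)"
    proof -
      have e: "\<bar>t\<bar> powr p = sgn t * \<bar>t\<bar> powr (p - 1) * t" for t :: real
      proof (cases "t = 0")
        case False
        then have "\<bar>t\<bar> powr p = \<bar>t\<bar> powr (p - 1) * \<bar>t\<bar>" by (simp add: powr_diff)
        then show ?thesis by (simp add: abs_sgn mult_ac)
      qed simp
      have "ip ?h (T f) = (\<Sum>x\<in>S. w x * ?h x * T f x)" by (rule ip_eq[OF S _ h]) (auto simp: cut_def split: if_splits)
      also have "\<dots> = ?X" by (intro sum.cong refl) (simp add: cut_def e mult.assoc)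
      finally show ?thesis by simp
    qed
    also have "\<dots> = ip f (Tadj T ?h)" by (rule Tadj_dual[OF lin f])
    also have "\<dots> \<le> (\<Sum>x | f x \<noteq> 0. w x * (\<bar>f x\<bar> * \<bar>Tadj T ?h x\<bar>))"
      unfolding ip_def
    proof (rule sum_mono)
      fix x
      have "f x * Tadj T ?h x \<le> \<bar>f x\<bar> * \<bar>Tadj T ?h x\<bar>"
        using abs_ge_self[of "f x * Tadj T ?h x"] by (simp only: abs_mult)
      then have "w x * (f x * Tadj T ?h x) \<le> w x * (\<bar>f x\<bar> * \<bar>Tadj T ?h x\<bar>)" by (intro mult_left_mono) auto
      then show "w x * f x * Tadj T ?h x \<le> w x * (\<bar>f x\<bar> * \<bar>Tadj T ?h x\<bar>)" by (simp add: mult.assoc)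
    qed
    also have "\<dots> \<le> ?N powr (1 / p) * (\<Sum>x | f x \<noteq> 0. w x * \<bar>Tadj T ?h x\<bar> powr r) powr (1 / r)"
      using p r fin_supp[OF f] by (intro holder_sum) auto
    also have "(\<Sum>x | f x \<noteq> 0. w x * \<bar>Tadj T ?h x\<bar> powr r) powr (1 / r) \<le> (C * ?X) powr (1 / r)"
    proof (rule powr_mono2)
      have "(\<Sum>x | f x \<noteq> 0. w x * \<bar>Tadj T ?h x\<bar> powr r) \<le> C * (\<Sum>x | ?h x \<noteq> 0. w x * \<bar>?h x\<bar> powr r)"
        using C(2)[OF h fin_supp[OF f]] r by (simp only: sq_powr)
      also have "(\<Sum>x | ?h x \<noteq> 0. w x * \<bar>?h x\<bar> powr r) \<le> (\<Sum>x\<in>S. w x * \<bar>?h x\<bar> powr r)"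
        using S by (intro sum_mono2) (auto simp: cut_def split: if_splits)
      also have "\<dots> = ?X"
      proof (intro sum.cong refl)
        fix x assume x: "x \<in> S"
        have "(\<bar>t\<bar> powr (p - 1)) powr r = \<bar>t\<bar> powr p" for t :: real using p by (simp add: powr_powr r_def)
        then show "w x * \<bar>?h x\<bar> powr r = w x * \<bar>T f x\<bar> powr p"
          using x r p by (cases "T f x = 0") (auto simp: cut_def abs_mult abs_sgn_eq)
      qed
      finally show "(\<Sum>x | f x \<noteq> 0. w x * \<bar>Tadj T ?h x\<bar> powr r) \<le> C * ?X" using C(1) by (simp add: mult_left_mono)
    qed (use r in \<open>auto intro!: sum_nonneg\<close>)
    finally have main: "?X \<le> ?N powr (1 / p) * (C * ?X) powr (1 / r)" by (simp add: mult_left_mono)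
    show ?thesis
    proof (cases "?X = 0")
      case True
      then show ?thesis using N0 by simp
    next
      case False
      then have X: "0 < ?X" using X0 by simp
      have "?X = ?X powr (1 / p) * ?X powr (1 / r)" using X r(2) by (simp flip: powr_add)
      with main have "?X powr (1 / p) * ?X powr (1 / r) \<le> (?N powr (1 / p) * C powr (1 / r)) * ?X powr (1 / r)"
        using C(1) X0 by (simp add: powr_mult mult_ac)
      then have "?X powr (1 / p) \<le> ?N powr (1 / p) * C powr (1 / r)" using X by (simp add: mult_le_cancel_right)
      then have "(?X powr (1 / p)) powr p \<le> (?N powr (1 / p) * C powr (1 / r)) powr p"
        using p by (intro powr_mono2) auto
      also have "\<dots> = (?N powr (1 / p)) powr p * (C powr (1 / r)) powr p" by (rule powr_mult)
      finally show ?thesis using p X0 N0 by (simp add: powr_powr mult.commute)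
    qed
  qed
  then show ?thesis by (intro exI[of _ "C powr (p / r)"]) auto
qed

text \<open>Truncations of \<open>f\<close> converge in \<open>L\<^sup>2\<close>, hence their images converge pointwise, and the bound for finitely
  supported functions passes to the limit on finite sums.\<close>

theorem interpolation:
  assumes T: "admissible T A2 A1" and p: "1 < p" "p < 2"
  shows "\<exists>C\<ge>0. \<forall>f. f \<in> Lp (vol mu) p \<longrightarrow> l2 f \<longrightarrow> T f \<in> Lp (vol mu) p \<and> Lp_norm (vol mu) p (T f) \<le> C * Lp_norm (vol mu) p f"
proof -
  obtain C where C: "C \<ge> 0" "\<And>f S. fin f \<Longrightarrow> finite S \<Longrightarrow> (\<Sum>x\<in>S. w x * \<bar>T f x\<bar> powr p) \<le> C * (\<Sum>x | f x \<noteq> 0. w x * \<bar>f x\<bar> powr p)"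
    using interpolation_fin[OF T p] by blast
  have A2: "0 \<le> A2" and lin: "linear_op (Lp (vol mu) 2) T" and bd: "\<And>f. l2 f \<Longrightarrow> l2 (T f)" "\<And>f. l2 f \<Longrightarrow> n2 (T f) \<le> A2 * n2 f"
    using T unfolding admissible_def by blast+
  have "T f \<in> Lp (vol mu) p \<and> Lp_norm (vol mu) p (T f) \<le> C powr (1 / p) * Lp_norm (vol mu) p f"
    if f: "f \<in> Lp (vol mu) p" and f2: "l2 f" for f
  proof -
    let ?N = "Lp_norm (vol mu) p f"
    have "\<exists>R. finite R \<and> n2 (\<lambda>x. f x - cut R f x) \<le> 1 / (real n + 1)" for n
      using l2_cut[OF f2, of "1 / (real n + 1)"] by (metis divide_pos_pos of_nat_0_le_iff add_nonneg_pos zero_less_one order_refl)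
    then obtain R where R: "\<And>n. finite (R n)" "\<And>n. n2 (\<lambda>x. f x - cut (R n) f x) \<le> 1 / (real n + 1)" by metis
    have lim: "(\<lambda>n. T (cut (R n) f) x) \<longlonglongrightarrow> T f x" for x
    proof (rule LIM_zero_cancel, rule Lim_null_comparison)
      show "\<forall>\<^sub>F n in sequentially. norm (T (cut (R n) f) x - T f x) \<le> (1 / sqrt (w x) * A2) * (1 / (real n + 1))"
      proof (rule always_eventually, rule allI)
        fix n
        let ?c = "cut (R n) f"
        have c: "l2 ?c" by (intro fin_l2 fin_cut R)
        have "T (\<lambda>y. f y + (-1) * ?c y) = (\<lambda>y. T f y + (-1) * T ?c y)"
          using lin[unfolded linear_op_def, THEN conjunct1, rule_format, OF f2 l2_cmult[OF c, of "-1"]]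
            lin[unfolded linear_op_def, THEN conjunct2, rule_format, OF c, of "-1"] by simp
        then have d: "T (\<lambda>y. f y - ?c y) = (\<lambda>y. T f y - T ?c y)" by simp
        have l: "l2 (\<lambda>y. f y - ?c y)" by (intro l2_diff f2 c)
        have "\<bar>T f x - T ?c x\<bar> \<le> 1 / sqrt (w x) * s2 {x} (T (\<lambda>y. f y - ?c y))"
          using s2_eval[of "\<lambda>y. T f y - T ?c y" x] by (simp only: d)
        also have "\<dots> \<le> 1 / sqrt (w x) * (A2 * (1 / (real n + 1)))"
        proof (rule mult_left_mono)
          have "s2 {x} (T (\<lambda>y. f y - ?c y)) \<le> n2 (T (\<lambda>y. f y - ?c y))" by (intro s2_le bd l) simp
          also have "\<dots> \<le> A2 * n2 (\<lambda>y. f y - ?c y)" by (rule bd(2)[OF l])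
          also have "\<dots> \<le> A2 * (1 / (real n + 1))" by (intro mult_left_mono R A2)
          finally show "s2 {x} (T (\<lambda>y. f y - ?c y)) \<le> A2 * (1 / (real n + 1))" .
        qed simp
        finally show "norm (T ?c x - T f x) \<le> (1 / sqrt (w x) * A2) * (1 / (real n + 1))"
          by (simp add: abs_minus_commute)
      qed
      have "(\<lambda>n. 1 / (real n + 1)) \<longlonglongrightarrow> 0" using LIMSEQ_inverse_real_of_nat by (simp add: inverse_eq_divide add.commute)
      then show "(\<lambda>n. (1 / sqrt (w x) * A2) * (1 / (real n + 1))) \<longlonglongrightarrow> 0" by (rule tendsto_mult_right_zero)
    qed
    have "(\<Sum>x\<in>S. w x * \<bar>T f x\<bar> powr p) \<le> (C powr (1 / p) * ?N) powr p" if S: "finite S" for S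
    proof -
      have "(\<Sum>x\<in>S. w x * \<bar>T f x\<bar> powr p) \<le> C * ?N powr p"
      proof (rule LIMSEQ_le_const2)
        show "(\<lambda>n. \<Sum>x\<in>S. w x * \<bar>T (cut (R n) f) x\<bar> powr p) \<longlonglongrightarrow> (\<Sum>x\<in>S. w x * \<bar>T f x\<bar> powr p)"
          using p by (intro tendsto_sum tendsto_mult tendsto_const tendsto_powr' tendsto_rabs lim) auto
        show "\<exists>N. \<forall>n\<ge>N. (\<Sum>x\<in>S. w x * \<bar>T (cut (R n) f) x\<bar> powr p) \<le> C * ?N powr p"
        proof (intro exI allI impI)
          fix n
          have "(\<Sum>x\<in>S. w x * \<bar>T (cut (R n) f) x\<bar> powr p) \<le> C * (\<Sum>x | cut (R n) f x \<noteq> 0. w x * \<bar>cut (R n) f x\<bar> powr p)"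
            by (intro C fin_cut R S)
          also have "(\<Sum>x | cut (R n) f x \<noteq> 0. w x * \<bar>cut (R n) f x\<bar> powr p) \<le> (\<Sum>x\<in>R n. w x * \<bar>cut (R n) f x\<bar> powr p)"
            using R by (intro sum_mono2) (auto simp: cut_def split: if_splits)
          also have "\<dots> = (\<Sum>x\<in>R n. w x * \<bar>f x\<bar> powr p)" by (intro sum.cong) (auto simp: cut_def)
          also have "\<dots> \<le> ?N powr p" using p by (intro Lp_partial f R) auto
          finally show "(\<Sum>x\<in>S. w x * \<bar>T (cut (R n) f) x\<bar> powr p) \<le> C * ?N powr p" using C(1) by (simp add: mult_left_mono)
        qed
      qed
      also have "\<dots> = (C powr (1 / p) * ?N) powr p" using C(1) p by (simp add: powr_mult powr_powr)
      finally show ?thesis .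
    qed
    then show ?thesis using LpI[of p "C powr (1 / p) * ?N" "T f"] p by auto
  qed
  then show ?thesis by (intro exI[of _ "C powr (1 / p)"]) auto
qed

end

section \<open>The Hardy spaces\<close>

text \<open>Both Hardy spaces are given by a condition \<open>W\<close> on pointwise limits and a family of seminorms, each of
  which depends on finitely many values.\<close>

definition sup_space :: "'i set \<Rightarrow> ('i \<Rightarrow> ('b \<Rightarrow> real) \<Rightarrow> real) \<Rightarrow> ('b \<Rightarrow> real) set \<Rightarrow> ('b \<Rightarrow> real) set" where
  "sup_space I \<phi> W = {f \<in> W. \<exists>C. \<forall>i\<in>I. \<phi> i f \<le> C}"

definition sup_norm :: "'i set \<Rightarrow> ('i \<Rightarrow> ('b \<Rightarrow> real) \<Rightarrow> real) \<Rightarrow> ('b \<Rightarrow> real) \<Rightarrow> real" where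
  "sup_norm I \<phi> f = (SUP i\<in>I. \<phi> i f)"

lemma sup_norm_le: "I \<noteq> {} \<Longrightarrow> (\<And>i. i \<in> I \<Longrightarrow> \<phi> i f \<le> C) \<Longrightarrow> sup_norm I \<phi> f \<le> C"
  unfolding sup_norm_def by (intro cSUP_least) auto

lemma sup_norm_ge: "f \<in> sup_space I \<phi> W \<Longrightarrow> i \<in> I \<Longrightarrow> \<phi> i f \<le> sup_norm I \<phi> f"
  unfolding sup_norm_def sup_space_def by (intro cSUP_upper) (auto simp: bdd_above_def)

text \<open>By \<open>cauchy_sup_limit\<close>. The assumption on \<open>W\<close> may use the uniform convergence of the seminorms,
  because pointwise convergence of \<open>d K\<^sub>n f\<close> as \<open>n\<close> tends to infinity is only preserved by uniform limits.\<close>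

lemma sup_space_complete:
  fixes \<phi> :: "'i \<Rightarrow> ('b \<Rightarrow> real) \<Rightarrow> real"
  assumes ne: "I \<noteq> {}"
    and eval: "\<And>x. \<exists>i\<in>I. \<exists>c. \<forall>f. \<bar>f x\<bar> \<le> c * \<phi> i f"
    and cont: "\<And>i g (h :: nat \<Rightarrow> 'b \<Rightarrow> real). i \<in> I \<Longrightarrow> (\<forall>x. (\<lambda>n. h n x) \<longlonglongrightarrow> g x) \<Longrightarrow> (\<lambda>n. \<phi> i (h n)) \<longlonglongrightarrow> \<phi> i g"
    and nonneg: "\<And>i f. 0 \<le> \<phi> i f"
    and tri: "\<And>i f g. \<phi> i (\<lambda>x. f x + g x) \<le> \<phi> i f + \<phi> i g"
    and hom: "\<And>i c f. \<phi> i (\<lambda>x. c * f x) = \<bar>c\<bar> * \<phi> i f"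
    and W0: "(\<lambda>_. 0) \<in> W" and Wadd: "\<And>f g. f \<in> W \<Longrightarrow> g \<in> W \<Longrightarrow> (\<lambda>x. f x + g x) \<in> W"
    and Wmult: "\<And>c f. f \<in> W \<Longrightarrow> (\<lambda>x. c * f x) \<in> W"
    and Wclosed: "\<And>u f. (\<And>n :: nat. u n \<in> W) \<Longrightarrow> (\<And>x. (\<lambda>n. u n x) \<longlonglongrightarrow> f x) \<Longrightarrow>
       (\<And>e. e > 0 \<Longrightarrow> \<exists>n0. \<forall>k\<ge>n0. \<forall>i\<in>I. \<phi> i (\<lambda>x. u k x - f x) \<le> e) \<Longrightarrow> f \<in> W"
  shows "complete_normed_space (sup_space I \<phi> W) (sup_norm I \<phi>)"
proof -
  let ?V = "sup_space I \<phi> W" and ?N = "sup_norm I \<phi>"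
  obtain i0 where i0: "i0 \<in> I" using ne by blast
  have z: "\<phi> i (\<lambda>x. 0) = 0" for i using hom[of i 0 "\<lambda>x. 0"] by simp
  have Vadd: "(\<lambda>x. f x + g x) \<in> ?V" if f: "f \<in> ?V" and g: "g \<in> ?V" for f g
  proof -
    obtain C D where "\<forall>i\<in>I. \<phi> i f \<le> C" "\<forall>i\<in>I. \<phi> i g \<le> D" using f g by (auto simp: sup_space_def)
    then have "\<forall>i\<in>I. \<phi> i (\<lambda>x. f x + g x) \<le> C + D" using tri by (meson add_mono order_trans)
    then show ?thesis using f g Wadd by (auto simp: sup_space_def)
  qed
  have Vmult: "(\<lambda>x. c * f x) \<in> ?V" if f: "f \<in> ?V" for f c
  proof -
    obtain C where "\<forall>i\<in>I. \<phi> i f \<le> C" using f by (auto simp: sup_space_def)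
    then have "\<forall>i\<in>I. \<phi> i (\<lambda>x. c * f x) \<le> \<bar>c\<bar> * C" by (simp add: hom mult_left_mono)
    then show ?thesis using f Wmult by (auto simp: sup_space_def)
  qed
  have Vdiff: "(\<lambda>x. f x - g x) \<in> ?V" if f: "f \<in> ?V" and g: "g \<in> ?V" for f g
    using Vadd[OF f Vmult[OF g, of "-1"]] by simp
  have N0: "0 \<le> ?N f" if "f \<in> ?V" for f using sup_norm_ge[OF that i0] nonneg[of i0 f] by linarith
  have Nle: "?N (\<lambda>x. c * f x) \<le> \<bar>c\<bar> * ?N f" if f: "f \<in> ?V" for c f
    using sup_norm_ge[OF f] by (intro sup_norm_le ne) (simp add: hom mult_left_mono)
  have Nhom: "?N (\<lambda>x. c * f x) = \<bar>c\<bar> * ?N f" if f: "f \<in> ?V" for c f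
  proof (cases "c = 0")
    case True
    have "?N (\<lambda>x. 0) = 0" using sup_norm_le[OF ne, of \<phi> "\<lambda>x. 0" 0] N0[of "\<lambda>x. 0"] z W0 by (force simp: sup_space_def)
    then show ?thesis using True by simp
  next
    case False
    have "?N f \<le> \<bar>1 / c\<bar> * ?N (\<lambda>x. c * f x)" using Nle[OF Vmult[OF f, of c], of "1 / c"] False by simp
    then have "\<bar>c\<bar> * ?N f \<le> ?N (\<lambda>x. c * f x)" using False by (simp add: abs_divide field_simps)
    then show ?thesis using Nle[OF f, of c] by simp
  qed
  show ?thesis
    unfolding complete_normed_space_def
  proof (intro conjI ballI allI impI)
    show "(\<lambda>_. 0) \<in> ?V" using W0 z by (auto simp: sup_space_def)
    fix f assume f: "f \<in> ?V"
    show "0 \<le> ?N f" by (rule N0[OF f])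
    show "(?N f = 0) = (f = (\<lambda>_. 0))"
    proof
      assume N: "?N f = 0"
      show "f = (\<lambda>_. 0)"
      proof
        fix x
        obtain i c where ic: "i \<in> I" "\<forall>f. \<bar>f x\<bar> \<le> c * \<phi> i f" using eval by blast
        have "\<phi> i f = 0" using sup_norm_ge[OF f ic(1)] N nonneg[of i f] by linarith
        then show "f x = 0" using ic(2) by (metis abs_le_zero_iff mult_zero_right)
      qed
    next
      assume "f = (\<lambda>_. 0)"
      then show "?N f = 0" using Nhom[OF f, of 0] by simp
    qed
    show "?N (\<lambda>x. c * f x) = \<bar>c\<bar> * ?N f" for c by (rule Nhom[OF f])
    fix g assume g: "g \<in> ?V"
    show "?N (\<lambda>x. f x + g x) \<le> ?N f + ?N g"
      by (intro sup_norm_le ne order_trans[OF tri] add_mono sup_norm_ge[OF f] sup_norm_ge[OF g])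
  next
    fix u assume u: "(\<forall>n::nat. u n \<in> ?V) \<and> (\<forall>e>0. \<exists>n0. \<forall>i\<ge>n0. \<forall>j\<ge>n0. ?N (\<lambda>x. u i x - u j x) < e)"
    have c: "\<exists>n0. \<forall>k\<ge>n0. \<forall>l\<ge>n0. \<forall>i\<in>I. \<phi> i (\<lambda>x. u k x - u l x) \<le> e" if e: "e > 0" for e
    proof -
      obtain n0 where n0: "\<forall>k\<ge>n0. \<forall>l\<ge>n0. ?N (\<lambda>x. u k x - u l x) < e" using u e by blast
      have "\<phi> i (\<lambda>x. u k x - u l x) \<le> e" if "k \<ge> n0" "l \<ge> n0" "i \<in> I" for k l i
      proof -
        have "\<phi> i (\<lambda>x. u k x - u l x) \<le> ?N (\<lambda>x. u k x - u l x)" using u that by (intro sup_norm_ge[OF Vdiff]) auto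
        then show ?thesis using n0 that by (meson less_imp_le order_trans)
      qed
      then show ?thesis by blast
    qed
    obtain f where f: "\<And>x. (\<lambda>n. u n x) \<longlonglongrightarrow> f x" "\<And>e. e > 0 \<Longrightarrow> \<exists>n0. \<forall>k\<ge>n0. \<forall>i\<in>I. \<phi> i (\<lambda>x. u k x - f x) \<le> e"
      by (rule cauchy_sup_limit[OF eval cont nonneg c]) blast+
    have fW: "f \<in> W" by (rule Wclosed[OF _ f]) (use u in \<open>auto simp: sup_space_def\<close>)
    obtain n1 where n1: "\<forall>i\<in>I. \<phi> i (\<lambda>x. u n1 x - f x) \<le> 1" using f(2)[of 1] by auto
    have "(\<lambda>x. u n1 x - f x) \<in> ?V"
    proof -
      have "(\<lambda>x. u n1 x + (-1) * f x) \<in> W" using u fW by (intro Wadd Wmult) (auto simp: sup_space_def)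
      then show ?thesis using n1 by (auto simp: sup_space_def)
    qed
    then have fV: "f \<in> ?V" using Vdiff[of "u n1" "\<lambda>x. u n1 x - f x"] u by simp
    show "\<exists>f\<in>?V. (\<lambda>n. ?N (\<lambda>x. u n x - f x)) \<longlonglongrightarrow> 0"
    proof (rule bexI[OF _ fV], rule LIMSEQ_I)
      fix r :: real assume r: "r > 0"
      obtain n0 where n0: "\<forall>k\<ge>n0. \<forall>i\<in>I. \<phi> i (\<lambda>x. u k x - f x) \<le> r / 2" using f(2)[of "r / 2"] r by auto
      have "?N (\<lambda>x. u k x - f x) \<le> r / 2" if "k \<ge> n0" for k using n0 that by (intro sup_norm_le ne) auto
      moreover have "0 \<le> ?N (\<lambda>x. u k x - f x)" for k using Vdiff[of "u k" f] u fV by (intro N0) auto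
      ultimately show "\<exists>n0. \<forall>n\<ge>n0. norm (?N (\<lambda>x. u n x - f x) - 0) < r" using r by (intro exI[of _ n0]) fastforce
    qed
  qed (use Vadd Vmult in auto)
qed

context riesz_graph
begin

text \<open>The regularised Riesz transforms \<open>d K\<^sub>n\<close> have finite range, so they act on all functions.
  The Hardy space of functions asks for uniform \<open>L\<^sup>1\<close> bounds of \<open>d K\<^sub>n f\<close> and for pointwise convergence.\<close>

definition hardy_idx :: "(nat \<times> 'a set) set" where "hardy_idx = UNIV \<times> {S. finite S}"

definition hardy_seminorm :: "nat \<times> 'a set \<Rightarrow> ('a \<Rightarrow> real) \<Rightarrow> real" where
  "hardy_seminorm i f = (\<Sum>x\<in>snd i. w x * \<bar>f x\<bar>) + (\<Sum>x\<in>snd i. w x * tnorm (df (K (fst i) f)) x)"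

definition hardy_conv :: "('a \<Rightarrow> real) set" where
  "hardy_conv = {f. \<forall>e. convergent (\<lambda>n. df (K n f) e)}"

abbreviation "hardy \<equiv> sup_space hardy_idx hardy_seminorm hardy_conv"
abbreviation "hardy_norm \<equiv> sup_norm hardy_idx hardy_seminorm"

text \<open>Forms: the second component of the index only forces the seminorms to separate points off the
  edges, where all forms vanish.\<close>

definition form_idx :: "('a set \<times> ('a \<times> 'a)) set" where "form_idx = {S. finite S} \<times> UNIV"

definition form_seminorm :: "'a set \<times> ('a \<times> 'a) \<Rightarrow> ('a \<times> 'a \<Rightarrow> real) \<Rightarrow> real" where
  "form_seminorm i F = (\<Sum>x\<in>fst i. w x * tnorm F x) + (if snd i \<in> edges mu then 0 else \<bar>F (snd i)\<bar>)"

definition forms :: "('a \<times> 'a \<Rightarrow> real) set" where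
  "forms = {F. (\<forall>e. e \<notin> edges mu \<longrightarrow> F e = 0) \<and> (\<forall>x y. F (y, x) = - F (x, y))}"

abbreviation "form_space \<equiv> sup_space form_idx form_seminorm forms"
abbreviation "form_norm \<equiv> sup_norm form_idx form_seminorm"

text \<open>A pointwise limit, and thus linear on the whole Hardy space without an appeal to density.\<close>

definition riesz_ext :: "('a \<Rightarrow> real) \<Rightarrow> 'a \<times> 'a \<Rightarrow> real" where
  "riesz_ext f e = lim (\<lambda>n. df (K n f) e)"

lemma df_K_add: "df (K n (\<lambda>x. f x + g x)) = (\<lambda>e. df (K n f) e + df (K n g) e)"
  by (simp add: pol_add_arg df_add)

lemma df_K_cmult: "df (K n (\<lambda>x. c * f x)) = (\<lambda>e. c * df (K n f) e)"
  by (simp add: pol_cmult_arg df_cmult)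

lemma df_K_diff: "df (K n (\<lambda>x. f x - g x)) = (\<lambda>e. df (K n f) e - df (K n g) e)"
  by (simp add: pol_diff_arg df_diff)

text \<open>Finite range operators are continuous for pointwise convergence.\<close>

lemma pol_tendsto:
  assumes "\<And>x. (\<lambda>j. u j x) \<longlonglongrightarrow> f x" shows "(\<lambda>j. pol q (u j) x) \<longlonglongrightarrow> pol q f x"
proof -
  obtain R where R: "finite R" "{x} \<subseteq> R" "\<And>R' f z. R \<subseteq> R' \<Longrightarrow> z \<in> {x} \<Longrightarrow> pol q (cut R' f) z = pol q f z"
    using local_cut[OF local_pol, of "{x}" q] by auto
  have eq: "pol q g x = (\<Sum>y\<in>R. g y * pol q (delta y) x)" for g
  proof -
    have "cut R g = (\<lambda>x. \<Sum>y\<in>R. g y * delta y x)"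
      by (subst fin_decomp[OF R(1), of "cut R g"]) (auto simp: cut_def split: if_splits)
    then have "pol q (cut R g) x = (\<Sum>y\<in>R. g y * pol q (delta y) x)" by (simp add: pol_sum_arg pol_cmult_arg)
    then show ?thesis using R(3)[of R x g] by simp
  qed
  have "(\<lambda>j. \<Sum>y\<in>R. u j y * pol q (delta y) x) \<longlonglongrightarrow> (\<Sum>y\<in>R. f y * pol q (delta y) x)"
    by (intro tendsto_intros assms)
  then show ?thesis by (simp only: eq[symmetric])
qed

lemma df_tendsto: "(\<And>x. (\<lambda>j. u j x) \<longlonglongrightarrow> f x) \<Longrightarrow> (\<lambda>j. df (u j) e) \<longlonglongrightarrow> df f e"
  by (cases e) (auto simp: diff_form_def intro!: tendsto_intros)

lemma hardy_complete: "complete_normed_space hardy hardy_norm"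
proof (rule sup_space_complete)
  show "hardy_idx \<noteq> {}" by (auto simp: hardy_idx_def)
  show nn: "0 \<le> hardy_seminorm i f" for i f
    by (simp add: hardy_seminorm_def sum_nonneg)
  show "\<exists>i\<in>hardy_idx. \<exists>c. \<forall>f. \<bar>f x\<bar> \<le> c * hardy_seminorm i f" for x
  proof (intro bexI[of _ "(0, {x})"] exI[of _ "1 / w x"] allI)
    fix f
    have "w x * \<bar>f x\<bar> \<le> hardy_seminorm (0, {x}) f" by (simp add: hardy_seminorm_def)
    then show "\<bar>f x\<bar> \<le> 1 / w x * hardy_seminorm (0, {x}) f" using w_pos[of x] by (simp add: field_simps)
  qed (simp add: hardy_idx_def)
  show "(\<lambda>n. hardy_seminorm i (h n)) \<longlonglongrightarrow> hardy_seminorm i g"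
    if "\<forall>x. (\<lambda>n. h n x) \<longlonglongrightarrow> g x" for i g and h :: "nat \<Rightarrow> 'a \<Rightarrow> real"
    unfolding hardy_seminorm_def using that
    by (intro tendsto_intros tnorm_tendsto df_tendsto pol_tendsto) auto
  show "hardy_seminorm i (\<lambda>x. f x + g x) \<le> hardy_seminorm i f + hardy_seminorm i g" for i f g
  proof -
    have "(\<Sum>x\<in>snd i. w x * \<bar>f x + g x\<bar>) \<le> (\<Sum>x\<in>snd i. w x * \<bar>f x\<bar> + w x * \<bar>g x\<bar>)"
      unfolding distrib_left[symmetric] by (intro sum_mono mult_left_mono abs_triangle_ineq) auto
    moreover have "(\<Sum>x\<in>snd i. w x * tnorm (df (K (fst i) (\<lambda>x. f x + g x))) x)
        \<le> (\<Sum>x\<in>snd i. w x * tnorm (df (K (fst i) f)) x + w x * tnorm (df (K (fst i) g)) x)"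
      unfolding distrib_left[symmetric] df_K_add by (intro sum_mono mult_left_mono tnorm_triangle) auto
    ultimately show ?thesis by (simp add: hardy_seminorm_def sum.distrib)
  qed
  show "hardy_seminorm i (\<lambda>x. c * f x) = \<bar>c\<bar> * hardy_seminorm i f" for i c f
    unfolding hardy_seminorm_def df_K_cmult tnorm_cmult distrib_left sum_distrib_left abs_mult
    by (simp add: mult_ac)
  show "(\<lambda>_. 0) \<in> hardy_conv"
  proof -
    have "df (K n (\<lambda>_. 0)) e = 0" for n e
      using fun_cong[OF df_K_cmult[of n 0 "\<lambda>_. 0"], of e] by simp
    then show ?thesis by (simp add: hardy_conv_def convergent_const)
  qed
  show "(\<lambda>x. f x + g x) \<in> hardy_conv" if "f \<in> hardy_conv" "g \<in> hardy_conv" for f g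
    using that by (simp add: hardy_conv_def df_K_add convergent_add)
  show "(\<lambda>x. c * f x) \<in> hardy_conv" if "f \<in> hardy_conv" for c f
    using that by (simp add: hardy_conv_def df_K_cmult convergent_mult convergent_const)
  show "f \<in> hardy_conv"
    if u: "\<And>n :: nat. u n \<in> hardy_conv" "\<And>x. (\<lambda>n. u n x) \<longlonglongrightarrow> f x"
      and lim: "\<And>e. e > 0 \<Longrightarrow> \<exists>n0. \<forall>k\<ge>n0. \<forall>i\<in>hardy_idx. hardy_seminorm i (\<lambda>x. u k x - f x) \<le> e" for u f
    unfolding hardy_conv_def
  proof (rule CollectI, rule allI)
    fix e :: "'a \<times> 'a"
    obtain x y where e: "e = (x, y)" by force
    show "convergent (\<lambda>n. df (K n f) e)"
    proof (cases "e \<in> edges mu")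
      case False
      then show ?thesis by (simp add: df_vanish convergent_const)
    next
      case True
      then have y: "y \<in> nb x" by (simp add: nbrs_def e)
      obtain c where c: "\<And>F. \<bar>F (x, y)\<bar> \<le> c * tnorm F x" using tnorm_eval[OF y] by blast
      have "Cauchy (\<lambda>n. df (K n f) e)"
        unfolding Cauchy_def
      proof (intro allI impI)
        fix r :: real assume r: "r > 0"
        define \<eta> where "\<eta> = r * w x / (4 * (\<bar>c\<bar> + 1))"
        \<comment> \<open>\<open>\<eta>\<close> is small enough that the seminorms at \<open>x\<close> keep \<open>d K\<^sub>n (u k - f)\<close> below \<open>r / 4\<close> at \<open>e\<close>, for all \<open>n\<close>
          at once; then the Cauchy property passes from \<open>u k\<close> to \<open>f\<close>.\<close>
        have \<eta>: "\<eta> > 0" using r w_pos[of x] by (simp add: \<eta>_def)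
        then obtain k where k: "\<forall>i\<in>hardy_idx. hardy_seminorm i (\<lambda>x. u k x - f x) \<le> \<eta>" using lim by blast
        have close: "\<bar>df (K n (u k)) e - df (K n f) e\<bar> \<le> r / 4" for n
        proof -
          have "hardy_seminorm (n, {x}) (\<lambda>x. u k x - f x) \<le> \<eta>" using k by (simp add: hardy_idx_def)
          then have "w x * tnorm (df (K n (\<lambda>x. u k x - f x))) x \<le> \<eta>"
          proof -
            have "hardy_seminorm (n, {x}) (\<lambda>x. u k x - f x)
                = w x * \<bar>u k x - f x\<bar> + w x * tnorm (df (K n (\<lambda>x. u k x - f x))) x" by (simp add: hardy_seminorm_def)
            moreover have "0 \<le> w x * \<bar>u k x - f x\<bar>" by simp
            ultimately show ?thesis using \<open>hardy_seminorm (n, {x}) (\<lambda>x. u k x - f x) \<le> \<eta>\<close> by linarith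
          qed
          then have t: "tnorm (df (K n (\<lambda>x. u k x - f x))) x \<le> \<eta> / w x" using w_pos[of x] by (simp add: field_simps)
          have "\<bar>df (K n (\<lambda>x. u k x - f x)) e\<bar> \<le> c * tnorm (df (K n (\<lambda>x. u k x - f x))) x" unfolding e by (rule c)
          also have "\<dots> \<le> (\<bar>c\<bar> + 1) * tnorm (df (K n (\<lambda>x. u k x - f x))) x" by (intro mult_right_mono) auto
          also have "\<dots> \<le> (\<bar>c\<bar> + 1) * (\<eta> / w x)" by (intro mult_left_mono t) auto
          also have "\<dots> = r / 4"
          proof -
            have "D * (r * v / (4 * D) / v) = r / 4" if "0 < v" "0 < D" for v D :: real
              using that by simp
            from this[OF w_pos, of "\<bar>c\<bar> + 1" x] show ?thesis by (simp add: \<eta>_def)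
          qed
          finally show ?thesis by (simp only: df_K_diff)
        qed
        have "convergent (\<lambda>n. df (K n (u k)) e)" using u(1)[of k] unfolding hardy_conv_def by blast
        then have "Cauchy (\<lambda>n. df (K n (u k)) e)" by (rule convergent_Cauchy)
        then obtain M where M: "\<forall>m\<ge>M. \<forall>n\<ge>M. dist (df (K m (u k)) e) (df (K n (u k)) e) < r / 4"
          using r unfolding Cauchy_def by (meson zero_less_divide_iff zero_less_numeral)
        have "dist (df (K m f) e) (df (K n f) e) < r" if "m \<ge> M" "n \<ge> M" for m n
        proof -
          have "\<bar>df (K m (u k)) e - df (K n (u k)) e\<bar> < r / 4" using M that by (simp add: dist_real_def)
          then show ?thesis using close[of m] close[of n] r unfolding dist_real_def by linarith
        qed
        then show "\<exists>M. \<forall>m\<ge>M. \<forall>n\<ge>M. dist (df (K m f) e) (df (K n f) e) < r" by blast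
      qed
      then show ?thesis by (rule Cauchy_convergent)
    qed
  qed
qed

lemma forms_zero: "F \<in> forms \<Longrightarrow> e \<notin> edges mu \<Longrightarrow> F e = 0"
  unfolding forms_def by blast

lemma forms_antisym: "F \<in> forms \<Longrightarrow> F (y, x) = - F (x, y)"
  unfolding forms_def by blast

lemma formsI: "(\<And>e. e \<notin> edges mu \<Longrightarrow> F e = 0) \<Longrightarrow> (\<And>x y. F (y, x) = - F (x, y)) \<Longrightarrow> F \<in> forms"
  unfolding forms_def by blast

lemma form_space_complete: "complete_normed_space form_space form_norm"
proof (rule sup_space_complete)
  show "form_idx \<noteq> {}" by (auto simp: form_idx_def)
  show nn: "0 \<le> form_seminorm i f" for i f
    by (simp add: form_seminorm_def sum_nonneg)
  show "\<exists>i\<in>form_idx. \<exists>c. \<forall>f. \<bar>f e\<bar> \<le> c * form_seminorm i f" for e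
  proof -
    obtain x y where e: "e = (x, y)" by force
    show ?thesis
    proof (cases "e \<in> edges mu")
      case False
      show ?thesis
        by (intro bexI[of _ "({}, e)"] exI[of _ 1]) (use False in \<open>auto simp: form_seminorm_def form_idx_def\<close>)
    next
      case True
      then have y: "y \<in> nb x" by (simp add: nbrs_def e)
      obtain c where c: "\<And>F. \<bar>F (x, y)\<bar> \<le> c * tnorm F x" using tnorm_eval[OF y] by blast
      have "\<bar>F e\<bar> \<le> c / w x * form_seminorm ({x}, e) F" for F
        using c[of F] True w_pos[of x] by (simp add: form_seminorm_def e)
      then show ?thesis by (intro bexI[of _ "({x}, e)"] exI[of _ "c / w x"]) (auto simp: form_idx_def)
    qed
  qed
  show "(\<lambda>n. form_seminorm i (h n)) \<longlonglongrightarrow> form_seminorm i g"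
    if "\<forall>x. (\<lambda>n. h n x) \<longlonglongrightarrow> g x" for i g and h :: "nat \<Rightarrow> 'a \<times> 'a \<Rightarrow> real"
  proof -
    have "(\<lambda>n. if snd i \<in> edges mu then 0 else \<bar>h n (snd i)\<bar>) \<longlonglongrightarrow> (if snd i \<in> edges mu then 0 else \<bar>g (snd i)\<bar>)"
      using that[rule_format, of "snd i"] by (simp add: tendsto_rabs)
    moreover have "(\<lambda>n. \<Sum>x\<in>fst i. w x * tnorm (h n) x) \<longlonglongrightarrow> (\<Sum>x\<in>fst i. w x * tnorm g x)"
      by (intro tendsto_intros tnorm_tendsto that[rule_format])
    ultimately show ?thesis unfolding form_seminorm_def by (rule tendsto_add[rotated])
  qed
  show "form_seminorm i (\<lambda>x. f x + g x) \<le> form_seminorm i f + form_seminorm i g" for i f g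
  proof -
    have "(\<Sum>x\<in>fst i. w x * tnorm (\<lambda>x. f x + g x) x) \<le> (\<Sum>x\<in>fst i. w x * tnorm f x + w x * tnorm g x)"
      unfolding distrib_left[symmetric] by (intro sum_mono mult_left_mono tnorm_triangle) auto
    then show ?thesis using abs_triangle_ineq[of "f (snd i)" "g (snd i)"] by (simp add: form_seminorm_def sum.distrib)
  qed
  show "form_seminorm i (\<lambda>x. c * f x) = \<bar>c\<bar> * form_seminorm i f" for i c f
    unfolding form_seminorm_def tnorm_cmult distrib_left sum_distrib_left by (simp add: mult_ac abs_mult)
  show "(\<lambda>_. 0) \<in> forms" by (rule formsI) simp_all
  show "(\<lambda>x. f x + g x) \<in> forms" if fg: "f \<in> forms" "g \<in> forms" for f g
  proof (rule formsI)
    show "f (y, x) + g (y, x) = - (f (x, y) + g (x, y))" for x y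
      unfolding forms_antisym[OF fg(1), of y x] forms_antisym[OF fg(2), of y x] by simp
  qed (simp add: forms_zero[OF fg(1)] forms_zero[OF fg(2)])
  show "(\<lambda>x. c * f x) \<in> forms" if f: "f \<in> forms" for c f
  proof (rule formsI)
    show "c * f (y, x) = - (c * f (x, y))" for x y
      unfolding forms_antisym[OF f, of y x] by simp
  qed (simp add: forms_zero[OF f])
  show "f \<in> forms" if u: "\<And>n :: nat. u n \<in> forms" "\<And>x. (\<lambda>n. u n x) \<longlonglongrightarrow> f x" for u f
  proof -
    have "f e = 0" if "e \<notin> edges mu" for e
    proof (rule LIMSEQ_unique[OF u(2)])
      show "(\<lambda>n. u n e) \<longlonglongrightarrow> 0" unfolding forms_zero[OF u(1) that] by (rule tendsto_const)
    qed
    moreover have "f (y, x) = - f (x, y)" for x y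
    proof (rule LIMSEQ_unique[OF u(2)])
      have "(\<lambda>n. - u n (x, y)) \<longlonglongrightarrow> - f (x, y)" by (intro tendsto_minus u)
      then show "(\<lambda>n. u n (y, x)) \<longlonglongrightarrow> - f (x, y)" unfolding forms_antisym[OF u(1), of _ y x] .
    qed
    ultimately show ?thesis by (rule formsI)
  qed
qed

lemma hardy_included: "continuously_included hardy hardy_norm (Lp (vol mu) 1) (Lp_norm (vol mu) 1)"
proof -
  have "f \<in> Lp (vol mu) 1 \<and> Lp_norm (vol mu) 1 f \<le> 1 * hardy_norm f" if f: "f \<in> hardy" for f
  proof -
    have "(\<Sum>x\<in>S. w x * \<bar>f x\<bar>) \<le> hardy_norm f" if S: "finite S" for S
    proof -
      have "(\<Sum>x\<in>S. w x * \<bar>f x\<bar>) \<le> hardy_seminorm (0, S) f" by (simp add: hardy_seminorm_def sum_nonneg)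
      also have "\<dots> \<le> hardy_norm f" by (rule sup_norm_ge[OF f]) (use S in \<open>simp add: hardy_idx_def\<close>)
      finally show ?thesis .
    qed
    moreover from this[of "{}"] have "0 \<le> hardy_norm f" by simp
    ultimately show ?thesis using LpI[of 1 "hardy_norm f" f] by simp
  qed
  then show ?thesis unfolding continuously_included_def by blast
qed

lemma form_included: "continuously_included form_space form_norm (Lp_form mu 1) (Lp_form_norm mu 1)"
proof -
  have "F \<in> Lp_form mu 1 \<and> Lp_form_norm mu 1 F \<le> 1 * form_norm F" if F: "F \<in> form_space" for F
  proof -
    have le: "(\<Sum>x\<in>S. w x * \<bar>tnorm F x\<bar>) \<le> form_norm F" if S: "finite S" for S
    proof -
      have "(\<Sum>x\<in>S. w x * \<bar>tnorm F x\<bar>) \<le> form_seminorm (S, undefined) F" by (simp add: form_seminorm_def)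
      also have "\<dots> \<le> form_norm F" by (rule sup_norm_ge[OF F]) (use S in \<open>simp add: form_idx_def\<close>)
      finally show ?thesis .
    qed
    from le[of "{}"] have "0 \<le> form_norm F" by simp
    then have "tnorm F \<in> Lp (vol mu) 1" "Lp_norm (vol mu) 1 (tnorm F) \<le> form_norm F"
      using LpI[of 1 "form_norm F" "tnorm F"] le by auto
    moreover have "F \<in> forms" using F unfolding sup_space_def by blast
    ultimately show ?thesis unfolding Lp_form_def Lp_form_norm_def forms_def mult_1 by blast
  qed
  then show ?thesis unfolding continuously_included_def by blast
qed

lemma riesz_ext_tendsto: "f \<in> hardy_conv \<Longrightarrow> (\<lambda>n. df (K n f) e) \<longlonglongrightarrow> riesz_ext f e"
  unfolding riesz_ext_def hardy_conv_def by (blast intro: convergent_LIMSEQ_iff[THEN iffD1])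

lemma hardy_subset: "f \<in> hardy \<Longrightarrow> f \<in> hardy_conv" by (simp add: sup_space_def)

lemma riesz_ext_linear: "linear_op hardy riesz_ext"
  unfolding linear_op_def
proof (intro conjI ballI allI)
  fix f g assume fg: "f \<in> hardy" "g \<in> hardy"
  have "riesz_ext (\<lambda>x. f x + g x) e = riesz_ext f e + riesz_ext g e" for e
    unfolding riesz_ext_def[of "\<lambda>x. f x + g x"] df_K_add
    by (intro limI tendsto_add riesz_ext_tendsto hardy_subset fg)
  then show "riesz_ext (\<lambda>x. f x + g x) = (\<lambda>y. riesz_ext f y + riesz_ext g y)" by (rule ext)
next
  fix c f assume f: "f \<in> hardy"
  have "riesz_ext (\<lambda>x. c * f x) e = c * riesz_ext f e" for e
    unfolding riesz_ext_def[of "\<lambda>x. c * f x"] df_K_cmult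
    by (intro limI tendsto_mult_left riesz_ext_tendsto hardy_subset f)
  then show "riesz_ext (\<lambda>x. c * f x) = (\<lambda>y. c * riesz_ext f y)" by (rule ext)
qed

text \<open>Every finite sum in the norm of the limit is a limit of finite sums that enter the Hardy norm.\<close>

lemma riesz_ext_bounded: "bounded_op hardy hardy_norm form_space form_norm riesz_ext"
proof -
  have "riesz_ext f \<in> form_space \<and> form_norm (riesz_ext f) \<le> 1 * hardy_norm f" if f: "f \<in> hardy" for f
  proof -
    note lim = riesz_ext_tendsto[OF hardy_subset[OF f]]
    have van: "riesz_ext f e = 0" if "e \<notin> edges mu" for e
      using LIMSEQ_unique[OF lim[of e], of 0] that by (simp add: df_vanish)
    have anti: "riesz_ext f (y, x) = - riesz_ext f (x, y)" for x y
      using LIMSEQ_unique[OF lim[of "(y, x)"] tendsto_minus[OF lim[of "(x, y)"], folded df_form(2)]] .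
    have le: "form_seminorm i (riesz_ext f) \<le> hardy_norm f" if i: "i \<in> form_idx" for i
    proof -
      have S: "finite (fst i)" using i by (auto simp: form_idx_def)
      have "form_seminorm i (riesz_ext f) = (\<Sum>x\<in>fst i. w x * tnorm (riesz_ext f) x)"
        using van by (simp add: form_seminorm_def)
      also have "\<dots> \<le> hardy_norm f"
      proof (rule LIMSEQ_le_const2)
        show "(\<lambda>n. \<Sum>x\<in>fst i. w x * tnorm (df (K n f)) x) \<longlonglongrightarrow> (\<Sum>x\<in>fst i. w x * tnorm (riesz_ext f) x)"
          by (intro tendsto_intros tnorm_tendsto lim)
        have "(\<Sum>x\<in>fst i. w x * tnorm (df (K n f)) x) \<le> hardy_norm f" for n
        proof -
          have "(\<Sum>x\<in>fst i. w x * tnorm (df (K n f)) x) \<le> hardy_seminorm (n, fst i) f"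
            by (simp add: hardy_seminorm_def sum_nonneg)
          also have "\<dots> \<le> hardy_norm f" by (rule sup_norm_ge[OF f]) (use S in \<open>simp add: hardy_idx_def\<close>)
          finally show ?thesis .
        qed
        then show "\<exists>N. \<forall>n\<ge>N. (\<Sum>x\<in>fst i. w x * tnorm (df (K n f)) x) \<le> hardy_norm f" by blast
      qed
      finally show ?thesis .
    qed
    have "riesz_ext f \<in> forms" by (rule formsI) (use van anti in \<open>blast+\<close>)
    moreover have "form_norm (riesz_ext f) \<le> hardy_norm f" by (rule sup_norm_le) (use le in \<open>auto simp: form_idx_def\<close>)
    ultimately show ?thesis using le unfolding sup_space_def mult_1 by blast
  qed
  then show ?thesis unfolding bounded_op_def by blast
qed

lemma riesz_ext_eq: "l2 f \<Longrightarrow> riesz_ext f = riesz mu f"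
  unfolding riesz_ext_def by (intro ext limI riesz_limit(2))

lemma atom_in_hardy:
  "\<exists>C\<ge>0. \<forall>x k b. 1 \<le> k \<longrightarrow> (\<forall>z. b z \<noteq> 0 \<longrightarrow> z \<in> Bl x k) \<longrightarrow>
     (\<lambda>z. b z - Av k b z) \<in> hardy \<and> l2 (\<lambda>z. b z - Av k b z) \<and> hardy_norm (\<lambda>z. b z - Av k b z) \<le> C * (sqrt (V x k) * s2 (Bl x k) b)"
proof -
  obtain C where C: "C \<ge> 0" "\<And>x k b n S. 1 \<le> k \<Longrightarrow> finite S \<Longrightarrow> (\<forall>z. b z \<noteq> 0 \<longrightarrow> z \<in> Bl x k) \<Longrightarrow>
     (\<Sum>z\<in>S. w z * \<bar>b z - Av k b z\<bar>) + (\<Sum>z\<in>S. w z * tnorm (df (K n (\<lambda>z. b z - Av k b z))) z)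
       \<le> C * (sqrt (V x k) * s2 (Bl x k) b)" using atom_estimate by blast
  have "(\<lambda>z. b z - Av k b z) \<in> hardy \<and> l2 (\<lambda>z. b z - Av k b z) \<and> hardy_norm (\<lambda>z. b z - Av k b z) \<le> C * (sqrt (V x k) * s2 (Bl x k) b)"
    if k: "1 \<le> k" and b: "\<forall>z. b z \<noteq> 0 \<longrightarrow> z \<in> Bl x k" for x k and b :: "'a \<Rightarrow> real"
  proof -
    have "fin b" unfolding fin_def by (rule finite_subset[OF _ finite_Bl[of x k]]) (use b in auto)
    then have a2: "l2 (\<lambda>z. b z - Av k b z)" unfolding I_Av_pol by (intro fin_l2 fin_pol)
    have le: "hardy_seminorm i (\<lambda>z. b z - Av k b z) \<le> C * (sqrt (V x k) * s2 (Bl x k) b)" if "i \<in> hardy_idx" for i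
      unfolding hardy_seminorm_def by (rule C(2)[OF k _ b]) (use that in \<open>auto simp: hardy_idx_def\<close>)
    have "(\<lambda>z. b z - Av k b z) \<in> hardy_conv"
      unfolding hardy_conv_def convergent_def using riesz_limit(2)[OF a2] by blast
    moreover have "hardy_norm (\<lambda>z. b z - Av k b z) \<le> C * (sqrt (V x k) * s2 (Bl x k) b)"
      by (rule sup_norm_le) (use le in \<open>auto simp: hardy_idx_def\<close>)
    ultimately show ?thesis using le a2 unfolding sup_space_def by blast
  qed
  then show ?thesis using C(1) by blast
qed

theorem hardy_interpolation:
  assumes lin: "linear_op (Lp (vol mu) 2) T"
    and b2: "bounded_op (Lp (vol mu) 2) (Lp_norm (vol mu) 2) (Lp (vol mu) 2) (Lp_norm (vol mu) 2) T"
    and b1: "bounded_op (hardy \<inter> Lp (vol mu) 2) hardy_norm (Lp (vol mu) 1) (Lp_norm (vol mu) 1) T"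
    and p: "1 < p" "p < 2"
  shows "bounded_op (Lp (vol mu) p \<inter> Lp (vol mu) 2) (Lp_norm (vol mu) p) (Lp (vol mu) p) (Lp_norm (vol mu) p) T"
proof -
  obtain B2 where B2: "\<And>f. l2 f \<Longrightarrow> l2 (T f) \<and> n2 (T f) \<le> B2 * n2 f" using b2 unfolding bounded_op_def by blast
  obtain B1 where B1: "\<And>f. f \<in> hardy \<Longrightarrow> l2 f \<Longrightarrow> T f \<in> Lp (vol mu) 1 \<and> Lp_norm (vol mu) 1 (T f) \<le> B1 * hardy_norm f"
    using b1 unfolding bounded_op_def by blast
  obtain C where C: "C \<ge> 0" "\<And>x k b. 1 \<le> k \<Longrightarrow> (\<forall>z. b z \<noteq> 0 \<longrightarrow> z \<in> Bl x k) \<Longrightarrow>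
     (\<lambda>z. b z - Av k b z) \<in> hardy \<and> l2 (\<lambda>z. b z - Av k b z) \<and> hardy_norm (\<lambda>z. b z - Av k b z) \<le> C * (sqrt (V x k) * s2 (Bl x k) b)"
    using atom_in_hardy by blast
  have "admissible T (max 0 B2) (max 0 B1 * C)"
    unfolding admissible_def
  proof (intro conjI allI impI)
    fix f assume f: "l2 f"
    then show "l2 (T f)" using B2 by blast
    have "n2 (T f) \<le> B2 * n2 f" using B2 f by blast
    also have "\<dots> \<le> max 0 B2 * n2 f" by (intro mult_right_mono) auto
    finally show "n2 (T f) \<le> max 0 B2 * n2 f" .
  next
    fix x k and b :: "'a \<Rightarrow> real" and S :: "'a set"
    assume k: "1 \<le> k" and S: "finite S" and b: "\<forall>z. b z \<noteq> 0 \<longrightarrow> z \<in> Bl x k"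
    let ?a = "\<lambda>z. b z - Av k b z"
    have a: "?a \<in> hardy" "l2 ?a" "hardy_norm ?a \<le> C * (sqrt (V x k) * s2 (Bl x k) b)" using C(2)[OF k b] by auto
    have h0: "0 \<le> hardy_norm ?a"
      using hardy_complete a(1) unfolding complete_normed_space_def by blast
    have "(\<Sum>z\<in>S. w z * \<bar>T ?a z\<bar>) \<le> Lp_norm (vol mu) 1 (T ?a)"
      using Lp_partial[of "T ?a" 1 S] B1[OF a(1,2)] S by simp
    also have "\<dots> \<le> B1 * hardy_norm ?a" using B1[OF a(1,2)] by blast
    also have "\<dots> \<le> max 0 B1 * hardy_norm ?a" using h0 by (intro mult_right_mono) auto
    also have "\<dots> \<le> max 0 B1 * (C * (sqrt (V x k) * s2 (Bl x k) b))" by (intro mult_left_mono a) auto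
    finally show "(\<Sum>z\<in>S. w z * \<bar>T ?a z\<bar>) \<le> max 0 B1 * C * (sqrt (V x k) * s2 (Bl x k) b)" by (simp add: mult.assoc)
  qed (use lin C(1) in auto)
  from interpolation[OF this p] show ?thesis unfolding bounded_op_def by blast
qed

section \<open>The Riesz transform on \<open>L\<^sup>p\<close>\<close>

lemma sum_powr_le:
  fixes a :: "nat \<Rightarrow> real"
  assumes "\<And>j. 0 \<le> a j" "0 < p"
  shows "(\<Sum>j<n. a j) powr p \<le> real n powr p * (\<Sum>j<n. a j powr p)"
proof -
  let ?A = "\<Sum>j<n. a j powr p"
  have A: "0 \<le> ?A" by (intro sum_nonneg) auto
  have "a j \<le> ?A powr (1 / p)" if "j < n" for j
  proof -
    have "a j powr p \<le> ?A" using that by (intro member_le_sum) auto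
    then have "(a j powr p) powr (1 / p) \<le> ?A powr (1 / p)" using assms by (intro powr_mono2) auto
    then show ?thesis using assms by (simp add: powr_powr)
  qed
  then have "(\<Sum>j<n. a j) \<le> (\<Sum>j<n. ?A powr (1 / p))" by (intro sum_mono) auto
  then have "(\<Sum>j<n. a j) \<le> real n * ?A powr (1 / p)" by simp
  then have "(\<Sum>j<n. a j) powr p \<le> (real n * ?A powr (1 / p)) powr p"
    using assms by (intro powr_mono2 sum_nonneg) auto
  also have "\<dots> = real n powr p * ?A" using A assms by (simp add: powr_mult powr_powr)
  finally show ?thesis .
qed

text \<open>The pointwise norm of the Riesz transform is not linear in \<open>f\<close>. Its components along an enumeration of
  the neighbours are, and there are boundedly many of them.\<close>

theorem riesz_Lp:
  assumes p: "1 < p" "p < 2"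
  shows "\<exists>C. \<forall>f \<in> Lp (vol mu) p \<inter> Lp (vol mu) 2. tnorm (riesz mu f) \<in> Lp (vol mu) p \<and>
     Lp_norm (vol mu) p (tnorm (riesz mu f)) \<le> C * Lp_norm (vol mu) p f"
proof -
  obtain N where N: "\<And>x. card (nb x) \<le> N" using card_nb by blast
  have "\<exists>h. bij_betw h {0..<card (nb x)} (nb x)" for x by (rule ex_bij_betw_nat_finite) simp
  then obtain en where en: "\<And>x. bij_betw (en x) {0..<card (nb x)} (nb x)" by metis
  define comp where "comp j f x = (if j < card (nb x) then sqrt (mu x (en x j) / w x / 2) * riesz mu f (x, en x j) else 0)"
    for j :: nat and f x
  have en_nb: "en x j \<in> nb x" if "j < card (nb x)" for x j using en[of x] that by (auto simp: bij_betw_def)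
  have comp_le: "\<bar>comp j f x\<bar> \<le> tnorm (riesz mu f) x" for j f x
  proof (cases "j < card (nb x)")
    case True
    show ?thesis
      using member_le_L2_set[OF finite_nb en_nb[OF True], of "\<lambda>y. \<bar>sqrt (mu x y / w x / 2) * riesz mu f (x, y)\<bar>"] True
      unfolding tnorm_L2_set by (simp add: comp_def L2_set_def)
  qed (simp add: comp_def)
  have le_comp: "tnorm (riesz mu f) x \<le> (\<Sum>j<N. \<bar>comp j f x\<bar>)" for f x
  proof -
    have "tnorm (riesz mu f) x \<le> (\<Sum>y\<in>nb x. \<bar>sqrt (mu x y / w x / 2) * riesz mu f (x, y)\<bar>)"
      unfolding tnorm_L2_set by (rule L2_set_le_sum_abs)
    also have "\<dots> = (\<Sum>j\<in>{0..<card (nb x)}. \<bar>sqrt (mu x (en x j) / w x / 2) * riesz mu f (x, en x j)\<bar>)"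
      by (rule sum.reindex_bij_betw[OF en, symmetric])
    also have "\<dots> = (\<Sum>j\<in>{0..<card (nb x)}. \<bar>comp j f x\<bar>)" by (intro sum.cong) (auto simp: comp_def)
    also have "\<dots> \<le> (\<Sum>j<N. \<bar>comp j f x\<bar>)" using N[of x] by (intro sum_mono2) auto
    finally show ?thesis .
  qed
  obtain C where C: "C \<ge> 0" "\<And>x k b n S. 1 \<le> k \<Longrightarrow> finite S \<Longrightarrow> (\<forall>z. b z \<noteq> 0 \<longrightarrow> z \<in> Bl x k) \<Longrightarrow>
     (\<Sum>z\<in>S. w z * \<bar>b z - Av k b z\<bar>) + (\<Sum>z\<in>S. w z * tnorm (df (K n (\<lambda>z. b z - Av k b z))) z)
       \<le> C * (sqrt (V x k) * s2 (Bl x k) b)" using atom_estimate by blast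
  have radd: "riesz mu (\<lambda>x. f x + g x) e = riesz mu f e + riesz mu g e" if "l2 f" "l2 g" for f g e
    using LIMSEQ_unique[OF riesz_limit(2)[OF l2_add[OF that], of e]] tendsto_add[OF riesz_limit(2)[OF that(1), of e] riesz_limit(2)[OF that(2), of e]]
    by (simp add: df_K_add)
  have rmul: "riesz mu (\<lambda>x. c * f x) e = c * riesz mu f e" if "l2 f" for c f e
    using LIMSEQ_unique[OF riesz_limit(2)[OF l2_cmult[OF that], of c e]] tendsto_mult_left[OF riesz_limit(2)[OF that, of e], of c]
    by (simp add: df_K_cmult)
  have "admissible (comp j) 2 C" for j
    unfolding admissible_def
  proof (intro conjI allI impI)
    show "linear_op (Lp (vol mu) 2) (comp j)"
      unfolding linear_op_def comp_def by (auto simp: radd rmul fun_eq_iff distrib_left mult.left_commute)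
    fix f assume f: "l2 f"
    have "s2 S (comp j f) \<le> 2 * n2 f" if S: "finite S" for S
    proof -
      have "s2 S (comp j f) \<le> s2 S (tnorm (riesz mu f))" by (rule s2_mono) (simp add: comp_le)
      also have "\<dots> \<le> 2 * n2 f" by (rule riesz_limit(3)[OF f S])
      finally show ?thesis .
    qed
    then show "l2 (comp j f)" "n2 (comp j f) \<le> 2 * n2 f" using n2I by blast+
  next
    fix x k and b :: "'a \<Rightarrow> real" and S :: "'a set"
    assume k: "1 \<le> k" and S: "finite S" and b: "\<forall>z. b z \<noteq> 0 \<longrightarrow> z \<in> Bl x k"
    let ?a = "\<lambda>z. b z - Av k b z"
    have "fin b" unfolding fin_def by (rule finite_subset[OF _ finite_Bl[of x k]]) (use b in auto)
    then have a2: "l2 ?a" unfolding I_Av_pol by (intro fin_l2 fin_pol)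
    have "(\<Sum>z\<in>S. w z * \<bar>comp j ?a z\<bar>) \<le> (\<Sum>z\<in>S. w z * tnorm (riesz mu ?a) z)"
      by (intro sum_mono mult_left_mono comp_le) auto
    also have "\<dots> \<le> C * (sqrt (V x k) * s2 (Bl x k) b)"
    proof (rule LIMSEQ_le_const2)
      show "(\<lambda>n. \<Sum>z\<in>S. w z * tnorm (df (K n ?a)) z) \<longlonglongrightarrow> (\<Sum>z\<in>S. w z * tnorm (riesz mu ?a) z)"
        by (intro tendsto_intros tnorm_tendsto riesz_limit(2) a2)
      have "(\<Sum>z\<in>S. w z * tnorm (df (K n ?a)) z) \<le> C * (sqrt (V x k) * s2 (Bl x k) b)" for n
        using C(2)[OF k S b, of n] sum_nonneg[of S "\<lambda>z. w z * \<bar>?a z\<bar>"] by simp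
      then show "\<exists>N. \<forall>n\<ge>N. (\<Sum>z\<in>S. w z * tnorm (df (K n ?a)) z) \<le> C * (sqrt (V x k) * s2 (Bl x k) b)" by blast
    qed
    finally show "(\<Sum>z\<in>S. w z * \<bar>comp j ?a z\<bar>) \<le> C * (sqrt (V x k) * s2 (Bl x k) b)" .
  qed (use C(1) in auto)
  then have "\<forall>j. \<exists>c\<ge>0. \<forall>f. f \<in> Lp (vol mu) p \<longrightarrow> l2 f \<longrightarrow> comp j f \<in> Lp (vol mu) p \<and> Lp_norm (vol mu) p (comp j f) \<le> c * Lp_norm (vol mu) p f"
    using interpolation[OF _ p] by blast
  then obtain c where c: "\<And>j. 0 \<le> c j" "\<And>j f. f \<in> Lp (vol mu) p \<Longrightarrow> l2 f \<Longrightarrow> comp j f \<in> Lp (vol mu) p"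
    "\<And>j f. f \<in> Lp (vol mu) p \<Longrightarrow> l2 f \<Longrightarrow> Lp_norm (vol mu) p (comp j f) \<le> c j * Lp_norm (vol mu) p f" by metis
  define D where "D = real N * (\<Sum>j<N. c j powr p) powr (1 / p)"
  have "tnorm (riesz mu f) \<in> Lp (vol mu) p \<and> Lp_norm (vol mu) p (tnorm (riesz mu f)) \<le> D * Lp_norm (vol mu) p f"
    if f: "f \<in> Lp (vol mu) p" "l2 f" for f
  proof -
    let ?N = "Lp_norm (vol mu) p f"
    have "(\<Sum>x\<in>S. w x * \<bar>tnorm (riesz mu f) x\<bar> powr p) \<le> (D * ?N) powr p" if S: "finite S" for S
    proof -
      have "(\<Sum>x\<in>S. w x * \<bar>tnorm (riesz mu f) x\<bar> powr p) \<le> (\<Sum>x\<in>S. w x * (real N powr p * (\<Sum>j<N. \<bar>comp j f x\<bar> powr p)))"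
      proof (intro sum_mono mult_left_mono)
        fix x
        have "\<bar>tnorm (riesz mu f) x\<bar> powr p \<le> (\<Sum>j<N. \<bar>comp j f x\<bar>) powr p"
          using le_comp[of f x] p by (intro powr_mono2) auto
        also have "\<dots> \<le> real N powr p * (\<Sum>j<N. \<bar>comp j f x\<bar> powr p)" using p by (intro sum_powr_le) auto
        finally show "\<bar>tnorm (riesz mu f) x\<bar> powr p \<le> real N powr p * (\<Sum>j<N. \<bar>comp j f x\<bar> powr p)" .
      qed auto
      also have "\<dots> = real N powr p * (\<Sum>j<N. \<Sum>x\<in>S. w x * \<bar>comp j f x\<bar> powr p)"
        unfolding sum_distrib_left by (subst sum.swap) (simp add: mult_ac)
      also have "\<dots> \<le> real N powr p * (\<Sum>j<N. c j powr p * ?N powr p)"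
      proof (intro mult_left_mono sum_mono)
        fix j
        have "(\<Sum>x\<in>S. w x * \<bar>comp j f x\<bar> powr p) \<le> Lp_norm (vol mu) p (comp j f) powr p"
          using p by (intro Lp_partial c f S) auto
        also have "\<dots> \<le> (c j * ?N) powr p" using p by (intro powr_mono2 c f) auto
        finally show "(\<Sum>x\<in>S. w x * \<bar>comp j f x\<bar> powr p) \<le> c j powr p * ?N powr p" by (simp add: powr_mult)
      qed auto
      also have "\<dots> = (D * ?N) powr p"
        using p sum_nonneg[of "{..<N}" "\<lambda>j. c j powr p"] by (simp add: D_def powr_mult powr_powr sum_distrib_right[symmetric])
      finally show ?thesis .
    qed
    moreover have "0 \<le> D * ?N" by (simp add: D_def)
    ultimately show ?thesis using LpI[of p "D * ?N" "tnorm (riesz mu f)"] p by auto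
  qed
  then show ?thesis by blast
qed

end

theorem theorem1p6:
  fixes mu :: "'a \<Rightarrow> 'a \<Rightarrow> real" and \<beta> :: "'a \<Rightarrow> 'a \<Rightarrow> real" and B :: real
  assumes "weighted_graph mu"
    and "quasidistance_exponent mu B \<beta>"
    and "LB mu"
    and "doubling mu \<beta>"
    and "UE mu \<beta>"
  shows "(\<exists>(H :: ('a \<Rightarrow> real) set) (N :: ('a \<Rightarrow> real) \<Rightarrow> real)
            (HT :: ('a \<times> 'a \<Rightarrow> real) set) (NT :: ('a \<times> 'a \<Rightarrow> real) \<Rightarrow> real).
            complete_normed_space H N \<and>
            continuously_included H N (Lp (vol mu) 1) (Lp_norm (vol mu) 1) \<and>
            complete_normed_space HT NT \<and>
            continuously_included HT NT (Lp_form mu 1) (Lp_form_norm mu 1) \<and>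
            bounded_op (H \<inter> Lp (vol mu) 2) N HT NT (riesz mu) \<and>
            (\<exists>S. linear_op H S \<and> bounded_op H N HT NT S \<and>
                 (\<forall>f \<in> H \<inter> Lp (vol mu) 2. S f = riesz mu f)) \<and>
            (\<forall>T :: ('a \<Rightarrow> real) \<Rightarrow> ('a \<Rightarrow> real).
               linear_op (Lp (vol mu) 2) T \<and>
               bounded_op (Lp (vol mu) 2) (Lp_norm (vol mu) 2)
                          (Lp (vol mu) 2) (Lp_norm (vol mu) 2) T \<and>
               bounded_op (H \<inter> Lp (vol mu) 2) N (Lp (vol mu) 1) (Lp_norm (vol mu) 1) T \<longrightarrow>
               (\<forall>p. 1 < p \<and> p < 2 \<longrightarrow>
                  bounded_op (Lp (vol mu) p \<inter> Lp (vol mu) 2) (Lp_norm (vol mu) p)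
                             (Lp (vol mu) p) (Lp_norm (vol mu) p) T)))
         \<and> (\<forall>p. 1 < p \<and> p < 2 \<longrightarrow>
              (\<exists>C. \<forall>f \<in> Lp (vol mu) p \<inter> Lp (vol mu) 2.
                 tangent_norm mu (riesz mu f) \<in> Lp (vol mu) p \<and>
                 Lp_norm (vol mu) p (tangent_norm mu (riesz mu f)) \<le> C * Lp_norm (vol mu) p f))"
proof -
  interpret riesz_graph mu \<beta> B
    using assms by unfold_locales
  have "\<forall>T :: ('a \<Rightarrow> real) \<Rightarrow> ('a \<Rightarrow> real).
      linear_op (Lp (vol mu) 2) T \<and>
      bounded_op (Lp (vol mu) 2) (Lp_norm (vol mu) 2) (Lp (vol mu) 2) (Lp_norm (vol mu) 2) T \<and>
      bounded_op (hardy \<inter> Lp (vol mu) 2) hardy_norm (Lp (vol mu) 1) (Lp_norm (vol mu) 1) T \<longrightarrow>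
      (\<forall>p. 1 < p \<and> p < 2 \<longrightarrow>
        bounded_op (Lp (vol mu) p \<inter> Lp (vol mu) 2) (Lp_norm (vol mu) p) (Lp (vol mu) p) (Lp_norm (vol mu) p) T)"
    using hardy_interpolation by blast
  moreover have "bounded_op (hardy \<inter> Lp (vol mu) 2) hardy_norm form_space form_norm (riesz mu)"
    using riesz_ext_bounded riesz_ext_eq unfolding bounded_op_def by (metis IntD1 IntD2)
  moreover have "\<exists>S. linear_op hardy S \<and> bounded_op hardy hardy_norm form_space form_norm S \<and>
      (\<forall>f \<in> hardy \<inter> Lp (vol mu) 2. S f = riesz mu f)"
    using riesz_ext_linear riesz_ext_bounded riesz_ext_eq by blast
  ultimately have "\<exists>(H :: ('a \<Rightarrow> real) set) (N :: ('a \<Rightarrow> real) \<Rightarrow> real)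
            (HT :: ('a \<times> 'a \<Rightarrow> real) set) (NT :: ('a \<times> 'a \<Rightarrow> real) \<Rightarrow> real).
            complete_normed_space H N \<and>
            continuously_included H N (Lp (vol mu) 1) (Lp_norm (vol mu) 1) \<and>
            complete_normed_space HT NT \<and>
            continuously_included HT NT (Lp_form mu 1) (Lp_form_norm mu 1) \<and>
            bounded_op (H \<inter> Lp (vol mu) 2) N HT NT (riesz mu) \<and>
            (\<exists>S. linear_op H S \<and> bounded_op H N HT NT S \<and>
                 (\<forall>f \<in> H \<inter> Lp (vol mu) 2. S f = riesz mu f)) \<and>
            (\<forall>T :: ('a \<Rightarrow> real) \<Rightarrow> ('a \<Rightarrow> real).
               linear_op (Lp (vol mu) 2) T \<and>
               bounded_op (Lp (vol mu) 2) (Lp_norm (vol mu) 2)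
                          (Lp (vol mu) 2) (Lp_norm (vol mu) 2) T \<and>
               bounded_op (H \<inter> Lp (vol mu) 2) N (Lp (vol mu) 1) (Lp_norm (vol mu) 1) T \<longrightarrow>
               (\<forall>p. 1 < p \<and> p < 2 \<longrightarrow>
                  bounded_op (Lp (vol mu) p \<inter> Lp (vol mu) 2) (Lp_norm (vol mu) p)
                             (Lp (vol mu) p) (Lp_norm (vol mu) p) T))"
    using hardy_complete hardy_included form_space_complete form_included
    by (intro exI[of _ hardy] exI[of _ hardy_norm] exI[of _ form_space] exI[of _ form_norm] conjI)
  then show ?thesis using riesz_Lp by blast
qed

end
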